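(* Let $G$ be a locally compact group, and let $G_d$ denote the same group equipped with the discrete topology. Suppose $G_d$ is amenable. Then every cb-Helson subset of $G$ is finite.
   Context: All topological groups are assumed Hausdorff. For a locally compact group $G$, $\operatorname{VN}(G)\subseteq\mathcal{B}(L^2(G))$ is the group von Neumann algebra (generated by the left regular representation $\lambda$) and $\operatorname{A}(G)$ is the Fourier algebra of $G$ in the sense of Eymard, which is the predual of $\operatorname{VN}(G)$ and carries the operator space structure of this predual (so that its operator space dual is $\operatorname{VN}(G)$ with its $\mathrm{C}^*$-algebra operator space structure). For a closed subset $E\subseteq G$, let $I_G(E)$ be the kernel of the restriction homomorphism $\operatorname{A}(G)\to C_0(E)$, and let $\operatorname{A}_G(E)=\operatorname{A}(G)/I_G(E)$ with the quotient operator space structure. $C_0(E)$ carries its canonical operator space structure as a $\mathrm{C}^*$-algebra. Let $\operatorname{inc}_{G,E}:\operatorname{A}_G(E)\to C_0(E)$ be the injective homomorphism induced by restriction. The closed set $E$ is called a cb-Helson subset of $G$ if $\operatorname{inc}_{G,E}$ is an isomorphism of operator spaces, i.e. it is a bijection which is completely bounded with completely bounded inverse (it is automatically completely contractive, so this means that it is surjective with completely bounded inverse). *)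

theory Defs
  imports "HOL-Analysis.Analysis"
begin

text \<open>Groups are written additively but are not assumed commutative: in the class
  \<^class>\<open>topological_group_add\<close> the group \<open>G\<close> is the whole type, \<open>s + t\<close> is the product \<open>st\<close> and
  \<open>- s\<close> is the inverse.\<close>

section \<open>Haar measure and \<open>L\<^sup>2(G)\<close>\<close>

text \<open>Left Haar measures, as nonzero left invariant Radon measures on the Borel sets. No countability
  assumption is made on \<open>G\<close>, so inner regularity is only required on open sets.\<close>

definition left_haar_measure :: "'a::{topological_group_add, t2_space} measure \<Rightarrow> bool" where
  "left_haar_measure \<mu> \<longleftrightarrow>
     sets \<mu> = sets borel \<and>
     emeasure \<mu> UNIV \<noteq> 0 \<and>
     (\<forall>K. compact K \<longrightarrow> emeasure \<mu> K < \<infinity>) \<and>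
     (\<forall>A\<in>sets borel. emeasure \<mu> A = (INF U\<in>{U. open U \<and> A \<subseteq> U}. emeasure \<mu> U)) \<and>
     (\<forall>U. open U \<longrightarrow> emeasure \<mu> U = (SUP K\<in>{K. compact K \<and> K \<subseteq> U}. emeasure \<mu> K)) \<and>
     (\<forall>s. \<forall>A\<in>sets borel. emeasure \<mu> ((\<lambda>t. s + t) ` A) = emeasure \<mu> A)"

text \<open>Vectors of \<open>L\<^sup>2(\<mu>)\<close> are represented by square integrable functions; every notion below
  respects equality almost everywhere.\<close>

definition L2 :: "'a measure \<Rightarrow> ('a \<Rightarrow> complex) set" where
  "L2 \<mu> = {f. f \<in> borel_measurable \<mu> \<and> integrable \<mu> (\<lambda>x. (cmod (f x))\<^sup>2)}"

definition L2_inner :: "'a measure \<Rightarrow> ('a \<Rightarrow> complex) \<Rightarrow> ('a \<Rightarrow> complex) \<Rightarrow> complex" where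
  "L2_inner \<mu> f g = (LINT x|\<mu>. f x * cnj (g x))"

definition L2_norm :: "'a measure \<Rightarrow> ('a \<Rightarrow> complex) \<Rightarrow> real" where
  "L2_norm \<mu> f = sqrt (LINT x|\<mu>. (cmod (f x))\<^sup>2)"

type_synonym 'a L2_map = "('a \<Rightarrow> complex) \<Rightarrow> 'a \<Rightarrow> complex"

text \<open>The elements of \<open>B(L\<^sup>2(\<mu>))\<close>. Linearity and boundedness together imply that \<open>T\<close> maps functions
  that are equal almost everywhere to functions that are equal almost everywhere.\<close>

definition L2_operator :: "'a measure \<Rightarrow> 'a L2_map \<Rightarrow> bool" where
  "L2_operator \<mu> T \<longleftrightarrow>
     (\<forall>f\<in>L2 \<mu>. T f \<in> L2 \<mu>) \<and>
     (\<forall>c. \<forall>f\<in>L2 \<mu>. \<forall>g\<in>L2 \<mu>. AE x in \<mu>. T (\<lambda>y. c * f y + g y) x = c * T f x + T g x) \<and>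
     (\<exists>C. \<forall>f\<in>L2 \<mu>. L2_norm \<mu> (T f) \<le> C * L2_norm \<mu> f)"

definition L2_commute :: "'a measure \<Rightarrow> 'a L2_map \<Rightarrow> 'a L2_map \<Rightarrow> bool" where
  "L2_commute \<mu> S T \<longleftrightarrow> (\<forall>f\<in>L2 \<mu>. AE x in \<mu>. S (T f) x = T (S f) x)"

section \<open>The group von Neumann algebra\<close>

definition left_regular :: "'a::group_add \<Rightarrow> 'a L2_map" where
  "left_regular s f = (\<lambda>t. f (- s + t))"

text \<open>The set of all \<open>\<lambda>(s)\<close> is closed under adjoints, so the von Neumann algebra it generates
  is its bicommutant.\<close>

definition VN :: "'a::group_add measure \<Rightarrow> 'a L2_map set" where
  "VN \<mu> = {T. L2_operator \<mu> T \<and>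
     (\<forall>S. L2_operator \<mu> S \<longrightarrow> (\<forall>s. L2_commute \<mu> S (left_regular s)) \<longrightarrow> L2_commute \<mu> S T)}"

text \<open>The norm of \<open>M\<^sub>m(B(L\<^sup>2(\<mu>))) = B(L\<^sup>2(\<mu>)\<^sup>m)\<close>. Here and below only the entries with indices
  \<open>< m\<close> of a function of two indices are regarded as entries of the matrix.\<close>

definition L2_matrix_norm :: "'a measure \<Rightarrow> nat \<Rightarrow> (nat \<Rightarrow> nat \<Rightarrow> 'a L2_map) \<Rightarrow> real" where
  "L2_matrix_norm \<mu> m T = Inf {C. 0 \<le> C \<and>
     (\<forall>\<xi>. (\<forall>l<m. \<xi> l \<in> L2 \<mu>) \<longrightarrow>
        sqrt (\<Sum>k<m. (L2_norm \<mu> (\<lambda>x. \<Sum>l<m. T k l (\<xi> l) x))\<^sup>2)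
          \<le> C * sqrt (\<Sum>l<m. (L2_norm \<mu> (\<xi> l))\<^sup>2))}"

text \<open>The operator norm of a scalar matrix with rows and columns indexed by the finite set \<open>I\<close>.\<close>

definition matrix_opnorm :: "'i set \<Rightarrow> ('i \<Rightarrow> 'i \<Rightarrow> complex) \<Rightarrow> real" where
  "matrix_opnorm I A = Inf {C. 0 \<le> C \<and>
     (\<forall>v. sqrt (\<Sum>i\<in>I. (cmod (\<Sum>j\<in>I. A i j * v j))\<^sup>2) \<le> C * sqrt (\<Sum>j\<in>I. (cmod (v j))\<^sup>2))}"

section \<open>Operator spaces\<close>

text \<open>Complex vector spaces with a norm on each matrix level. All instances below are concrete
  operator spaces, so Ruan's axioms are not part of the structure.\<close>

record 'v matrix_normed =
  os_carrier :: "'v set"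
  os_add :: "'v \<Rightarrow> 'v \<Rightarrow> 'v"
  os_scale :: "complex \<Rightarrow> 'v \<Rightarrow> 'v"
  os_norm :: "nat \<Rightarrow> (nat \<Rightarrow> nat \<Rightarrow> 'v) \<Rightarrow> real"

definition completely_bounded ::
  "'v matrix_normed \<Rightarrow> 'w matrix_normed \<Rightarrow> ('v \<Rightarrow> 'w) \<Rightarrow> bool" where
  "completely_bounded V W \<phi> \<longleftrightarrow>
     (\<forall>x\<in>os_carrier V. \<phi> x \<in> os_carrier W) \<and>
     (\<forall>x\<in>os_carrier V. \<forall>y\<in>os_carrier V. \<phi> (os_add V x y) = os_add W (\<phi> x) (\<phi> y)) \<and>
     (\<forall>c. \<forall>x\<in>os_carrier V. \<phi> (os_scale V c x) = os_scale W c (\<phi> x)) \<and>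
     (\<exists>C. \<forall>n x. (\<forall>i<n. \<forall>j<n. x i j \<in> os_carrier V) \<longrightarrow>
        os_norm W n (\<lambda>i j. \<phi> (x i j)) \<le> C * os_norm V n x)"

definition operator_space_isomorphism ::
  "'v matrix_normed \<Rightarrow> 'w matrix_normed \<Rightarrow> ('v \<Rightarrow> 'w) \<Rightarrow> bool" where
  "operator_space_isomorphism V W \<phi> \<longleftrightarrow>
     bij_betw \<phi> (os_carrier V) (os_carrier W) \<and>
     completely_bounded V W \<phi> \<and>
     completely_bounded W V (inv_into (os_carrier V) \<phi>)"

definition os_coset :: "'v matrix_normed \<Rightarrow> 'v set \<Rightarrow> 'v \<Rightarrow> 'v set" where
  "os_coset V J x = os_add V x ` J"

text \<open>The quotient by a closed subspace \<open>J\<close>: \<open>M\<^sub>n(V/J)\<close> has the quotient norm of \<open>M\<^sub>n(V)/M\<^sub>n(J)\<close>,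
  the infimum being over all entrywise lifts.\<close>

definition quotient_space :: "'v matrix_normed \<Rightarrow> 'v set \<Rightarrow> 'v set matrix_normed" where
  "quotient_space V J =
     \<lparr> os_carrier = os_coset V J ` os_carrier V,
       os_add = (\<lambda>X Y. \<Union>x\<in>X. \<Union>y\<in>Y. os_coset V J (os_add V x y)),
       os_scale = (\<lambda>c X. \<Union>x\<in>X. os_coset V J (os_scale V c x)),
       os_norm = (\<lambda>n X. Inf {os_norm V n x | x. \<forall>i<n. \<forall>j<n. x i j \<in> X i j}) \<rparr>"

section \<open>The Fourier algebra\<close>

text \<open>Eymard's description of \<open>A(G)\<close>: the coefficient functions of the left regular representation
  (they form a vector space).\<close>

definition coefficient ::
  "'a::group_add measure \<Rightarrow> ('a \<Rightarrow> complex) \<Rightarrow> ('a \<Rightarrow> complex) \<Rightarrow> 'a \<Rightarrow> complex" where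
  "coefficient \<mu> \<xi> \<eta> = (\<lambda>s. L2_inner \<mu> (left_regular s \<xi>) \<eta>)"

definition fourier_functions :: "'a::group_add measure \<Rightarrow> ('a \<Rightarrow> complex) set" where
  "fourier_functions \<mu> = {coefficient \<mu> \<xi> \<eta> | \<xi> \<eta>. \<xi> \<in> L2 \<mu> \<and> \<eta> \<in> L2 \<mu>}"

text \<open>The duality of \<open>VN(G)\<close> and its predual \<open>A(G)\<close>: a function \<open>u(s) = \<langle>\<lambda>(s)\<xi>, \<eta>\<rangle>\<close> acts on
  \<open>T\<close> as \<open>\<langle>T\<xi>, \<eta>\<rangle>\<close>, so that \<open>\<lambda>(s)\<close> is evaluated to \<open>u(s)\<close>. For \<open>T\<close> in \<open>VN(G)\<close> the value does not
  depend on the chosen \<open>\<xi>\<close> and \<open>\<eta>\<close>, since the span of the \<open>\<lambda>(s)\<close> is weak operator dense.\<close>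

definition VN_pairing :: "'a::group_add measure \<Rightarrow> 'a L2_map \<Rightarrow> ('a \<Rightarrow> complex) \<Rightarrow> complex" where
  "VN_pairing \<mu> T u =
     (case (SOME p. fst p \<in> L2 \<mu> \<and> snd p \<in> L2 \<mu> \<and> u = coefficient \<mu> (fst p) (snd p)) of
        (\<xi>, \<eta>) \<Rightarrow> L2_inner \<mu> (T \<xi>) \<eta>)"

text \<open>The predual operator space structure: a matrix \<open>u\<close> in \<open>M\<^sub>n(A(G))\<close> has the completely bounded
  norm of the map \<open>T \<mapsto> (\<langle>T, u\<^sub>i\<^sub>j\<rangle>)\<close> from \<open>VN(G)\<close> to \<open>M\<^sub>n\<close>.\<close>

definition fourier_matrix_norm ::
  "'a::group_add measure \<Rightarrow> nat \<Rightarrow> (nat \<Rightarrow> nat \<Rightarrow> 'a \<Rightarrow> complex) \<Rightarrow> real" where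
  "fourier_matrix_norm \<mu> n u = Inf {C. 0 \<le> C \<and>
     (\<forall>m T. (\<forall>k<m. \<forall>l<m. T k l \<in> VN \<mu>) \<longrightarrow>
        matrix_opnorm ({..<m} \<times> {..<n}) (\<lambda>(k, i) (l, j). VN_pairing \<mu> (T k l) (u i j))
          \<le> C * L2_matrix_norm \<mu> m T)}"

definition fourier_algebra :: "'a::group_add measure \<Rightarrow> ('a \<Rightarrow> complex) matrix_normed" where
  "fourier_algebra \<mu> =
     \<lparr> os_carrier = fourier_functions \<mu>,
       os_add = (\<lambda>u v s. u s + v s),
       os_scale = (\<lambda>c u s. c * u s),
       os_norm = fourier_matrix_norm \<mu> \<rparr>"

section \<open>Cb-Helson sets\<close>

text \<open>Functions on \<open>E\<close> are represented by functions on the whole group that vanish off \<open>E\<close>.\<close>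

definition restrict_zero :: "'a set \<Rightarrow> ('a \<Rightarrow> complex) \<Rightarrow> 'a \<Rightarrow> complex" where
  "restrict_zero E u = (\<lambda>s. if s \<in> E then u s else 0)"

definition C0_space :: "'a::topological_space set \<Rightarrow> ('a \<Rightarrow> complex) matrix_normed" where
  "C0_space E =
     \<lparr> os_carrier = {f. continuous_on E f \<and> (\<forall>e>0. compact {s\<in>E. e \<le> cmod (f s)}) \<and>
                        (\<forall>s. s \<notin> E \<longrightarrow> f s = 0)},
       os_add = (\<lambda>f g s. f s + g s),
       os_scale = (\<lambda>c f s. c * f s),
       os_norm = (\<lambda>n f. Inf {C. 0 \<le> C \<and>
                        (\<forall>s\<in>E. matrix_opnorm {..<n} (\<lambda>i j. f i j s) \<le> C)}) \<rparr>"

definition vanishing_ideal :: "'a::group_add measure \<Rightarrow> 'a set \<Rightarrow> ('a \<Rightarrow> complex) set" where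
  "vanishing_ideal \<mu> E = {u \<in> fourier_functions \<mu>. restrict_zero E u = (\<lambda>s. 0)}"

definition fourier_quotient ::
  "'a::group_add measure \<Rightarrow> 'a set \<Rightarrow> ('a \<Rightarrow> complex) set matrix_normed" where
  "fourier_quotient \<mu> E = quotient_space (fourier_algebra \<mu>) (vanishing_ideal \<mu> E)"

text \<open>All members of a coset of \<open>vanishing_ideal \<mu> E\<close> have the same restriction to \<open>E\<close>.\<close>

definition fourier_inc :: "'a set \<Rightarrow> ('a \<Rightarrow> complex) set \<Rightarrow> 'a \<Rightarrow> complex" where
  "fourier_inc E X = restrict_zero E (SOME u. u \<in> X)"

definition cb_Helson :: "'a::{topological_group_add, t2_space} measure \<Rightarrow> 'a set \<Rightarrow> bool" where
  "cb_Helson \<mu> E \<longleftrightarrow>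
     closed E \<and> operator_space_isomorphism (fourier_quotient \<mu> E) (C0_space E) (fourier_inc E)"

section \<open>Amenability of the discrete group\<close>

text \<open>A left invariant mean on all bounded functions; the topology of the group plays no role.\<close>

definition discretely_amenable :: "'a::group_add itself \<Rightarrow> bool" where
  "discretely_amenable _ \<longleftrightarrow>
     (\<exists>M :: ('a \<Rightarrow> real) \<Rightarrow> real.
        (\<forall>f g. bounded (range f) \<longrightarrow> bounded (range g) \<longrightarrow> M (\<lambda>t. f t + g t) = M f + M g) \<and>
        (\<forall>c f. bounded (range f) \<longrightarrow> M (\<lambda>t. c * f t) = c * M f) \<and>
        (\<forall>f. bounded (range f) \<longrightarrow> (\<forall>t. 0 \<le> f t) \<longrightarrow> 0 \<le> M f) \<and>
        M (\<lambda>t. 1) = 1 \<and>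
        (\<forall>s f. bounded (range f) \<longrightarrow> M (\<lambda>t. f (s + t)) = M f))"

end

theory Submission
  imports Defs "HOL-Library.Function_Algebras" "HOL-Computational_Algebra.Polynomial"
begin

text \<open>Suppose \<open>E\<close> is cb-Helson with distinct points \<open>s\<^sub>1, \<dots>, s\<^sub>n\<close>. Bump functions at these points show
  that for any permutation matrices \<open>u\<^sub>i \<in> M\<^sub>N\<close> there is \<open>x \<in> M\<^sub>N(A(G))\<close> with \<open>x(s\<^sub>i) = u\<^sub>i\<close> and norm at most
  a constant \<open>C\<close> that depends on neither \<open>n\<close> nor \<open>N\<close>. Amenability of the discrete group gives \<open>w \<ge> 0\<close> of finite
  support with \<open>\<Sum> w\<^sup>2 = 1\<close> whose coefficient \<open>\<phi>(s) = \<Sum>\<^sub>h w(sh) w(h)\<close> is at least \<open>1/2\<close> at each \<open>s\<^sub>i\<close>. Pairing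
  \<open>x\<close> with \<open>T = \<Sum>\<^sub>i \<phi>(s\<^sub>i) u\<^sub>i e \<otimes> \<lambda>(s\<^sub>i)\<close>, for a projection \<open>e \<in> M\<^sub>N\<close> of trace at least \<open>N/2\<close>, and testing on the
  vector \<open>\<Sum>\<^sub>l \<delta>\<^sub>l \<otimes> \<delta>\<^sub>l\<close> gives \<open>nN/4 \<le> C N \<parallel>T\<parallel>\<close>.

  The factor \<open>\<phi>\<close> bounds \<open>\<parallel>T\<parallel>\<close> by the norm of \<open>\<Sum>\<^sub>i b\<^sub>i \<otimes> u\<^sub>i e\<close>, where \<open>b\<^sub>i\<close> is the compression of the translation
  by \<open>s\<^sub>i\<close> to the support of \<open>w\<close>. Taking for \<open>u\<^sub>i\<close> the left multiplications of a symmetric group by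
  involutions without short relations, which come from a finite tree, the moment method bounds the norm of
  \<open>\<Sum>\<^sub>i b\<^sub>i \<otimes> u\<^sub>i\<close> off a subspace of small dimension by \<open>\<surd>(8n)\<close>, and \<open>e\<close> avoids that subspace. Hence \<open>n\<close> is
  bounded.

  Entries of the lift \<open>x\<close> are sums of two coefficients, so one also needs Eymard's theorem that \<open>A(G)\<close> is closed
  under addition. It follows by embedding the cyclic subrepresentation generated by a compactly supported
  sequence in \<open>\<oplus>\<^sub>n L\<^sup>2(G)\<close> into \<open>L\<^sup>2(G)\<close>.\<close>

section \<open>Involutions without short relations\<close>

text \<open>The projection \<open>e\<close> answers a real obstacle. Permutation matrices fix the
  constant vector, and the compressions \<open>b\<^sub>i\<close> satisfy \<Sum> \<langle>b_i w,
  w\<rangle> = \<Sum> \<phi>(s_i) \<ge> n/2, so on \<open>w\<close> tensor a constant the operator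
  \<Sum> b_i \<otimes> u_i already has norm at least n/2. A bound of order sqrt n can therefore hold
  only off a subspace. The trace method fits this situation: it does not bound the norm, it counts
  orthonormal vectors on which the operator is large, and these can be cut away.

  The order of choices is forced. The constant \<open>C\<close> determines \<open>n\<close>;
  amenability then gives \<open>F\<close>, whose size is not controlled; the exponent of the moment
  method is chosen large in terms of \<open>card F\<close>; only then are \<open>N\<close> and the
  involutions built, free of relations up to the word length that this exponent produces.

  Vectors of \<open>L2\<close> are functions and not classes of functions, so all inner products are
  degenerate. Hence operators are characterised, and identities between vectors stated, through
  inner products.\<close>

definition cancel_step :: "nat \<Rightarrow> nat list \<Rightarrow> nat list" where
  "cancel_step i xs = (if xs \<noteq> [] \<and> hd xs = i then tl xs else i # xs)"

text \<open>\<open>cancel_step\<close> multiplies by a generator in the free product of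
  \<open>n\<close> copies of Z/2, the reduced word being kept as a stack. The estimate is Kesten's
  bound for returns to the root of a tree. Give a stack of height k the weight (sqrt n)^(-k): at
  most n pushes each divide it by sqrt n and at most one pop multiplies it by sqrt n, so one step
  multiplies the total weight by at most 2 sqrt n.\<close>

lemma card_trivial_words:
  assumes "1 \<le> n"
  shows "real (card {ws. set ws \<subseteq> {..<n} \<and> length ws = m \<and> fold cancel_step ws xs = []})
           * sqrt n ^ length xs \<le> 2 ^ m * sqrt n ^ m"
proof (induction m arbitrary: xs)
  case 0
  show ?case
  proof (cases "xs = []")
    case True
    have "{ws :: nat list. set ws \<subseteq> {..<n} \<and> length ws = 0 \<and> fold cancel_step ws xs = []} = {[]}"
      using True by auto
    then show ?thesis using True by simp
  next
    case False
    then have eq: "{ws :: nat list. set ws \<subseteq> {..<n} \<and> length ws = 0 \<and> fold cancel_step ws xs = []} = {}"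
      by auto
    show ?thesis unfolding eq by simp
  qed
next
  case (Suc m)
  define T where "T k zs = {ws. set ws \<subseteq> {..<n} \<and> length ws = k \<and> fold cancel_step ws zs = []}" for k zs
  define s where "s = sqrt (real n)"
  have s: "s > 0" "s * s = real n" using assms by (auto simp: s_def)
  have fin: "finite (T k zs)" for k zs
    by (rule finite_subset[OF _ finite_lists_length_eq[of "{..<n}" k]]) (auto simp: T_def)
  have IH: "real (card (T m zs)) * s ^ length zs \<le> 2 ^ m * s ^ m" for zs
    using Suc.IH[of zs] by (simp add: T_def s_def)
  have eq: "T (Suc m) xs = (\<Union>i<n. Cons i ` T m (cancel_step i xs))"
    by (auto simp: T_def length_Suc_conv image_iff)
  have "card (T (Suc m) xs) \<le> (\<Sum>i<n. card (Cons i ` T m (cancel_step i xs)))"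
    unfolding eq by (rule card_UN_le) simp
  also have "\<dots> = (\<Sum>i<n. card (T m (cancel_step i xs)))"
    by (intro sum.cong card_image) auto
  finally have 1: "real (card (T (Suc m) xs)) \<le> (\<Sum>i<n. real (card (T m (cancel_step i xs))))"
    by (metis (mono_tags) of_nat_le_iff of_nat_sum)
  have push: "real (card (T m zs)) * s ^ length xs \<le> 2 ^ m * s ^ m / s" if "length zs = Suc (length xs)" for zs
    using IH[of zs] that s(1) by (simp add: field_simps)
  have pop: "real (card (T m zs)) * s ^ length xs \<le> 2 ^ m * s ^ m * s" if "Suc (length zs) = length xs" for zs
    using mult_right_mono[OF IH[of zs], of s] that[symmetric] s(1) by (simp add: mult_ac)
  have each: "real (card (T m (cancel_step i xs))) * s ^ length xs
      \<le> 2 ^ m * s ^ m / s + (if xs \<noteq> [] \<and> i = hd xs then 2 ^ m * s ^ m * s else 0)" for i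
  proof (cases "xs \<noteq> [] \<and> i = hd xs")
    case True
    then have "Suc (length (cancel_step i xs)) = length xs" by (cases xs) (auto simp: cancel_step_def)
    then show ?thesis using pop[of "cancel_step i xs"] True s(1) by (simp add: add_increasing)
  next
    case False
    then have "length (cancel_step i xs) = Suc (length xs)" by (auto simp: cancel_step_def)
    then have "real (card (T m (cancel_step i xs))) * s ^ length xs \<le> 2 ^ m * s ^ m / s"
      by (rule push)
    then show ?thesis using False by auto
  qed
  have "real (card (T (Suc m) xs)) * s ^ length xs
      \<le> (\<Sum>i<n. real (card (T m (cancel_step i xs)))) * s ^ length xs"
    using 1 s(1) by (intro mult_right_mono) auto
  also have "\<dots> \<le> (\<Sum>i<n. 2 ^ m * s ^ m / s + (if xs \<noteq> [] \<and> i = hd xs then 2 ^ m * s ^ m * s else 0))"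
    unfolding sum_distrib_right by (intro sum_mono each)
  also have "\<dots> = real n * (2 ^ m * s ^ m / s) + (\<Sum>i<n. if xs \<noteq> [] \<and> i = hd xs then 2 ^ m * s ^ m * s else 0)"
    by (simp add: sum.distrib)
  also have "(\<Sum>i<n. if xs \<noteq> [] \<and> i = hd xs then 2 ^ m * s ^ m * s else 0) \<le> 2 ^ m * s ^ m * s"
    using s(1) by (cases "xs = []") (simp_all add: sum.delta)
  also have "real n * (2 ^ m * s ^ m / s) = 2 ^ m * s ^ m * s"
    using s(1) by (simp add: s(2)[symmetric])
  finally show ?case
    by (simp add: T_def s_def mult_ac)
qed

text \<open>The generators act on the ball of radius \<open>R\<close> in the tree of reduced words;
  a push that would leave the ball is replaced by a fixed point, which keeps each generator an
  involution. In the ball itself a single letter may fix a boundary point. So the ball is replaced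
  by its symmetric group, on which the generators act by left multiplication: a word with one fixed
  point there is the identity permutation, and in particular fixes the root.\<close>

lemma involutions_without_short_relations:
  obtains N \<tau> where "0 < (N::nat)"
    "\<And>i x. i < n \<Longrightarrow> x < N \<Longrightarrow> \<tau> i x < N"
    "\<And>i x. i < n \<Longrightarrow> x < N \<Longrightarrow> \<tau> i (\<tau> i x) = x"
    "\<And>ws x. set ws \<subseteq> {..<n} \<Longrightarrow> length ws \<le> R \<Longrightarrow> x < N \<Longrightarrow> fold \<tau> ws x = x
       \<Longrightarrow> fold cancel_step ws [] = []"
proof -
  define B where "B = {xs. set xs \<subseteq> {..<n} \<and> length xs \<le> R \<and> distinct_adj xs}"
  define p where "p i xs = (if xs \<in> B then
      if xs \<noteq> [] \<and> hd xs = i then tl xs else if length xs < R then i # xs else xs else xs)" for i xs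
  have finB: "finite B"
    by (rule finite_subset[OF _ finite_lists_length_le[of "{..<n}" R]]) (auto simp: B_def)
  have pB: "p i xs \<in> B" if "i < n" "xs \<in> B" for i xs
    using that by (cases xs) (auto simp: p_def B_def distinct_adj_Cons)
  have pp: "p i (p i xs) = xs" if "i < n" for i xs
  proof (cases "xs \<in> B")
    case True
    then show ?thesis using pB[OF that True] that
      by (cases xs; cases "tl xs") (auto simp: p_def B_def distinct_adj_Cons)
  qed (simp add: p_def)
  have perm: "p i permutes B" if "i < n" for i
    using pB[OF that] pp[OF that] by (metis (no_types, lifting) bij_betw_byWitness[of B "p i" "p i" B]
        image_subset_iff bij_imp_permutes p_def)
  define X where "X = {f. f permutes B}"
  have finX: "finite X" unfolding X_def using finite_permutations[OF finB] by simp
  have idX: "id \<in> X" by (simp add: X_def permutes_id)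
  obtain h where h: "bij_betw h {..<card X} X"
    using ex_bij_betw_nat_finite[OF finX] by (metis atLeast0LessThan)
  define g where "g = inv_into {..<card X} h"
  have gX: "f \<in> X \<Longrightarrow> g f < card X" "f \<in> X \<Longrightarrow> h (g f) = f" for f
    using h by (metis bij_betw_def g_def inv_into_into lessThan_iff, metis bij_betw_inv_into_right g_def h)
  have hX: "x < card X \<Longrightarrow> h x \<in> X" "x < card X \<Longrightarrow> g (h x) = x" for x
    using h by (auto simp: bij_betw_def g_def)
  define \<tau> where "\<tau> i x = g (p i \<circ> h x)" for i x
  have pX: "p i \<circ> f \<in> X" if "i < n" "f \<in> X" for i f
    using that perm[OF that(1)] by (auto simp: X_def intro: permutes_compose)
  have \<tau>N: "\<tau> i x < card X" if "i < n" "x < card X" for i x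
    using that by (simp add: \<tau>_def gX hX pX)
  have fold\<tau>: "fold \<tau> ws x < card X \<and> h (fold \<tau> ws x) = fold p ws \<circ> h x"
    if "set ws \<subseteq> {..<n}" "x < card X" for ws x
    using that
  proof (induction ws arbitrary: x)
    case (Cons i ws)
    then have "\<tau> i x < card X" "h (\<tau> i x) = p i \<circ> h x"
      using \<tau>N[of i x] gX(2)[OF pX[of i "h x"]] hX by (auto simp: \<tau>_def)
    then show ?case using Cons by (simp add: o_assoc)
  qed simp
  \<comment> \<open>As long as stack height plus remaining length is at most \<open>R\<close>, no
    push is blocked at the boundary.\<close>
  have short: "fold p ws xs = fold cancel_step ws xs"
    if "set ws \<subseteq> {..<n}" "length ws + length xs \<le> R" "xs \<in> B" for ws xs
    using that
  proof (induction ws arbitrary: xs)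
    case (Cons i ws)
    then have 1: "p i xs = cancel_step i xs" by (auto simp: p_def cancel_step_def)
    have "length (cancel_step i xs) \<le> Suc (length xs)" by (auto simp: cancel_step_def)
    then show ?case using Cons 1 pB[of i xs] by simp
  qed simp
  show ?thesis
  proof
    show "0 < card X" using finX idX card_gt_0_iff by blast
    show "\<tau> i x < card X" if "i < n" "x < card X" for i x by (rule \<tau>N[OF that])
    show "\<tau> i (\<tau> i x) = x" if "i < n" "x < card X" for i x
    proof -
      have "p i \<circ> (p i \<circ> h x) = h x" using pp[OF that(1)] by auto
      then show ?thesis using that by (simp add: \<tau>_def gX(2)[OF pX] hX)
    qed
    show "fold cancel_step ws [] = []"
      if "set ws \<subseteq> {..<n}" "length ws \<le> R" "x < card X" "fold \<tau> ws x = x" for ws x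
    proof -
      have eq: "h x = fold p ws \<circ> h x" using fold\<tau>[OF that(1,3)] that(4) by simp
      have "h x permutes B" using hX that(3) by (auto simp: X_def)
      \<comment> \<open>The relation is read off at the point that \<open>h x\<close> sends to the
        root.\<close>
      then obtain y where y: "h x y = []" by (metis permutes_inverses(1))
      have "fold p ws [] = []" using fun_cong[OF eq, of y] y by simp
      moreover have "fold p ws [] = fold cancel_step ws []"
        using that by (intro short) (auto simp: B_def)
      ultimately show ?thesis by simp
    qed
  qed
qed

section \<open>Counting words in the moment method\<close>

definition fip :: "'p set \<Rightarrow> ('p \<Rightarrow> real) \<Rightarrow> ('p \<Rightarrow> real) \<Rightarrow> real" where
  "fip I f g = (\<Sum>p\<in>I. f p * g p)"

definition kernel_apply :: "'p set \<Rightarrow> ('p \<Rightarrow> 'p \<Rightarrow> real) \<Rightarrow> ('p \<Rightarrow> real) \<Rightarrow> 'p \<Rightarrow> real" where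
  "kernel_apply I S f p = (\<Sum>q\<in>I. S p q * f q)"

lemma fip_commute: "fip I f g = fip I g f"
  by (simp add: fip_def mult.commute)

lemma fip_nonneg: "0 \<le> fip I f f"
  by (simp add: fip_def sum_nonneg)

lemma fip_sum_left: "fip I (\<lambda>p. \<Sum>j\<in>J. c j * f j p) g = (\<Sum>j\<in>J. c j * fip I (f j) g)"
  unfolding fip_def sum_distrib_right sum_distrib_left
  by (subst sum.swap) (simp add: mult_ac)

lemma fip_diff_left: "fip I (\<lambda>p. f p - g p) h = fip I f h - fip I g h"
  by (simp add: fip_def sum_subtractf left_diff_distrib)

lemma fip_delta: "finite I \<Longrightarrow> p \<in> I \<Longrightarrow> fip I f (\<lambda>q. if q = p then 1 else 0) = f p"
  by (simp add: fip_def if_distrib sum.delta cong: if_cong)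

lemma fip_Cauchy_Schwarz: "(fip I f g)\<^sup>2 \<le> fip I f f * fip I g g"
  unfolding fip_def using Cauchy_Schwarz_ineq_sum[of f g I] by (simp add: power2_eq_square)

lemma fip_Bessel:
  fixes \<xi> :: "nat \<Rightarrow> 'p \<Rightarrow> real"
  assumes "\<And>j l. j < r \<Longrightarrow> l < r \<Longrightarrow> fip I (\<xi> j) (\<xi> l) = (if j = l then 1 else 0)"
  shows "(\<Sum>j<r. (fip I (\<xi> j) v)\<^sup>2) \<le> fip I v v"
proof -
  define w where "w = (\<lambda>p. \<Sum>j<r. fip I (\<xi> j) v * \<xi> j p)"
  have 1: "fip I w u = (\<Sum>j<r. fip I (\<xi> j) v * fip I (\<xi> j) u)" for u
    unfolding w_def by (rule fip_sum_left)
  have 2: "fip I w w = (\<Sum>j<r. (fip I (\<xi> j) v)\<^sup>2)"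
  proof -
    have "fip I (\<xi> j) w = fip I (\<xi> j) v" if "j < r" for j
    proof -
      have "fip I (\<xi> j) w = (\<Sum>l<r. fip I (\<xi> l) v * fip I (\<xi> l) (\<xi> j))"
        using 1[of "\<xi> j"] by (simp add: fip_commute)
      also have "\<dots> = (\<Sum>l<r. if l = j then fip I (\<xi> l) v else 0)"
        using assms that by (intro sum.cong) auto
      finally show ?thesis using that by simp
    qed
    then show ?thesis unfolding 1 by (simp add: power2_eq_square)
  qed
  have "0 \<le> fip I (\<lambda>p. v p - w p) (\<lambda>p. v p - w p)" by (rule fip_nonneg)
  also have "\<dots> = fip I v v - fip I w v - (fip I v w - fip I w w)"
    by (simp add: fip_diff_left fip_commute[of _ _ "\<lambda>p. v p - w p"])
  also have "\<dots> = fip I v v - (\<Sum>j<r. (fip I (\<xi> j) v)\<^sup>2)"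
    using 1[of v] 2 by (simp add: fip_commute[of _ v w] power2_eq_square)
  finally show ?thesis by simp
qed

lemma fip_kernel_apply:
  "fip I (kernel_apply I S f) g = fip I f (kernel_apply I (\<lambda>p q. S q p) g)"
  unfolding fip_def kernel_apply_def sum_distrib_left sum_distrib_right
  by (subst sum.swap) (simp add: mult_ac)

definition gram_apply :: "'p set \<Rightarrow> ('p \<Rightarrow> 'p \<Rightarrow> real) \<Rightarrow> ('p \<Rightarrow> real) \<Rightarrow> 'p \<Rightarrow> real" where
  "gram_apply I S f = kernel_apply I (\<lambda>p q. S q p) (kernel_apply I S f)"

lemma fip_gram_apply: "fip I (gram_apply I S f) g = fip I (kernel_apply I S f) (kernel_apply I S g)"
  unfolding gram_apply_def fip_kernel_apply by simp

lemma fip_gram_apply_commute: "fip I (gram_apply I S f) g = fip I f (gram_apply I S g)"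
  by (metis fip_gram_apply fip_commute)

lemma fip_gram_funpow: "fip I ((gram_apply I S ^^ k) f) g = fip I f ((gram_apply I S ^^ k) g)"
proof (induction k arbitrary: g)
  case (Suc k)
  have "(gram_apply I S ^^ Suc k) g = (gram_apply I S ^^ k) (gram_apply I S g)"
    by (simp add: funpow_swap1)
  then show ?case using Suc[of "gram_apply I S g"] by (simp add: fip_gram_apply_commute)
qed simp

lemma fip_gram_funpow_double:
  "fip I ((gram_apply I S ^^ (2 * k)) f) f = fip I ((gram_apply I S ^^ k) f) ((gram_apply I S ^^ k) f)"
  by (simp add: mult_2 funpow_add fip_gram_funpow)

text \<open>Jensen's inequality for the spectral measure of a Gram matrix, obtained without
  diagonalising: Cauchy-Schwarz squares the bound whenever the exponent doubles. This is why all
  exponents are powers of two.\<close>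

lemma fip_gram_power_ge:
  assumes "fip I \<xi> \<xi> = 1" and "0 \<le> c" and "c \<le> fip I (kernel_apply I S \<xi>) (kernel_apply I S \<xi>)"
  shows "c ^ (2 ^ m) \<le> fip I ((gram_apply I S ^^ (2 ^ m)) \<xi>) \<xi>"
proof (induction m)
  case 0
  then show ?case using assms by (simp add: fip_gram_apply)
next
  case (Suc m)
  have "c ^ (2 ^ Suc m) = (c ^ (2 ^ m))\<^sup>2" by (simp add: power_mult[symmetric] mult.commute)
  also have "\<dots> \<le> (fip I ((gram_apply I S ^^ (2 ^ m)) \<xi>) \<xi>)\<^sup>2"
    using Suc assms(2) by (intro power_mono) auto
  also have "\<dots> \<le> fip I ((gram_apply I S ^^ (2 ^ m)) \<xi>) ((gram_apply I S ^^ (2 ^ m)) \<xi>)"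
    using fip_Cauchy_Schwarz[of I "(gram_apply I S ^^ (2 ^ m)) \<xi>" \<xi>] assms(1) by simp
  also have "\<dots> = fip I ((gram_apply I S ^^ (2 ^ Suc m)) \<xi>) \<xi>"
    by (simp only: power_Suc fip_gram_funpow_double)
  finally show ?case .
qed

text \<open>Trace method: the trace of a positive matrix dominates the sum of its quadratic form
  over any orthonormal family. Writing the power as the square of the symmetric matrix
  \<open>A\<close> reduces this to Bessel's inequality for the columns
  \<open>A (\<delta> p)\<close>; the exponent \<open>2 ^ Suc m\<close> is one that can be
  halved.\<close>

lemma card_orthonormal_large:
  assumes fin: "finite I"
    and on: "\<And>j l. j < r \<Longrightarrow> l < r \<Longrightarrow> fip I (\<xi> j) (\<xi> l) = (if j = l then 1 else 0)"
    and big: "\<And>j. j < r \<Longrightarrow> c \<le> fip I (kernel_apply I S (\<xi> j)) (kernel_apply I S (\<xi> j))"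
    and c: "0 \<le> c"
    and diag: "\<And>p. p \<in> I \<Longrightarrow> (gram_apply I S ^^ (2 ^ Suc m)) (\<lambda>q. if q = p then 1 else 0) p \<le> d"
  shows "real r * c ^ (2 ^ Suc m) \<le> real (card I) * d"
proof -
  define A where "A = gram_apply I S ^^ (2 ^ m)"
  define \<delta> where "\<delta> p = (\<lambda>q::'a. if q = p then 1::real else 0)" for p
  have "real r * c ^ (2 ^ Suc m) = (\<Sum>j<r. c ^ (2 ^ Suc m))" by simp
  also have "\<dots> \<le> (\<Sum>j<r. fip I ((gram_apply I S ^^ (2 ^ Suc m)) (\<xi> j)) (\<xi> j))"
    using on big c by (intro sum_mono fip_gram_power_ge) auto
  also have "\<dots> = (\<Sum>j<r. fip I (A (\<xi> j)) (A (\<xi> j)))"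
    by (simp only: A_def power_Suc fip_gram_funpow_double)
  also have "\<dots> = (\<Sum>j<r. \<Sum>p\<in>I. (fip I (\<xi> j) (A (\<delta> p)))\<^sup>2)"
  proof (rule sum.cong[OF refl])
    fix j
    have "A (\<xi> j) p = fip I (\<xi> j) (A (\<delta> p))" if "p \<in> I" for p
      using fip_delta[OF fin that, of "A (\<xi> j)"] fip_gram_funpow[where I=I and S=S and k="2 ^ m" and f="\<xi> j" and g="\<delta> p"]
      by (simp add: A_def \<delta>_def)
    then show "fip I (A (\<xi> j)) (A (\<xi> j)) = (\<Sum>p\<in>I. (fip I (\<xi> j) (A (\<delta> p)))\<^sup>2)"
      by (simp add: fip_def[of I "A (\<xi> j)"] power2_eq_square)
  qed
  also have "\<dots> = (\<Sum>p\<in>I. \<Sum>j<r. (fip I (\<xi> j) (A (\<delta> p)))\<^sup>2)" by (rule sum.swap)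
  also have "\<dots> \<le> (\<Sum>p\<in>I. fip I (A (\<delta> p)) (A (\<delta> p)))"
    using on by (intro sum_mono fip_Bessel) auto
  also have "\<dots> = (\<Sum>p\<in>I. fip I ((gram_apply I S ^^ (2 ^ Suc m)) (\<delta> p)) (\<delta> p))"
    by (simp only: A_def power_Suc fip_gram_funpow_double)
  also have "\<dots> = (\<Sum>p\<in>I. (gram_apply I S ^^ (2 ^ Suc m)) (\<delta> p) p)"
    by (intro sum.cong refl) (simp add: \<delta>_def fip_delta[OF fin])
  also have "\<dots> \<le> (\<Sum>p\<in>I. d)"
    using diag by (intro sum_mono) (simp add: \<delta>_def)
  finally show ?thesis by simp
qed

text \<open>The matrix of \<Sum> b_i \<otimes> u_i, where u_i is the permutation matrix of
  \<open>\<tau> i\<close>.\<close>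

definition word_kernel ::
  "nat \<Rightarrow> (nat \<Rightarrow> 'g \<Rightarrow> 'g \<Rightarrow> real) \<Rightarrow> (nat \<Rightarrow> nat \<Rightarrow> nat) \<Rightarrow> 'g \<times> nat \<Rightarrow> 'g \<times> nat \<Rightarrow> real" where
  "word_kernel n b \<tau> = (\<lambda>(g, x) (h, y). \<Sum>i<n. b i g h * (if y = \<tau> i x then 1 else 0))"

lemma word_kernel_apply:
  assumes "finite F" and "\<And>i x. i < n \<Longrightarrow> x < N \<Longrightarrow> \<tau> i x < N" and "x < N"
  shows "kernel_apply (F \<times> {..<N}) (word_kernel n b \<tau>) f (g, x) = (\<Sum>i<n. \<Sum>h\<in>F. b i g h * f (h, \<tau> i x))"
proof -
  have "kernel_apply (F \<times> {..<N}) (word_kernel n b \<tau>) f (g, x)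
      = (\<Sum>(h, y)\<in>F \<times> {..<N}. \<Sum>i<n. b i g h * (if y = \<tau> i x then 1 else 0) * f (h, y))"
    unfolding kernel_apply_def by (intro sum.cong) (auto simp: word_kernel_def sum_distrib_right)
  also have "\<dots> = (\<Sum>h\<in>F. \<Sum>y<N. \<Sum>i<n. b i g h * (if y = \<tau> i x then 1 else 0) * f (h, y))"
    by (rule sum.cartesian_product[symmetric])
  also have "\<dots> = (\<Sum>h\<in>F. \<Sum>i<n. \<Sum>y<N. if y = \<tau> i x then b i g h * f (h, y) else 0)"
    by (rule sum.cong[OF refl], subst sum.swap) (auto intro!: sum.cong)
  also have "\<dots> = (\<Sum>h\<in>F. \<Sum>i<n. b i g h * f (h, \<tau> i x))"
    using assms by (intro sum.cong refl) (simp add: sum.delta)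
  finally show ?thesis by (subst sum.swap)
qed

lemma kernel_apply_cong:
  "(\<And>q. q \<in> I \<Longrightarrow> S p q = S' p q) \<Longrightarrow> kernel_apply I S f p = kernel_apply I S' f p"
  by (simp add: kernel_apply_def)

definition word_count :: "nat \<Rightarrow> (nat \<Rightarrow> nat \<Rightarrow> nat) \<Rightarrow> nat \<Rightarrow> nat \<Rightarrow> nat \<Rightarrow> nat" where
  "word_count n \<tau> x0 k x = card {ws. set ws \<subseteq> {..<n} \<and> length ws = k \<and> fold \<tau> ws x = x0}"

lemma word_count_Suc: "word_count n \<tau> x0 (Suc k) x = (\<Sum>i<n. word_count n \<tau> x0 k (\<tau> i x))"
proof -
  define T where "T k x = {ws. set ws \<subseteq> {..<n} \<and> length ws = k \<and> fold \<tau> ws x = x0}" for k x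
  have fin: "finite (T k x)" for k x
    by (rule finite_subset[OF _ finite_lists_length_eq[of "{..<n}" k]]) (auto simp: T_def)
  have "T (Suc k) x = (\<Union>i<n. Cons i ` T k (\<tau> i x))"
    by (auto simp: T_def length_Suc_conv image_iff)
  then have "card (T (Suc k) x) = (\<Sum>i<n. card (Cons i ` T k (\<tau> i x)))"
    by (simp only:) (intro card_UN_disjoint, auto simp: fin)
  also have "\<dots> = (\<Sum>i<n. card (T k (\<tau> i x)))"
    by (intro sum.cong card_image) auto
  finally show ?thesis by (simp add: word_count_def T_def)
qed

text \<open>One application of the kernel spells one more letter in the second coordinate. In the
  first coordinate it averages against rows of \<open>b i\<close>, which are nonnegative of total
  mass at most 1, so a bound depending on \<open>x\<close> alone survives.\<close>

lemma word_kernel_bound: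
  fixes f :: "'g \<times> nat \<Rightarrow> real"
  assumes F: "finite F" and \<tau>: "\<And>i x. i < n \<Longrightarrow> x < N \<Longrightarrow> \<tau> i x < N"
    and b0: "\<And>i g h. 0 \<le> b i g h" and b1: "\<And>i g. i < n \<Longrightarrow> g \<in> F \<Longrightarrow> (\<Sum>h\<in>F. b i g h) \<le> 1"
    and f: "\<And>h x. h \<in> F \<Longrightarrow> x < N \<Longrightarrow> 0 \<le> f (h, x) \<and> f (h, x) \<le> word_count n \<tau> x0 k x"
    and g: "g \<in> F" and x: "x < N"
  shows "0 \<le> kernel_apply (F \<times> {..<N}) (word_kernel n b \<tau>) f (g, x)
     \<and> kernel_apply (F \<times> {..<N}) (word_kernel n b \<tau>) f (g, x) \<le> word_count n \<tau> x0 (Suc k) x"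
proof
  have *: "kernel_apply (F \<times> {..<N}) (word_kernel n b \<tau>) f (g, x) = (\<Sum>i<n. \<Sum>h\<in>F. b i g h * f (h, \<tau> i x))"
    by (rule word_kernel_apply) (use F \<tau> x in auto)
  show "0 \<le> kernel_apply (F \<times> {..<N}) (word_kernel n b \<tau>) f (g, x)"
    unfolding * using f b0 \<tau> x by (intro sum_nonneg mult_nonneg_nonneg) auto
  have "(\<Sum>h\<in>F. b i g h * f (h, \<tau> i x)) \<le> word_count n \<tau> x0 k (\<tau> i x)" if "i < n" for i
  proof -
    have "(\<Sum>h\<in>F. b i g h * f (h, \<tau> i x)) \<le> (\<Sum>h\<in>F. b i g h * word_count n \<tau> x0 k (\<tau> i x))"
      using f b0 \<tau> x that by (intro sum_mono mult_left_mono) auto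
    also have "\<dots> = (\<Sum>h\<in>F. b i g h) * word_count n \<tau> x0 k (\<tau> i x)" by (simp add: sum_distrib_right)
    also have "\<dots> \<le> 1 * real (word_count n \<tau> x0 k (\<tau> i x))" using b1[OF that g] by (intro mult_right_mono) auto
    finally show ?thesis by simp
  qed
  then show "kernel_apply (F \<times> {..<N}) (word_kernel n b \<tau>) f (g, x) \<le> word_count n \<tau> x0 (Suc k) x"
    unfolding * word_count_Suc of_nat_sum by (intro sum_mono) auto
qed

text \<open>Because each \<open>\<tau> i\<close> is an involution, the transposed kernel is again a
  word kernel, with every \<open>b i\<close> transposed; column sums take over the role of row sums.
  Each Gram step therefore spells two letters.\<close>

lemma gram_word_bound:
  assumes F: "finite F" and \<tau>: "\<And>i x. i < n \<Longrightarrow> x < N \<Longrightarrow> \<tau> i x < N"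
    and inv: "\<And>i x. i < n \<Longrightarrow> x < N \<Longrightarrow> \<tau> i (\<tau> i x) = x"
    and b0: "\<And>i g h. 0 \<le> b i g h"
    and b1: "\<And>i g. i < n \<Longrightarrow> g \<in> F \<Longrightarrow> (\<Sum>h\<in>F. b i g h) \<le> 1"
    and b2: "\<And>i h. i < n \<Longrightarrow> h \<in> F \<Longrightarrow> (\<Sum>g\<in>F. b i g h) \<le> 1"
    and g: "g \<in> F" and x: "x < N"
  shows "(gram_apply (F \<times> {..<N}) (word_kernel n b \<tau>) ^^ k) (\<lambda>q. if q = (g0, x0) then 1 else 0) (g, x)
     \<le> word_count n \<tau> x0 (2 * k) x"
proof -
  let ?I = "F \<times> {..<N}" and ?S = "word_kernel n b \<tau>" and ?b = "\<lambda>i g h. b i h g"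
  have tr: "?S q p = word_kernel n ?b \<tau> p q" if "p \<in> ?I" "q \<in> ?I" for p q
    using that inv by (auto simp: word_kernel_def intro!: sum.cong)
  have "\<forall>g\<in>F. \<forall>x<N. 0 \<le> (gram_apply ?I ?S ^^ k) (\<lambda>q. if q = (g0, x0) then 1 else 0) (g, x)
      \<and> (gram_apply ?I ?S ^^ k) (\<lambda>q. if q = (g0, x0) then 1 else 0) (g, x) \<le> word_count n \<tau> x0 (2 * k) x"
  proof (induction k)
    case 0
    have "word_count n \<tau> x0 0 x = (if x = x0 then 1 else 0)" for x
    proof -
      have "{ws. set ws \<subseteq> {..<n} \<and> length ws = 0 \<and> fold \<tau> ws x = x0} = (if x = x0 then {[]} else {})"
        by auto
      then show ?thesis unfolding word_count_def by (simp only:) simp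
    qed
    then show ?case by auto
  next
    case (Suc k)
    define f where "f = (gram_apply ?I ?S ^^ k) (\<lambda>q. if q = (g0, x0) then 1 else 0)"
    show ?case
    proof (intro ballI allI impI)
      fix g x assume gx: "g \<in> F" "x < N"
      have "kernel_apply ?I (\<lambda>p q. ?S q p) (kernel_apply ?I ?S f) (g, x)
          = kernel_apply ?I (word_kernel n ?b \<tau>) (kernel_apply ?I ?S f) (g, x)"
        using gx by (intro kernel_apply_cong tr) auto
      moreover have "0 \<le> kernel_apply ?I (word_kernel n ?b \<tau>) (kernel_apply ?I ?S f) (g, x)
        \<and> kernel_apply ?I (word_kernel n ?b \<tau>) (kernel_apply ?I ?S f) (g, x)
          \<le> word_count n \<tau> x0 (Suc (Suc (2 * k))) x"
      proof (rule word_kernel_bound[OF F \<tau>])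
        fix h y assume hy: "h \<in> F" "y < N"
        show "0 \<le> kernel_apply ?I ?S f (h, y) \<and> kernel_apply ?I ?S f (h, y) \<le> word_count n \<tau> x0 (Suc (2 * k)) y"
          by (rule word_kernel_bound[OF F \<tau> b0 b1]) (use Suc[folded f_def] hy in auto)
      qed (use b0 b2 gx in auto)
      ultimately show "0 \<le> (gram_apply ?I ?S ^^ Suc k) (\<lambda>q. if q = (g0, x0) then 1 else 0) (g, x)
        \<and> (gram_apply ?I ?S ^^ Suc k) (\<lambda>q. if q = (g0, x0) then 1 else 0) (g, x)
           \<le> word_count n \<tau> x0 (2 * Suc k) x"
        by (simp add: f_def[symmetric] gram_apply_def)
    qed
  qed
  then show ?thesis using g x by blast
qed

section \<open>Involutions compressed by a projection of large trace\<close>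

definition is_projection :: "nat \<Rightarrow> (nat \<Rightarrow> nat \<Rightarrow> real) \<Rightarrow> bool" where
  "is_projection N e \<longleftrightarrow> (\<forall>x<N. \<forall>y<N. e x y = e y x \<and> (\<Sum>z<N. e x z * e z y) = e x y)"

lemma is_projectionD:
  assumes "is_projection N e" "x < N" "y < N"
  shows "e x y = e y x" "(\<Sum>z<N. e x z * e z y) = e x y"
  using assms unfolding is_projection_def by blast+

text \<open>For orthogonal projections the matrix identity \<open>e' e = e'\<close> says that the
  range of \<open>e'\<close> lies in that of \<open>e\<close>. In this form it shows at once that
  vectors killed by \<open>e\<close> are killed by \<open>e'\<close>.\<close>

definition below_projection :: "nat \<Rightarrow> (nat \<Rightarrow> nat \<Rightarrow> real) \<Rightarrow> (nat \<Rightarrow> nat \<Rightarrow> real) \<Rightarrow> bool" where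
  "below_projection N e' e \<longleftrightarrow> (\<forall>x<N. \<forall>y<N. (\<Sum>z<N. e' x z * e z y) = e' x y)"

text \<open>With \<open>u = e v\<close>, the rank one projection onto \<open>u\<close> is subtracted
  from \<open>e\<close>. As \<open>u\<close> lies in the range of \<open>e\<close>, the difference
  is a projection of trace one less, and it kills \<open>v\<close> because \<langle>u, v\<rangle> =
  \<langle>u, u\<rangle>. If \<open>u = 0\<close>, then \<open>e\<close> itself will do.\<close>

lemma projection_cut_vector:
  assumes e: "is_projection N e"
  obtains e' where "is_projection N e'" "below_projection N e' e"
    "\<And>x. x < N \<Longrightarrow> (\<Sum>y<N. e' x y * v y) = 0" "(\<Sum>x<N. e x x) - 1 \<le> (\<Sum>x<N. e' x x)"
proof -
  define u where "u x = (\<Sum>y<N. e x y * v y)" for x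
  define s where "s = (\<Sum>x<N. u x * u x)"
  have sym: "e x y = e y x" and idem: "(\<Sum>z<N. e x z * e z y) = e x y" if "x < N" "y < N" for x y
    using e that unfolding is_projection_def by blast+
  have eu: "(\<Sum>z<N. e x z * u z) = u x" if "x < N" for x
  proof -
    have "(\<Sum>z<N. e x z * u z) = (\<Sum>y<N. (\<Sum>z<N. e x z * e z y) * v y)"
      unfolding u_def sum_distrib_left sum_distrib_right by (subst sum.swap) (simp add: mult_ac)
    also have "\<dots> = (\<Sum>y<N. e x y * v y)" using that by (intro sum.cong) (auto simp: idem)
    finally show ?thesis by (simp add: u_def)
  qed
  have ue: "(\<Sum>z<N. u z * e z y) = u y" if "y < N" for y
    using eu[OF that] that by (simp add: sym mult.commute)
  have uv: "(\<Sum>y<N. u y * v y) = s"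
  proof -
    have "s = (\<Sum>x<N. \<Sum>y<N. u x * (e x y * v y))"
      unfolding s_def by (subst (2) u_def) (simp add: sum_distrib_left)
    also have "\<dots> = (\<Sum>y<N. (\<Sum>x<N. u x * e x y) * v y)"
      by (subst sum.swap) (simp add: sum_distrib_right sum_distrib_left mult_ac)
    also have "\<dots> = (\<Sum>y<N. u y * v y)" by (intro sum.cong) (auto simp: ue)
    finally show ?thesis by simp
  qed
  show ?thesis
  proof (cases "s = 0")
    case True
    then have "u x = 0" if "x < N" for x
      using that unfolding s_def by (subst (asm) sum_nonneg_eq_0_iff) auto
    then show ?thesis
      using e by (intro that[of e]) (auto simp: below_projection_def idem u_def)
  next
    case False
    define e' where "e' x y = e x y - u x * u y / s" for x y
    have mult: "(\<Sum>z<N. e' x z * w z) = (\<Sum>z<N. e x z * w z) - u x * (\<Sum>z<N. u z * w z) / s" for x w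
    proof -
      have "(\<Sum>z<N. e' x z * w z) = (\<Sum>z<N. e x z * w z - (u x / s) * (u z * w z))"
        by (simp add: e'_def left_diff_distrib mult.assoc)
      then show ?thesis by (simp add: sum_subtractf sum_distrib_left sum_divide_distrib)
    qed
    have below: "(\<Sum>z<N. e' x z * e z y) = e' x y" if "x < N" "y < N" for x y
      using that by (simp add: mult idem ue) (simp add: e'_def)
    have u0: "(\<Sum>z<N. e' x z * u z) = 0" if "x < N" for x
      using that False by (simp add: mult eu s_def[symmetric])
    have "is_projection N e'"
      unfolding is_projection_def
    proof (intro allI impI conjI)
      fix x y assume xy: "x < N" "y < N"
      show "e' x y = e' y x" using sym[OF xy] by (simp add: e'_def mult.commute)
      have "(\<Sum>z<N. e' x z * e' z y) = (\<Sum>z<N. e' x z * e z y - (e' x z * u z) * (u y / s))"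
        by (simp add: e'_def[of _ y] right_diff_distrib mult.assoc)
      also have "\<dots> = (\<Sum>z<N. e' x z * e z y) - (\<Sum>z<N. e' x z * u z) * (u y / s)"
        by (simp only: sum_subtractf sum_distrib_right)
      finally show "(\<Sum>z<N. e' x z * e' z y) = e' x y" using xy by (simp add: below u0)
    qed
    moreover have "(\<Sum>y<N. e' x y * v y) = 0" if "x < N" for x
      using False by (simp add: mult uv u_def[symmetric])
    moreover have "(\<Sum>x<N. e' x x) = (\<Sum>x<N. e x x) - 1"
      using False by (simp add: e'_def sum_subtractf sum_divide_distrib[symmetric] s_def)
    ultimately show ?thesis using below by (intro that[of e']) (auto simp: below_projection_def)
  qed
qed

lemma below_projection_refl: "is_projection N e \<Longrightarrow> below_projection N e e"
  unfolding below_projection_def using is_projectionD(2) by blast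

lemma below_projection_apply:
  assumes "below_projection N e' e" "x < N"
  shows "(\<Sum>z<N. e' x z * (\<Sum>y<N. e z y * v y)) = (\<Sum>y<N. e' x y * v y)"
proof -
  have "(\<Sum>z<N. e' x z * (\<Sum>y<N. e z y * v y)) = (\<Sum>y<N. (\<Sum>z<N. e' x z * e z y) * v y)"
    unfolding sum_distrib_left sum_distrib_right by (subst sum.swap) (simp add: mult_ac)
  also have "\<dots> = (\<Sum>y<N. e' x y * v y)"
    using assms by (intro sum.cong) (auto simp: below_projection_def)
  finally show ?thesis .
qed

lemma below_projection_vanish:
  assumes "below_projection N e' e" "\<And>x. x < N \<Longrightarrow> (\<Sum>y<N. e x y * v y) = 0" "x < N"
  shows "(\<Sum>y<N. e' x y * v y) = 0"
  using below_projection_apply[OF assms(1,3), of v] assms(2) by simp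

lemma projection_cut_vectors:
  assumes F: "finite F" and e: "is_projection N e"
  shows "\<exists>e'. is_projection N e' \<and> below_projection N e' e \<and>
    (\<forall>h\<in>F. \<forall>x<N. (\<Sum>y<N. e' x y * v h y) = 0) \<and>
    (\<Sum>x<N. e x x) - real (card F) \<le> (\<Sum>x<N. e' x x)"
  using F
proof induction
  case empty
  show ?case using e below_projection_refl[OF e] by (intro exI[of _ e]) auto
next
  case (insert h F)
  then obtain e1 where e1: "is_projection N e1" "below_projection N e1 e"
    "\<forall>h\<in>F. \<forall>x<N. (\<Sum>y<N. e1 x y * v h y) = 0"
    "(\<Sum>x<N. e x x) - real (card F) \<le> (\<Sum>x<N. e1 x x)" by blast
  obtain e2 where e2: "is_projection N e2" "below_projection N e2 e1"
    "\<And>x. x < N \<Longrightarrow> (\<Sum>y<N. e2 x y * v h y) = 0" "(\<Sum>x<N. e1 x x) - 1 \<le> (\<Sum>x<N. e2 x x)"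
    using projection_cut_vector[OF e1(1), of "v h"] by blast
  have "below_projection N e2 e"
    unfolding below_projection_def
  proof (intro allI impI)
    fix x y assume xy: "x < N" "y < N"
    have "(\<Sum>z<N. e2 x z * e z y) = (\<Sum>w<N. e2 x w * (\<Sum>z<N. e1 w z * e z y))"
      using below_projection_apply[OF e2(2) xy(1), of "\<lambda>z. e z y"] by simp
    also have "\<dots> = (\<Sum>w<N. e2 x w * e1 w y)"
      using e1(2) xy by (intro sum.cong) (auto simp: below_projection_def)
    also have "\<dots> = e2 x y" using e2(2) xy by (simp add: below_projection_def)
    finally show "(\<Sum>z<N. e2 x z * e z y) = e2 x y" .
  qed
  moreover have "\<forall>k\<in>insert h F. \<forall>x<N. (\<Sum>y<N. e2 x y * v k y) = 0"
    using e2(3) below_projection_vanish[OF e2(2)] e1(3) by auto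
  ultimately show ?case using e1 e2 insert.hyps by (intro exI[of _ e2]) auto
qed

text \<open>The operator 1 \<otimes> e; a vector over \<open>F\<close> times \<open>{..<N}\<close>
  is regarded as a family of slices indexed by \<open>F\<close>.\<close>

definition slice_apply :: "nat \<Rightarrow> (nat \<Rightarrow> nat \<Rightarrow> real) \<Rightarrow> ('g \<times> nat \<Rightarrow> real) \<Rightarrow> 'g \<times> nat \<Rightarrow> real" where
  "slice_apply N e v = (\<lambda>(h, x). \<Sum>y<N. e x y * v (h, y))"

lemma fip_slices: "fip (F \<times> {..<N}) f g = (\<Sum>h\<in>F. \<Sum>x<N. f (h, x) * g (h, x))"
  by (simp add: fip_def sum.cartesian_product case_prod_unfold)

lemma fip_slice_apply:
  assumes "is_projection N e"
  shows "fip (F \<times> {..<N}) (slice_apply N e v) w = fip (F \<times> {..<N}) v (slice_apply N e w)"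
proof -
  have "(\<Sum>x<N. slice_apply N e v (h, x) * w (h, x)) = (\<Sum>x<N. v (h, x) * slice_apply N e w (h, x))" for h
  proof -
    have "(\<Sum>x<N. slice_apply N e v (h, x) * w (h, x)) = (\<Sum>x<N. \<Sum>y<N. e x y * v (h, y) * w (h, x))"
      by (simp add: slice_apply_def sum_distrib_right)
    also have "\<dots> = (\<Sum>y<N. \<Sum>x<N. e x y * v (h, y) * w (h, x))" by (rule sum.swap)
    also have "\<dots> = (\<Sum>y<N. \<Sum>x<N. v (h, y) * (e y x * w (h, x)))"
      using assms by (intro sum.cong refl) (auto simp: is_projection_def)
    finally show ?thesis by (simp add: slice_apply_def sum_distrib_left)
  qed
  then show ?thesis by (simp add: fip_slices)
qed

lemma slice_apply_idem:
  assumes "is_projection N e" "x < N"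
  shows "slice_apply N e (slice_apply N e v) (h, x) = slice_apply N e v (h, x)"
proof -
  from below_projection_apply[OF below_projection_refl[OF assms(1)] assms(2), of "\<lambda>y. v (h, y)"] show ?thesis
    by (simp add: slice_apply_def)
qed

lemma fip_cong: "(\<And>p. p \<in> I \<Longrightarrow> f p = f' p) \<Longrightarrow> (\<And>p. p \<in> I \<Longrightarrow> g p = g' p) \<Longrightarrow> fip I f g = fip I f' g'"
  by (simp add: fip_def)

lemma fip_scale: "fip I (\<lambda>p. c * f p) (\<lambda>p. d * g p) = c * d * fip I f g"
  by (simp add: fip_def sum_distrib_left mult_ac)

lemma fip_slice_apply_le:
  assumes e: "is_projection N e"
  shows "fip (F \<times> {..<N}) (slice_apply N e v) (slice_apply N e v) \<le> fip (F \<times> {..<N}) v v"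
proof -
  let ?I = "F \<times> {..<N}" and ?w = "slice_apply N e v"
  have "fip ?I ?w ?w = fip ?I v (slice_apply N e ?w)" by (rule fip_slice_apply[OF e])
  also have "\<dots> = fip ?I v ?w" by (rule fip_cong) (auto simp: slice_apply_idem[OF e])
  finally have 1: "fip ?I ?w ?w = fip ?I v ?w" .
  have "0 \<le> fip ?I (\<lambda>p. v p - ?w p) (\<lambda>p. v p - ?w p)" by (rule fip_nonneg)
  also have "\<dots> = fip ?I v v - fip ?I ?w v - (fip ?I v ?w - fip ?I ?w ?w)"
    by (simp add: fip_diff_left fip_commute[of _ _ "\<lambda>p. v p - ?w p"])
  finally show ?thesis using 1 by (simp add: fip_commute[of _ ?w v])
qed

text \<open>If \<open>S\<close> is large at some vector fixed by the projection, cut the projection down by the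
  slices of that vector. Each round costs trace \<open>card F\<close>, and the vectors met are orthonormal.\<close>

lemma projection_avoiding_large_vectors:
  fixes S :: "'g \<times> nat \<Rightarrow> 'g \<times> nat \<Rightarrow> real"
  assumes F: "finite F" and c: "0 \<le> c"
    and few: "\<And>r \<xi>. (\<And>j l. j < r \<Longrightarrow> l < r \<Longrightarrow> fip (F \<times> {..<N}) (\<xi> j) (\<xi> l) = (if j = l then 1 else 0)) \<Longrightarrow>
      (\<And>j. j < r \<Longrightarrow> c \<le> fip (F \<times> {..<N}) (kernel_apply (F \<times> {..<N}) S (\<xi> j)) (kernel_apply (F \<times> {..<N}) S (\<xi> j)))
      \<Longrightarrow> real r \<le> r0"
  shows "\<exists>e. is_projection N e \<and> real N - real (card F) * r0 \<le> (\<Sum>x<N. e x x) \<and>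
    (\<forall>v. fip (F \<times> {..<N}) (kernel_apply (F \<times> {..<N}) S (slice_apply N e v)) (kernel_apply (F \<times> {..<N}) S (slice_apply N e v))
      \<le> c * fip (F \<times> {..<N}) v v)"
proof -
  let ?I = "F \<times> {..<N}"
  let ?n = "\<lambda>v. fip ?I (kernel_apply ?I S v) (kernel_apply ?I S v)"
  \<comment> \<open>State after \<open>r\<close> rounds. The last clause says that 1 \<otimes> e
    annihilates the vectors found so far; any later vector in the range of 1 \<otimes> e is then
    orthogonal to them.\<close>
  define Q where "Q r \<longleftrightarrow> (\<exists>e (\<xi> :: nat \<Rightarrow> 'g \<times> nat \<Rightarrow> real). is_projection N e \<and>
      real N - real (card F) * real r \<le> (\<Sum>x<N. e x x) \<and>
      (\<forall>j<r. \<forall>l<r. fip ?I (\<xi> j) (\<xi> l) = (if j = l then 1 else 0)) \<and>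
      (\<forall>j<r. c \<le> ?n (\<xi> j)) \<and> (\<forall>j<r. \<forall>p\<in>?I. slice_apply N e (\<xi> j) p = 0))" for r
  have Q0: "Q 0"
    unfolding Q_def is_projection_def
    by (intro exI[of _ "\<lambda>x y. if x = y then 1 else 0"] exI)
      (auto simp: if_distrib[where f = "\<lambda>a. a * _"] sum.delta cong: if_cong)
  have bound: "real r \<le> r0" if Qr: "Q r" for r
  proof -
    obtain \<xi> :: "nat \<Rightarrow> 'g \<times> nat \<Rightarrow> real" where "\<forall>j<r. \<forall>l<r. fip ?I (\<xi> j) (\<xi> l) = (if j = l then 1 else 0)" "\<forall>j<r. c \<le> ?n (\<xi> j)"
      using Qr unfolding Q_def by blast
    then show ?thesis by (intro few[of r \<xi>]) auto
  qed
  \<comment> \<open>By \<open>few\<close> the rounds cannot go on forever, and the projection of a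
    last round has no large vector left in its range.\<close>
  have "\<exists>r. Q r \<and> \<not> Q (Suc r)"
  proof (rule ccontr)
    assume "\<not> ?thesis"
    then have "Q r" for r by (induction r) (auto simp: Q0)
    then have "real r \<le> r0" for r by (rule bound)
    then show False by (meson not_le reals_Archimedean2)
  qed
  then obtain r where r: "Q r" "\<not> Q (Suc r)" by blast
  obtain e and \<xi> :: "nat \<Rightarrow> 'g \<times> nat \<Rightarrow> real" where e: "is_projection N e" "real N - real (card F) * real r \<le> (\<Sum>x<N. e x x)"
    and \<xi>: "\<And>j l. j < r \<Longrightarrow> l < r \<Longrightarrow> fip ?I (\<xi> j) (\<xi> l) = (if j = l then 1 else 0)"
      "\<And>j. j < r \<Longrightarrow> c \<le> ?n (\<xi> j)" "\<And>j p. j < r \<Longrightarrow> p \<in> ?I \<Longrightarrow> slice_apply N e (\<xi> j) p = 0"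
    using r(1) unfolding Q_def by blast
  have "?n (slice_apply N e v) \<le> c * fip ?I v v" for v
  proof (rule ccontr)
    assume large: "\<not> ?thesis"
    define w where "w = slice_apply N e v"
    define s where "s = fip ?I w w"
    \<comment> \<open>Projecting shortens \<open>v\<close>, so a violation at \<open>v\<close> is
      also one at \<open>w\<close> relative to the length of \<open>w\<close> itself;
      \<open>w\<close> can then be normalised.\<close>
    have "c * s \<le> c * fip ?I v v"
      unfolding s_def w_def using c fip_slice_apply_le[OF e(1)] by (intro mult_left_mono) auto
    then have large': "c * s < ?n w" using large by (simp add: w_def)
    have "s \<noteq> 0"
    proof
      assume "s = 0"
      then have "\<forall>p\<in>?I. w p * w p = 0"
        unfolding s_def fip_def using F by (subst (asm) sum_nonneg_eq_0_iff) auto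
      then have "kernel_apply ?I S w = (\<lambda>p. 0)"
        unfolding kernel_apply_def fun_eq_iff by (intro allI sum.neutral) auto
      then show False using large' \<open>s = 0\<close> by (simp add: fip_def)
    qed
    then have s: "s > 0" using fip_nonneg[of ?I w] by (simp add: s_def)
    define \<eta> where "\<eta> = (\<lambda>p. 1 / sqrt s * w p)"
    have \<eta>1: "fip ?I \<eta> \<eta> = 1" using s unfolding \<eta>_def fip_scale by (simp add: s_def)
    have "kernel_apply ?I S \<eta> = (\<lambda>p. 1 / sqrt s * kernel_apply ?I S w p)"
      by (simp add: \<eta>_def kernel_apply_def sum_distrib_left sum_divide_distrib mult_ac fun_eq_iff)
    then have "?n \<eta> = ?n w / s" using s by (simp only: fip_scale) simp
    moreover have "c \<le> ?n w / s" using large' s by (simp add: pos_le_divide_eq)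
    ultimately have \<eta>2: "c \<le> ?n \<eta>" by simp
    have \<eta>3: "fip ?I (\<xi> j) \<eta> = 0" if "j < r" for j
    proof -
      have "fip ?I (\<xi> j) w = fip ?I (slice_apply N e (\<xi> j)) v"
        unfolding w_def by (rule fip_slice_apply[OF e(1), symmetric])
      also have "\<dots> = 0" unfolding fip_def using \<xi>(3)[OF that] by (simp del: mult_eq_0_iff)
      finally show ?thesis using fip_scale[of ?I 1 "\<xi> j" "1 / sqrt s" w] by (simp add: \<eta>_def)
    qed
    then have \<eta>3': "fip ?I \<eta> (\<xi> j) = 0" if "j < r" for j
      using that by (simp add: fip_commute[of ?I \<eta> "\<xi> j"])
    obtain e' where e': "is_projection N e'" "below_projection N e' e"
      "\<forall>h\<in>F. \<forall>x<N. (\<Sum>y<N. e' x y * \<eta> (h, y)) = 0"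
      "(\<Sum>x<N. e x x) - real (card F) \<le> (\<Sum>x<N. e' x x)"
      using projection_cut_vectors[OF F e(1), of "\<lambda>h y. \<eta> (h, y)"] by blast
    define \<xi>' where "\<xi>' = \<xi>(r := \<eta>)"
    have "Q (Suc r)"
      unfolding Q_def
    proof (rule exI[of _ e'], rule exI[of _ \<xi>'], intro conjI allI impI ballI)
      show "is_projection N e'" by (rule e')
      show "real N - real (card F) * real (Suc r) \<le> (\<Sum>x<N. e' x x)"
        using e(2) e'(4) by (simp add: algebra_simps)
      show "fip ?I (\<xi>' j) (\<xi>' l) = (if j = l then 1 else 0)" if "j < Suc r" "l < Suc r" for j l
        using that \<xi>(1) \<eta>1 \<eta>3 \<eta>3' by (auto simp: \<xi>'_def less_Suc_eq)
      show "c \<le> ?n (\<xi>' j)" if "j < Suc r" for j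
        using that \<xi>(2) \<eta>2 by (auto simp: \<xi>'_def less_Suc_eq)
      show "slice_apply N e' (\<xi>' j) p = 0" if jp: "j < Suc r" "p \<in> ?I" for j p
      proof (cases "j = r")
        case True
        then show ?thesis using e'(3) that by (auto simp: \<xi>'_def slice_apply_def)
      next
        case False
        obtain h x where p: "p = (h, x)" "h \<in> F" "x < N" using jp by auto
        have "(\<Sum>z<N. e y z * \<xi> j (h, z)) = 0" if "y < N" for y
          using \<xi>(3)[of j "(h, y)"] False \<open>j < Suc r\<close> p that by (simp add: slice_apply_def)
        then show ?thesis
          using below_projection_vanish[OF e'(2), of "\<lambda>z. \<xi> j (h, z)" x] False p
          by (simp add: \<xi>'_def slice_apply_def)
      qed
    qed
    then show False using r(2) by simp
  qed
  moreover have "real N - real (card F) * r0 \<le> (\<Sum>x<N. e x x)"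
    using e(2) bound[OF r(1)] mult_left_mono[OF bound[OF r(1)], of "real (card F)"] by simp
  ultimately show ?thesis using e(1) by blast
qed

text \<open>The threshold \<open>8 * real n\<close> is twice the moment bound
  \<open>4 * real n\<close>, so the q-th power leaves at most card F * N / 2^q orthonormal vectors
  above the threshold. Removing one costs trace at most \<open>card F\<close>, one unit for each
  slice. The total loss (card F)^2 N / 2^q is at most N/2 once 2^q \<ge> 2 (card F)^2.\<close>

lemma generic_sandwich:
  assumes n: "1 \<le> n" and F: "finite F" and b0: "\<And>i g h. 0 \<le> b i g h"
    and b1: "\<And>i g. i < n \<Longrightarrow> g \<in> F \<Longrightarrow> (\<Sum>h\<in>F. b i g h) \<le> (1::real)"
    and b2: "\<And>i h. i < n \<Longrightarrow> h \<in> F \<Longrightarrow> (\<Sum>g\<in>F. b i g h) \<le> 1"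
  obtains N \<tau> e where "0 < (N::nat)" "\<And>i x. i < n \<Longrightarrow> x < N \<Longrightarrow> \<tau> i x < N"
    "\<And>i x. i < n \<Longrightarrow> x < N \<Longrightarrow> \<tau> i (\<tau> i x) = x"
    "is_projection N e" "real N / 2 \<le> (\<Sum>x<N. e x x)"
    "\<And>v. (\<Sum>g\<in>F. \<Sum>x<N. (\<Sum>i<n. \<Sum>h\<in>F. b i g h * (\<Sum>y<N. e (\<tau> i x) y * v h y))\<^sup>2)
       \<le> 8 * real n * (\<Sum>h\<in>F. \<Sum>y<N. (v h y)\<^sup>2)"
proof -
  have "\<exists>m. 2 * (real (card F))\<^sup>2 < 2 ^ m"
    by (rule real_arch_pow) simp
  then obtain m where m: "2 * (real (card F))\<^sup>2 < 2 ^ m" by blast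
  define q :: nat where "q = 2 ^ Suc m"
  obtain N :: nat and \<tau> where N: "0 < N" and \<tau>N: "\<And>i x. i < n \<Longrightarrow> x < N \<Longrightarrow> \<tau> i x < N"
    and inv: "\<And>i x. i < n \<Longrightarrow> x < N \<Longrightarrow> \<tau> i (\<tau> i x) = x"
    and free: "\<And>ws x. set ws \<subseteq> {..<n} \<Longrightarrow> length ws \<le> 2 * q \<Longrightarrow> x < N \<Longrightarrow> fold \<tau> ws x = x
       \<Longrightarrow> fold cancel_step ws [] = []"
    using involutions_without_short_relations[of n "2 * q"] by blast
  let ?I = "F \<times> {..<N}" and ?S = "word_kernel n b \<tau>"
  \<comment> \<open>The q-th Gram power spells loops of length \<open>2 * q\<close>. Up to this
    length a loop must cancel in the free product, so the tree estimate (2 sqrt n)^(2q) = (4n)^q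
    applies.\<close>
  have diag: "(gram_apply ?I ?S ^^ q) (\<lambda>p'. if p' = p then 1 else 0) p \<le> (4 * real n) ^ q" if pI: "p \<in> ?I" for p
  proof -
    obtain g x where p: "p = (g, x)" "g \<in> F" "x < N" using pI by auto
    have "(gram_apply ?I ?S ^^ q) (\<lambda>p'. if p' = p then 1 else 0) p \<le> word_count n \<tau> x (2 * q) x"
      unfolding p(1) by (rule gram_word_bound[OF F \<tau>N inv b0 b1 b2 p(2,3)])
    also have "word_count n \<tau> x (2 * q) x
        \<le> card {ws. set ws \<subseteq> {..<n} \<and> length ws = 2 * q \<and> fold cancel_step ws [] = []}"
      unfolding word_count_def
      by (rule card_mono, rule finite_subset[OF _ finite_lists_length_eq[of "{..<n}" "2 * q"]])
        (use free[of _ x] p in auto)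
    also have "real \<dots> \<le> 2 ^ (2 * q) * sqrt n ^ (2 * q)"
      using card_trivial_words[OF n, of "2 * q" "[]"] by simp
    also have "\<dots> = (4 * real n) ^ q"
      by (simp add: power_mult power_mult_distrib)
    finally show ?thesis by simp
  qed
  define r0 where "r0 = real (card F) * real N / 2 ^ q"
  have few: "real r \<le> r0"
    if "\<And>j l. j < r \<Longrightarrow> l < r \<Longrightarrow> fip ?I (\<xi> j) (\<xi> l) = (if j = l then 1 else 0)"
      "\<And>j. j < r \<Longrightarrow> 8 * real n \<le> fip ?I (kernel_apply ?I ?S (\<xi> j)) (kernel_apply ?I ?S (\<xi> j))" for r \<xi>
  proof -
    have "real r * (8 * real n) ^ q \<le> real (card ?I) * (4 * real n) ^ q"
      unfolding q_def by (rule card_orthonormal_large[of ?I r \<xi>])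
        (use F that diag in \<open>auto simp: q_def\<close>)
    moreover have "(8 * real n) ^ q = 2 ^ q * (4 * real n) ^ q"
      by (subst power_mult_distrib[symmetric]) simp
    ultimately have "(real r * 2 ^ q) * (4 * real n) ^ q \<le> real (card ?I) * (4 * real n) ^ q"
      by (simp only: mult.assoc)
    moreover have "(4 * real n) ^ q > 0" using n by simp
    ultimately have "real r * 2 ^ q \<le> real (card ?I)" by (rule mult_right_le_imp_le)
    then show ?thesis by (simp add: r0_def pos_le_divide_eq card_cartesian_product)
  qed
  obtain e where e: "is_projection N e" "real N - real (card F) * r0 \<le> (\<Sum>x<N. e x x)"
    "\<And>v. fip ?I (kernel_apply ?I ?S (slice_apply N e v)) (kernel_apply ?I ?S (slice_apply N e v))
      \<le> 8 * real n * fip ?I v v"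
  proof -
    have "\<exists>e. is_projection N e \<and> real N - real (card F) * r0 \<le> (\<Sum>x<N. e x x) \<and>
      (\<forall>v. fip ?I (kernel_apply ?I ?S (slice_apply N e v)) (kernel_apply ?I ?S (slice_apply N e v))
        \<le> 8 * real n * fip ?I v v)"
      by (rule projection_avoiding_large_vectors[OF F _ few]) auto
    then show thesis using that by blast
  qed
  have "m \<le> q" unfolding q_def by (metis less_imp_le_nat less_exp less_trans lessI)
  then have "(2::real) ^ m \<le> 2 ^ q" by (intro power_increasing) auto
  then have "2 * (real (card F))\<^sup>2 \<le> 2 ^ q" using m by linarith
  then have "real (card F) * r0 \<le> real N / 2"
    using mult_left_mono[of "2 * (real (card F))\<^sup>2" "2 ^ q" "real N"]
    by (simp add: r0_def field_simps power2_eq_square)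
  then have tr: "real N / 2 \<le> (\<Sum>x<N. e x x)" using e(2) by simp
  show ?thesis
  proof (rule that[OF N \<tau>N inv e(1) tr])
    fix v :: "'a \<Rightarrow> nat \<Rightarrow> real"
    let ?w = "slice_apply N e (\<lambda>(h, y). v h y)"
    have *: "kernel_apply ?I ?S ?w (g, x) = (\<Sum>i<n. \<Sum>h\<in>F. b i g h * (\<Sum>y<N. e (\<tau> i x) y * v h y))"
      if "x < N" for g x
      using word_kernel_apply[of F n N \<tau> x b ?w g] F \<tau>N that by (simp add: slice_apply_def)
    have "(\<Sum>g\<in>F. \<Sum>x<N. (\<Sum>i<n. \<Sum>h\<in>F. b i g h * (\<Sum>y<N. e (\<tau> i x) y * v h y))\<^sup>2)
        = fip ?I (kernel_apply ?I ?S ?w) (kernel_apply ?I ?S ?w)"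
      unfolding fip_slices by (intro sum.cong refl) (simp add: * power2_eq_square)
    also have "\<dots> \<le> 8 * real n * fip ?I (\<lambda>(h, y). v h y) (\<lambda>(h, y). v h y)" by (rule e(3))
    finally show "(\<Sum>g\<in>F. \<Sum>x<N. (\<Sum>i<n. \<Sum>h\<in>F. b i g h * (\<Sum>y<N. e (\<tau> i x) y * v h y))\<^sup>2)
       \<le> 8 * real n * (\<Sum>h\<in>F. \<Sum>y<N. (v h y)\<^sup>2)"
      by (simp add: fip_slices power2_eq_square)
  qed
qed

section \<open>The Hahn-Banach theorem for sublinear functionals\<close>

text \<open>With pointwise scaling the vocabulary of subspaces applies both to finitely supported
  vectors and to \<open>L2\<close>, the latter regarded as a real vector space.\<close>

instantiation "fun" :: (type, real_vector) real_vector
begin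

definition scaleR_fun :: "real \<Rightarrow> ('a \<Rightarrow> 'b) \<Rightarrow> 'a \<Rightarrow> 'b" where
  "scaleR_fun r f = (\<lambda>x. r *\<^sub>R f x)"

instance
  by standard (simp_all add: scaleR_fun_def fun_eq_iff scaleR_add_left scaleR_add_right)

end

lemma scaleR_fun_apply [simp]: "(r *\<^sub>R f) x = r *\<^sub>R f x"
  by (simp add: scaleR_fun_def)

lemma sum_fun_apply: "(\<Sum>i\<in>I. f i) x = (\<Sum>i\<in>I. f i x)"
  by (induction I rule: infinite_finite_induct) auto

text \<open>Homogeneity is asked for as an inequality, which is easy to check for infima; scaling by
  1/c gives the reverse inequality.\<close>

definition sublinear_on :: "'v::real_vector set \<Rightarrow> ('v \<Rightarrow> real) \<Rightarrow> bool" where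
  "sublinear_on V q \<longleftrightarrow> (\<forall>x\<in>V. \<forall>y\<in>V. q (x + y) \<le> q x + q y) \<and>
     (\<forall>c\<ge>0. \<forall>x\<in>V. q (c *\<^sub>R x) \<le> c * q x)"

lemma sublinear_onD:
  assumes "sublinear_on V q" "subspace V"
  shows "x \<in> V \<Longrightarrow> y \<in> V \<Longrightarrow> q (x + y) \<le> q x + q y"
    and "0 \<le> c \<Longrightarrow> x \<in> V \<Longrightarrow> q (c *\<^sub>R x) = c * q x"
    and "q 0 = 0"
    and "x \<in> V \<Longrightarrow> - q (- x) \<le> q x"
proof -
  have le: "q (c *\<^sub>R x) \<le> c * q x" if "0 \<le> c" "x \<in> V" for c x
    using assms(1) that by (auto simp: sublinear_on_def)
  show add: "q (x + y) \<le> q x + q y" if "x \<in> V" "y \<in> V" for x y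
    using assms(1) that by (auto simp: sublinear_on_def)
  have 0: "0 \<in> V" by (rule subspace_0[OF assms(2)])
  show q0: "q 0 = 0" using le[OF order_refl 0] add[OF 0 0] by simp
  show "q (c *\<^sub>R x) = c * q x" if c: "0 \<le> c" and x: "x \<in> V" for c x
  proof (cases "c = 0")
    case False
    have "q x \<le> (1 / c) * q (c *\<^sub>R x)"
      using le[of "1 / c" "c *\<^sub>R x"] c False subspace_scale[OF assms(2) x] by simp
    then have "c * q x \<le> q (c *\<^sub>R x)" using c False by (simp add: field_simps)
    then show ?thesis using le[OF c x] by simp
  qed (simp add: q0)
  show "- q (- x) \<le> q x" if "x \<in> V" for x
    using add[OF that subspace_neg[OF assms(2) that]] by (simp add: q0)
qed

text \<open>A minimal sublinear functional below \<open>p\<close> is additive: for each \<open>y\<close> the functional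
  \<open>x \<mapsto> inf\<^sub>t q (x + t y) - t q y\<close> is sublinear and lies below \<open>q\<close>.\<close>

lemma Hahn_Banach_sublinear:
  fixes p :: "'v::real_vector \<Rightarrow> real"
  assumes V: "subspace V" and p: "sublinear_on V p"
  shows "\<exists>L. (\<forall>x\<in>V. L x \<le> p x) \<and> (\<forall>x\<in>V. \<forall>y\<in>V. L (x + y) = L x + L y) \<and>
    (\<forall>c. \<forall>x\<in>V. L (c *\<^sub>R x) = c * L x)"
proof -
  \<comment> \<open>Values off \<open>V\<close> are pinned to 0; otherwise they could be lowered
    indefinitely and no minimal element would exist.\<close>
  define S where "S = {q. sublinear_on V q \<and> (\<forall>x\<in>V. q x \<le> p x) \<and> (\<forall>x. x \<notin> V \<longrightarrow> q x = (0::real))}"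
  note Vs = subspace_0[OF V] subspace_add[OF V] subspace_scale[OF V] subspace_neg[OF V]
  \<comment> \<open>A lower bound common to all of \<open>S\<close>, so that pointwise infima along
    a chain are finite.\<close>
  have below: "- p (- x) \<le> q x" if "q \<in> S" "x \<in> V" for q x
    using that sublinear_onD(4)[of V q x, OF _ V] Vs(4)[of x] unfolding S_def by fastforce
  let ?P = "\<lambda>q q' :: 'v \<Rightarrow> real. q' \<le> q"
  have "\<exists>m\<in>S. \<forall>a\<in>S. a \<le> m \<longrightarrow> a = m"
  proof (rule predicate_Zorn)
    show "partial_order_on S (relation_of ?P S)"
      by (auto simp: partial_order_on_def preorder_on_def refl_on_def trans_def antisym_def relation_of_def)
    fix C assume C: "C \<in> Chains (relation_of ?P S)"
    have CS: "C \<subseteq> S" using Chains_relation_of[OF C] .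
    have chain: "q \<le> q' \<or> q' \<le> q" if "q \<in> C" "q' \<in> C" for q q'
      using C that unfolding Chains_def relation_of_def by auto
    show "\<exists>u\<in>S. \<forall>a\<in>C. u \<le> a"
    proof (cases "C = {}")
      case True
      define u where "u x = (if x \<in> V then p x else 0)" for x
      have "u \<in> S" using p Vs by (auto simp: S_def u_def sublinear_on_def)
      then show ?thesis using True by auto
    next
      case False
      define u where "u x = (if x \<in> V then INF q\<in>C. q x else 0)" for x
      have bdd: "bdd_below ((\<lambda>q. q x) ` C)" if "x \<in> V" for x
        using below[OF subsetD[OF CS] that] by (intro bdd_belowI[of _ "- p (- x)"]) auto
      have ule: "u x \<le> q x" if "q \<in> C" for q x
        using cINF_lower[OF bdd that, of x] that CS by (auto simp: u_def S_def)
      have uge: "t \<le> u x" if "\<And>q. q \<in> C \<Longrightarrow> t \<le> q x" "x \<in> V" for t x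
        using cINF_greatest[OF False, of t "\<lambda>q. q x"] that by (auto simp: u_def)
      have "u (x + y) \<le> u x + u y" if xy: "x \<in> V" "y \<in> V" for x y
      proof -
        have "u (x + y) \<le> q1 x + q2 y" if qq: "q1 \<in> C" "q2 \<in> C" for q1 q2
        proof -
          obtain q where q: "q \<in> C" "q \<le> q1" "q \<le> q2"
            using chain[OF qq] qq by blast
          have "u (x + y) \<le> q (x + y)" by (rule ule[OF q(1)])
          also have "\<dots> \<le> q x + q y" using CS q(1) xy by (auto simp: S_def sublinear_on_def)
          also have "\<dots> \<le> q1 x + q2 y" using q by (intro add_mono) (auto simp: le_fun_def)
          finally show ?thesis .
        qed
        then have "u (x + y) - q2 y \<le> u x" if "q2 \<in> C" for q2
          using that xy by (intro uge) (auto simp: algebra_simps)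
        then have "u (x + y) - u x \<le> u y"
          using xy by (intro uge) (auto simp: algebra_simps)
        then show ?thesis by simp
      qed
      moreover have "u (c *\<^sub>R x) \<le> c * u x" if c: "0 \<le> c" and x: "x \<in> V" for c x
      proof (cases "c = 0")
        case True
        obtain q where "q \<in> C" using False by auto
        then have "u 0 \<le> 0" using ule[of q 0] sublinear_onD(3)[OF _ V, of q] CS by (auto simp: S_def)
        then show ?thesis using True by simp
      next
        case False
        have "u (c *\<^sub>R x) / c \<le> u x"
        proof (rule uge[OF _ x])
          fix q assume q: "q \<in> C"
          have "u (c *\<^sub>R x) \<le> q (c *\<^sub>R x)" by (rule ule[OF q])
          also have "\<dots> \<le> c * q x" using CS q c x by (auto simp: S_def sublinear_on_def)
          finally show "u (c *\<^sub>R x) / c \<le> q x" using c False by (simp add: field_simps)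
        qed
        then show ?thesis using c False by (simp add: field_simps)
      qed
      moreover have "u x \<le> p x" if "x \<in> V" for x
      proof -
        obtain q where "q \<in> C" using False by auto
        then show ?thesis using ule[of q x] CS that by (fastforce simp: S_def)
      qed
      ultimately have "u \<in> S" by (auto simp: S_def sublinear_on_def u_def)
      then show ?thesis using ule by (auto simp: le_fun_def)
    qed
  qed
  then obtain q where qS: "q \<in> S" and min: "\<And>a. a \<in> S \<Longrightarrow> a \<le> q \<Longrightarrow> a = q" by blast
  have q: "sublinear_on V q" "\<And>x. x \<in> V \<Longrightarrow> q x \<le> p x" "\<And>x. x \<notin> V \<Longrightarrow> q x = 0"
    using qS by (auto simp: S_def)
  note qD = sublinear_onD[OF q(1) V]
  have add: "q (x + y) = q x + q y" if x: "x \<in> V" and y: "y \<in> V" for x y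
  proof -
    define r where "r x = (if x \<in> V then INF t\<in>{0..}. q (x + t *\<^sub>R y) - t * q y else 0)" for x
    have bdd: "bdd_below ((\<lambda>t. q (x + t *\<^sub>R y) - t * q y) ` {0..})" if x: "x \<in> V" for x
    proof (rule bdd_belowI2[of _ "- q (- x)"])
      fix t :: real assume t: "t \<in> {0..}"
      have "t * q y = q ((x + t *\<^sub>R y) + - x)" using qD(2)[of t y] t y by simp
      also have "\<dots> \<le> q (x + t *\<^sub>R y) + q (- x)" using x y Vs by (intro qD(1)) auto
      finally show "- q (- x) \<le> q (x + t *\<^sub>R y) - t * q y" by simp
    qed
    have rle: "r x \<le> q (x + t *\<^sub>R y) - t * q y" if "x \<in> V" "0 \<le> t" for x t
      using cINF_lower[OF bdd[OF that(1)], of t] that by (auto simp: r_def)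
    have rge: "s \<le> r x" if "\<And>t. 0 \<le> t \<Longrightarrow> s \<le> q (x + t *\<^sub>R y) - t * q y" "x \<in> V" for s x
      using cINF_greatest[of "{0..}" s "\<lambda>t. q (x + t *\<^sub>R y) - t * q y"] that by (auto simp: r_def)
    have rq: "r x \<le> q x" if "x \<in> V" for x using rle[OF that, of 0] by simp
    have "r (x1 + x2) \<le> r x1 + r x2" if xx: "x1 \<in> V" "x2 \<in> V" for x1 x2
    proof -
      have "r (x1 + x2) \<le> (q (x1 + t1 *\<^sub>R y) - t1 * q y) + (q (x2 + t2 *\<^sub>R y) - t2 * q y)"
        if t: "0 \<le> t1" "0 \<le> t2" for t1 t2
      proof -
        have "r (x1 + x2) \<le> q ((x1 + x2) + (t1 + t2) *\<^sub>R y) - (t1 + t2) * q y"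
          using xx t Vs by (intro rle) auto
        also have "(x1 + x2) + (t1 + t2) *\<^sub>R y = (x1 + t1 *\<^sub>R y) + (x2 + t2 *\<^sub>R y)"
          by (simp add: algebra_simps)
        also have "q \<dots> \<le> q (x1 + t1 *\<^sub>R y) + q (x2 + t2 *\<^sub>R y)"
          using xx y Vs by (intro qD(1)) auto
        finally show ?thesis by (simp add: algebra_simps)
      qed
      then have "r (x1 + x2) - (q (x2 + t2 *\<^sub>R y) - t2 * q y) \<le> r x1" if "0 \<le> t2" for t2
        using xx that by (intro rge) (auto simp: algebra_simps)
      then have "r (x1 + x2) - r x1 \<le> r x2"
        using xx by (intro rge) (auto simp: algebra_simps)
      then show ?thesis by simp
    qed
    moreover have "r (c *\<^sub>R z) \<le> c * r z" if c: "0 \<le> c" and z: "z \<in> V" for c z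
    proof (cases "c = 0")
      case True
      then show ?thesis using rq[OF Vs(1)] qD(3) by simp
    next
      case False
      have "r (c *\<^sub>R z) / c \<le> r z"
      proof (rule rge[OF _ z])
        fix t :: real assume t: "0 \<le> t"
        have "r (c *\<^sub>R z) \<le> q (c *\<^sub>R z + (c * t) *\<^sub>R y) - c * t * q y"
          using c t z Vs by (intro rle) auto
        also have "c *\<^sub>R z + (c * t) *\<^sub>R y = c *\<^sub>R (z + t *\<^sub>R y)" by (simp add: scaleR_add_right)
        also have "q \<dots> = c * q (z + t *\<^sub>R y)" using c z y Vs by (intro qD(2)) auto
        finally have "r (c *\<^sub>R z) \<le> c * (q (z + t *\<^sub>R y) - t * q y)" by (simp add: algebra_simps)
        then show "r (c *\<^sub>R z) / c \<le> q (z + t *\<^sub>R y) - t * q y"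
          using c False by (simp add: pos_divide_le_eq mult.commute)
      qed
      then show ?thesis using c False by (simp add: pos_divide_le_eq mult.commute)
    qed
    moreover have "r x \<le> p x" if "x \<in> V" for x
      using rq[OF that] q(2)[OF that] by (rule order_trans)
    moreover have "r x = 0" if "x \<notin> V" for x using that by (simp add: r_def)
    ultimately have "r \<in> S" by (auto simp: S_def sublinear_on_def)
    moreover have "r \<le> q" using rq q(3) by (auto simp: le_fun_def r_def)
    ultimately have "r = q" by (rule min)
    then have "q x \<le> q (x + 1 *\<^sub>R y) - 1 * q y" using rle[OF x, of 1] by simp
    then show ?thesis using qD(1)[OF x y] by simp
  qed
  have "q (c *\<^sub>R x) = c * q x" if x: "x \<in> V" for c x
  proof (cases "0 \<le> c")
    case False
    have neg: "q (- z) = - q z" if "z \<in> V" for z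
      using add[OF that Vs(4)[OF that]] qD(3) by simp
    have "q (c *\<^sub>R x) = q (- ((- c) *\<^sub>R x))" by simp
    also have "\<dots> = - q ((- c) *\<^sub>R x)" using x Vs by (intro neg) auto
    also have "q ((- c) *\<^sub>R x) = - c * q x" using False x by (intro qD(2)) auto
    finally show ?thesis by simp
  qed (simp add: qD(2) x)
  then show ?thesis using add q(2) by blast
qed

section \<open>Reiter vectors of amenable discrete groups\<close>

definition finsupp :: "('b \<Rightarrow> real) set" where
  "finsupp = {v. finite {b. v b \<noteq> 0}}"

definition l1_norm :: "('b \<Rightarrow> real) \<Rightarrow> real" where
  "l1_norm v = (\<Sum>b | v b \<noteq> 0. \<bar>v b\<bar>)"

lemma l1_norm_eq: "finite T \<Longrightarrow> (\<And>b. v b \<noteq> 0 \<Longrightarrow> b \<in> T) \<Longrightarrow> l1_norm v = (\<Sum>b\<in>T. \<bar>v b\<bar>)"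
  unfolding l1_norm_def by (rule sum.mono_neutral_left) auto

lemma subspace_finsupp: "subspace finsupp"
proof (rule subspaceI)
  show "x + y \<in> finsupp" if "x \<in> finsupp" "y \<in> finsupp" for x y :: "'b \<Rightarrow> real"
    using that unfolding finsupp_def mem_Collect_eq
    by (rule finite_subset[rotated, OF finite_UnI]) auto
  show "c *\<^sub>R x \<in> finsupp" if "x \<in> finsupp" for c and x :: "'b \<Rightarrow> real"
    using that unfolding finsupp_def mem_Collect_eq by (rule rev_finite_subset) auto
qed (simp add: finsupp_def)

lemma l1_norm_add: "v \<in> finsupp \<Longrightarrow> w \<in> finsupp \<Longrightarrow> l1_norm (v + w) \<le> l1_norm v + l1_norm w"
proof -
  assume v: "v \<in> finsupp" and w: "w \<in> finsupp"
  define T where "T = {b. v b \<noteq> 0} \<union> {b. w b \<noteq> 0}"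
  have T: "finite T" using v w by (simp add: T_def finsupp_def)
  have "l1_norm (v + w) = (\<Sum>b\<in>T. \<bar>v b + w b\<bar>)"
    using l1_norm_eq[OF T, of "v + w"] by (auto simp: T_def)
  also have "\<dots> \<le> (\<Sum>b\<in>T. \<bar>v b\<bar> + \<bar>w b\<bar>)" by (intro sum_mono) simp
  also have "\<dots> = l1_norm v + l1_norm w"
    using l1_norm_eq[OF T, of v] l1_norm_eq[OF T, of w] by (auto simp: T_def sum.distrib)
  finally show ?thesis .
qed

lemma l1_norm_scale: "l1_norm (c *\<^sub>R v) = \<bar>c\<bar> * l1_norm v"
proof (cases "c = 0")
  case False
  then show ?thesis by (simp add: l1_norm_def abs_mult sum_distrib_left)
qed (simp add: l1_norm_def)

lemma l1_norm_minus: "l1_norm (- v) = l1_norm v"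
  by (simp add: l1_norm_def)

lemma l1_norm_nonneg: "0 \<le> l1_norm v"
  by (simp add: l1_norm_def sum_nonneg)

text \<open>The differences for all \<open>n\<close> translations are collected in one vector, so
  that a single l1 estimate controls them simultaneously.\<close>

definition translation_defect :: "nat \<Rightarrow> (nat \<Rightarrow> 'a::group_add) \<Rightarrow> ('a \<Rightarrow> real) \<Rightarrow> nat \<times> 'a \<Rightarrow> real" where
  "translation_defect n s f = (\<lambda>(i, x). if i < n then f (s i + x) - f x else 0)"

lemma translation_defect_finsupp:
  assumes "f \<in> finsupp"
  shows "translation_defect n s f \<in> finsupp"
proof -
  let ?A = "{x. f x \<noteq> 0}"
  have "{b. translation_defect n s f b \<noteq> 0} \<subseteq> {..<n} \<times> (?A \<union> (\<Union>i<n. (+) (- s i) ` ?A))"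
  proof
    fix b assume b: "b \<in> {b. translation_defect n s f b \<noteq> 0}"
    obtain i x where ix: "b = (i, x)" by fastforce
    have i: "i < n" and "f (s i + x) \<noteq> 0 \<or> f x \<noteq> 0"
      using b by (auto simp: ix translation_defect_def split: if_splits)
    then have "x \<in> ?A \<union> (+) (- s i) ` ?A"
      by (metis (mono_tags) UnI1 UnI2 image_eqI mem_Collect_eq minus_add_cancel)
    then show "b \<in> {..<n} \<times> (?A \<union> (\<Union>i<n. (+) (- s i) ` ?A))"
      using i by (auto simp: ix)
  qed
  moreover have "finite ({..<n} \<times> (?A \<union> (\<Union>i<n. (+) (- s i) ` ?A)))"
    using assms by (auto simp: finsupp_def)
  ultimately show ?thesis unfolding finsupp_def mem_Collect_eq by (rule finite_subset)
qed

lemma translation_defect_add: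
  "translation_defect n s (f + g) = translation_defect n s f + translation_defect n s g"
  by (auto simp: translation_defect_def fun_eq_iff)

lemma translation_defect_scale:
  "translation_defect n s (c *\<^sub>R f) = c *\<^sub>R translation_defect n s f"
  by (auto simp: translation_defect_def fun_eq_iff right_diff_distrib)

text \<open>A convexity argument in the manner of Day. If every nonnegative \<open>f\<close> had
  defect at least its norm, Hahn-Banach would give a functional \<open>L\<close> of norm at most 1
  on l1 with \<open>L (?D f)\<close> at least the norm of \<open>f\<close>. It is given by bounded
  functions \<open>h i\<close>, and evaluation at point masses yields \<Sum> (h_i(-s_i + y) -
  h_i(y)) \<ge> 1 for every \<open>y\<close>. An invariant mean gives this sum the value 0.\<close>

lemma almost_invariant_from_mean:
  fixes s :: "nat \<Rightarrow> 'a::group_add"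
  assumes amen: "discretely_amenable TYPE('a)"
  shows "\<exists>f. f \<in> finsupp \<and> (\<forall>x. 0 \<le> f x) \<and> l1_norm (translation_defect n s f) < l1_norm f"
proof (rule ccontr)
  assume contra: "\<not> ?thesis"
  define P where "P = {f :: 'a \<Rightarrow> real. f \<in> finsupp \<and> (\<forall>x. 0 \<le> f x)}"
  let ?D = "translation_defect n s"
  note Vs = subspace_0[OF subspace_finsupp] subspace_add[OF subspace_finsupp]
    subspace_scale[OF subspace_finsupp] subspace_neg[OF subspace_finsupp]
  have D: "?D f \<in> finsupp" if "f \<in> P" for f using that by (simp add: P_def translation_defect_finsupp)
  have far: "l1_norm f \<le> l1_norm (?D f)" if "f \<in> P" for f
    using contra that by (auto simp: P_def not_less)
  have P0: "0 \<in> P" by (auto simp: P_def intro: Vs)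
  have Padd: "f + g \<in> P" if "f \<in> P" "g \<in> P" for f g using that by (auto simp: P_def intro: Vs)
  have Pscale: "c *\<^sub>R f \<in> P" if "0 \<le> c" "f \<in> P" for c f using that by (auto simp: P_def intro: Vs)
  \<comment> \<open>Additivity of the l1 norm on nonnegative vectors is what makes \<open>p\<close>
    below subadditive.\<close>
  have normadd: "l1_norm (f + g) = l1_norm f + l1_norm g" if "f \<in> P" "g \<in> P" for f g
  proof -
    have T: "finite ({x. f x \<noteq> 0} \<union> {x. g x \<noteq> 0})" using that by (simp add: P_def finsupp_def)
    have "l1_norm h = (\<Sum>b\<in>{x. f x \<noteq> 0} \<union> {x. g x \<noteq> 0}. \<bar>h b\<bar>)" if "h = f \<or> h = g \<or> h = f + g" for h
      using that by (intro l1_norm_eq[OF T]) auto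
    then show ?thesis using that by (simp add: P_def sum.distrib[symmetric])
  qed
  \<comment> \<open>The separation is encoded in a sublinear functional: \<open>p\<close> is at most
    the l1 norm (take \<open>f = 0\<close>), and at the vector \<open>- ?D f\<close> it is at most
    minus the norm of \<open>f\<close>. It is finite because the defect of \<open>f\<close> is at
    least its norm.\<close>
  define p where "p v = (INF f\<in>P. l1_norm (v + ?D f) - l1_norm f)" for v
  have lower: "- l1_norm v \<le> l1_norm (v + ?D f) - l1_norm f" if v: "v \<in> finsupp" and f: "f \<in> P" for v f
  proof -
    have "l1_norm (?D f) = l1_norm ((v + ?D f) + - v)" by simp
    also have "\<dots> \<le> l1_norm (v + ?D f) + l1_norm (- v)"
      using v D[OF f] Vs by (intro l1_norm_add) auto
    finally show ?thesis using far[OF f] by (simp add: l1_norm_minus)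
  qed
  have ple: "p v \<le> l1_norm (v + ?D f) - l1_norm f" if "v \<in> finsupp" "f \<in> P" for v f
    unfolding p_def
    by (rule cINF_lower[OF bdd_belowI2[of _ "- l1_norm v"]]) (use lower that in auto)
  have pge: "t \<le> p v" if "\<And>f. f \<in> P \<Longrightarrow> t \<le> l1_norm (v + ?D f) - l1_norm f" for t v
    unfolding p_def using P0 that by (intro cINF_greatest) auto
  have "?D 0 = 0" by (auto simp: translation_defect_def fun_eq_iff)
  moreover have "l1_norm (0 :: 'a \<Rightarrow> real) = 0" by (simp add: l1_norm_def)
  ultimately have p1: "p v \<le> l1_norm v" if "v \<in> finsupp" for v
    using ple[OF that P0] by simp
  have "p (v + w) \<le> p v + p w" if v: "v \<in> finsupp" and w: "w \<in> finsupp" for v w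
  proof -
    have *: "p (v + w) \<le> (l1_norm (v + ?D f) - l1_norm f) + (l1_norm (w + ?D g) - l1_norm g)"
      if f: "f \<in> P" and g: "g \<in> P" for f g
    proof -
      have "p (v + w) \<le> l1_norm ((v + w) + ?D (f + g)) - l1_norm (f + g)"
        using v w Vs Padd[OF f g] by (intro ple) auto
      also have "(v + w) + ?D (f + g) = (v + ?D f) + (w + ?D g)"
        by (simp add: translation_defect_add)
      also have "l1_norm \<dots> \<le> l1_norm (v + ?D f) + l1_norm (w + ?D g)"
        using v w D f g Vs by (intro l1_norm_add) auto
      finally show ?thesis using normadd[OF f g] by linarith
    qed
    have "p (v + w) - (l1_norm (w + ?D g) - l1_norm g) \<le> p v" if "g \<in> P" for g
      using *[OF _ that] by (intro pge) (auto simp: algebra_simps)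
    then have "p (v + w) - p v \<le> p w" by (intro pge) (auto simp: algebra_simps)
    then show ?thesis by simp
  qed
  moreover have "p (c *\<^sub>R v) \<le> c * p v" if c: "0 \<le> c" and v: "v \<in> finsupp" for c v
  proof (cases "c = 0")
    case True
    then show ?thesis using p1[OF Vs(1)] by (simp add: l1_norm_def)
  next
    case False
    have "p (c *\<^sub>R v) / c \<le> p v"
    proof (rule pge)
      fix f assume f: "f \<in> P"
      have "p (c *\<^sub>R v) \<le> l1_norm (c *\<^sub>R v + ?D (c *\<^sub>R f)) - l1_norm (c *\<^sub>R f)"
        using v Vs Pscale[OF c f] by (intro ple) auto
      also have "c *\<^sub>R v + ?D (c *\<^sub>R f) = c *\<^sub>R (v + ?D f)"
        by (simp add: translation_defect_scale scaleR_add_right)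
      also have "l1_norm (c *\<^sub>R (v + ?D f)) - l1_norm (c *\<^sub>R f) = c * (l1_norm (v + ?D f) - l1_norm f)"
        using c by (simp add: l1_norm_scale right_diff_distrib)
      finally show "p (c *\<^sub>R v) / c \<le> l1_norm (v + ?D f) - l1_norm f"
        using c False by (subst pos_divide_le_eq) (auto simp only: mult.commute less_le)
    qed
    then show ?thesis using c False by (simp add: pos_divide_le_eq mult.commute)
  qed
  ultimately have "sublinear_on finsupp p" by (simp add: sublinear_on_def)
  from Hahn_Banach_sublinear[OF subspace_finsupp this]
  obtain L where Lp: "\<And>v. v \<in> finsupp \<Longrightarrow> L v \<le> p v"
    and Ladd: "\<And>v w. v \<in> finsupp \<Longrightarrow> w \<in> finsupp \<Longrightarrow> L (v + w) = L v + L w"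
    and Lscale: "\<And>c v. v \<in> finsupp \<Longrightarrow> L (c *\<^sub>R v) = c * L v" by blast
  have Lneg: "L (- v) = - L v" if "v \<in> finsupp" for v
    using Lscale[OF that, of "-1"] by simp
  have Ldiff: "L (v - w) = L v - L w" if "v \<in> finsupp" "w \<in> finsupp" for v w
  proof -
    have "L (v + - w) = L v + L (- w)" by (intro Ladd Vs(4) that)
    then show ?thesis using Lneg[OF that(2)] by (simp only: add_uminus_conv_diff)
  qed
  have Lsum: "L (\<Sum>i\<in>I. v i) = (\<Sum>i\<in>I. L (v i))" if "finite I" "\<And>i. i \<in> I \<Longrightarrow> v i \<in> finsupp" for I :: "nat set" and v
    using that
  proof induction
    case empty
    show ?case using Lscale[OF Vs(1), of 0] by (simp add: zero_fun_def)
  next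
    case (insert i I)
    then have "L (v i + sum v I) = L (v i) + L (sum v I)"
      by (intro Ladd subspace_sum[OF subspace_finsupp]) auto
    moreover have "L (sum v I) = (\<Sum>i\<in>I. L (v i))" using insert by blast
    ultimately show ?case unfolding sum.insert[OF insert.hyps(1,2)] by (rule trans[OF _ arg_cong])
  qed
  have LD: "l1_norm f \<le> L (?D f)" if f: "f \<in> P" for f
  proof -
    have "L (- ?D f) \<le> p (- ?D f)" by (intro Lp Vs(4) D f)
    also have "\<dots> \<le> l1_norm (- ?D f + ?D f) - l1_norm f" by (intro ple Vs(4) D f)
    also have "l1_norm (- ?D f + ?D f) = 0" by (simp add: l1_norm_def)
    finally show ?thesis using Lneg[OF D[OF f]] by linarith
  qed
  define \<delta> :: "nat \<Rightarrow> 'a \<Rightarrow> nat \<times> 'a \<Rightarrow> real" where "\<delta> i x = (\<lambda>b. if b = (i, x) then 1 else 0)" for i x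
  have \<delta>V: "\<delta> i x \<in> finsupp" for i x
    unfolding finsupp_def mem_Collect_eq by (rule finite_subset[of _ "{(i, x)}"]) (auto simp: \<delta>_def split: if_splits)
  have \<delta>1: "l1_norm (\<delta> i x) = 1" for i x
    by (subst l1_norm_eq[of "{(i, x)}"]) (auto simp: \<delta>_def split: if_splits)
  define h where "h i x = L (\<delta> i x)" for i x
  have h1: "\<bar>h i x\<bar> \<le> 1" for i x
  proof -
    have "L (\<delta> i x) \<le> 1" using Lp[OF \<delta>V] p1[OF \<delta>V] \<delta>1 by (metis order_trans)
    moreover have "L (- \<delta> i x) \<le> 1"
      using Lp[OF Vs(4)[OF \<delta>V]] p1[OF Vs(4)[OF \<delta>V]] \<delta>1 by (metis l1_norm_minus order_trans)
    ultimately show ?thesis by (simp add: h_def Lneg[OF \<delta>V] abs_le_iff)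
  qed
  have key: "1 \<le> (\<Sum>i<n. h i (- s i + y) - h i y)" for y
  proof -
    define f :: "'a \<Rightarrow> real" where "f = (\<lambda>x. if x = y then 1 else 0)"
    have "{x. f x \<noteq> 0} = {y}" by (auto simp: f_def)
    then have "f \<in> P" unfolding P_def finsupp_def by (simp add: f_def)
    moreover have "l1_norm f = 1" by (subst l1_norm_eq[of "{y}"]) (auto simp: f_def split: if_splits)
    moreover have "?D f = (\<Sum>i<n. \<delta> i (- s i + y) - \<delta> i y)"
    proof
      fix b :: "nat \<times> 'a"
      obtain j x where b: "b = (j, x)" by fastforce
      have eq: "s j + x = y \<longleftrightarrow> x = - s j + y" by (metis minus_add_cancel add_minus_cancel)
      have "(\<Sum>i<n. \<delta> i (- s i + y) - \<delta> i y) b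
          = (\<Sum>i<n. if i = j then (if x = - s j + y then 1 else 0) - (if x = y then 1 else 0) else 0)"
        unfolding sum_fun_apply by (intro sum.cong) (auto simp: \<delta>_def b)
      also have "\<dots> = ?D f b" by (simp add: b translation_defect_def f_def eq)
      finally show "?D f b = (\<Sum>i<n. \<delta> i (- s i + y) - \<delta> i y) b" by simp
    qed
    moreover have "L (\<Sum>i<n. \<delta> i (- s i + y) - \<delta> i y) = (\<Sum>i<n. h i (- s i + y) - h i y)"
    proof -
      have "L (\<Sum>i<n. \<delta> i (- s i + y) - \<delta> i y) = (\<Sum>i<n. L (\<delta> i (- s i + y) - \<delta> i y))"
        by (intro Lsum subspace_diff[OF subspace_finsupp] \<delta>V) simp
      then show ?thesis by (simp only: Ldiff[OF \<delta>V \<delta>V] h_def)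
    qed
    ultimately show ?thesis using LD[of f] by simp
  qed
  obtain M :: "('a \<Rightarrow> real) \<Rightarrow> real" where
    M: "\<forall>f g. bounded (range f) \<longrightarrow> bounded (range g) \<longrightarrow> M (\<lambda>t. f t + g t) = M f + M g"
      "\<forall>c f. bounded (range f) \<longrightarrow> M (\<lambda>t. c * f t) = c * M f"
      "\<forall>f. bounded (range f) \<longrightarrow> (\<forall>t. 0 \<le> f t) \<longrightarrow> 0 \<le> M f"
      "M (\<lambda>t. 1) = 1"
      "\<forall>s f. bounded (range f) \<longrightarrow> M (\<lambda>t. f (s + t)) = M f"
    using amen unfolding discretely_amenable_def by (elim exE conjE) (rule that)
  note Madd = M(1)[rule_format] and Mscale = M(2)[rule_format] and Mpos = M(3)[rule_format]
    and M1 = M(4) and Minv = M(5)[rule_format]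
  have bd: "bounded (range g)" if "\<And>t. \<bar>g t\<bar> \<le> c" for g :: "'a \<Rightarrow> real" and c
    using that by (auto simp: bounded_iff)
  define G where "G k y = (\<Sum>i<k. h i (- s i + y) - h i y)" for k y
  have Gb: "\<bar>G k y\<bar> \<le> 2 * real k" for k y
  proof -
    have "\<bar>G k y\<bar> \<le> (\<Sum>i<k. \<bar>h i (- s i + y) - h i y\<bar>)" unfolding G_def by (rule sum_abs)
    also have "\<dots> \<le> (\<Sum>i<k. 2)"
    proof (rule sum_mono)
      fix i show "\<bar>h i (- s i + y) - h i y\<bar> \<le> 2" using h1[of i "- s i + y"] h1[of i y] by linarith
    qed
    finally show ?thesis by simp
  qed
  \<comment> \<open>Invariance of the mean cancels each difference. Induction is used because the
    mean is only known to be additive for two functions.\<close>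
  have MG: "M (G k) = 0" for k
  proof (induction k)
    case 0
    show ?case using Mscale[of "\<lambda>t. 1" 0] bd[of "\<lambda>t. 1" 1] by (simp add: G_def)
  next
    case (Suc k)
    have b: "bounded (range (h k))" "bounded (range (\<lambda>y. h k (- s k + y)))" "bounded (range (\<lambda>y. - 1 * h k y))"
      using h1 by (auto intro!: bd[of _ 1])
    have b2: "bounded (range (\<lambda>y. h k (- s k + y) + - 1 * h k y))"
    proof (rule bd[of _ 2])
      fix y show "\<bar>h k (- s k + y) + - 1 * h k y\<bar> \<le> 2" using h1[of k "- s k + y"] h1[of k y] by linarith
    qed
    have "M (G (Suc k)) = M (\<lambda>y. G k y + (h k (- s k + y) + - 1 * h k y))"
      by (rule arg_cong[of _ _ M]) (simp add: G_def fun_eq_iff)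
    also have "\<dots> = M (G k) + (M (\<lambda>y. h k (- s k + y)) + - 1 * M (h k))"
      using b b2 bd[OF Gb] by (simp only: Madd Mscale)
    also have "M (\<lambda>y. h k (- s k + y)) = M (h k)" by (rule Minv[OF b(1)])
    finally show ?case using Suc by simp
  qed
  have "0 \<le> M (\<lambda>y. G n y + - 1 * 1)"
  proof (rule Mpos)
    show "bounded (range (\<lambda>y. G n y + - 1 * 1))"
    proof (rule bd[of _ "2 * real n + 1"])
      fix y show "\<bar>G n y + - 1 * 1\<bar> \<le> 2 * real n + 1" using Gb[of n y] by linarith
    qed
    show "0 \<le> G n t + - 1 * 1" for t using key[of t] by (simp add: G_def)
  qed
  also have "\<dots> = M (G n) + M (\<lambda>y. - 1 * 1)"
    using bd[OF Gb] bd[of "\<lambda>y. - 1 * 1" 1] by (intro Madd) auto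
  also have "M (\<lambda>y. - 1 * 1) = - 1 * M (\<lambda>y. 1)"
    using bd[of "\<lambda>y. 1" 1] by (intro Mscale) auto
  finally show False using MG M1 by simp
qed

text \<open>Take \<open>w\<close> to be the square root of the normalised almost invariant
  \<open>f\<close>. From (a - b)^2 \<le> |a^2 - b^2| for nonnegative a, b one gets 2 - 2 \<phi>(s_i)
  = ||\<lambda> w - w||^2 \<le> ||\<lambda> f - f||_1 / ||f||_1 < 1, where \<lambda> is the
  translation by s_i.\<close>

lemma Reiter_vector:
  fixes s :: "nat \<Rightarrow> 'a::group_add"
  assumes amen: "discretely_amenable TYPE('a)"
  obtains F and w :: "'a \<Rightarrow> real" where "finite F" "\<And>h. 0 \<le> w h" "\<And>h. h \<notin> F \<Longrightarrow> w h = 0"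
    "(\<Sum>h\<in>F. (w h)\<^sup>2) = 1" "\<And>i. i < n \<Longrightarrow> 1 / 2 \<le> (\<Sum>h\<in>F. w (s i + h) * w h)"
proof -
  obtain f :: "'a \<Rightarrow> real" where f: "f \<in> finsupp" "\<And>x. 0 \<le> f x"
    "l1_norm (translation_defect n s f) < l1_norm f"
    using almost_invariant_from_mean[OF amen, of n s] by blast
  define m where "m = l1_norm f"
  have m: "0 < m" using f(3) l1_norm_nonneg[of "translation_defect n s f"] by (simp add: m_def)
  define F where "F = {x. f x \<noteq> 0}"
  have F: "finite F" using f(1) by (simp add: F_def finsupp_def)
  define w where "w h = sqrt (f h / m)" for h
  have w2: "(w h)\<^sup>2 = f h / m" for h using f(2) m by (simp add: w_def)
  have w0: "0 \<le> w h" for h using f(2) m by (simp add: w_def)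
  have wF: "w h = 0" if "h \<notin> F" for h using that by (simp add: w_def F_def)
  have mF: "m = (\<Sum>h\<in>F. f h)" unfolding m_def using f(2) l1_norm_eq[OF F, of f] by (simp add: F_def)
  have sum1: "(\<Sum>h\<in>T. (w h)\<^sup>2) = 1" if "finite T" "F \<subseteq> T" for T
  proof -
    have "(\<Sum>h\<in>T. (w h)\<^sup>2) = (\<Sum>h\<in>F. (w h)\<^sup>2)"
      using that wF by (intro sum.mono_neutral_right) auto
    also have "\<dots> = 1" using m mF by (simp add: w2 sum_divide_distrib[symmetric])
    finally show ?thesis .
  qed
  have "1 / 2 \<le> (\<Sum>h\<in>F. w (s i + h) * w h)" if i: "i < n" for i
  proof -
    \<comment> \<open>On \<open>T\<close> both \<open>w\<close> and its translate have their full
      mass 1, so the square of their difference can be expanded there.\<close>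
    define T where "T = F \<union> (+) (- s i) ` F"
    have T: "finite T" "F \<subseteq> T" using F by (auto simp: T_def)
    have inT: "h \<in> T" if "s i + h \<in> F" for h
      using that unfolding T_def by (metis UnI2 image_eqI minus_add_cancel)
    have shift: "(\<Sum>h\<in>T. (w (s i + h))\<^sup>2) = 1"
    proof -
      have "(\<Sum>h\<in>T. (w (s i + h))\<^sup>2) = (\<Sum>k\<in>(+) (s i) ` T. (w k)\<^sup>2)"
        by (subst sum.reindex) (auto simp: inj_on_def)
      also have "\<dots> = 1"
      proof (rule sum1)
        show "finite ((+) (s i) ` T)" using T by simp
        show "F \<subseteq> (+) (s i) ` T"
        proof
          fix k assume "k \<in> F"
          then have "- s i + k \<in> T" by (auto simp: T_def)
          then show "k \<in> (+) (s i) ` T" by (metis image_eqI add_minus_cancel)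
        qed
      qed
      finally show ?thesis .
    qed
    have "(\<Sum>h\<in>T. \<bar>f (s i + h) - f h\<bar>) \<le> l1_norm (translation_defect n s f)"
    proof -
      let ?d = "translation_defect n s f"
      have fin: "finite {b. ?d b \<noteq> 0}" using translation_defect_finsupp[OF f(1), of n s] by (simp add: finsupp_def)
      have "(\<Sum>h\<in>T. \<bar>f (s i + h) - f h\<bar>) = (\<Sum>b\<in>Pair i ` T. \<bar>?d b\<bar>)"
        using i by (subst sum.reindex) (auto simp: inj_on_def translation_defect_def)
      also have "\<dots> \<le> (\<Sum>b\<in>Pair i ` T \<union> {b. ?d b \<noteq> 0}. \<bar>?d b\<bar>)"
        using T fin by (intro sum_mono2) auto
      also have "\<dots> = l1_norm ?d" using T fin by (intro l1_norm_eq[symmetric]) auto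
      finally show ?thesis .
    qed
    then have lt: "(\<Sum>h\<in>T. \<bar>f (s i + h) - f h\<bar>) / m < 1" using f(3) m by (simp add: m_def[symmetric])
    have sq: "(a - b)\<^sup>2 \<le> \<bar>a\<^sup>2 - b\<^sup>2\<bar>" if "0 \<le> a" "0 \<le> b" for a b :: real
    proof -
      have "(a - b)\<^sup>2 = \<bar>a - b\<bar> * \<bar>a - b\<bar>" by (simp add: power2_eq_square)
      also have "\<dots> \<le> \<bar>a - b\<bar> * \<bar>a + b\<bar>" using that by (intro mult_left_mono) auto
      also have "\<dots> = \<bar>a\<^sup>2 - b\<^sup>2\<bar>" by (simp add: abs_mult[symmetric] power2_eq_square algebra_simps)
      finally show ?thesis .
    qed
    have "2 - 2 * (\<Sum>h\<in>T. w (s i + h) * w h) = (\<Sum>h\<in>T. (w (s i + h))\<^sup>2 + (w h)\<^sup>2 - 2 * (w (s i + h) * w h))"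
      using shift sum1[OF T] by (simp add: sum_subtractf sum.distrib sum_distrib_left)
    also have "\<dots> = (\<Sum>h\<in>T. (w (s i + h) - w h)\<^sup>2)"
      by (intro sum.cong) (auto simp: power2_diff algebra_simps)
    also have "\<dots> \<le> (\<Sum>h\<in>T. \<bar>(w (s i + h))\<^sup>2 - (w h)\<^sup>2\<bar>)"
      by (intro sum_mono sq w0)
    also have "\<dots> = (\<Sum>h\<in>T. \<bar>f (s i + h) - f h\<bar>) / m"
      using m by (simp add: w2 diff_divide_distrib[symmetric] sum_divide_distrib)
    finally have "1 / 2 \<le> (\<Sum>h\<in>T. w (s i + h) * w h)" using lt by simp
    also have "\<dots> = (\<Sum>h\<in>F. w (s i + h) * w h)"
      using T wF by (intro sum.mono_neutral_right) auto
    finally show ?thesis .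
  qed
  then show ?thesis using that[OF F w0 wF sum1[OF F order_refl]] by blast
qed

section \<open>Polar decomposition of injective contractions\<close>

text \<open>A real Hilbert space up to null vectors. The inner product may be degenerate, since
  functions are not identified when they agree almost everywhere, and it is real; complex linearity
  is recovered later as equivariance under complex multiples.\<close>

locale semi_hilbert =
  fixes V :: "'v::real_vector set" and ip :: "'v \<Rightarrow> 'v \<Rightarrow> real"
  assumes subspace_carrier: "subspace V"
    and ip_commute: "x \<in> V \<Longrightarrow> y \<in> V \<Longrightarrow> ip x y = ip y x"
    and ip_add_left: "x \<in> V \<Longrightarrow> y \<in> V \<Longrightarrow> z \<in> V \<Longrightarrow> ip (x + y) z = ip x z + ip y z"
    and ip_scale_left: "x \<in> V \<Longrightarrow> y \<in> V \<Longrightarrow> ip (c *\<^sub>R x) y = c * ip x y"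
    and ip_nonneg: "x \<in> V \<Longrightarrow> 0 \<le> ip x x"
    and ip_complete: "(\<And>n. X n \<in> V) \<Longrightarrow>
      (\<And>e. 0 < e \<Longrightarrow> \<exists>K. \<forall>m\<ge>K. \<forall>n\<ge>K. ip (X m - X n) (X m - X n) < e) \<Longrightarrow>
      \<exists>x\<in>V. (\<lambda>n. ip (X n - x) (X n - x)) \<longlonglongrightarrow> (0::real)"
begin

lemmas zero_mem = subspace_0[OF subspace_carrier]
  and add_mem = subspace_add[OF subspace_carrier]
  and diff_mem = subspace_diff[OF subspace_carrier]
  and scale_mem = subspace_scale[OF subspace_carrier]

lemma ip_add_right: "x \<in> V \<Longrightarrow> y \<in> V \<Longrightarrow> z \<in> V \<Longrightarrow> ip z (x + y) = ip z x + ip z y"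
  using ip_add_left[of x y z] by (simp add: ip_commute add_mem)

lemma ip_scale_right: "x \<in> V \<Longrightarrow> y \<in> V \<Longrightarrow> ip y (c *\<^sub>R x) = c * ip y x"
  using ip_scale_left[of x y c] by (simp add: ip_commute scale_mem)

lemma ip_zero_left: "x \<in> V \<Longrightarrow> ip 0 x = 0"
  using ip_scale_left[of x x 0] by simp

lemma ip_diff_left: "x \<in> V \<Longrightarrow> y \<in> V \<Longrightarrow> z \<in> V \<Longrightarrow> ip (x - y) z = ip x z - ip y z"
  using ip_add_left[of x "(-1) *\<^sub>R y" z] ip_scale_left[of y z "-1"] scale_mem[of y "-1"] by simp

lemma ip_diff_right: "x \<in> V \<Longrightarrow> y \<in> V \<Longrightarrow> z \<in> V \<Longrightarrow> ip z (x - y) = ip z x - ip z y"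
  using ip_diff_left[of x y z] by (simp add: ip_commute diff_mem)

lemma ip_minus_minus: "x \<in> V \<Longrightarrow> ip (- x) (- x) = ip x x"
  using ip_scale_left[of x "- x" "-1"] ip_scale_right[of x x "-1"] scale_mem[of x "-1"] by simp

definition nm :: "'v \<Rightarrow> real" where "nm x = sqrt (ip x x)"

lemma nm_nonneg: "x \<in> V \<Longrightarrow> 0 \<le> nm x"
  by (simp add: nm_def ip_nonneg)

lemma nm_power2: "x \<in> V \<Longrightarrow> (nm x)\<^sup>2 = ip x x"
  by (simp add: nm_def ip_nonneg)

lemma ip_Cauchy_Schwarz2:
  assumes x: "x \<in> V" and y: "y \<in> V"
  shows "(ip x y)\<^sup>2 \<le> ip x x * ip y y"
proof -
  have q: "0 \<le> ip x x + 2 * t * ip x y + t * t * ip y y" for t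
  proof -
    have "0 \<le> ip (x + t *\<^sub>R y) (x + t *\<^sub>R y)" by (intro ip_nonneg add_mem scale_mem x y)
    also have "\<dots> = ip x x + 2 * t * ip x y + t * t * ip y y"
      using x y by (simp add: ip_add_left ip_add_right ip_scale_left ip_scale_right add_mem scale_mem
          ip_commute[of y x] algebra_simps)
    finally show ?thesis .
  qed
  show ?thesis
  proof (cases "ip y y = 0")
    case True
    have "ip x y = 0"
    proof (rule ccontr)
      assume n: "ip x y \<noteq> 0"
      \<comment> \<open>With \<open>ip y y = 0\<close> the quadratic is affine in \<open>t\<close>,
        and at this \<open>t\<close> it equals -1.\<close>
      show False using q[of "- (ip x x + 1) / (2 * ip x y)"] n True by (simp add: field_simps)
    qed
    then show ?thesis using True by simp
  next
    case False
    then have p: "ip y y > 0" using ip_nonneg[OF y] by simp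
    have "0 \<le> (ip x x + 2 * (- ip x y / ip y y) * ip x y + (- ip x y / ip y y) * (- ip x y / ip y y) * ip y y) * ip y y"
      using q[of "- ip x y / ip y y"] p by (intro mult_nonneg_nonneg) auto
    also have "\<dots> = ip x x * ip y y - (ip x y)\<^sup>2"
      using p by (simp add: field_simps power2_eq_square)
    finally show ?thesis by simp
  qed
qed

lemma ip_Cauchy_Schwarz: "x \<in> V \<Longrightarrow> y \<in> V \<Longrightarrow> \<bar>ip x y\<bar> \<le> nm x * nm y"
  using ip_Cauchy_Schwarz2[of x y] real_sqrt_le_mono[of "(ip x y)\<^sup>2" "ip x x * ip y y"]
  by (simp add: nm_def real_sqrt_mult)

lemma ip_null_left: "x \<in> V \<Longrightarrow> ip x x = 0 \<Longrightarrow> y \<in> V \<Longrightarrow> ip x y = 0"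
  using ip_Cauchy_Schwarz2[of x y] by simp

lemma nm_add: 
  assumes x: "x \<in> V" and y: "y \<in> V" shows "nm (x + y) \<le> nm x + nm y"
proof (rule power2_le_imp_le)
  have "(nm (x + y))\<^sup>2 = ip x x + 2 * ip x y + ip y y"
    using x y by (simp add: nm_power2 add_mem ip_add_left ip_add_right ip_commute[of y x])
  also have "\<dots> \<le> (nm x)\<^sup>2 + 2 * (nm x * nm y) + (nm y)\<^sup>2"
    using ip_Cauchy_Schwarz[OF x y] by (simp add: nm_power2 x y)
  finally show "(nm (x + y))\<^sup>2 \<le> (nm x + nm y)\<^sup>2" by (simp add: power2_sum)
qed (simp add: nm_nonneg x y)

lemma nm_scale: "x \<in> V \<Longrightarrow> nm (c *\<^sub>R x) = \<bar>c\<bar> * nm x"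
  by (simp add: nm_def ip_scale_left ip_scale_right scale_mem real_sqrt_mult mult.assoc[symmetric] power2_eq_square[symmetric])

lemma nm_minus: "x \<in> V \<Longrightarrow> nm (- x) = nm x"
  using nm_scale[of x "-1"] by simp

lemma nm_minus_commute: "x \<in> V \<Longrightarrow> y \<in> V \<Longrightarrow> nm (x - y) = nm (y - x)"
  using nm_minus[of "x - y"] by (simp add: diff_mem)

lemma nm_diff_triangle: "x \<in> V \<Longrightarrow> y \<in> V \<Longrightarrow> z \<in> V \<Longrightarrow> nm (x - z) \<le> nm (x - y) + nm (y - z)"
  using nm_add[of "x - y" "y - z"] by (simp add: diff_mem)

definition conv :: "(nat \<Rightarrow> 'v) \<Rightarrow> 'v \<Rightarrow> bool" where
  "conv X x \<longleftrightarrow> (\<lambda>n. nm (X n - x)) \<longlonglongrightarrow> 0"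

lemma complete:
  assumes X: "\<And>n. X n \<in> V" and C: "\<And>e. 0 < e \<Longrightarrow> \<exists>K. \<forall>m\<ge>K. \<forall>n\<ge>K. ip (X m - X n) (X m - X n) < e"
  obtains x where "x \<in> V" "conv X x"
proof -
  obtain x where "x \<in> V" "(\<lambda>n. ip (X n - x) (X n - x)) \<longlonglongrightarrow> 0"
    using ip_complete[OF X C] by blast
  then show ?thesis using tendsto_real_sqrt[of "\<lambda>n. ip (X n - x) (X n - x)" 0 sequentially] that[of x]
    by (simp add: conv_def nm_def)
qed

lemma ip_tendsto:
  assumes X: "\<And>n. X n \<in> V" and x: "x \<in> V" and Xx: "conv X x"
    and Y: "\<And>n. Y n \<in> V" and y: "y \<in> V" and Yy: "conv Y y"
  shows "(\<lambda>n. ip (X n) (Y n)) \<longlonglongrightarrow> ip x y"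
proof -
  have "(\<lambda>n. ip (X n) (Y n) - ip x y) \<longlonglongrightarrow> 0"
  proof (rule Lim_null_comparison)
    show "\<forall>\<^sub>F n in sequentially. norm (ip (X n) (Y n) - ip x y)
        \<le> nm (X n - x) * nm (Y n - y) + nm (X n - x) * nm y + nm x * nm (Y n - y)"
    proof (intro always_eventually allI)
      fix n
      have "ip (X n) (Y n) - ip x y = ip (X n - x) (Y n - y) + ip (X n - x) y + ip x (Y n - y)"
        using X x Y y by (simp add: ip_diff_left ip_diff_right diff_mem)
      then show "norm (ip (X n) (Y n) - ip x y)
          \<le> nm (X n - x) * nm (Y n - y) + nm (X n - x) * nm y + nm x * nm (Y n - y)"
        using ip_Cauchy_Schwarz[of "X n - x" "Y n - y"] ip_Cauchy_Schwarz[of "X n - x" y]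
          ip_Cauchy_Schwarz[of x "Y n - y"] X x Y y by (simp add: diff_mem)
    qed
    show "(\<lambda>n. nm (X n - x) * nm (Y n - y) + nm (X n - x) * nm y + nm x * nm (Y n - y)) \<longlonglongrightarrow> 0"
      using Xx Yy unfolding conv_def by (auto intro!: tendsto_eq_intros)
  qed
  then show ?thesis by (rule LIM_zero_cancel)
qed

lemma conv_const: "conv (\<lambda>n. x) x"
  using zero_mem by (simp add: conv_def nm_def ip_zero_left)

text \<open>The representing vector minimises \<open>J\<close>, the square norm minus twice the
  functional. The parallelogram identity makes minimising sequences Cauchy, and the first variation
  at the minimum is the claim. Minimising directly avoids projections onto kernels in a degenerate
  space.\<close>

lemma Riesz:
  assumes add: "\<And>x y. x \<in> V \<Longrightarrow> y \<in> V \<Longrightarrow> \<phi> (x + y) = \<phi> x + \<phi> y"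
    and scale: "\<And>c x. x \<in> V \<Longrightarrow> \<phi> (c *\<^sub>R x) = c * \<phi> x"
    and bound: "\<And>x. x \<in> V \<Longrightarrow> \<bar>\<phi> x\<bar> \<le> B * nm x"
  shows "\<exists>h\<in>V. \<forall>x\<in>V. \<phi> x = ip x h"
proof -
  define J where "J x = ip x x - 2 * \<phi> x" for x
  have lower: "- B\<^sup>2 \<le> J x" if "x \<in> V" for x
  proof -
    have "0 \<le> (nm x - B)\<^sup>2" by simp
    also have "\<dots> = ip x x - 2 * (B * nm x) + B\<^sup>2" by (simp add: power2_diff nm_power2 that)
    finally show ?thesis using bound[OF that] by (simp add: J_def abs_le_iff)
  qed
  have bdd: "bdd_below (J ` V)" using lower by (intro bdd_belowI2)
  define m where "m = Inf (J ` V)"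
  have mJ: "m \<le> J x" if "x \<in> V" for x unfolding m_def using bdd that by (intro cInf_lower) auto
  have "\<exists>x\<in>V. J x < m + 1 / real (Suc n)" for n
  proof -
    have "\<exists>a\<in>J ` V. a < m + 1 / real (Suc n)"
      unfolding m_def by (rule cInf_lessD) (use zero_mem in auto)
    then show ?thesis by auto
  qed
  then obtain X where X: "\<And>n. X n \<in> V" "\<And>n. J (X n) < m + 1 / real (Suc n)" by metis
  \<comment> \<open>Apply the parallelogram identity with midpoint \<open>c\<close> and use
    \<open>m \<le> J c\<close>.\<close>
  have par: "ip (a - b) (a - b) \<le> 2 * (J a - m) + 2 * (J b - m)" if ab: "a \<in> V" "b \<in> V" for a b
  proof -
    define c where "c = (1 / 2) *\<^sub>R (a + b)"
    have cV: "c \<in> V" unfolding c_def by (intro scale_mem add_mem ab)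
    have "ip c c = (1 / 4) * (ip a a + 2 * ip a b + ip b b)"
      using ab by (simp add: c_def ip_scale_left ip_scale_right ip_add_left ip_add_right add_mem scale_mem
          ip_commute[of b a] add_divide_distrib)
    moreover have "\<phi> c = (1 / 2) * (\<phi> a + \<phi> b)"
      using ab by (simp add: c_def scale add add_mem)
    moreover have "ip (a - b) (a - b) = ip a a - 2 * ip a b + ip b b"
      using ab by (simp add: ip_diff_left ip_diff_right diff_mem ip_commute[of b a])
    ultimately have "ip (a - b) (a - b) = 2 * J a + 2 * J b - 4 * J c"
      unfolding J_def by algebra
    then show ?thesis using mJ[OF cV] by simp
  qed
  obtain h where h: "h \<in> V" "conv X h"
  proof (rule complete[OF X(1)])
    fix e :: real assume e: "0 < e"
    obtain K :: nat where K: "1 / real (Suc K) < e / 4" using e by (metis divide_pos_pos nat_approx_posE zero_less_numeral)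
    have "ip (X i - X j) (X i - X j) < e" if "i \<ge> K" "j \<ge> K" for i j
    proof -
      have "1 / real (Suc i) \<le> 1 / real (Suc K)" "1 / real (Suc j) \<le> 1 / real (Suc K)"
        using that by (auto intro!: divide_left_mono)
      then have "J (X i) - m < e / 4" "J (X j) - m < e / 4" using X(2)[of i] X(2)[of j] K by linarith+
      moreover have "z < e" if "z \<le> 2 * a + 2 * b" "a < e / 4" "b < e / 4" for z a b :: real
        using that by linarith
      ultimately show ?thesis using par[OF X(1) X(1), of i j] by blast
    qed
    then show "\<exists>K. \<forall>m\<ge>K. \<forall>n\<ge>K. ip (X m - X n) (X m - X n) < e" by blast
  qed
  have "(\<lambda>n. J (X n)) \<longlonglongrightarrow> J h"
  proof -
    have diff: "\<phi> (x - y) = \<phi> x - \<phi> y" if "x \<in> V" "y \<in> V" for x y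
      using add[of x "(-1) *\<^sub>R y"] scale[of y "-1"] scale_mem[OF that(2), of "-1"] that by simp
    have "(\<lambda>n. \<phi> (X n) - \<phi> h) \<longlonglongrightarrow> 0"
    proof (rule Lim_null_comparison)
      show "\<forall>\<^sub>F n in sequentially. norm (\<phi> (X n) - \<phi> h) \<le> B * nm (X n - h)"
        using bound[OF diff_mem[OF X(1) h(1)]] by (simp add: diff X h)
      show "(\<lambda>n. B * nm (X n - h)) \<longlonglongrightarrow> 0"
        using h(2) unfolding conv_def by (auto intro!: tendsto_eq_intros)
    qed
    then have "(\<lambda>n. \<phi> (X n)) \<longlonglongrightarrow> \<phi> h" by (rule LIM_zero_cancel)
    then show ?thesis
      unfolding J_def using ip_tendsto[OF X(1) h X(1) h] by (intro tendsto_intros) auto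
  qed
  moreover have "(\<lambda>n. m + 1 / real (Suc n)) \<longlonglongrightarrow> m + 0"
    by (intro tendsto_intros LIMSEQ_inverse_real_of_nat[unfolded inverse_eq_divide])
  ultimately have Jh: "J h \<le> m"
    using X(2) by (intro LIMSEQ_le[of "\<lambda>n. J (X n)" "J h" "\<lambda>n. m + 1 / real (Suc n)" m]) (auto intro: less_imp_le)
  have "\<phi> x = ip x h" if x: "x \<in> V" for x
  proof -
    define d where "d = ip x h - \<phi> x"
    have q: "0 \<le> 2 * t * d + t * t * ip x x" for t
    proof -
      have "J h \<le> J (h + t *\<^sub>R x)" using Jh mJ[OF add_mem[OF h(1) scale_mem[OF x]], of t] by simp
      also have "\<dots> = J h + 2 * t * d + t * t * ip x x"
        using x h by (simp add: J_def d_def ip_add_left ip_add_right ip_scale_left ip_scale_right add scale add_mem scale_mem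
            ip_commute[of h x] algebra_simps)
      finally show ?thesis by simp
    qed
    have "d = 0"
    proof (rule ccontr)
      assume d: "d \<noteq> 0"
      \<comment> \<open>Adding 1 keeps \<open>s\<close> positive even for a null vector
        \<open>x\<close>; with t = - d / s the quadratic term is at most half as large as the linear
        one.\<close>
      define s where "s = ip x x + 1"
      have s: "s > 0" using ip_nonneg[OF x] by (simp add: s_def)
      have "0 \<le> 2 * (- d / s) * d + (- d / s) * (- d / s) * ip x x" by (rule q)
      also have "\<dots> = (d * d / s) * (ip x x / s - 2)" using s by (simp add: field_simps)
      also have "\<dots> < 0"
      proof (rule mult_pos_neg)
        show "0 < d * d / s" using d s by (metis not_real_square_gt_zero divide_pos_pos)
        have "ip x x / s \<le> 1" using s by (simp add: s_def)
        then show "ip x x / s - 2 < 0" by simp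
      qed
      finally show False by simp
    qed
    then show ?thesis by (simp add: d_def)
  qed
  then show ?thesis using h(1) by blast
qed

end

section \<open>Polynomials approximating the inverse square root\<close>

definition nonneg_coeffs :: "real poly \<Rightarrow> bool" where
  "nonneg_coeffs p \<longleftrightarrow> (\<forall>i. 0 \<le> coeff p i)"

lemma nonneg_coeffs_add: "nonneg_coeffs p \<Longrightarrow> nonneg_coeffs q \<Longrightarrow> nonneg_coeffs (p + q)"
  and nonneg_coeffs_mult: "nonneg_coeffs p \<Longrightarrow> nonneg_coeffs q \<Longrightarrow> nonneg_coeffs (p * q)"
  and nonneg_coeffs_smult: "0 \<le> c \<Longrightarrow> nonneg_coeffs p \<Longrightarrow> nonneg_coeffs (smult c p)"
  and nonneg_coeffs_1: "nonneg_coeffs 1"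
  and nonneg_coeffs_numeral: "nonneg_coeffs (numeral n)"
  and nonneg_coeffs_0: "nonneg_coeffs 0"
  by (auto simp: nonneg_coeffs_def coeff_mult numeral_poly coeff_pCons split: nat.splits intro!: sum_nonneg)

lemmas nonneg_coeffs_intros = nonneg_coeffs_add nonneg_coeffs_mult nonneg_coeffs_smult
  nonneg_coeffs_1 nonneg_coeffs_numeral nonneg_coeffs_0

lemma nonneg_coeffs_power: "nonneg_coeffs p \<Longrightarrow> nonneg_coeffs (p ^ n)"
  by (induction n) (auto intro: nonneg_coeffs_intros)

text \<open>The Newton--Schulz iteration \<open>p' = p (3 - (1 - y) p\<^sup>2) / 2\<close> for \<open>(1 - y)\<^sup>-\<^sup>1\<^sup>/\<^sup>2\<close>, together
  with its error \<open>e = 1 - (1 - y) p\<^sup>2\<close>. In the variable \<open>y\<close> all coefficients are nonnegative.\<close>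

fun sqrt_iter :: "nat \<Rightarrow> real poly \<times> real poly" where
  "sqrt_iter 0 = (1, [:0, 1:])"
| "sqrt_iter (Suc k) = (let (p, e) = sqrt_iter k in
     (p + smult (1 / 2) (p * e), smult (1 / 4) (e\<^sup>2 * (3 + e))))"

definition sqrt_poly :: "nat \<Rightarrow> real poly" where "sqrt_poly k = fst (sqrt_iter k)"
definition sqrt_err :: "nat \<Rightarrow> real poly" where "sqrt_err k = snd (sqrt_iter k)"

abbreviation Yp :: "real poly" where "Yp \<equiv> [:0, 1:]"

lemma sqrt_poly_Suc: "sqrt_poly (Suc k) = sqrt_poly k + smult (1 / 2) (sqrt_poly k * sqrt_err k)"
  and sqrt_err_Suc: "sqrt_err (Suc k) = smult (1 / 4) ((sqrt_err k)\<^sup>2 * (3 + sqrt_err k))"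
  and sqrt_poly_0: "sqrt_poly 0 = 1" and sqrt_err_0: "sqrt_err 0 = Yp"
  by (auto simp: sqrt_poly_def sqrt_err_def Let_def case_prod_unfold)

lemma nonneg_sqrt_err: "nonneg_coeffs (sqrt_err k)"
proof (induction k)
  case 0
  show ?case by (auto simp: sqrt_err_0 nonneg_coeffs_def coeff_pCons split: nat.splits)
next
  case (Suc k)
  then show ?case unfolding sqrt_err_Suc
    by (intro nonneg_coeffs_intros nonneg_coeffs_power) auto
qed

lemma nonneg_sqrt_poly: "nonneg_coeffs (sqrt_poly k)"
  by (induction k)
    (auto simp: sqrt_poly_0 sqrt_poly_Suc intro!: nonneg_coeffs_intros nonneg_sqrt_err)

lemma nonneg_sqrt_poly_diff: "l \<le> k \<Longrightarrow> nonneg_coeffs (sqrt_poly k - sqrt_poly l)"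
proof (induction rule: dec_induct)
  case base
  show ?case by (simp add: nonneg_coeffs_0)
next
  case (step i)
  have eq: "sqrt_poly (Suc i) - sqrt_poly l
      = (sqrt_poly i - sqrt_poly l) + smult (1 / 2) (sqrt_poly i * sqrt_err i)"
    by (simp add: sqrt_poly_Suc)
  show ?case
    unfolding eq using step by (intro nonneg_coeffs_intros nonneg_sqrt_err nonneg_sqrt_poly) auto
qed

lemma poly_eq_by_eval:
  fixes p q :: "real poly"
  assumes "\<And>x. poly p x = poly q x"
  shows "p = q"
  using assms poly_eq_poly_eq_iff[of p q] by (simp add: fun_eq_iff)

text \<open>The inductive step is the identity (1 - e) (1 + e/2)^2 = 1 - e^2 (3 + e) / 4, verified
  by evaluating at every real number.\<close>

lemma sqrt_iter_invariant: "(1 - Yp) * (sqrt_poly k)\<^sup>2 = 1 - sqrt_err k"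
proof (rule poly_eq_by_eval)
  fix x
  show "poly ((1 - Yp) * (sqrt_poly k)\<^sup>2) x = poly (1 - sqrt_err k) x"
  proof (induction k)
    case 0
    show ?case by (simp add: sqrt_poly_0 sqrt_err_0)
  next
    case (Suc k)
    define p e where "p = poly (sqrt_poly k) x" and "e = poly (sqrt_err k) x"
    have IH: "(1 - x) * p\<^sup>2 = 1 - e" using Suc by (simp add: p_def e_def)
    have "poly ((1 - Yp) * (sqrt_poly (Suc k))\<^sup>2) x = (1 - x) * (p + p * e / 2)\<^sup>2"
      by (simp add: sqrt_poly_Suc p_def e_def)
    also have "\<dots> = ((1 - x) * p\<^sup>2) * (1 + e / 2)\<^sup>2"
      by (simp add: power2_eq_square field_simps)
    also have "\<dots> = 1 - e\<^sup>2 * (3 + e) / 4"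
      unfolding IH by (simp add: power2_eq_square field_simps)
    also have "\<dots> = poly (1 - sqrt_err (Suc k)) x"
      by (simp add: sqrt_err_Suc e_def)
    finally show ?case .
  qed
qed

text \<open>\<open>W\<close> is an injective contraction between Hilbert spaces and \<open>Y = 1 - W\<^sup>*W\<close>.\<close>

locale injective_contraction = K: semi_hilbert V ip + L: semi_hilbert V2 ip2
  for V :: "'v::real_vector set" and ip and V2 :: "'w::real_vector set" and ip2 +
  fixes W :: "'v \<Rightarrow> 'w" and Y :: "'v \<Rightarrow> 'v"
  assumes W_mem: "x \<in> V \<Longrightarrow> W x \<in> V2"
    and W_add: "x \<in> V \<Longrightarrow> y \<in> V \<Longrightarrow> W (x + y) = W x + W y"
    and W_scale: "x \<in> V \<Longrightarrow> W (c *\<^sub>R x) = c *\<^sub>R W x"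
    and W_contraction: "x \<in> V \<Longrightarrow> ip2 (W x) (W x) \<le> ip x x"
    and W_injective: "x \<in> V \<Longrightarrow> ip2 (W x) (W x) = 0 \<Longrightarrow> ip x x = 0"
    and Y_mem: "x \<in> V \<Longrightarrow> Y x \<in> V"
    and ip_Y: "x \<in> V \<Longrightarrow> y \<in> V \<Longrightarrow> ip (Y x) y = ip x y - ip2 (W x) (W y)"
begin

lemma ip_Y_swap: "x \<in> V \<Longrightarrow> y \<in> V \<Longrightarrow> ip (Y x) y = ip x (Y y)"
  using ip_Y[of x y] ip_Y[of y x] K.ip_commute L.ip_commute W_mem Y_mem by metis

text \<open>The vector p(Y) x, by Horner's scheme with \<open>Y\<close> applied on the
  inside.\<close>

definition pv :: "real poly \<Rightarrow> 'v \<Rightarrow> 'v" where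
  "pv p = fold_coeffs (\<lambda>a f x. a *\<^sub>R x + f (Y x)) p (\<lambda>x. 0)"

lemma pv_0: "pv 0 x = 0"
  by (simp add: pv_def)

lemma pv_pCons: "pv (pCons a p) x = a *\<^sub>R x + pv p (Y x)"
  by (cases "p = 0 \<and> a = 0") (auto simp: pv_def fold_coeffs_pCons_not_0_0_eq)

lemma pv_mem: "x \<in> V \<Longrightarrow> pv p x \<in> V"
proof (induction p arbitrary: x)
  case (pCons a p)
  then show ?case by (simp add: pv_pCons K.add_mem K.scale_mem Y_mem)
qed (simp add: pv_0 K.zero_mem)

lemmas mem = pv_mem Y_mem K.add_mem K.scale_mem K.diff_mem

text \<open>\<open>Y\<close> is determined only through inner products, so it is linear and commutes
  with its polynomials only up to null vectors. The rules of the functional calculus are therefore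
  proved inside \<open>ip\<close>.\<close>

lemma ip_Y_pv: "x \<in> V \<Longrightarrow> y \<in> V \<Longrightarrow> ip (Y (pv p y)) x = ip (pv p (Y y)) x"
proof (induction p arbitrary: y)
  case (pCons a p)
  then show ?case
    by (simp add: pv_pCons ip_Y_swap mem K.ip_add_left K.ip_scale_left)
qed (simp add: pv_0 ip_Y_swap K.zero_mem K.ip_zero_left Y_mem)

lemma ip_pv_swap: "x \<in> V \<Longrightarrow> y \<in> V \<Longrightarrow> ip (pv p x) y = ip x (pv p y)"
proof (induction p arbitrary: x y)
  case (pCons a p)
  have "ip (pv p (Y x)) y = ip (Y x) (pv p y)" using pCons by (simp add: mem)
  also have "\<dots> = ip (Y (pv p y)) x" using pCons.prems by (simp add: ip_Y_swap mem K.ip_commute)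
  also have "\<dots> = ip (pv p (Y y)) x" using pCons.prems by (simp add: ip_Y_pv)
  finally show ?case
    using pCons.prems by (simp add: pv_pCons K.ip_add_left K.ip_add_right K.ip_scale_left K.ip_scale_right mem K.ip_commute[of x "pv p (Y y)"])
qed (simp add: pv_0 K.ip_zero_left K.ip_commute[of _ 0] K.zero_mem)

lemma pv_add: "pv (p + q) x = pv p x + pv q x"
proof (induction p q arbitrary: x rule: poly_induct2)
  case (pCons a p b q)
  then show ?case by (simp add: pv_pCons scaleR_add_left)
qed (simp add: pv_0)

lemma pv_smult: "pv (smult c p) x = c *\<^sub>R pv p x"
proof (induction p arbitrary: x)
  case (pCons a p)
  then show ?case by (simp add: pv_pCons scaleR_add_right)
qed (simp add: pv_0)

lemma pv_diff: "pv (p - q) x = pv p x - pv q x"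
  using pv_add[of p "smult (-1) q" x] pv_smult[of "-1" q x] by simp

lemma pv_1: "pv 1 x = x"
  by (simp add: one_pCons pv_pCons pv_0)

lemma ip_pv_mult: "x \<in> V \<Longrightarrow> y \<in> V \<Longrightarrow> ip (pv (p * q) x) y = ip (pv p (pv q x)) y"
proof (induction p arbitrary: x y)
  case (pCons a p)
  have "ip (pv (p * q) (Y x)) y = ip (pv p (pv q (Y x))) y" using pCons by (simp add: mem)
  also have "\<dots> = ip (pv q (Y x)) (pv p y)" using pCons.prems by (simp add: ip_pv_swap mem)
  also have "\<dots> = ip (Y (pv q x)) (pv p y)" using pCons.prems by (simp add: ip_Y_pv mem)
  also have "\<dots> = ip (pv p (Y (pv q x))) y" using pCons.prems by (simp add: ip_pv_swap mem)
  finally show ?case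
    using pCons.prems by (simp add: pv_pCons pv_add pv_smult K.ip_add_left K.ip_scale_left mem)
qed (simp add: pv_0)

lemma ip_pv_pv: "x \<in> V \<Longrightarrow> y \<in> V \<Longrightarrow> ip (pv p x) (pv q y) = ip (pv (p * q) x) y"
  by (metis ip_pv_swap ip_pv_mult mult.commute pv_mem)

lemma ip2_W: "x \<in> V \<Longrightarrow> y \<in> V \<Longrightarrow> ip2 (W x) (W y) = ip (pv (1 - Yp) x) y"
  by (simp add: pv_diff pv_1 pv_pCons pv_0 K.ip_diff_left ip_Y Y_mem)

lemma ip2_W_pv:
  assumes "x \<in> V" "y \<in> V"
  shows "ip2 (W (pv p x)) (W (pv q y)) = ip (pv ((1 - Yp) * p * q) x) y"
proof -
  have "ip2 (W (pv p x)) (W (pv q y)) = ip (pv (1 - Yp) (pv p x)) (pv q y)"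
    using assms by (simp add: ip2_W mem)
  also have "\<dots> = ip (pv ((1 - Yp) * p) x) (pv q y)"
    using assms by (simp only: ip_pv_mult mem)
  also have "\<dots> = ip (pv ((1 - Yp) * p * q) x) y"
    using assms by (simp only: ip_pv_pv mem)
  finally show ?thesis .
qed

text \<open>Positivity of the operator p(Y). Operator inequalities are deduced below from polynomial
  identities and coefficient signs, in place of the spectral theorem.\<close>

definition psd :: "real poly \<Rightarrow> bool" where
  "psd p \<longleftrightarrow> (\<forall>x\<in>V. 0 \<le> ip (pv p x) x)"

lemma psd_add: "psd p \<Longrightarrow> psd q \<Longrightarrow> psd (p + q)"
  by (simp add: psd_def pv_add K.ip_add_left mem)

lemma psd_smult: "0 \<le> c \<Longrightarrow> psd p \<Longrightarrow> psd (smult c p)"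
  by (simp add: psd_def pv_smult K.ip_scale_left mem)

lemma psd_0: "psd 0"
  by (simp add: psd_def pv_0 K.ip_zero_left)

lemma psd_sum: "(\<And>i. i \<in> I \<Longrightarrow> psd (f i)) \<Longrightarrow> psd (\<Sum>i\<in>I. f i)"
  by (induction I rule: infinite_finite_induct) (auto intro: psd_add psd_0)

lemma psd_square_mult: "psd p \<Longrightarrow> psd (q\<^sup>2 * p)"
  unfolding psd_def
proof
  fix x assume p: "\<forall>x\<in>V. 0 \<le> ip (pv p x) x" and x: "x \<in> V"
  have "ip (pv (q\<^sup>2 * p) x) x = ip (pv ((p * q) * q) x) x"
    by (simp add: power2_eq_square mult_ac)
  also have "\<dots> = ip (pv (p * q) x) (pv q x)" using x by (simp only: ip_pv_pv)
  also have "\<dots> = ip (pv p (pv q x)) (pv q x)" using x by (simp only: ip_pv_mult mem)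
  finally show "0 \<le> ip (pv (q\<^sup>2 * p) x) x" using p x by (simp add: mem)
qed

lemma psd_1: "psd 1"
  by (simp add: psd_def pv_1 K.ip_nonneg)

lemma psd_Y: "psd Yp"
  using W_contraction by (simp add: psd_def pv_pCons pv_0 ip_Y Y_mem)

lemma psd_1_minus_Y: "psd (1 - Yp)"
  unfolding psd_def using ip2_W L.ip_nonneg W_mem by metis

text \<open>Write p (1 - p) as (1 - p) p (1 - p) + p (1 - p) p; each summand is a positive operator
  conjugated by a symmetric one.\<close>

lemma psd_mult_1_minus: "psd p \<Longrightarrow> psd (1 - p) \<Longrightarrow> psd (p * (1 - p))"
proof -
  assume a: "psd p" "psd (1 - p)"
  have "p * (1 - p) = (1 - p)\<^sup>2 * p + p\<^sup>2 * (1 - p)"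
    by (simp add: power2_eq_square algebra_simps)
  then show ?thesis using a by (simp add: psd_add psd_square_mult del: mult_1_left)
qed

lemma monom_square: "monom c (2 * i) = smult c ((Yp ^ i)\<^sup>2)"
  and monom_odd: "monom c (Suc (2 * i)) = smult c ((Yp ^ i)\<^sup>2 * Yp)"
proof -
  have m: "Yp ^ k = monom 1 k" for k
    by (simp add: monom_altdef)
  show "monom c (2 * i) = smult c ((Yp ^ i)\<^sup>2)"
    by (simp add: m power2_eq_square mult_monom smult_monom mult_2)
  have "(Yp ^ i)\<^sup>2 * Yp = Yp ^ (Suc (2 * i))" by (simp only: power_even_eq power_Suc2)
  then show "monom c (Suc (2 * i)) = smult c ((Yp ^ i)\<^sup>2 * Yp)"
    unfolding m by (simp add: m smult_monom)
qed

text \<open>Every monomial of \<open>p\<close> is a nonnegative multiple of a square or of a square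
  times \<open>Yp\<close>, and multiplying by a square preserves positivity. So only
  \<open>q\<close> and \<open>Yp * q\<close> have to be tested.\<close>

lemma psd_nonneg_coeffs: 
  assumes "nonneg_coeffs p" and "psd q" and "psd (Yp * q)"
  shows "psd (p * q)"
proof -
  have "psd (monom (coeff p i) i * q)" for i
  proof (cases "even i")
    case True
    then obtain j where j: "i = 2 * j" by auto
    have "monom (coeff p i) i * q = smult (coeff p i) ((Yp ^ j)\<^sup>2 * q)"
      unfolding j monom_square by (simp only: mult_smult_left)
    then show ?thesis using assms by (simp add: psd_smult psd_square_mult nonneg_coeffs_def)
  next
    case False
    then obtain j where j: "i = Suc (2 * j)" using oddE by fastforce
    have "monom (coeff p i) i * q = smult (coeff p i) ((Yp ^ j)\<^sup>2 * (Yp * q))"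
      unfolding j monom_odd by (simp only: mult_smult_left mult.assoc)
    then show ?thesis using assms
      by (simp add: psd_smult psd_square_mult nonneg_coeffs_def del: mult_pCons_left)
  qed
  then have "psd (\<Sum>i\<le>degree p. monom (coeff p i) i * q)" by (intro psd_sum)
  then show ?thesis by (simp add: sum_distrib_right[symmetric] poly_as_sum_of_monoms)
qed

lemma psd_nonneg: "nonneg_coeffs p \<Longrightarrow> psd p"
  using psd_nonneg_coeffs[of p 1] psd_1 psd_Y by simp

lemma psd_nonneg_1: "nonneg_coeffs p \<Longrightarrow> psd (p * (1 - Yp))"
  by (rule psd_nonneg_coeffs) (auto intro: psd_1_minus_Y psd_mult_1_minus psd_Y simp del: mult_pCons_left)

lemma psd_nonneg_2: "nonneg_coeffs p \<Longrightarrow> psd (p * (1 - Yp)\<^sup>2)"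
  using psd_square_mult[OF psd_nonneg, of p "1 - Yp"] by (simp add: mult.commute)

lemma psd_mono: "psd (q - p) \<Longrightarrow> x \<in> V \<Longrightarrow> ip (pv p x) x \<le> ip (pv q x) x"
  by (simp add: psd_def pv_diff K.ip_diff_left mem)

definition err_form :: "nat \<Rightarrow> 'v \<Rightarrow> real" where "err_form k x = ip (pv (sqrt_err k) x) x"

lemma invariant_diff: "sqrt_err l - sqrt_err k = (1 - Yp) * ((sqrt_poly k)\<^sup>2 - (sqrt_poly l)\<^sup>2)"
proof -
  have "sqrt_err l - sqrt_err k = (1 - sqrt_err k) - (1 - sqrt_err l)" by simp
  also have "\<dots> = (1 - Yp) * ((sqrt_poly k)\<^sup>2 - (sqrt_poly l)\<^sup>2)"
    unfolding sqrt_iter_invariant[symmetric] by (simp only: right_diff_distrib)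
  finally show ?thesis .
qed

lemma nonneg_sqrt_poly_square_diff:
  assumes "l \<le> k" shows "nonneg_coeffs ((sqrt_poly k)\<^sup>2 - (sqrt_poly l)\<^sup>2)"
proof -
  have "(sqrt_poly k)\<^sup>2 - (sqrt_poly l)\<^sup>2 = (sqrt_poly k - sqrt_poly l) * (sqrt_poly k + sqrt_poly l)"
    by (simp add: power2_eq_square algebra_simps)
  then show ?thesis
    using nonneg_sqrt_poly_diff[OF assms] nonneg_sqrt_poly by (auto intro!: nonneg_coeffs_intros)
qed

text \<open>The invariant writes e_l - e_k as (1 - Y) (p_k^2 - p_l^2), where the second factor has
  nonnegative coefficients.\<close>

lemma err_form_decreasing:
  assumes "l \<le> k" "x \<in> V" shows "err_form k x \<le> err_form l x"
proof -
  have "psd (sqrt_err l - sqrt_err k)"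
    unfolding invariant_diff using psd_nonneg_1[OF nonneg_sqrt_poly_square_diff[OF assms(1)]]
    by (simp only: mult.commute)
  then show ?thesis unfolding err_form_def using assms(2) by (rule psd_mono)
qed

lemma err_form_nonneg: "x \<in> V \<Longrightarrow> 0 \<le> err_form k x"
  using psd_nonneg[OF nonneg_sqrt_err, of k] by (simp add: psd_def err_form_def)

lemma err_form_Cauchy:
  assumes x: "x \<in> V" and e: "0 < (e::real)"
  shows "\<exists>K. \<forall>l\<ge>K. \<forall>k\<ge>l. err_form l x - err_form k x < e"
proof -
  have "decseq (\<lambda>k. err_form k x)" using err_form_decreasing[OF _ x] by (simp add: decseq_def)
  then have "convergent (\<lambda>k. err_form k x)"
    using err_form_nonneg[OF x] by (intro Bseq_monoseq_convergent decseq_imp_monoseq)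
      (auto intro!: decseq_bounded simp: Bseq_def[symmetric])
  then have "Cauchy (\<lambda>k. err_form k x)" by (rule convergent_Cauchy)
  then obtain K where K: "\<And>m n. K \<le> m \<Longrightarrow> K \<le> n \<Longrightarrow> dist (err_form m x) (err_form n x) < e"
    using e unfolding Cauchy_def by blast
  have "err_form l x - err_form k x < e" if "K \<le> l" "l \<le> k" for l k
    using K[of l k] that by (simp add: dist_real_def)
  then show ?thesis by blast
qed

text \<open>With d = p_k - p_l the left side is the quadratic form of (1 - Y) d^2, and e_l - e_k -
  (1 - Y) d^2 = 2 p_l d (1 - Y) is positive.\<close>

lemma sqrt_poly_Cauchy_bound:
  assumes "l \<le> k" "x \<in> V"
  shows "ip2 (W (pv (sqrt_poly k) x) - W (pv (sqrt_poly l) x)) (W (pv (sqrt_poly k) x) - W (pv (sqrt_poly l) x))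
     \<le> err_form l x - err_form k x"
proof -
  define d where "d = sqrt_poly k - sqrt_poly l"
  have "W (pv (sqrt_poly k) x) = W (pv d x + pv (sqrt_poly l) x)"
    by (simp add: d_def pv_diff)
  also have "\<dots> = W (pv d x) + W (pv (sqrt_poly l) x)" using assms by (intro W_add mem)
  finally have eq: "W (pv (sqrt_poly k) x) - W (pv (sqrt_poly l) x) = W (pv d x)" by simp
  have "(sqrt_err l - sqrt_err k) - (1 - Yp) * d * d = (1 - Yp) * (((sqrt_poly k)\<^sup>2 - (sqrt_poly l)\<^sup>2) - d * d)"
    unfolding invariant_diff by (simp only: right_diff_distrib mult.assoc)
  also have "((sqrt_poly k)\<^sup>2 - (sqrt_poly l)\<^sup>2) - d * d = 2 * sqrt_poly l * d"
    by (simp add: d_def power2_eq_square algebra_simps)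
  also have "(1 - Yp) * (2 * sqrt_poly l * d) = (2 * sqrt_poly l * d) * (1 - Yp)" by (rule mult.commute)
  finally have "psd ((sqrt_err l - sqrt_err k) - (1 - Yp) * d * d)"
    using nonneg_sqrt_poly_diff[OF assms(1)] nonneg_sqrt_poly[of l]
    by (simp only:) (intro psd_nonneg_1 nonneg_coeffs_intros, simp_all add: d_def)
  from psd_mono[OF this assms(2)] show ?thesis
    unfolding eq using assms(2) by (simp add: ip2_W_pv err_form_def pv_diff K.ip_diff_left mem del: mult_pCons_left mult_pCons_right)
qed

text \<open>For d = e_l - e_k one needs d^2 \<le> d. Here d = (1 - Y) n and 1 - d = (1 - Y) p_l^2 +
  e_k, so d - d^2 is a sum of polynomials with nonnegative coefficients times powers of 1 -
  Y.\<close>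

lemma err_Cauchy_bound:
  assumes "l \<le> k" "x \<in> V"
  shows "ip (pv (sqrt_err k) x - pv (sqrt_err l) x) (pv (sqrt_err k) x - pv (sqrt_err l) x)
     \<le> err_form l x - err_form k x"
proof -
  define n where "n = (sqrt_poly k)\<^sup>2 - (sqrt_poly l)\<^sup>2"
  define d where "d = sqrt_err l - sqrt_err k"
  have dn: "d = (1 - Yp) * n" by (simp only: d_def n_def invariant_diff)
  have "1 - d = (1 - Yp) * (sqrt_poly l)\<^sup>2 + sqrt_err k"
    unfolding sqrt_iter_invariant by (simp add: d_def)
  then have "d - d * d = (1 - Yp) * n * ((1 - Yp) * (sqrt_poly l)\<^sup>2 + sqrt_err k)"
    using dn by (metis mult.right_neutral right_diff_distrib)
  also have "\<dots> = (n * (sqrt_poly l)\<^sup>2) * (1 - Yp)\<^sup>2 + (n * sqrt_err k) * (1 - Yp)"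
    by (simp only: power2_eq_square distrib_left mult_ac)
  finally have "psd (d - d * d)"
    using nonneg_sqrt_poly_square_diff[OF assms(1)] nonneg_sqrt_poly[of l] nonneg_sqrt_err[of k]
    by (simp only:) (intro psd_add psd_nonneg_1 psd_nonneg_2 nonneg_coeffs_intros nonneg_coeffs_power, simp_all add: n_def)
  from psd_mono[OF this assms(2)] have "ip (pv (d * d) x) x \<le> err_form l x - err_form k x"
    using assms(2) by (simp add: d_def err_form_def pv_diff K.ip_diff_left mem)
  moreover have "pv (sqrt_err k) x - pv (sqrt_err l) x = - pv d x"
    by (simp add: d_def pv_diff)
  moreover have "ip (pv d x) (pv d x) = ip (pv (d * d) x) x" using assms(2) by (simp only: ip_pv_pv)
  ultimately show ?thesis
    using assms(2) by (simp add: K.ip_minus_minus mem)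
qed

text \<open>The iteration gives 4 (e_k - e_(k+1)) = e (4 + e) (1 - e) with e = e_k, and 1 - e = (1 -
  Y) p^2. After subtraction of (1 - Y) e^2 the cofactor of 1 - Y still has nonnegative coefficients,
  because p^2 - 1 has.\<close>

lemma W_err_bound:
  assumes "x \<in> V"
  shows "ip2 (W (pv (sqrt_err k) x)) (W (pv (sqrt_err k) x)) \<le> 4 * (err_form k x - err_form (Suc k) x)"
proof -
  define e p where "e = sqrt_err k" and "p = sqrt_poly k"
  have inv: "1 - e = (1 - Yp) * p\<^sup>2" by (simp only: e_def p_def sqrt_iter_invariant)
  have e': "smult 4 (sqrt_err (Suc k)) = e\<^sup>2 * (3 + e)" by (simp add: sqrt_err_Suc e_def)
  have "smult 4 (e - sqrt_err (Suc k)) - (1 - Yp) * e * e = (1 - e) * (e * (4 + e)) - (1 - Yp) * e * e"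
    unfolding smult_diff_right e'
    by (rule poly_eq_by_eval) (simp add: power2_eq_square algebra_simps)
  also have "\<dots> = ((p\<^sup>2 - 1) * (e * (4 + e)) + 4 * e) * (1 - Yp)"
    unfolding inv by (simp add: algebra_simps del: mult_pCons_left mult_pCons_right)
  finally have "psd (smult 4 (e - sqrt_err (Suc k)) - (1 - Yp) * e * e)"
    using nonneg_sqrt_poly_square_diff[of 0 k] nonneg_sqrt_err[of k]
    by (simp only:) (intro psd_nonneg_1 nonneg_coeffs_intros, simp_all add: e_def p_def sqrt_poly_0)
  from psd_mono[OF this assms] show ?thesis
    using assms by (simp add: ip2_W_pv err_form_def e_def pv_diff pv_smult K.ip_scale_left K.ip_diff_left mem
      del: mult_pCons_left mult_pCons_right)
qed

text \<open>The vectors p_k(Y) x need not converge, since 1 - Y may lack a bounded inverse. Their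
  images under \<open>W\<close> do, because the Cauchy estimate is measured after
  \<open>W\<close>.\<close>

lemma polar_limit:
  assumes x: "x \<in> V"
  obtains u where "u \<in> V2" "L.conv (\<lambda>k. W (pv (sqrt_poly k) x)) u"
proof (rule L.complete)
  show "W (pv (sqrt_poly k) x) \<in> V2" for k using x by (intro W_mem mem)
  fix e :: real assume "0 < e"
  then obtain K where K: "\<And>l k. K \<le> l \<Longrightarrow> l \<le> k \<Longrightarrow> err_form l x - err_form k x < e"
    using err_form_Cauchy[OF x] by blast
  let ?w = "\<lambda>k. W (pv (sqrt_poly k) x)"
  have one: "ip2 (?w k - ?w l) (?w k - ?w l) < e" if "K \<le> l" "l \<le> k" for l k
    using sqrt_poly_Cauchy_bound[OF that(2) x] K[OF that] by linarith
  have "ip2 (?w m - ?w n) (?w m - ?w n) < e" if "K \<le> m" "K \<le> n" for m n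
  proof (cases "n \<le> m")
    case False
    then have "ip2 (- (?w n - ?w m)) (- (?w n - ?w m)) < e"
      using one[of m n] that x by (subst L.ip_minus_minus) (auto intro!: L.diff_mem W_mem mem)
    then show ?thesis by simp
  qed (use one that in auto)
  then show "\<exists>K. \<forall>m\<ge>K. \<forall>n\<ge>K. ip2 (?w m - ?w n) (?w m - ?w n) < e" by blast
qed (rule that)

text \<open>The vectors e_k(Y) x converge to some \<open>z\<close>. Their images under
  \<open>W\<close> tend to 0, being bounded by consecutive differences of a convergent sequence, so
  \<open>W z\<close> is null. This is where injectivity of \<open>W\<close> enters: \<open>z\<close>
  itself is null.\<close>

lemma err_form_limit:
  assumes x: "x \<in> V" and y: "y \<in> V"
  shows "(\<lambda>k. ip (pv (sqrt_err k) x) y) \<longlonglongrightarrow> 0"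
proof -
  let ?z = "\<lambda>k. pv (sqrt_err k) x"
  have zV: "?z k \<in> V" for k using x by (rule mem)
  obtain z where z: "z \<in> V" "K.conv ?z z"
  proof (rule K.complete[OF zV])
    fix e :: real assume "0 < e"
    then obtain K where K: "\<And>l k. K \<le> l \<Longrightarrow> l \<le> k \<Longrightarrow> err_form l x - err_form k x < e"
      using err_form_Cauchy[OF x] by blast
    have one: "ip (?z k - ?z l) (?z k - ?z l) < e" if "K \<le> l" "l \<le> k" for l k
      using err_Cauchy_bound[OF that(2) x] K[OF that] by linarith
    have "ip (?z m - ?z n) (?z m - ?z n) < e" if "K \<le> m" "K \<le> n" for m n
    proof (cases "n \<le> m")
      case False
      then have "ip (- (?z n - ?z m)) (- (?z n - ?z m)) < e"
        using one[of m n] that zV by (subst K.ip_minus_minus) (auto intro!: K.diff_mem)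
      then show ?thesis by simp
    qed (use one that in auto)
    then show "\<exists>K. \<forall>m\<ge>K. \<forall>n\<ge>K. ip (?z m - ?z n) (?z m - ?z n) < e" by blast
  qed
  have lim0: "(\<lambda>k. 4 * (err_form k x - err_form (Suc k) x)) \<longlonglongrightarrow> 0"
  proof (rule LIMSEQ_I)
    fix r :: real assume "0 < r"
    then obtain K where K: "\<And>l k. K \<le> l \<Longrightarrow> l \<le> k \<Longrightarrow> err_form l x - err_form k x < r / 4"
      using err_form_Cauchy[OF x, of "r / 4"] by auto
    have "norm (4 * (err_form k x - err_form (Suc k) x) - 0) < r" if "K \<le> k" for k
      using K[of k "Suc k"] that err_form_decreasing[of k "Suc k" x] x by simp
    then show "\<exists>no. \<forall>n\<ge>no. norm (4 * (err_form n x - err_form (Suc n) x) - 0) < r" by blast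
  qed
  have "(\<lambda>k. ip2 (W (?z k)) (W (?z k))) \<longlonglongrightarrow> 0"
  proof (rule tendsto_sandwich[OF _ _ tendsto_const lim0])
    show "\<forall>\<^sub>F k in sequentially. 0 \<le> ip2 (W (?z k)) (W (?z k))"
      using L.ip_nonneg[OF W_mem[OF zV]] by simp
    show "\<forall>\<^sub>F k in sequentially. ip2 (W (?z k)) (W (?z k)) \<le> 4 * (err_form k x - err_form (Suc k) x)"
      using W_err_bound[OF x] by simp
  qed
  moreover have "(\<lambda>k. ip2 (W (?z k)) (W (?z k))) \<longlonglongrightarrow> ip2 (W z) (W z)"
  proof (rule L.ip_tendsto)
    have "L.nm (W (?z k) - W z) \<le> K.nm (?z k - z)" for k
    proof -
      have "W (?z k) = W ((?z k - z) + z)" by simp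
      also have "\<dots> = W (?z k - z) + W z" using zV z by (intro W_add K.diff_mem)
      finally have "W (?z k) - W z = W (?z k - z)" by simp
      then show ?thesis using W_contraction[OF K.diff_mem[OF zV z(1)]]
        by (simp add: L.nm_def K.nm_def)
    qed
    moreover have "0 \<le> L.nm (W (?z k) - W z)" for k
      by (intro L.nm_nonneg L.diff_mem W_mem zV z(1))
    ultimately have "norm (L.nm (W (?z k) - W z)) \<le> K.nm (?z k - z)" for k by simp
    then have "(\<lambda>k. L.nm (W (?z k) - W z)) \<longlonglongrightarrow> 0"
      using z(2)[unfolded K.conv_def] by (rule Lim_null_comparison[OF always_eventually[OF allI]])
    then show "L.conv (\<lambda>k. W (?z k)) (W z)" "L.conv (\<lambda>k. W (?z k)) (W z)"
      by (simp_all add: L.conv_def)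
  qed (use zV z W_mem in auto)
  ultimately have "ip2 (W z) (W z) = 0" using LIMSEQ_unique by blast
  then have "ip z z = 0" using W_injective z(1) by blast
  then have "ip z y = 0" using K.ip_null_left z(1) y by blast
  then show ?thesis using K.ip_tendsto[OF zV z, of "\<lambda>_. y" y] y by (simp add: K.conv_const)
qed

text \<open>The isometry is the limit of W p_k(Y), formally W (1 - Y)^(-1/2). It intertwines
  whatever \<open>W\<close> intertwines together with adjoints, since such a \<open>\<rho>\<close>
  commutes with 1 - Y. The quantifiers over \<open>\<rho>\<close> and \<open>\<sigma>\<close> stand
  inside the existential so that one \<open>U\<close> serves translations and complex multiples
  alike.\<close>

theorem polar_isometry:
  "\<exists>U. (\<forall>x\<in>V. U x \<in> V2) \<and> (\<forall>x\<in>V. \<forall>y\<in>V. ip2 (U x) (U y) = ip x y) \<and>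
     (\<forall>\<rho> \<rho>' \<sigma> \<sigma>'.
        (\<forall>x\<in>V. \<rho> x \<in> V \<and> \<rho>' x \<in> V \<and> W (\<rho> x) = \<sigma> (W x) \<and> W (\<rho>' x) = \<sigma>' (W x)) \<longrightarrow>
        (\<forall>x\<in>V. \<forall>y\<in>V. ip (\<rho> x) y = ip x (\<rho>' y)) \<longrightarrow>
        (\<forall>a\<in>V2. \<sigma> a \<in> V2 \<and> \<sigma>' a \<in> V2) \<longrightarrow> (\<forall>a\<in>V2. \<forall>b\<in>V2. ip2 (\<sigma> a) b = ip2 a (\<sigma>' b)) \<longrightarrow>
        (\<forall>x\<in>V. \<forall>b\<in>V2. ip2 (U (\<rho> x)) b = ip2 (\<sigma> (U x)) b))"
proof -
  have "\<forall>x\<in>V. \<exists>u. u \<in> V2 \<and> L.conv (\<lambda>k. W (pv (sqrt_poly k) x)) u"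
    using polar_limit by metis
  then obtain U where U: "\<And>x. x \<in> V \<Longrightarrow> U x \<in> V2"
    "\<And>x. x \<in> V \<Longrightarrow> L.conv (\<lambda>k. W (pv (sqrt_poly k) x)) (U x)" by metis
  have WV: "W (pv p x) \<in> V2" if "x \<in> V" for p x using that by (intro W_mem mem)
  have iso: "ip2 (U x) (U y) = ip x y" if x: "x \<in> V" and y: "y \<in> V" for x y
  proof -
    have "ip2 (W (pv (sqrt_poly k) x)) (W (pv (sqrt_poly k) y)) = ip x y - ip (pv (sqrt_err k) x) y" for k
    proof -
      have "ip2 (W (pv (sqrt_poly k) x)) (W (pv (sqrt_poly k) y)) = ip (pv ((1 - Yp) * (sqrt_poly k)\<^sup>2) x) y"
        using x y by (simp only: ip2_W_pv power2_eq_square mult.assoc)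
      then show ?thesis unfolding sqrt_iter_invariant
        using x y by (simp add: pv_diff pv_1 K.ip_diff_left mem)
    qed
    then have "(\<lambda>k. ip2 (W (pv (sqrt_poly k) x)) (W (pv (sqrt_poly k) y))) \<longlonglongrightarrow> ip x y - 0"
      using tendsto_diff[OF tendsto_const err_form_limit[OF x y], of "ip x y"] by simp
    moreover have "(\<lambda>k. ip2 (W (pv (sqrt_poly k) x)) (W (pv (sqrt_poly k) y))) \<longlonglongrightarrow> ip2 (U x) (U y)"
      by (rule L.ip_tendsto[OF WV[OF x] U[OF x] WV[OF y] U[OF y]])
    ultimately show ?thesis using LIMSEQ_unique by fastforce
  qed
  have comm: "ip2 (U (\<rho> x)) b = ip2 (\<sigma> (U x)) b"
    if \<rho>: "\<And>x. x \<in> V \<Longrightarrow> \<rho> x \<in> V \<and> \<rho>' x \<in> V \<and> W (\<rho> x) = \<sigma> (W x) \<and> W (\<rho>' x) = \<sigma>' (W x)"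
      and \<rho>adj: "\<And>x y. x \<in> V \<Longrightarrow> y \<in> V \<Longrightarrow> ip (\<rho> x) y = ip x (\<rho>' y)"
      and \<sigma>: "\<And>a. a \<in> V2 \<Longrightarrow> \<sigma> a \<in> V2 \<and> \<sigma>' a \<in> V2"
      and \<sigma>adj: "\<And>a b. a \<in> V2 \<Longrightarrow> b \<in> V2 \<Longrightarrow> ip2 (\<sigma> a) b = ip2 a (\<sigma>' b)"
      and x: "x \<in> V" and b: "b \<in> V2" for \<rho> \<rho>' \<sigma> \<sigma>' x b
  proof -
    \<comment> \<open>Moving \<open>W\<close> past \<open>\<rho>\<close> and back requires the
      intertwining relation for \<open>\<rho>\<close> and for its adjoint.\<close>
    have Y\<rho>: "ip (Y (\<rho> x)) w = ip (\<rho> (Y x)) w" if xw: "x \<in> V" "w \<in> V" for x w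
    proof -
      have "ip (Y (\<rho> x)) w = ip (\<rho> x) w - ip2 (W (\<rho> x)) (W w)" using xw \<rho> by (intro ip_Y) auto
      also have "ip2 (W (\<rho> x)) (W w) = ip2 (W x) (\<sigma>' (W w))" using xw \<rho> \<sigma>adj W_mem by auto
      also have "\<dots> = ip2 (W x) (W (\<rho>' w))" using xw \<rho> by auto
      finally show ?thesis using xw \<rho> \<rho>adj ip_Y Y_mem by auto
    qed
    have pv\<rho>: "ip (pv p (\<rho> x)) w = ip (\<rho> (pv p x)) w" if xw: "x \<in> V" "w \<in> V" for p x w
      using xw
    proof (induction p arbitrary: x w)
      case 0
      then show ?case using \<rho>adj \<rho> K.zero_mem by (simp add: pv_0 K.ip_zero_left)
    next
      case (pCons c p)
      have "ip (pv p (Y (\<rho> x))) w = ip (Y (\<rho> x)) (pv p w)" using pCons.prems \<rho> by (simp add: ip_pv_swap mem)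
      also have "\<dots> = ip (\<rho> (Y x)) (pv p w)" using pCons.prems by (intro Y\<rho> mem)
      also have "\<dots> = ip (pv p (\<rho> (Y x))) w" using pCons.prems \<rho> by (simp add: ip_pv_swap mem)
      also have "\<dots> = ip (\<rho> (pv p (Y x))) w" using pCons by (simp add: mem)
      finally show ?case
        using pCons.prems \<rho> \<rho>adj by (simp add: pv_pCons K.ip_add_left K.ip_scale_left mem)
    qed
    \<comment> \<open>Vectors with equal inner products differ by a null vector, which the
      contraction \<open>W\<close> sends to a null vector.\<close>
    have Weq: "ip2 (W u) b = ip2 (W v) b" if uv: "u \<in> V" "v \<in> V" and eq: "\<And>w. w \<in> V \<Longrightarrow> ip u w = ip v w" for u v
    proof -
      have "u = (u - v) + v" by simp
      then have "W u = W (u - v) + W v" using W_add[OF K.diff_mem[OF uv] uv(2)] by simp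
      moreover have "ip (u - v) (u - v) = 0"
        using eq[OF K.diff_mem[OF uv]] uv by (simp add: K.ip_diff_left K.diff_mem)
      then have "ip2 (W (u - v)) (W (u - v)) = 0"
        using W_contraction[OF K.diff_mem[OF uv]] L.ip_nonneg[OF W_mem[OF K.diff_mem[OF uv]]] by simp
      then have "ip2 (W (u - v)) b = 0" using L.ip_null_left W_mem K.diff_mem[OF uv] b by blast
      ultimately show ?thesis using uv b by (simp add: L.ip_add_left W_mem K.diff_mem)
    qed
    have "ip2 (W (pv (sqrt_poly k) (\<rho> x))) b = ip2 (W (pv (sqrt_poly k) x)) (\<sigma>' b)" for k
    proof -
      have "ip2 (W (pv (sqrt_poly k) (\<rho> x))) b = ip2 (W (\<rho> (pv (sqrt_poly k) x))) b"
        using x \<rho> pv\<rho> by (intro Weq) (auto simp: mem)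
      then show ?thesis using x \<rho> \<sigma>adj b by (simp add: mem W_mem)
    qed
    moreover have "(\<lambda>k. ip2 (W (pv (sqrt_poly k) (\<rho> x))) b) \<longlonglongrightarrow> ip2 (U (\<rho> x)) b"
      using x \<rho> b WV U by (intro L.ip_tendsto L.conv_const) auto
    moreover have "(\<lambda>k. ip2 (W (pv (sqrt_poly k) x)) (\<sigma>' b)) \<longlonglongrightarrow> ip2 (U x) (\<sigma>' b)"
      using x \<sigma> b WV U by (intro L.ip_tendsto L.conv_const) auto
    ultimately have "ip2 (U (\<rho> x)) b = ip2 (U x) (\<sigma>' b)" using LIMSEQ_unique by force
    then show ?thesis using U x \<sigma>adj b by simp
  qed
  show ?thesis
  proof (rule exI[of _ U], intro conjI allI impI ballI)
    show "U x \<in> V2" if "x \<in> V" for x by (rule U(1)[OF that])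
    show "ip2 (U x) (U y) = ip x y" if "x \<in> V" "y \<in> V" for x y by (rule iso[OF that])
  next
    fix \<rho> \<rho>' \<sigma> \<sigma>' x b
    assume 1: "\<forall>x\<in>V. \<rho> x \<in> V \<and> \<rho>' x \<in> V \<and> W (\<rho> x) = \<sigma> (W x) \<and> W (\<rho>' x) = \<sigma>' (W x)"
      and 2: "\<forall>x\<in>V. \<forall>y\<in>V. ip (\<rho> x) y = ip x (\<rho>' y)"
      and 3: "\<forall>a\<in>V2. \<sigma> a \<in> V2 \<and> \<sigma>' a \<in> V2"
      and 4: "\<forall>a\<in>V2. \<forall>b\<in>V2. ip2 (\<sigma> a) b = ip2 a (\<sigma>' b)" and xb: "x \<in> V" "b \<in> V2"
    show "ip2 (U (\<rho> x)) b = ip2 (\<sigma> (U x)) b"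
      by (rule comm[where \<rho>' = \<rho>' and \<sigma>' = \<sigma>', OF bspec[OF 1] bspec[OF bspec[OF 2]] bspec[OF 3] bspec[OF bspec[OF 4]] xb])
  qed
qed

end

section \<open>Square integrable functions\<close>

lemma L2D:
  assumes "f \<in> L2 M"
  shows "f \<in> borel_measurable M" "integrable M (\<lambda>x. (cmod (f x))\<^sup>2)"
  using assms by (auto simp: L2_def)

lemma L2I: "f \<in> borel_measurable M \<Longrightarrow> integrable M (\<lambda>x. (cmod (f x))\<^sup>2) \<Longrightarrow> f \<in> L2 M"
  by (simp add: L2_def)

lemma L2_bound:
  assumes "f \<in> borel_measurable M" "integrable M g" "\<And>x. (cmod (f x))\<^sup>2 \<le> g x"
  shows "f \<in> L2 M"
proof (rule L2I[OF assms(1)], rule Bochner_Integration.integrable_bound[OF assms(2)])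
  show "(\<lambda>x. (cmod (f x))\<^sup>2) \<in> borel_measurable M" using assms(1) by measurable
  show "AE x in M. norm ((cmod (f x))\<^sup>2) \<le> norm (g x)"
  proof (rule AE_I2)
    fix x
    have "(cmod (f x))\<^sup>2 \<le> \<bar>g x\<bar>" using assms(3)[of x] by linarith
    then show "norm ((cmod (f x))\<^sup>2) \<le> norm (g x)" by simp
  qed
qed

lemma L2_zero: "(\<lambda>x. 0) \<in> L2 M"
  by (rule L2I) auto

lemma L2_scale:
  assumes "f \<in> L2 M" shows "(\<lambda>x. c * f x) \<in> L2 M"
proof (rule L2_bound[of _ _ "\<lambda>x. (cmod c)\<^sup>2 * (cmod (f x))\<^sup>2"])
  show "(\<lambda>x. c * f x) \<in> borel_measurable M" using L2D(1)[OF assms] by measurable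
qed (use L2D(2)[OF assms] in \<open>auto simp: norm_mult power_mult_distrib\<close>)

lemma L2_add:
  assumes f: "f \<in> L2 M" and g: "g \<in> L2 M" shows "(\<lambda>x. f x + g x) \<in> L2 M"
proof (rule L2_bound[of _ _ "\<lambda>x. 2 * (cmod (f x))\<^sup>2 + 2 * (cmod (g x))\<^sup>2"])
  show "(\<lambda>x. f x + g x) \<in> borel_measurable M" using L2D(1)[OF f] L2D(1)[OF g] by measurable
  show "integrable M (\<lambda>x. 2 * (cmod (f x))\<^sup>2 + 2 * (cmod (g x))\<^sup>2)"
    using L2D(2)[OF f] L2D(2)[OF g] by auto
  fix x
  have "(cmod (f x + g x))\<^sup>2 \<le> (cmod (f x) + cmod (g x))\<^sup>2"
    by (intro power_mono norm_triangle_ineq) auto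
  also have "\<dots> \<le> 2 * (cmod (f x))\<^sup>2 + 2 * (cmod (g x))\<^sup>2"
    using sum_squares_bound[of "cmod (f x)" "cmod (g x)"] by (simp add: power2_sum)
  finally show "(cmod (f x + g x))\<^sup>2 \<le> 2 * (cmod (f x))\<^sup>2 + 2 * (cmod (g x))\<^sup>2" .
qed

lemma L2_diff: "f \<in> L2 M \<Longrightarrow> g \<in> L2 M \<Longrightarrow> (\<lambda>x. f x - g x) \<in> L2 M"
  using L2_add[of f M "\<lambda>x. (- 1) * g x"] L2_scale[of g M "-1"] by simp

lemma L2_sum: "(\<And>i. i \<in> I \<Longrightarrow> f i \<in> L2 M) \<Longrightarrow> (\<lambda>x. \<Sum>i\<in>I. f i x) \<in> L2 M"
  by (induction I rule: infinite_finite_induct) (auto intro: L2_add L2_zero)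

lemma cnj_borel_measurable: "f \<in> borel_measurable M \<Longrightarrow> (\<lambda>x. cnj (f x)) \<in> borel_measurable M"
  by (rule measurable_compose[OF _ borel_measurable_continuous_onI]) (auto intro: continuous_intros)

lemma L2_mult_integrable:
  assumes f: "f \<in> L2 M" and g: "g \<in> L2 M"
  shows "integrable M (\<lambda>x. f x * cnj (g x))"
proof (rule Bochner_Integration.integrable_bound[of M "\<lambda>x. (cmod (f x))\<^sup>2 + (cmod (g x))\<^sup>2"])
  show "integrable M (\<lambda>x. (cmod (f x))\<^sup>2 + (cmod (g x))\<^sup>2)"
    using L2D(2)[OF f] L2D(2)[OF g] by auto
  show "(\<lambda>x. f x * cnj (g x)) \<in> borel_measurable M" 
    using L2D(1)[OF f] cnj_borel_measurable[OF L2D(1)[OF g]] by measurable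
  show "AE x in M. norm (f x * cnj (g x)) \<le> norm ((cmod (f x))\<^sup>2 + (cmod (g x))\<^sup>2)"
  proof (rule AE_I2)
    fix x
    have "cmod (f x) * cmod (g x) \<le> (cmod (f x))\<^sup>2 + (cmod (g x))\<^sup>2"
      using sum_squares_bound[of "cmod (f x)" "cmod (g x)"]
        mult_nonneg_nonneg[OF norm_ge_zero[of "f x"] norm_ge_zero[of "g x"]] by linarith
    then show "norm (f x * cnj (g x)) \<le> norm ((cmod (f x))\<^sup>2 + (cmod (g x))\<^sup>2)"
      by (simp add: norm_mult)
  qed
qed

lemma L2_inner_add_left:
  "f \<in> L2 M \<Longrightarrow> g \<in> L2 M \<Longrightarrow> h \<in> L2 M \<Longrightarrow> L2_inner M (\<lambda>x. f x + g x) h = L2_inner M f h + L2_inner M g h"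
  unfolding L2_inner_def distrib_right by (intro Bochner_Integration.integral_add L2_mult_integrable)

lemma L2_inner_scale_left: "L2_inner M (\<lambda>x. c * f x) h = c * L2_inner M f h"
  by (simp add: L2_inner_def mult.assoc)

lemma L2_inner_cnj: "cnj (L2_inner M f g) = L2_inner M g f"
proof -
  have "cnj (L2_inner M f g) = (LINT x|M. cnj (f x * cnj (g x)))"
    unfolding L2_inner_def by (rule Bochner_Integration.integral_cnj[symmetric])
  then show ?thesis by (simp add: L2_inner_def mult.commute)
qed

lemma L2_inner_sum_left:
  assumes "\<And>i. i \<in> I \<Longrightarrow> f i \<in> L2 M" "h \<in> L2 M"
  shows "L2_inner M (\<lambda>x. \<Sum>i\<in>I. c i * f i x) h = (\<Sum>i\<in>I. c i * L2_inner M (f i) h)"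
proof -
  have "L2_inner M (\<lambda>x. \<Sum>i\<in>I. c i * f i x) h = (LINT x|M. (\<Sum>i\<in>I. c i * (f i x * cnj (h x))))"
    by (simp add: L2_inner_def sum_distrib_right mult.assoc)
  also have "\<dots> = (\<Sum>i\<in>I. (LINT x|M. c i * (f i x * cnj (h x))))"
    using assms by (intro Bochner_Integration.integral_sum integrable_mult_right L2_mult_integrable)
  finally show ?thesis by (simp add: L2_inner_def)
qed

definition L2_ip :: "'a measure \<Rightarrow> ('a \<Rightarrow> complex) \<Rightarrow> ('a \<Rightarrow> complex) \<Rightarrow> real" where
  "L2_ip M f g = Re (L2_inner M f g)"

lemma L2_ip_self: "L2_ip M f f = (LINT x|M. (cmod (f x))\<^sup>2)"
proof -
  have "L2_inner M f f = (LINT x|M. complex_of_real ((cmod (f x))\<^sup>2))"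
    unfolding L2_inner_def complex_norm_square ..
  also have "\<dots> = complex_of_real (LINT x|M. (cmod (f x))\<^sup>2)" by (rule integral_complex_of_real)
  finally show ?thesis by (simp add: L2_ip_def)
qed

lemma nn_integral_L2:
  assumes "f \<in> L2 M"
  shows "(\<integral>\<^sup>+x. ennreal ((cmod (f x))\<^sup>2) \<partial>M) = ennreal (L2_ip M f f)"
  unfolding L2_ip_self by (rule nn_integral_eq_integral[OF L2D(2)[OF assms]]) auto

lemma L2_nn_integralI:
  assumes "f \<in> borel_measurable M" "(\<integral>\<^sup>+x. ennreal ((cmod (f x))\<^sup>2) \<partial>M) \<le> ennreal c" "0 \<le> c"
  shows "f \<in> L2 M" "L2_ip M f f \<le> c"
proof -
  show f: "f \<in> L2 M"
  proof (rule L2I[OF assms(1)])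
    show "integrable M (\<lambda>x. (cmod (f x))\<^sup>2)"
      unfolding integrable_iff_bounded
    proof
      show "(\<lambda>x. (cmod (f x))\<^sup>2) \<in> borel_measurable M" using assms(1) by measurable
      show "(\<integral>\<^sup>+ x. ennreal (norm ((cmod (f x))\<^sup>2)) \<partial>M) < \<infinity>"
        using assms(2) by (simp add: order_le_less_trans)
    qed
  qed
  show "L2_ip M f f \<le> c" using assms(2,3) nn_integral_L2[OF f] by simp
qed

lemma L2_subspace: "subspace (L2 M)"
proof (rule subspaceI)
  show "0 \<in> L2 M" using L2_zero[of M] by (simp add: zero_fun_def)
  show "x + y \<in> L2 M" if "x \<in> L2 M" "y \<in> L2 M" for x y
    using L2_add[OF that] by (simp add: plus_fun_def)
  show "c *\<^sub>R x \<in> L2 M" if "x \<in> L2 M" for c x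
    using L2_scale[OF that, of "of_real c"] by (simp add: scaleR_fun_def scaleR_conv_of_real)
qed

text \<open>Riesz-Fischer: a fast subsequence converges almost everywhere, and Fatou's lemma turns
  this into convergence in norm, along the whole sequence at once.\<close>

lemma L2_complete:
  fixes X :: "nat \<Rightarrow> 'a \<Rightarrow> complex"
  assumes X: "\<And>n. X n \<in> L2 M"
    and C: "\<And>e. 0 < e \<Longrightarrow> \<exists>K. \<forall>m\<ge>K. \<forall>n\<ge>K. L2_ip M (\<lambda>x. X m x - X n x) (\<lambda>x. X m x - X n x) < e"
  shows "\<exists>f\<in>L2 M. (\<lambda>n. L2_ip M (\<lambda>x. X n x - f x) (\<lambda>x. X n x - f x)) \<longlonglongrightarrow> 0"
proof -
  note [measurable] = L2D(1)[OF X]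
  let ?d = "\<lambda>m n. L2_ip M (\<lambda>x. X m x - X n x) (\<lambda>x. X m x - X n x)"
  have "\<exists>r. \<forall>j. (\<forall>m\<ge>r j. \<forall>n\<ge>r j. ?d m n < (1 / 4) ^ j) \<and> r j < (r (Suc j) :: nat)"
  proof (rule dependent_nat_choice)
    show "\<exists>k. \<forall>m\<ge>k. \<forall>n\<ge>k. ?d m n < (1 / 4) ^ 0" using C[of 1] by simp
    fix k j :: nat
    obtain K where K: "\<forall>m\<ge>K. \<forall>n\<ge>K. ?d m n < (1 / 4) ^ Suc j" using C[of "(1 / 4) ^ Suc j"] by auto
    show "\<exists>k'. (\<forall>m\<ge>k'. \<forall>n\<ge>k'. ?d m n < (1 / 4) ^ Suc j) \<and> k < k'"
      using K by (intro exI[of _ "max K (Suc k)"]) auto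
  qed
  then obtain r where r: "\<And>j m n. r j \<le> m \<Longrightarrow> r j \<le> n \<Longrightarrow> ?d m n < (1 / 4) ^ j"
    and r_mono: "\<And>j. r j < r (Suc j)" by blast
  have sm: "strict_mono r" using r_mono by (simp add: strict_mono_Suc_iff)
  define D where "D j x = cmod (X (r (Suc j)) x - X (r j) x)" for j x
  have [measurable]: "D j \<in> borel_measurable M" for j unfolding D_def by measurable
  have intD: "(\<integral>\<^sup>+x. ennreal ((D j x)\<^sup>2) \<partial>M) \<le> ennreal ((1 / 4) ^ j)" for j
  proof -
    have "(\<integral>\<^sup>+x. ennreal ((D j x)\<^sup>2) \<partial>M) = ennreal (?d (r (Suc j)) (r j))"
      unfolding D_def by (rule nn_integral_L2[OF L2_diff[OF X X]])
    also have "\<dots> \<le> ennreal ((1 / 4) ^ j)"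
      using r[of j "r (Suc j)" "r j"] r_mono[of j] by (intro ennreal_leI) auto
    finally show ?thesis .
  qed
  \<comment> \<open>The weights 2^j leave a convergent series 2^j 4^(-j) of integrals, while
    finiteness of \<open>h x\<close> forces \<open>D j x\<close> to be of order 2^(-j/2), which is
    summable.\<close>
  define h where "h x = (\<Sum>j. ennreal (2 ^ j * (D j x)\<^sup>2))" for x
  have [measurable]: "h \<in> borel_measurable M" unfolding h_def by measurable
  have "(\<integral>\<^sup>+x. h x \<partial>M) = (\<Sum>j. \<integral>\<^sup>+x. ennreal (2 ^ j * (D j x)\<^sup>2) \<partial>M)"
    unfolding h_def by (rule nn_integral_suminf) measurable
  also have "\<dots> = (\<Sum>j. ennreal (2 ^ j) * (\<integral>\<^sup>+x. ennreal ((D j x)\<^sup>2) \<partial>M))"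
    by (simp add: ennreal_mult nn_integral_cmult)
  also have "\<dots> \<le> (\<Sum>j. ennreal (2 ^ j) * ennreal ((1 / 4) ^ j))"
    by (intro suminf_le mult_left_mono intD) auto
  also have "\<dots> = (\<Sum>j. ennreal ((1 / 2) ^ j))"
    by (simp add: ennreal_mult[symmetric] power_mult_distrib[symmetric])
  also have "\<dots> = ennreal (\<Sum>j. (1 / 2) ^ j)"
    by (intro suminf_ennreal2) (auto intro: summable_geometric)
  finally have "(\<integral>\<^sup>+x. h x \<partial>M) \<noteq> \<infinity>" by (auto simp: top_unique)
  then have AEh: "AE x in M. h x \<noteq> \<infinity>" by (intro nn_integral_PInf_AE) measurable
  have conv: "AE x in M. convergent (\<lambda>j. X (r j) x)"
    using AEh
  proof eventually_elim
    fix x assume hx: "h x \<noteq> \<infinity>"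
    then obtain c where c: "h x = ennreal c" "0 \<le> c" by (cases "h x") auto
    have "D j x \<le> sqrt c * (1 / sqrt 2) ^ j" for j
    proof -
      have "ennreal (2 ^ j * (D j x)\<^sup>2) \<le> h x"
      proof -
        define F where "F j = ennreal (2 ^ j * (D j x)\<^sup>2)" for j
        have "sum F {j} \<le> suminf F" by (rule sum_le_suminf) auto
        then show ?thesis by (simp add: h_def F_def[symmetric])
      qed
      then have "2 ^ j * (D j x)\<^sup>2 \<le> c" using c by simp
      then have "sqrt (2 ^ j * (D j x)\<^sup>2) \<le> sqrt c" by (rule real_sqrt_le_mono)
      then have "sqrt 2 ^ j * D j x \<le> sqrt c"
        by (simp add: real_sqrt_mult real_sqrt_power D_def)
      then show ?thesis by (simp add: power_divide field_simps)
    qed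
    moreover have "summable (\<lambda>j. sqrt c * (1 / sqrt 2) ^ j)"
      by (intro summable_mult summable_geometric) simp
    moreover have "norm (D j x) = D j x" for j by (simp add: D_def)
    ultimately have "summable (\<lambda>j. D j x)"
      using summable_comparison_test'[of "\<lambda>j. sqrt c * (1 / sqrt 2) ^ j" 0 "\<lambda>j. D j x"] by metis
    then have "summable (\<lambda>j. X (r (Suc j)) x - X (r j) x)"
      unfolding D_def by (rule summable_norm_cancel)
    then have "convergent (\<lambda>n. \<Sum>j<n. X (r (Suc j)) x - X (r j) x)" by (rule summable_iff_convergent[THEN iffD1])
    then have "convergent (\<lambda>n. X (r n) x - X (r 0) x)" by (simp only: sum_lessThan_telescope[of "\<lambda>j. X (r j) x"])
    then show "convergent (\<lambda>j. X (r j) x)"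
      using convergent_add[OF _ convergent_const[of "X (r 0) x"]] by fastforce
  qed
  define f where "f x = lim (\<lambda>j. X (r j) x)" for x
  have [measurable]: "f \<in> borel_measurable M" unfolding f_def by measurable
  have lim: "AE x in M. (\<lambda>j. X (r j) x) \<longlonglongrightarrow> f x"
    using conv by eventually_elim (simp add: f_def convergent_LIMSEQ_iff)
  have fatou: "(\<integral>\<^sup>+x. ennreal ((cmod (X n x - f x))\<^sup>2) \<partial>M) \<le> ennreal ((1 / 4) ^ i)" if n: "r i \<le> n" for i n
  proof -
    have "(\<integral>\<^sup>+x. ennreal ((cmod (X n x - f x))\<^sup>2) \<partial>M)
        = (\<integral>\<^sup>+x. liminf (\<lambda>j. ennreal ((cmod (X n x - X (r j) x))\<^sup>2)) \<partial>M)"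
    proof (rule nn_integral_cong_AE, use lim in eventually_elim)
      fix x assume "(\<lambda>j. X (r j) x) \<longlonglongrightarrow> f x"
      then have "(\<lambda>j. ennreal ((cmod (X n x - X (r j) x))\<^sup>2)) \<longlonglongrightarrow> ennreal ((cmod (X n x - f x))\<^sup>2)"
        by (intro tendsto_intros)
      then show "ennreal ((cmod (X n x - f x))\<^sup>2) = liminf (\<lambda>j. ennreal ((cmod (X n x - X (r j) x))\<^sup>2))"
        by (rule lim_imp_Liminf[OF trivial_limit_sequentially, symmetric])
    qed
    also have "\<dots> \<le> liminf (\<lambda>j. \<integral>\<^sup>+x. ennreal ((cmod (X n x - X (r j) x))\<^sup>2) \<partial>M)"
      by (rule nn_integral_liminf) measurable
    also have "\<dots> = liminf (\<lambda>j. ennreal (?d n (r j)))"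
      by (simp add: nn_integral_L2[OF L2_diff[OF X X]])
    also have "\<dots> \<le> ennreal ((1 / 4) ^ i)"
    proof (rule Liminf_le)
      show "\<forall>\<^sub>F j in sequentially. ennreal (?d n (r j)) \<le> ennreal ((1 / 4) ^ i)"
      proof (rule eventually_sequentiallyI[of i])
        fix j assume "i \<le> j"
        then have "r i \<le> r j" using sm by (simp add: strict_mono_less_eq)
        then show "ennreal (?d n (r j)) \<le> ennreal ((1 / 4) ^ i)"
          using r[OF n, of "r j"] by (intro ennreal_leI) auto
      qed
    qed simp
    finally show ?thesis .
  qed
  have diff: "(\<lambda>x. X n x - f x) \<in> L2 M" "L2_ip M (\<lambda>x. X n x - f x) (\<lambda>x. X n x - f x) \<le> (1 / 4) ^ i"
    if "r i \<le> n" for i n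
    using L2_nn_integralI[OF _ fatou[OF that]] by auto
  have "f = (\<lambda>x. X (r 0) x - (X (r 0) x - f x))" by simp
  then have "f \<in> L2 M" using L2_diff[OF X diff(1)[of 0 "r 0"], of "r 0"] by simp
  moreover have "(\<lambda>n. L2_ip M (\<lambda>x. X n x - f x) (\<lambda>x. X n x - f x)) \<longlonglongrightarrow> 0"
  proof (rule LIMSEQ_I)
    fix e :: real assume "0 < e"
    then obtain i where i: "(1 / 4 :: real) ^ i < e"
      using real_arch_pow_inv[of e "1 / 4"] by auto
    have "norm (L2_ip M (\<lambda>x. X n x - f x) (\<lambda>x. X n x - f x) - 0) < e" if "r i \<le> n" for n
      using diff(2)[OF that] i by (simp add: L2_ip_self)
    then show "\<exists>no. \<forall>n\<ge>no. norm (L2_ip M (\<lambda>x. X n x - f x) (\<lambda>x. X n x - f x) - 0) < e" by blast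
  qed
  ultimately show ?thesis by blast
qed

lemma L2_semi_hilbert: "semi_hilbert (L2 M) (L2_ip M)"
proof
  show "subspace (L2 M)" by (rule L2_subspace)
  show "L2_ip M x y = L2_ip M y x" for x y
    using L2_inner_cnj[of M x y] by (metis L2_ip_def complex_cnj(1) cnj.simps(1))
  show "L2_ip M (x + y) z = L2_ip M x z + L2_ip M y z" if "x \<in> L2 M" "y \<in> L2 M" "z \<in> L2 M" for x y z
    using L2_inner_add_left[OF that] by (simp add: L2_ip_def plus_fun_def)
  show "L2_ip M (c *\<^sub>R x) y = c * L2_ip M x y" for x y c
    using L2_inner_scale_left[of M "of_real c" x y] by (simp add: L2_ip_def scaleR_fun_def scaleR_conv_of_real)
  show "0 \<le> L2_ip M x x" for x by (simp add: L2_ip_self)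
  show "\<exists>f\<in>L2 M. (\<lambda>n. L2_ip M (X n - f) (X n - f)) \<longlonglongrightarrow> 0"
    if "\<And>n. X n \<in> L2 M" "\<And>e. 0 < e \<Longrightarrow> \<exists>K. \<forall>m\<ge>K. \<forall>n\<ge>K. L2_ip M (X m - X n) (X m - X n) < e" for X
    using L2_complete[of X M] that by (simp add: fun_diff_def)
qed

section \<open>Translations on \<open>L\<^sup>2(G)\<close>\<close>

text \<open>Multiplying \<open>f\<close> by a unimodular constant makes the complex inner product
  real, which reduces the claim to the real inner product \<open>L2_ip\<close>.\<close>

lemma L2_Cauchy_Schwarz:
  assumes f: "f \<in> L2 M" and g: "g \<in> L2 M"
  shows "cmod (L2_inner M f g) \<le> sqrt (L2_ip M f f) * sqrt (L2_ip M g g)"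
proof (cases "L2_inner M f g = 0")
  case False
  interpret semi_hilbert "L2 M" "L2_ip M" by (rule L2_semi_hilbert)
  define c where "c = cnj (L2_inner M f g) / cmod (L2_inner M f g)"
  have c: "cmod c = 1" using False by (simp add: c_def norm_divide)
  have "c * L2_inner M f g = cmod (L2_inner M f g)"
    using False complex_norm_square[of "L2_inner M f g"]
    by (simp add: c_def mult.commute power2_eq_square field_simps)
  then have "cmod (L2_inner M f g) = L2_ip M (\<lambda>x. c * f x) g"
    by (simp add: L2_ip_def L2_inner_scale_left)
  also have "\<dots> \<le> nm (\<lambda>x. c * f x) * nm g"
    using ip_Cauchy_Schwarz[OF L2_scale[OF f] g, of c] by simp
  also have "nm (\<lambda>x. c * f x) = nm f" by (simp add: nm_def L2_ip_self norm_mult c)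
  finally show ?thesis by (simp add: nm_def)
qed (simp add: L2_ip_self)

lemma L2_norm_eq: "L2_norm M f = sqrt (L2_ip M f f)"
  by (simp add: L2_norm_def L2_ip_self)

definition cind :: "'a set \<Rightarrow> 'a \<Rightarrow> complex" where
  "cind A x = of_real (indicator A x)"

lemma cind_L2:
  assumes "A \<in> sets M" "emeasure M A < \<infinity>" shows "cind A \<in> L2 M"
proof (rule L2I)
  have "(cmod (cind A x))\<^sup>2 = indicator A x" for x by (simp add: cind_def indicator_def)
  then show "integrable M (\<lambda>x. (cmod (cind A x))\<^sup>2)" using assms by simp
  show "cind A \<in> borel_measurable M" unfolding cind_def[abs_def] using assms(1) by measurable
qed

lemma L2_induct:
  assumes space: "space M = UNIV" and f: "f \<in> L2 M"
    and ind: "\<And>A. A \<in> sets M \<Longrightarrow> emeasure M A < \<infinity> \<Longrightarrow> P (cind A)"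
    and add: "\<And>f g. f \<in> L2 M \<Longrightarrow> g \<in> L2 M \<Longrightarrow> P f \<Longrightarrow> P g \<Longrightarrow> P (\<lambda>x. f x + g x)"
    and scale: "\<And>c f. f \<in> L2 M \<Longrightarrow> P f \<Longrightarrow> P (\<lambda>x. c * f x)"
    and lim: "\<And>f X. f \<in> L2 M \<Longrightarrow> (\<And>n. X n \<in> L2 M) \<Longrightarrow> (\<And>n. P (X n)) \<Longrightarrow>
      (\<lambda>n::nat. L2_ip M (\<lambda>x. X n x - f x) (\<lambda>x. X n x - f x)) \<longlonglongrightarrow> 0 \<Longrightarrow> P f"
  shows "P f"
proof -
  note fm = L2D(1)[OF f]
  obtain s where s: "\<And>i. simple_function M (s i)" "\<And>x. x \<in> space M \<Longrightarrow> (\<lambda>i. s i x) \<longlonglongrightarrow> f x"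
    "\<And>i x. x \<in> space M \<Longrightarrow> dist (s i x) 0 \<le> 2 * dist (f x) 0"
    using borel_measurable_implies_sequence_metric[OF fm, of 0] by blast
  have sm: "s i \<in> borel_measurable M" for i by (rule borel_measurable_simple_function[OF s(1)])
  have sb: "(cmod (s i x))\<^sup>2 \<le> 4 * (cmod (f x))\<^sup>2" for i x
    using power_mono[OF s(3)[of x i], of 2] space by (simp add: power_mult_distrib)
  have sL2: "s i \<in> L2 M" for i
    by (rule L2_bound[OF sm _ sb]) (use L2D(2)[OF f] in auto)
  have Ps: "P (s i)" for i
  proof -
    define Y where "Y = s i ` UNIV - {0}"
    have finY: "finite Y" using simple_functionD(1)[OF s(1)[of i]] space by (simp add: Y_def)
    have AY: "s i -` {y} \<in> sets M" for y using simple_functionD(2)[OF s(1)[of i], of "{y}"] space by simp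
    \<comment> \<open>Chebyshev's inequality: a level set away from 0 of a square integrable
      function has finite measure.\<close>
    have fin: "emeasure M (s i -` {y}) < \<infinity>" if "y \<in> Y" for y
    proof -
      have "ennreal ((cmod y)\<^sup>2) * emeasure M (s i -` {y}) = (\<integral>\<^sup>+x. ennreal ((cmod y)\<^sup>2) * indicator (s i -` {y}) x \<partial>M)"
        using AY by (simp add: nn_integral_cmult_indicator)
      also have "\<dots> \<le> (\<integral>\<^sup>+x. ennreal ((cmod (s i x))\<^sup>2) \<partial>M)"
        by (intro nn_integral_mono) (auto simp: indicator_def)
      also have "\<dots> < \<infinity>" by (simp add: nn_integral_L2[OF sL2])
      finally show ?thesis using that by (auto simp: Y_def ennreal_mult_less_top)
    qed
    have "(\<lambda>x. \<Sum>y\<in>Z. y * cind (s i -` {y}) x) \<in> L2 M \<and> P (\<lambda>x. \<Sum>y\<in>Z. y * cind (s i -` {y}) x)"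
      if "Z \<subseteq> Y" for Z
      using finite_subset[OF that finY] that
    proof induction
      case empty
      have "P (\<lambda>x. 0)" using ind[of "{}"] by (simp add: cind_def[abs_def])
      then show ?case using L2_zero[of M] by simp
    next
      case (insert y Z)
      then have "cind (s i -` {y}) \<in> L2 M" "P (cind (s i -` {y}))"
        using fin[of y] AY[of y] ind cind_L2 by auto
      then show ?case using insert by (auto simp: L2_add L2_scale add scale)
    qed
    moreover have "s i x = (\<Sum>y\<in>Y. y * cind (s i -` {y}) x)" for x
    proof -
      have "(\<Sum>y\<in>Y. y * cind (s i -` {y}) x) = (\<Sum>y\<in>Y. if y = s i x then y else 0)"
        by (intro sum.cong) (auto simp: cind_def indicator_def)
      then show ?thesis using finY by (auto simp: Y_def)
    qed
    ultimately show ?thesis by (metis (no_types, lifting) ext order_refl)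
  qed
  have "(\<lambda>i. LINT x|M. (cmod (s i x - f x))\<^sup>2) \<longlonglongrightarrow> (LINT x|M. 0)"
  \<comment> \<open>The constant is 10 = 2 * 4 + 2, as \<open>s i\<close> is at most twice
    \<open>f\<close> in modulus.\<close>
  proof (rule integral_dominated_convergence[where w = "\<lambda>x. 10 * (cmod (f x))\<^sup>2"])
    show "integrable M (\<lambda>x. 10 * (cmod (f x))\<^sup>2)" using L2D(2)[OF f] by simp
    show "(\<lambda>x. (cmod (s i x - f x))\<^sup>2) \<in> borel_measurable M" for i using sm fm by measurable
    show "AE x in M. (\<lambda>i. (cmod (s i x - f x))\<^sup>2) \<longlonglongrightarrow> 0"
    proof (rule AE_I2)
      fix x assume "x \<in> space M"
      from tendsto_norm_zero[OF LIM_zero[OF s(2)[OF this]]]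
      show "(\<lambda>i. (cmod (s i x - f x))\<^sup>2) \<longlonglongrightarrow> 0" using tendsto_power[of _ 0 _ 2] by fastforce
    qed
    show "AE x in M. norm ((cmod (s i x - f x))\<^sup>2) \<le> 10 * (cmod (f x))\<^sup>2" for i
    proof (rule AE_I2)
      fix x
      have "(cmod (s i x - f x))\<^sup>2 \<le> (cmod (s i x) + cmod (f x))\<^sup>2"
        by (intro power_mono norm_triangle_ineq4) auto
      also have "\<dots> \<le> 2 * (cmod (s i x))\<^sup>2 + 2 * (cmod (f x))\<^sup>2"
        using sum_squares_bound[of "cmod (s i x)" "cmod (f x)"] by (simp add: power2_sum)
      finally show "norm ((cmod (s i x - f x))\<^sup>2) \<le> 10 * (cmod (f x))\<^sup>2" using sb[of i x] by simp
    qed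
  qed auto
  then have "(\<lambda>i. L2_ip M (\<lambda>x. s i x - f x) (\<lambda>x. s i x - f x)) \<longlonglongrightarrow> 0"
    by (simp add: L2_ip_self)
  then show ?thesis by (rule lim[OF f sL2 Ps])
qed

section \<open>Haar measure: regularity, approximation and continuity of translation\<close>

locale haar =
  fixes \<mu> :: "'a::{topological_group_add, t2_space} measure"
  assumes locally_compact: "locally_compact_space (euclidean :: 'a topology)"
    and left_haar: "left_haar_measure \<mu>"
begin

lemma sets_haar [simp, measurable_cong]: "sets \<mu> = sets borel"
  using left_haar by (simp add: left_haar_measure_def)

lemma space_haar [simp]: "space \<mu> = UNIV"
  using sets_eq_imp_space_eq[OF sets_haar] by simp

lemma compact_finite: "compact K \<Longrightarrow> emeasure \<mu> K < \<infinity>"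
  and outer_regular: "A \<in> sets borel \<Longrightarrow> emeasure \<mu> A = (INF U\<in>{U. open U \<and> A \<subseteq> U}. emeasure \<mu> U)"
  and inner_regular: "open U \<Longrightarrow> emeasure \<mu> U = (SUP K\<in>{K. compact K \<and> K \<subseteq> U}. emeasure \<mu> K)"
  and emeasure_translate: "A \<in> sets borel \<Longrightarrow> emeasure \<mu> ((\<lambda>t. s + t) ` A) = emeasure \<mu> A"
  and emeasure_UNIV: "emeasure \<mu> UNIV \<noteq> 0"
  using left_haar unfolding left_haar_measure_def by blast+

lemma continuous_translate: "continuous_on A (\<lambda>t. s + t :: 'a)"
  by (intro continuous_intros)

lemma compact_borel: "compact K \<Longrightarrow> K \<in> sets (borel :: 'a measure)"
  by (simp add: compact_imp_closed)

lemma translate_vimage: "(\<lambda>t. s + t) -` A = (\<lambda>t. - s + t) ` (A :: 'a set)"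
proof safe
  fix x assume "s + x \<in> A"
  then show "x \<in> (\<lambda>t. - s + t) ` A" by (metis image_eqI minus_add_cancel)
qed (simp add: add.assoc[symmetric])

lemma translate_measurable [measurable]: "(\<lambda>t. s + t) \<in> \<mu> \<rightarrow>\<^sub>M borel"
  using borel_measurable_continuous_onI[OF continuous_translate, of s] by (simp cong: measurable_cong_sets)

lemma distr_translate: "distr \<mu> borel (\<lambda>t. s + t) = \<mu>"
proof (rule measure_eqI)
  fix A assume "A \<in> sets (distr \<mu> borel (\<lambda>t. s + t))"
  then have A: "A \<in> sets borel" by simp
  have "emeasure (distr \<mu> borel (\<lambda>t. s + t)) A = emeasure \<mu> ((\<lambda>t. - s + t) ` A)"
    using A by (simp add: emeasure_distr translate_vimage)
  then show "emeasure (distr \<mu> borel (\<lambda>t. s + t)) A = emeasure \<mu> A"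
    using emeasure_translate[OF A] by simp
qed simp

lemma integral_translate:
  fixes f :: "'a \<Rightarrow> 'b::{banach, second_countable_topology}"
  assumes "f \<in> borel_measurable \<mu>"
  shows "(LINT x|\<mu>. f (s + x)) = (LINT x|\<mu>. f x)"
proof -
  have "(LINT x|\<mu>. f (s + x)) = integral\<^sup>L (distr \<mu> borel (\<lambda>t. s + t)) f"
    using assms by (intro integral_distr[symmetric]) (auto cong: measurable_cong_sets)
  then show ?thesis by (simp add: distr_translate)
qed

lemma integrable_translate:
  fixes f :: "'a \<Rightarrow> 'b::{banach, second_countable_topology}"
  assumes "f \<in> borel_measurable \<mu>"
  shows "integrable \<mu> (\<lambda>x. f (s + x)) \<longleftrightarrow> integrable \<mu> f"
proof -
  have "integrable (distr \<mu> borel (\<lambda>t. s + t)) f \<longleftrightarrow> integrable \<mu> (\<lambda>x. f (s + x))"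
    using assms by (intro integrable_distr_eq) (auto cong: measurable_cong_sets)
  then show ?thesis by (simp add: distr_translate)
qed

lemma measurable_translate:
  assumes "f \<in> borel_measurable \<mu>" shows "(\<lambda>x. f (s + x)) \<in> borel_measurable \<mu>"
proof (rule measurable_compose[OF translate_measurable])
  show "f \<in> borel_measurable borel" using assms by (simp cong: measurable_cong_sets)
qed

lemma left_regular_L2: assumes "f \<in> L2 \<mu>" shows "left_regular s f \<in> L2 \<mu>"
proof (rule L2I)
  note fm = L2D(1)[OF assms]
  show "left_regular s f \<in> borel_measurable \<mu>"
    unfolding left_regular_def by (rule measurable_translate[OF fm])
  have "(\<lambda>x. (cmod (f x))\<^sup>2) \<in> borel_measurable \<mu>" using fm by measurable
  then show "integrable \<mu> (\<lambda>x. (cmod (left_regular s f x))\<^sup>2)"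
    unfolding left_regular_def by (subst integrable_translate[of "\<lambda>x. (cmod (f x))\<^sup>2"]) (use L2D(2)[OF assms] in auto)
qed

lemma left_regular_left_regular: "left_regular s (left_regular t f) = left_regular (s + t) f"
  by (simp add: left_regular_def minus_add add.assoc del: add_uminus_conv_diff)

lemma left_regular_zero: "left_regular 0 f = f"
  by (simp add: left_regular_def)

lemma L2_inner_left_regular:
  assumes "f \<in> L2 \<mu>" "g \<in> L2 \<mu>"
  shows "L2_inner \<mu> (left_regular s f) (left_regular s g) = L2_inner \<mu> f g"
  unfolding L2_inner_def left_regular_def
  by (rule integral_translate[of "\<lambda>x. f x * cnj (g x)"])
    (use L2_mult_integrable[OF assms] in auto)

lemma L2_inner_left_regular_adjoint:
  assumes "f \<in> L2 \<mu>" "g \<in> L2 \<mu>"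
  shows "L2_inner \<mu> (left_regular s f) g = L2_inner \<mu> f (left_regular (- s) g)"
  using L2_inner_left_regular[OF assms(1) left_regular_L2[OF assms(2), of "- s"], of s]
  by (simp add: left_regular_left_regular left_regular_zero)

lemma L2_ip_left_regular:
  "f \<in> L2 \<mu> \<Longrightarrow> g \<in> L2 \<mu> \<Longrightarrow> L2_ip \<mu> (left_regular s f) (left_regular s g) = L2_ip \<mu> f g"
  by (simp add: L2_ip_def L2_inner_left_regular)

lemma compact_neighbourhood:
  obtains U C where "open U" "compact C" "(0::'a) \<in> U" "U \<subseteq> C"
proof -
  have "\<exists>U C. open U \<and> compact C \<and> (0::'a) \<in> U \<and> U \<subseteq> C"
    using locally_compact unfolding locally_compact_space_def by auto
  then show ?thesis using that by blast
qed

lemma compact_plus: "compact A \<Longrightarrow> compact B \<Longrightarrow> compact {a + b | a b. a \<in> A \<and> b \<in> (B :: 'a set)}"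
proof -
  assume "compact A" "compact B"
  then have "compact ((\<lambda>p. fst p + snd p) ` (A \<times> B))"
    by (intro compact_continuous_image compact_Times continuous_intros)
  moreover have "(\<lambda>p. fst p + snd p) ` (A \<times> B) = {a + b | a b. a \<in> A \<and> b \<in> B}" by force
  ultimately show ?thesis by simp
qed

lemma compact_uminus: "compact A \<Longrightarrow> compact (uminus ` (A :: 'a set))"
  by (intro compact_continuous_image continuous_intros)

lemma open_translate: "open U \<Longrightarrow> open ((\<lambda>t. s + t) ` (U :: 'a set))"
  using open_vimage[OF _ continuous_translate, of U "- s"] by (simp add: translate_vimage)

text \<open>Finitely many translates of \<open>U\<close> cover any compact set. If \<open>U\<close>
  were null, all compact sets would be null and, by inner regularity, so would the whole
  group.\<close>

lemma emeasure_open_pos: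
  assumes U: "open U" "U \<noteq> {}" shows "emeasure \<mu> U \<noteq> 0"
proof
  assume 0: "emeasure \<mu> U = 0"
  obtain u where u: "u \<in> U" using U by auto
  have "emeasure \<mu> K = 0" if "compact K" for K
  proof -
    have "K \<subseteq> (\<Union>k\<in>K. (\<lambda>t. (k - u) + t) ` U)"
      using u by (force simp: image_iff intro: bexI[of _ u])
    then obtain F where F: "F \<subseteq> K" "finite F" "K \<subseteq> (\<Union>k\<in>F. (\<lambda>t. (k - u) + t) ` U)"
      using compactE_image[OF \<open>compact K\<close>, of K "\<lambda>k. (\<lambda>t. (k - u) + t) ` U"] open_translate[OF U(1)] by metis
    have "emeasure \<mu> K \<le> emeasure \<mu> (\<Union>k\<in>F. (\<lambda>t. (k - u) + t) ` U)"
      using F open_translate[OF U(1)] by (intro emeasure_mono) auto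
    also have "\<dots> \<le> (\<Sum>k\<in>F. emeasure \<mu> ((\<lambda>t. (k - u) + t) ` U))"
      using F open_translate[OF U(1)] by (intro emeasure_subadditive_finite) auto
    also have "\<dots> = 0" using U 0 by (simp add: emeasure_translate)
    finally show ?thesis by simp
  qed
  then have "emeasure \<mu> UNIV = 0" using inner_regular[of UNIV] by (simp add: SUP_eq_const[of _ _ 0] exI[of _ "{}"])
  then show False using emeasure_UNIV by simp
qed

sublocale L2: semi_hilbert "L2 \<mu>" "L2_ip \<mu>"
  by (rule L2_semi_hilbert)

text \<open>The tube lemma for addition around the compact set of pairs (0, k) with \<open>k\<close>
  in \<open>K\<close>.\<close>

lemma compact_translate_nbhd:
  assumes K: "compact (K :: 'a set)" and U: "open U" "K \<subseteq> U"
  shows "\<exists>N. open N \<and> 0 \<in> N \<and> (\<forall>s\<in>N. \<forall>k\<in>K. s + k \<in> U)"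
proof -
  let ?a = "\<lambda>p :: 'a \<times> 'a. fst p + snd p"
  have op: "open (?a -` U)" by (rule open_vimage[OF U(1)]) (intro continuous_intros)
  have "\<exists>p. open (fst p) \<and> open (snd p) \<and> 0 \<in> fst p \<and> k \<in> snd p \<and> fst p \<times> snd p \<subseteq> ?a -` U"
    if k: "k \<in> K" for k
  proof -
    have "(0, k) \<in> ?a -` U" using k U(2) by auto
    from open_prod_elim[OF op this] obtain A B
      where "open A" "open B" "(0, k) \<in> A \<times> B" "A \<times> B \<subseteq> ?a -` U" .
    then show ?thesis by (intro exI[of _ "(A, B)"]) auto
  qed
  then have "\<forall>k\<in>K. \<exists>p. open (fst p) \<and> open (snd p) \<and> 0 \<in> fst p \<and> k \<in> snd p \<and> fst p \<times> snd p \<subseteq> ?a -` U"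
    by blast
  from bchoice[OF this] obtain P where P: "\<forall>k\<in>K. open (fst (P k)) \<and> open (snd (P k)) \<and>
    0 \<in> fst (P k) \<and> k \<in> snd (P k) \<and> fst (P k) \<times> snd (P k) \<subseteq> ?a -` U" by blast
  define N V where "N k = fst (P k)" and "V k = snd (P k)" for k
  have NV: "\<And>k. k \<in> K \<Longrightarrow> open (N k)" "\<And>k. k \<in> K \<Longrightarrow> open (V k)"
    "\<And>k. k \<in> K \<Longrightarrow> 0 \<in> N k" "\<And>k. k \<in> K \<Longrightarrow> k \<in> V k" "\<And>k. k \<in> K \<Longrightarrow> N k \<times> V k \<subseteq> ?a -` U"
    using P by (simp_all add: N_def V_def)
  obtain F where F: "F \<subseteq> K" "finite F" "K \<subseteq> (\<Union>k\<in>F. V k)"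
    by (rule compactE_image[OF K, of K V]) (use NV in auto)
  have "open (\<Inter>k\<in>F. N k)" using F NV by (intro open_INT) auto
  moreover have "0 \<in> (\<Inter>k\<in>F. N k)" using F NV by auto
  moreover have "s + k \<in> U" if sk: "s \<in> (\<Inter>k\<in>F. N k)" "k \<in> K" for s k
  proof -
    obtain j where "j \<in> F" "k \<in> V j" using F sk by blast
    then have "(s, k) \<in> N j \<times> V j" using sk by auto
    then have "(s, k) \<in> ?a -` U" by (rule subsetD[OF NV(5)[OF subsetD[OF F(1) \<open>j \<in> F\<close>]]])
    then show ?thesis by simp
  qed
  ultimately show ?thesis by blast
qed

lemma finite_outer_open:
  assumes A: "A \<in> sets borel" "emeasure \<mu> A < \<infinity>" and e: "0 < e"
  obtains U where "open U" "A \<subseteq> U" "emeasure \<mu> U < \<infinity>" "measure \<mu> (U - A) < e"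
proof -
  have "emeasure \<mu> A < emeasure \<mu> A + ennreal e" using A(2) e by (simp add: ennreal_add_left_cancel_less)
  then have "(INF U\<in>{U. open U \<and> A \<subseteq> U}. emeasure \<mu> U) < emeasure \<mu> A + ennreal e"
    using outer_regular[OF A(1)] by simp
  then obtain U where U: "open U" "A \<subseteq> U" "emeasure \<mu> U < emeasure \<mu> A + ennreal e"
    by (auto simp: INF_less_iff)
  have fin: "emeasure \<mu> U < \<infinity>" using order.strict_trans2[OF U(3) top_greatest] by simp
  have "(U - A) \<inter> A = {}" by blast
  then have "emeasure \<mu> (U - A) + emeasure \<mu> A = emeasure \<mu> U"
    using U A plus_emeasure[of "U - A" \<mu> A] by (simp add: Un_absorb2)
  then have "emeasure \<mu> A + emeasure \<mu> (U - A) < emeasure \<mu> A + ennreal e"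
    using U(3) by (simp add: add.commute)
  then have "emeasure \<mu> (U - A) < ennreal e" using A(2) by (simp add: ennreal_add_left_cancel_less)
  moreover from this have "emeasure \<mu> (U - A) \<noteq> top" by auto
  ultimately have "measure \<mu> (U - A) < e" by (simp add: emeasure_eq_ennreal_measure ennreal_less_iff)
  then show ?thesis using that U fin by blast
qed

lemma finite_inner_compact:
  assumes U: "open U" "emeasure \<mu> U < \<infinity>" and e: "0 < e"
  obtains K where "compact K" "K \<subseteq> U" "measure \<mu> (U - K) < e"
proof (cases "emeasure \<mu> U = 0")
  case True
  then have "measure \<mu> (U - {}) < e" using e by (simp add: measure_def)
  then show ?thesis using that[of "{}"] by simp
next
  case False
  have "emeasure \<mu> U - ennreal e < emeasure \<mu> U"
  proof (cases "emeasure \<mu> U")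
    case (real u)
    then have "0 < u" using False by (cases "u = 0") auto
    then show ?thesis using real e by (simp add: ennreal_minus ennreal_lessI)
  qed (use U(2) in auto)
  also have "emeasure \<mu> U = (SUP K\<in>{K. compact K \<and> K \<subseteq> U}. emeasure \<mu> K)" by (rule inner_regular[OF U(1)])
  finally obtain K where K: "compact K" "K \<subseteq> U" "emeasure \<mu> U - ennreal e < emeasure \<mu> K"
    by (auto simp: less_SUP_iff)
  have sum: "measure \<mu> (U - K) + measure \<mu> K = measure \<mu> U"
    using measure_Diff[of \<mu> U K] K U compact_finite[OF K(1)] compact_borel[OF K(1)] by (simp add: less_top)
  have "emeasure \<mu> U = ennreal (measure \<mu> U)" "emeasure \<mu> K = ennreal (measure \<mu> K)"
    using U(2) compact_finite[OF K(1)] by (simp_all add: emeasure_eq_ennreal_measure less_top)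
  then have "ennreal (measure \<mu> U - e) < ennreal (measure \<mu> K)"
    using K(3) e by (simp add: ennreal_minus)
  then have "measure \<mu> U - e < measure \<mu> K" by (metis ennreal_leI not_le)
  then show ?thesis using that[OF K(1,2)] sum by simp
qed

lemma cind_diff_ip:
  assumes "A \<in> sets borel" "B \<in> sets borel"
  shows "L2_ip \<mu> (\<lambda>x. cind A x - cind B x) (\<lambda>x. cind A x - cind B x) = measure \<mu> ((A - B) \<union> (B - A))"
proof -
  have "(cmod (cind A x - cind B x))\<^sup>2 = indicator ((A - B) \<union> (B - A)) x" for x
    by (cases "x \<in> A"; cases "x \<in> B") (simp_all add: cind_def)
  then have "L2_ip \<mu> (\<lambda>x. cind A x - cind B x) (\<lambda>x. cind A x - cind B x) = (LINT x|\<mu>. indicator ((A - B) \<union> (B - A)) x)"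
    by (simp only: L2_ip_self)
  also have "\<dots> = measure \<mu> ((A - B) \<union> (B - A))" using assms by simp
  finally show ?thesis .
qed

text \<open>The definition grants outer regularity for Borel sets but inner regularity only for open
  ones. So \<open>A\<close> is first enlarged to an open set, which is then shrunk to a compact one;
  the result need not lie inside \<open>A\<close>.\<close>

lemma compact_indicator_approx:
  assumes A: "A \<in> sets borel" "emeasure \<mu> A < \<infinity>" and e: "0 < e"
  obtains K where "compact K" "L2_ip \<mu> (\<lambda>x. cind K x - cind A x) (\<lambda>x. cind K x - cind A x) < e"
proof -
  obtain U where U: "open U" "A \<subseteq> U" "emeasure \<mu> U < \<infinity>" "measure \<mu> (U - A) < e / 2"
    using finite_outer_open[OF A half_gt_zero[OF e]] by blast
  obtain K where K: "compact K" "K \<subseteq> U" "measure \<mu> (U - K) < e / 2"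
    using finite_inner_compact[OF U(1,3) half_gt_zero[OF e]] by blast
  note [measurable] = compact_borel[OF K(1)] A(1)
  have fm: "B \<in> fmeasurable \<mu>" if "B \<in> sets borel" "B \<subseteq> U" for B
    using that U(1,3) by (intro fmeasurableI) (auto intro: order_le_less_trans[OF emeasure_mono])
  have "measure \<mu> ((K - A) \<union> (A - K)) \<le> measure \<mu> ((U - A) \<union> (U - K))"
    using U K A compact_borel[OF K(1)] by (intro measure_mono_fmeasurable fm) auto
  also have "\<dots> \<le> measure \<mu> (U - A) + measure \<mu> (U - K)"
    using U K A compact_borel[OF K(1)] by (intro measure_Un_le) auto
  finally have "measure \<mu> ((K - A) \<union> (A - K)) < e" using U K by simp
  then show ?thesis using that[OF K(1)] cind_diff_ip[OF compact_borel[OF K(1)] A(1)] by simp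
qed

lemma haar_L2_induct [consumes 1, case_names compact add scale limit]:
  assumes f: "f \<in> L2 \<mu>"
    and ind: "\<And>K. compact K \<Longrightarrow> P (cind K)"
    and add: "\<And>f g. f \<in> L2 \<mu> \<Longrightarrow> g \<in> L2 \<mu> \<Longrightarrow> P f \<Longrightarrow> P g \<Longrightarrow> P (\<lambda>x. f x + g x)"
    and scale: "\<And>c f. f \<in> L2 \<mu> \<Longrightarrow> P f \<Longrightarrow> P (\<lambda>x. c * f x)"
    and lim: "\<And>f X. f \<in> L2 \<mu> \<Longrightarrow> (\<And>n. X n \<in> L2 \<mu>) \<Longrightarrow> (\<And>n. P (X n)) \<Longrightarrow>
      (\<lambda>n::nat. L2_ip \<mu> (\<lambda>x. X n x - f x) (\<lambda>x. X n x - f x)) \<longlonglongrightarrow> 0 \<Longrightarrow> P f"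
  shows "P f"
proof (rule L2_induct[where P = P, OF space_haar f])
  fix A assume A: "A \<in> sets \<mu>" "emeasure \<mu> A < \<infinity>"
  have "\<exists>K. compact K \<and> L2_ip \<mu> (\<lambda>x. cind K x - cind A x) (\<lambda>x. cind K x - cind A x) < inverse (real (Suc n))" for n
  proof -
    have "A \<in> sets borel" "0 < inverse (real (Suc n))" using A(1) by auto
    from compact_indicator_approx[OF this(1) A(2) this(2)] show ?thesis by blast
  qed
  then obtain K where K: "\<And>n. compact (K n)"
    "\<And>n. L2_ip \<mu> (\<lambda>x. cind (K n) x - cind A x) (\<lambda>x. cind (K n) x - cind A x) < inverse (real (Suc n))"
    by metis
  show "P (cind A)"
  proof (rule lim[of "cind A" "\<lambda>n. cind (K n)"])
    show "cind A \<in> L2 \<mu>" using A by (rule cind_L2)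
    show "cind (K n) \<in> L2 \<mu>" for n using K compact_finite compact_borel by (intro cind_L2) auto
    show "P (cind (K n))" for n by (rule ind[OF K(1)])
    show "(\<lambda>n. L2_ip \<mu> (\<lambda>x. cind (K n) x - cind A x) (\<lambda>x. cind (K n) x - cind A x)) \<longlonglongrightarrow> 0"
    proof (rule tendsto_sandwich[OF _ _ tendsto_const LIMSEQ_inverse_real_of_nat])
      show "\<forall>\<^sub>F n in sequentially. 0 \<le> L2_ip \<mu> (\<lambda>x. cind (K n) x - cind A x) (\<lambda>x. cind (K n) x - cind A x)"
        by (simp add: L2_ip_self)
      show "\<forall>\<^sub>F n in sequentially. L2_ip \<mu> (\<lambda>x. cind (K n) x - cind A x) (\<lambda>x. cind (K n) x - cind A x)
          \<le> inverse (real (Suc n))"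
        using K(2) by (intro always_eventually allI less_imp_le)
    qed
  qed
qed (fact add, fact scale, fact lim)

lemma compact_L2: "compact K \<Longrightarrow> cind K \<in> L2 \<mu>"
  by (rule cind_L2) (simp_all add: compact_borel compact_finite[unfolded infinity_ennreal_def])

lemma nm_cmult: "f \<in> L2 \<mu> \<Longrightarrow> L2.nm (\<lambda>x. c * f x) = cmod c * L2.nm f"
  unfolding L2.nm_def L2_ip_self norm_mult power_mult_distrib by (simp add: real_sqrt_mult)

lemma nm_left_regular: "f \<in> L2 \<mu> \<Longrightarrow> L2.nm (left_regular s f) = L2.nm f"
  by (simp add: L2.nm_def L2_ip_left_regular)

lemma L2_tendsto_nm:
  assumes "(\<lambda>n. L2_ip \<mu> (\<lambda>x. X n x - f x) (\<lambda>x. X n x - f x)) \<longlonglongrightarrow> 0"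
  shows "(\<lambda>n. L2.nm (X n - f)) \<longlonglongrightarrow> 0"
  using tendsto_real_sqrt[OF assms] unfolding L2.nm_def fun_diff_def by simp

lemma left_regular_continuous_at_0:
  assumes f: "f \<in> L2 \<mu>"
  shows "\<forall>e>0. \<exists>N. open N \<and> 0 \<in> N \<and> (\<forall>s\<in>N. L2.nm (left_regular s f - f) < e)"
  using f
proof (induct rule: haar_L2_induct)
  case (compact K)
  show ?case
  proof (intro allI impI)
    fix e :: real assume e: "0 < e"
    \<comment> \<open>For small \<open>s\<close> the translate of \<open>K\<close> stays in
      \<open>U\<close> and has the same measure as \<open>K\<close>. Hence the symmetric difference
      has twice the measure of one half of it, at most twice that of \<open>U - K\<close>.\<close>
    obtain U where U: "open U" "K \<subseteq> U" "emeasure \<mu> U < \<infinity>" "measure \<mu> (U - K) < e\<^sup>2 / 2"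
    proof -
      have "0 < e\<^sup>2 / 2" using e by simp
      from finite_outer_open[OF compact_borel[OF compact] compact_finite[OF compact] this] show ?thesis
        using that by blast
    qed
    obtain N where N: "open N" "0 \<in> N" "\<And>s k. s \<in> N \<Longrightarrow> k \<in> K \<Longrightarrow> s + k \<in> U"
      using compact_translate_nbhd[OF compact U(1,2)] by blast
    have "L2.nm (left_regular s (cind K) - cind K) < e" if s: "s \<in> N" for s
    proof -
      define L where "L = (\<lambda>t. s + t) ` K"
      have L: "compact L" unfolding L_def by (intro compact_continuous_image continuous_translate compact)
      have lr: "left_regular s (cind K) = cind L"
      proof
        fix x
        have "- s + x \<in> K \<longleftrightarrow> x \<in> L"
          unfolding L_def using translate_vimage[of "- s" K] by auto
        then show "left_regular s (cind K) x = cind L x"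
          by (simp add: left_regular_def cind_def indicator_def)
      qed
      note b = compact_borel[OF L] compact_borel[OF compact]
      have LU: "L \<subseteq> U" using N(3)[OF s] by (auto simp: L_def)
      have fm: "B \<in> fmeasurable \<mu>" if "B \<in> sets borel" "B \<subseteq> U" for B
        using that U(1,3) by (intro fmeasurableI) (auto intro: order_le_less_trans[OF emeasure_mono])
      have mL: "measure \<mu> L = measure \<mu> K"
        using emeasure_translate[OF b(2), of s] by (simp add: measure_def L_def)
      have eqs: "measure \<mu> (L - K) = measure \<mu> L - measure \<mu> (L \<inter> K)" "measure \<mu> (K - L) = measure \<mu> K - measure \<mu> (L \<inter> K)"
        using measurable_measure_Diff[of L \<mu> "L \<inter> K"] measurable_measure_Diff[of K \<mu> "L \<inter> K"] fm b LU U(2)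
        by (auto simp: Diff_Int)
      have "measure \<mu> ((L - K) \<union> (K - L)) \<le> measure \<mu> (L - K) + measure \<mu> (K - L)"
        using b by (intro measure_Un_le) auto
      also have "\<dots> = 2 * measure \<mu> (L - K)" using eqs mL by simp
      also have "measure \<mu> (L - K) \<le> measure \<mu> (U - K)"
        using LU b U(1) by (intro measure_mono_fmeasurable fm) auto
      finally have "measure \<mu> ((L - K) \<union> (K - L)) < e\<^sup>2" using U(4) by simp
      moreover have "(L2.nm (cind L - cind K))\<^sup>2 = measure \<mu> ((L - K) \<union> (K - L))"
        using cind_diff_ip[OF b] L2.nm_power2[OF L2.diff_mem[OF compact_L2[OF L] compact_L2[OF compact]]]
        by (simp only: fun_diff_def)
      ultimately have "(L2.nm (left_regular s (cind K) - cind K))\<^sup>2 < e\<^sup>2" unfolding lr by simp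
      then show ?thesis using e by (simp add: power2_less_imp_less)
    qed
    then show "\<exists>N. open N \<and> 0 \<in> N \<and> (\<forall>s\<in>N. L2.nm (left_regular s (cind K) - cind K) < e)"
      using N by blast
  qed
next
  case (add f g)
  show ?case
  proof (intro allI impI)
    fix e :: real assume e: "0 < e"
    obtain N1 N2 where N: "open N1" "0 \<in> N1" "\<And>s. s \<in> N1 \<Longrightarrow> L2.nm (left_regular s f - f) < e / 2"
      "open N2" "0 \<in> N2" "\<And>s. s \<in> N2 \<Longrightarrow> L2.nm (left_regular s g - g) < e / 2"
      using add(3)[rule_format, OF half_gt_zero[OF e]] add(4)[rule_format, OF half_gt_zero[OF e]] by blast
    have "L2.nm (left_regular s (\<lambda>x. f x + g x) - (\<lambda>x. f x + g x)) < e" if "s \<in> N1 \<inter> N2" for s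
    proof -
      have "left_regular s (\<lambda>x. f x + g x) - (\<lambda>x. f x + g x) = (left_regular s f - f) + (left_regular s g - g)"
        by (auto simp: left_regular_def fun_eq_iff)
      then have "L2.nm (left_regular s (\<lambda>x. f x + g x) - (\<lambda>x. f x + g x))
          \<le> L2.nm (left_regular s f - f) + L2.nm (left_regular s g - g)"
        using add(1,2) by (simp only:) (intro L2.nm_add L2.diff_mem left_regular_L2)
      then show ?thesis using N(3)[of s] N(6)[of s] that by simp
    qed
    then show "\<exists>N. open N \<and> 0 \<in> N \<and> (\<forall>s\<in>N. L2.nm (left_regular s (\<lambda>x. f x + g x) - (\<lambda>x. f x + g x)) < e)"
      using N by (intro exI[of _ "N1 \<inter> N2"]) auto
  qed
next
  case (scale c f)
  show ?case
  proof (intro allI impI)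
    fix e :: real assume e: "0 < e"
    have "0 < e / (cmod c + 1)" using e by (intro divide_pos_pos) (auto intro: add_nonneg_pos)
    from scale(2)[rule_format, OF this]
    obtain N where N: "open N" "0 \<in> N" "\<And>s. s \<in> N \<Longrightarrow> L2.nm (left_regular s f - f) < e / (cmod c + 1)"
      by blast
    have "L2.nm (left_regular s (\<lambda>x. c * f x) - (\<lambda>x. c * f x)) < e" if "s \<in> N" for s
    proof -
      have eq: "left_regular s (\<lambda>x. c * f x) - (\<lambda>x. c * f x) = (\<lambda>x. c * (left_regular s f - f) x)"
        by (auto simp: left_regular_def fun_eq_iff right_diff_distrib)
      have d: "left_regular s f - f \<in> L2 \<mu>" using scale(1) by (intro L2.diff_mem left_regular_L2)
      have "L2.nm (left_regular s (\<lambda>x. c * f x) - (\<lambda>x. c * f x)) = cmod c * L2.nm (left_regular s f - f)"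
        unfolding eq by (rule nm_cmult[OF d])
      also have "\<dots> \<le> (cmod c + 1) * L2.nm (left_regular s f - f)"
        using L2.nm_nonneg[OF d] by (intro mult_right_mono) auto
      also have "\<dots> < e" using N(3)[OF that] by (simp add: pos_less_divide_eq add_nonneg_pos mult.commute)
      finally show ?thesis .
    qed
    then show "\<exists>N. open N \<and> 0 \<in> N \<and> (\<forall>s\<in>N. L2.nm (left_regular s (\<lambda>x. c * f x) - (\<lambda>x. c * f x)) < e)"
      using N by blast
  qed
next
  case (limit f X)
  show ?case
  proof (intro allI impI)
    fix e :: real assume e: "0 < e"
    have "\<forall>\<^sub>F n in sequentially. L2.nm (X n - f) < e / 3"
      using L2_tendsto_nm[OF limit(4)] e by (intro order_tendstoD) auto
    then obtain n where n: "L2.nm (X n - f) < e / 3" by (auto simp: eventually_sequentially)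
    have "0 < e / 3" using e by simp
    from limit(3)[rule_format, OF this, of n]
    obtain N where N: "open N" "0 \<in> N" "\<And>s. s \<in> N \<Longrightarrow> L2.nm (left_regular s (X n) - X n) < e / 3"
      by blast
    have "L2.nm (left_regular s f - f) < e" if "s \<in> N" for s
    proof -
      note mem = limit(1) limit(2)[of n] left_regular_L2[OF limit(1), of s] left_regular_L2[OF limit(2), of s n]
      have "L2.nm (left_regular s f - f) \<le> L2.nm (left_regular s f - left_regular s (X n)) + L2.nm (left_regular s (X n) - f)"
        by (intro L2.nm_diff_triangle mem)
      also have "L2.nm (left_regular s (X n) - f) \<le> L2.nm (left_regular s (X n) - X n) + L2.nm (X n - f)"
        by (intro L2.nm_diff_triangle mem)
      also have "left_regular s f - left_regular s (X n) = left_regular s (f - X n)"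
        by (auto simp: left_regular_def)
      also have "L2.nm (left_regular s (f - X n)) = L2.nm (X n - f)"
        using mem by (simp add: nm_left_regular L2.diff_mem L2.nm_minus_commute)
      finally show ?thesis using n N(3)[OF that] by linarith
    qed
    then show "\<exists>N. open N \<and> 0 \<in> N \<and> (\<forall>s\<in>N. L2.nm (left_regular s f - f) < e)" using N by blast
  qed
qed

lemma continuous_inner_left_regular:
  assumes g: "g \<in> L2 \<mu>" and f: "f \<in> L2 \<mu>"
  shows "continuous_on UNIV (\<lambda>s. L2_inner \<mu> g (left_regular s f))"
  unfolding continuous_on_eq_continuous_at[OF open_UNIV]
proof
  fix s0 :: 'a
  show "isCont (\<lambda>s. L2_inner \<mu> g (left_regular s f)) s0"
    unfolding isCont_def tendsto_iff
  proof (intro allI impI)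
    fix e :: real assume e: "0 < e"
    have pos: "0 < L2.nm g + 1" using L2.nm_nonneg[OF g] by simp
    have "0 < e / (L2.nm g + 1)" using e pos by simp
    from left_regular_continuous_at_0[OF f, rule_format, OF this]
    obtain N where N: "open N" "0 \<in> N" "\<And>s. s \<in> N \<Longrightarrow> L2.nm (left_regular s f - f) < e / (L2.nm g + 1)"
      by blast
    have "dist (L2_inner \<mu> g (left_regular s f)) (L2_inner \<mu> g (left_regular s0 f)) < e"
      if s: "s \<in> (\<lambda>t. s0 + t) ` N" for s
    proof -
      note mem = left_regular_L2[OF f, of s] left_regular_L2[OF f, of s0]
      define d where "d = left_regular s f - left_regular s0 f"
      have d: "d \<in> L2 \<mu>" unfolding d_def by (intro L2.diff_mem mem)
      have "left_regular s f = (\<lambda>x. d x + left_regular s0 f x)" by (simp add: d_def fun_eq_iff)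
      then have "cnj (L2_inner \<mu> g (left_regular s f)) = L2_inner \<mu> d g + L2_inner \<mu> (left_regular s0 f) g"
        using L2_inner_add_left[OF d mem(2) g] by (simp add: L2_inner_cnj)
      then have "L2_inner \<mu> d g = cnj (L2_inner \<mu> g (left_regular s f) - L2_inner \<mu> g (left_regular s0 f))"
        by (simp add: L2_inner_cnj)
      then have "dist (L2_inner \<mu> g (left_regular s f)) (L2_inner \<mu> g (left_regular s0 f)) = cmod (L2_inner \<mu> d g)"
        by (simp only: dist_norm complex_mod_cnj)
      also have "\<dots> \<le> L2.nm d * L2.nm g" using L2_Cauchy_Schwarz[OF d g] by (simp add: L2.nm_def)
      also have "\<dots> \<le> L2.nm d * (L2.nm g + 1)" using L2.nm_nonneg[OF d] by (intro mult_left_mono) auto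
      also have "L2.nm d = L2.nm (left_regular (- s0 + s) f - f)"
      proof -
        have "left_regular s0 (left_regular (- s0 + s) f - f)
            = left_regular s0 (left_regular (- s0 + s) f) - left_regular s0 f"
          by (simp add: left_regular_def fun_eq_iff)
        then have "d = left_regular s0 (left_regular (- s0 + s) f - f)"
          by (simp only: left_regular_left_regular add_minus_cancel d_def)
        then show ?thesis using f by (simp add: nm_left_regular L2.diff_mem left_regular_L2)
      qed
      also have "- s0 + s \<in> N" using s by auto
      then have "L2.nm (left_regular (- s0 + s) f - f) * (L2.nm g + 1) < e"
        using N(3) pos by (simp add: pos_less_divide_eq)
      finally show ?thesis .
    qed
    moreover have "open ((\<lambda>t. s0 + t) ` N)" "s0 \<in> (\<lambda>t. s0 + t) ` N"
      using open_translate[OF N(1), of s0] N(2) by (auto simp: image_iff intro!: bexI[of _ 0])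
    ultimately show "\<forall>\<^sub>F s in at s0. dist (L2_inner \<mu> g (left_regular s f)) (L2_inner \<mu> g (left_regular s0 f)) < e"
      unfolding eventually_at_topological by blast
  qed
qed

end

section \<open>Right bounded vectors\<close>

context haar
begin

lemma compact_support_approx:
  assumes f: "f \<in> L2 \<mu>"
  shows "\<forall>e>0. \<exists>g K. g \<in> L2 \<mu> \<and> compact K \<and> (\<forall>x. x \<notin> K \<longrightarrow> g x = 0) \<and> L2.nm (g - f) < e"
  using f
proof (induct rule: haar_L2_induct)
  case (compact K)
  have "L2.nm (cind K - cind K) = 0" by (simp add: L2.nm_def L2_ip_self)
  moreover have "\<forall>x. x \<notin> K \<longrightarrow> cind K x = 0" by (simp add: cind_def)
  ultimately show ?case using compact compact_L2[OF compact] by metis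
next
  case (add f g)
  show ?case
  proof (intro allI impI)
    fix e :: real assume e: "0 < e"
    obtain f' K where f': "f' \<in> L2 \<mu>" "compact K" "\<forall>x. x \<notin> K \<longrightarrow> f' x = 0" "L2.nm (f' - f) < e / 2"
      using add(3)[rule_format, OF half_gt_zero[OF e]] by blast
    obtain g' L where g': "g' \<in> L2 \<mu>" "compact L" "\<forall>x. x \<notin> L \<longrightarrow> g' x = 0" "L2.nm (g' - g) < e / 2"
      using add(4)[rule_format, OF half_gt_zero[OF e]] by blast
    have "(f' + g') - (\<lambda>x. f x + g x) = (f' - f) + (g' - g)" by (simp add: fun_eq_iff)
    then have "L2.nm ((f' + g') - (\<lambda>x. f x + g x)) \<le> L2.nm (f' - f) + L2.nm (g' - g)"
      using add(1,2) f'(1) g'(1) by (simp only:) (intro L2.nm_add L2.diff_mem)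
    then have "L2.nm ((f' + g') - (\<lambda>x. f x + g x)) < e" using f'(4) g'(4) by linarith
    then show "\<exists>h K. h \<in> L2 \<mu> \<and> compact K \<and> (\<forall>x. x \<notin> K \<longrightarrow> h x = 0) \<and> L2.nm (h - (\<lambda>x. f x + g x)) < e"
      using f' g' L2.add_mem[OF f'(1) g'(1)] by (intro exI[of _ "f' + g'"] exI[of _ "K \<union> L"]) (auto intro: compact_Un)
  qed
next
  case (scale c f)
  show ?case
  proof (intro allI impI)
    fix e :: real assume e: "0 < e"
    have "0 < e / (cmod c + 1)" using e by (intro divide_pos_pos) (auto intro: add_nonneg_pos)
    from scale(2)[rule_format, OF this]
    obtain g K where g: "g \<in> L2 \<mu>" "compact K" "\<forall>x. x \<notin> K \<longrightarrow> g x = 0" "L2.nm (g - f) < e / (cmod c + 1)"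
      by blast
    have d: "g - f \<in> L2 \<mu>" using g(1) scale(1) by (rule L2.diff_mem)
    have "(\<lambda>x. c * g x) - (\<lambda>x. c * f x) = (\<lambda>x. c * (g - f) x)" by (simp add: fun_eq_iff right_diff_distrib)
    then have "L2.nm ((\<lambda>x. c * g x) - (\<lambda>x. c * f x)) = cmod c * L2.nm (g - f)"
      by (simp only: nm_cmult[OF d])
    also have "\<dots> \<le> (cmod c + 1) * L2.nm (g - f)"
      using L2.nm_nonneg[OF d] by (intro mult_right_mono) auto
    also have "\<dots> < e" using g(4) by (simp add: pos_less_divide_eq add_nonneg_pos mult.commute)
    finally show "\<exists>h K. h \<in> L2 \<mu> \<and> compact K \<and> (\<forall>x. x \<notin> K \<longrightarrow> h x = 0) \<and> L2.nm (h - (\<lambda>x. c * f x)) < e"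
      using g L2_scale[OF g(1), of c] by (intro exI[of _ "\<lambda>x. c * g x"] exI[of _ K]) auto
  qed
next
  case (limit f X)
  show ?case
  proof (intro allI impI)
    fix e :: real assume e: "0 < e"
    have "\<forall>\<^sub>F n in sequentially. L2.nm (X n - f) < e / 2"
      using L2_tendsto_nm[OF limit(4)] e by (intro order_tendstoD) auto
    then obtain n where n: "L2.nm (X n - f) < e / 2" by (auto simp: eventually_sequentially)
    obtain g K where g: "g \<in> L2 \<mu>" "compact K" "\<forall>x. x \<notin> K \<longrightarrow> g x = 0" "L2.nm (g - X n) < e / 2"
      using limit(3)[rule_format, OF half_gt_zero[OF e], of n] by blast
    have "L2.nm (g - f) \<le> L2.nm (g - X n) + L2.nm (X n - f)"
      by (intro L2.nm_diff_triangle g limit)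
    then have "L2.nm (g - f) < e" using g(4) n by linarith
    then show "\<exists>g K. g \<in> L2 \<mu> \<and> compact K \<and> (\<forall>x. x \<notin> K \<longrightarrow> g x = 0) \<and> L2.nm (g - f) < e"
      using g by blast
  qed
qed

lemma packing_bound:
  assumes F: "finite F" and disj: "disjoint_family_on (\<lambda>s. (\<lambda>t. s + t) ` U) F"
    and U: "open U" and B: "compact B" and sub: "\<And>s. s \<in> F \<Longrightarrow> (\<lambda>t. s + t) ` U \<subseteq> B"
  shows "real (card F) * measure \<mu> U \<le> measure \<mu> B"
proof -
  have fB: "B \<in> fmeasurable \<mu>" using B by (intro fmeasurableI) (auto simp: compact_borel compact_finite[unfolded infinity_ennreal_def])
  have sU: "(\<lambda>t. s + t) ` U \<in> sets \<mu>" for s using open_translate[OF U] by simp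
  have mU: "measure \<mu> ((\<lambda>t. s + t) ` U) = measure \<mu> U" for s
    using emeasure_translate[of U s] U by (simp add: measure_def)
  have "real (card F) * measure \<mu> U = (\<Sum>s\<in>F. measure \<mu> ((\<lambda>t. s + t) ` U))" by (simp add: mU)
  also have "\<dots> = measure \<mu> (\<Union>s\<in>F. (\<lambda>t. s + t) ` U)"
  proof (rule measure_finite_Union[symmetric, OF F _ disj])
    show "(\<lambda>s. (\<lambda>t. s + t) ` U) ` F \<subseteq> sets \<mu>" using sU by auto
    fix s assume "s \<in> F"
    then have "emeasure \<mu> ((\<lambda>t. s + t) ` U) \<le> emeasure \<mu> B" using sub B by (intro emeasure_mono) (auto simp: compact_borel)
    then show "emeasure \<mu> ((\<lambda>t. s + t) ` U) \<noteq> \<infinity>" using compact_finite[OF B] by (auto simp: top_unique)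
  qed
  also have "\<dots> \<le> measure \<mu> B" 
    using sub sU F by (intro measure_mono_fmeasurable fB sets.finite_UN) auto
  finally show ?thesis .
qed

text \<open>As a function of \<open>s\<close> this is \<open>g\<close> convolved with the involuted
  \<open>\<alpha>\<close>. The vector \<open>\<alpha>\<close> is right bounded when this depends
  boundedly on \<open>g\<close> in the L2 norm.\<close>

definition matrix_coeff :: "('a \<Rightarrow> complex) \<Rightarrow> ('a \<Rightarrow> complex) \<Rightarrow> 'a \<Rightarrow> complex" where
  "matrix_coeff \<alpha> g s = L2_inner \<mu> g (left_regular s \<alpha>)"

lemma matrix_coeff_local:
  assumes \<alpha>: "\<alpha> \<in> L2 \<mu>" and g: "g \<in> L2 \<mu>" and D: "D \<in> sets borel"
    and supp: "\<And>x. \<alpha> (- s + x) \<noteq> 0 \<Longrightarrow> x \<in> D"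
  shows "ennreal ((cmod (matrix_coeff \<alpha> g s))\<^sup>2)
    \<le> ennreal (L2_ip \<mu> \<alpha> \<alpha>) * (\<integral>\<^sup>+x. ennreal ((cmod (g x))\<^sup>2) * indicator D x \<partial>\<mu>)"
proof -
  define g' where "g' x = g x * indicator D x" for x
  have gm: "g' \<in> borel_measurable \<mu>" unfolding g'_def using L2D(1)[OF g] D by measurable
  have g': "g' \<in> L2 \<mu>"
    by (rule L2_bound[OF gm L2D(2)[OF g]]) (auto simp: g'_def indicator_def)
  have "g x * cnj (\<alpha> (- s + x)) = g' x * cnj (\<alpha> (- s + x))" for x
    using supp[of x] by (cases "\<alpha> (- s + x) = 0") (auto simp: g'_def)
  then have "matrix_coeff \<alpha> g s = L2_inner \<mu> g' (left_regular s \<alpha>)"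
    by (simp only: matrix_coeff_def L2_inner_def left_regular_def)
  then have "(cmod (matrix_coeff \<alpha> g s))\<^sup>2 \<le> (sqrt (L2_ip \<mu> g' g') * sqrt (L2_ip \<mu> \<alpha> \<alpha>))\<^sup>2"
    using L2_Cauchy_Schwarz[OF g' left_regular_L2[OF \<alpha>, of s]] \<alpha> by (intro power_mono) (simp_all add: L2_ip_left_regular)
  also have "\<dots> = L2_ip \<mu> \<alpha> \<alpha> * L2_ip \<mu> g' g'"
    using L2.ip_nonneg[OF g'] L2.ip_nonneg[OF \<alpha>] by (simp add: power_mult_distrib)
  finally have "ennreal ((cmod (matrix_coeff \<alpha> g s))\<^sup>2) \<le> ennreal (L2_ip \<mu> \<alpha> \<alpha>) * ennreal (L2_ip \<mu> g' g')"
    using L2.ip_nonneg[OF g'] L2.ip_nonneg[OF \<alpha>] by (simp add: ennreal_mult[symmetric] ennreal_leI)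
  also have "ennreal (L2_ip \<mu> g' g') = (\<integral>\<^sup>+x. ennreal ((cmod (g' x))\<^sup>2) \<partial>\<mu>)" by (rule nn_integral_L2[OF g', symmetric])
  also have "\<dots> = (\<integral>\<^sup>+x. ennreal ((cmod (g x))\<^sup>2) * indicator D x \<partial>\<mu>)"
    by (intro nn_integral_cong) (auto simp: g'_def indicator_def)
  finally show ?thesis .
qed

lemma matrix_coeff_measurable:
  assumes "\<alpha> \<in> L2 \<mu>" "g \<in> L2 \<mu>" shows "matrix_coeff \<alpha> g \<in> borel_measurable \<mu>"
proof -
  have "matrix_coeff \<alpha> g \<in> borel_measurable borel"
    using continuous_inner_left_regular[OF assms(2,1)] unfolding matrix_coeff_def[abs_def]
    by (rule borel_measurable_continuous_onI)
  then show ?thesis by (simp cong: measurable_cong_sets)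
qed

text \<open>No measurability of \<open>(s, x) \<mapsto> s + x\<close> for the product \<open>\<sigma>\<close>-algebra is available here, so instead
  of Fubini's theorem the bound uses a covering by translates \<open>j + C\<close> whose enlargements have
  bounded overlap; the overlap is controlled by packing disjoint translates of \<open>U\<close>.\<close>

lemma matrix_coeff_bound_compact:
  assumes \<alpha>: "\<alpha> \<in> L2 \<mu>" and L: "compact L" and supp: "\<And>x. x \<notin> L \<Longrightarrow> \<alpha> x = 0"
  shows "\<exists>r\<ge>0. \<forall>Q g. compact Q \<longrightarrow> g \<in> L2 \<mu> \<longrightarrow>
    (\<integral>\<^sup>+s. ennreal ((cmod (matrix_coeff \<alpha> g s))\<^sup>2) * indicator Q s \<partial>\<mu>) \<le> ennreal (r * L2_ip \<mu> g g)"
proof -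
  obtain U0 C where UC: "open U0" "compact C" "(0::'a) \<in> U0" "U0 \<subseteq> C" by (rule compact_neighbourhood)
  have "open ((\<lambda>p. fst p - snd p) -` U0 :: ('a \<times> 'a) set)"
    by (rule open_vimage[OF UC(1)]) (unfold diff_conv_add_uminus, intro continuous_intros)
  moreover have "(0, 0) \<in> (\<lambda>p. fst p - snd p) -` U0" using UC(3) by simp
  ultimately obtain A B where AB: "open A" "open B" "(0, 0) \<in> A \<times> B" "A \<times> B \<subseteq> (\<lambda>p. fst p - snd p) -` U0"
    by (rule open_prod_elim)
  \<comment> \<open>Differences of \<open>U\<close> lie in \<open>C\<close>. So if
    \<open>q + U\<close> meets \<open>j + U\<close>, then \<open>q\<close> lies in
    \<open>j + C\<close>, and a maximal packing by translates of \<open>U\<close> yields a covering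
    by translates of \<open>C\<close>.\<close>
  define U where "U = A \<inter> B"
  have U: "open U" "0 \<in> U" using AB by (auto simp: U_def)
  have UU: "u - u' \<in> U0" if "u \<in> U" "u' \<in> U" for u u'
    using that AB(4) by (auto simp: U_def)
  have UsubC: "U \<subseteq> C" using UU[OF _ U(2)] UC(4) by auto
  have "emeasure \<mu> U \<le> emeasure \<mu> C" using UsubC UC(2) by (intro emeasure_mono) (auto simp: compact_borel)
  then have "emeasure \<mu> U \<noteq> top" using compact_finite[OF UC(2)] by (auto simp: top_unique)
  then have mU: "0 < measure \<mu> U"
    using emeasure_open_pos[OF U(1)] U(2) by (auto simp: zero_less_measure_iff emeasure_eq_ennreal_measure)
  define D where "D = {a + b | a b. a \<in> C \<and> b \<in> L}"
  have D: "compact D" unfolding D_def using UC(2) L by (rule compact_plus)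
  define T where "T = {a + b | a b. a \<in> uminus ` D \<and> b \<in> C}"
  have T: "compact T" unfolding T_def by (intro compact_plus compact_uminus D UC)
  \<comment> \<open>If \<open>x\<close> lies in \<open>j + D\<close>, then \<open>j + U\<close> lies
    in \<open>x + T\<close>. As the sets \<open>j + U\<close> are disjoint, at most
    \<open>N0\<close> indices \<open>j\<close> occur. Neither \<open>N0\<close> nor \<open>r\<close>
    depends on \<open>Q\<close> or \<open>g\<close>, so \<open>Q\<close> can be removed
    afterwards.\<close>
  define N0 where "N0 = measure \<mu> T / measure \<mu> U"
  define r where "r = measure \<mu> C * L2_ip \<mu> \<alpha> \<alpha> * N0"
  have N0: "0 \<le> N0" using mU by (simp add: N0_def)
  have r0: "0 \<le> r" using L2.ip_nonneg[OF \<alpha>] N0 by (simp add: r_def)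
  have "(\<integral>\<^sup>+s. ennreal ((cmod (matrix_coeff \<alpha> g s))\<^sup>2) * indicator Q s \<partial>\<mu>) \<le> ennreal (r * L2_ip \<mu> g g)"
    if Q: "compact Q" and g: "g \<in> L2 \<mu>" for Q g
  proof -
    define P where "P F \<longleftrightarrow> finite F \<and> F \<subseteq> Q \<and> disjoint_family_on (\<lambda>s. (\<lambda>t. s + t) ` U) F" for F
    define B where "B = {a + b | a b. a \<in> Q \<and> b \<in> C}"
    have B: "compact B" unfolding B_def using Q UC(2) by (rule compact_plus)
    have bound: "card F \<le> nat \<lceil>measure \<mu> B / measure \<mu> U\<rceil>" if "P F" for F
    proof -
      have "real (card F) * measure \<mu> U \<le> measure \<mu> B"
        using that UsubC by (intro packing_bound[OF _ _ U(1) B]) (auto simp: P_def B_def)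
      then have "real (card F) \<le> measure \<mu> B / measure \<mu> U" using mU by (simp add: pos_le_divide_eq)
      then show ?thesis by linarith
    qed
    have P0: "P {}" by (simp add: P_def disjoint_family_on_def)
    \<comment> \<open>A packing of largest size exists, since every packing lies in the compact set
      \<open>B\<close>.\<close>
    have "\<exists>F. P F \<and> (\<forall>F'. P F' \<longrightarrow> card F' \<le> card F)"
      by (rule ex_has_greatest_nat[of P "{}" card "Suc (nat \<lceil>measure \<mu> B / measure \<mu> U\<rceil>)", OF P0])
        (use bound in \<open>simp add: le_imp_less_Suc le_SucI\<close>)
    then obtain F where F: "P F" and max: "\<And>F'. P F' \<Longrightarrow> card F' \<le> card F" by blast
    have finF: "finite F" and FQ: "F \<subseteq> Q" and disjF: "disjoint_family_on (\<lambda>s. (\<lambda>t. s + t) ` U) F"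
      using F by (auto simp: P_def)
    have cover: "\<exists>j\<in>F. - j + q \<in> C" if q: "q \<in> Q" for q
    proof (cases "q \<in> F")
      case True
      then show ?thesis using UC by (intro bexI[of _ q]) auto
    next
      case False
      then have "\<not> P (insert q F)" using max[of "insert q F"] finF by auto
      then have "\<not> disjoint_family_on (\<lambda>s. (\<lambda>t. s + t) ` U) (insert q F)"
        using q finF FQ by (simp add: P_def)
      then obtain j where j: "j \<in> F" "(\<lambda>t. j + t) ` U \<inter> (\<lambda>t. q + t) ` U \<noteq> {}"
        using disjF unfolding disjoint_family_on_def by (auto simp: Int_commute)
      then obtain u u' where "u \<in> U" "u' \<in> U" "j + u = q + u'" by auto
      then have "- j + q = u - u'"
        by (metis add_diff_cancel add.assoc minus_add_cancel add_diff_eq)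
      then have "- j + q \<in> U0" by (simp only: UU[OF \<open>u \<in> U\<close> \<open>u' \<in> U\<close>])
      then show ?thesis using UC(4) j(1) by blast
    qed
    define Cj Dj where "Cj j = (\<lambda>t. j + t) ` C" and "Dj j = (\<lambda>t. j + t) ` D" for j
    have cpt: "compact (Cj j)" "compact (Dj j)" for j
      unfolding Cj_def Dj_def by (intro compact_continuous_image continuous_translate UC D)+
    have bor [measurable]: "Cj j \<in> sets borel" "Dj j \<in> sets borel" for j using cpt by (auto intro: compact_borel)
    have loc: "ennreal ((cmod (matrix_coeff \<alpha> g s))\<^sup>2)
        \<le> ennreal (L2_ip \<mu> \<alpha> \<alpha>) * (\<integral>\<^sup>+x. ennreal ((cmod (g x))\<^sup>2) * indicator (Dj j) x \<partial>\<mu>)" if s: "s \<in> Cj j" for s j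
    proof (rule matrix_coeff_local[OF \<alpha> g bor(2)])
      fix x assume "\<alpha> (- s + x) \<noteq> 0"
      then have l: "- s + x \<in> L" using supp by blast
      obtain c where c: "s = j + c" "c \<in> C" using s by (auto simp: Cj_def)
      have "x = j + (c + (- s + x))" unfolding c(1) by (simp add: add.assoc minus_add del: add_uminus_conv_diff)
      then show "x \<in> Dj j" using l c(2) unfolding Dj_def D_def by blast
    qed
    note hm [measurable] = matrix_coeff_measurable[OF \<alpha> g]
    note gm [measurable] = L2D(1)[OF g]
    let ?h = "\<lambda>s. ennreal ((cmod (matrix_coeff \<alpha> g s))\<^sup>2)" and ?g = "\<lambda>x. ennreal ((cmod (g x))\<^sup>2)"
    let ?a = "ennreal (L2_ip \<mu> \<alpha> \<alpha>)" and ?c = "ennreal (measure \<mu> C)"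
    have mC: "emeasure \<mu> (Cj j) = ?c" for j
      using emeasure_translate[of C j] compact_borel[OF UC(2)] compact_finite[OF UC(2)]
      by (simp add: Cj_def emeasure_eq_ennreal_measure less_top)
    have "(\<integral>\<^sup>+s. ?h s * indicator Q s \<partial>\<mu>) \<le> (\<integral>\<^sup>+s. (\<Sum>j\<in>F. ?h s * indicator (Cj j) s) \<partial>\<mu>)"
    proof (rule nn_integral_mono)
      fix s
      show "?h s * indicator Q s \<le> (\<Sum>j\<in>F. ?h s * indicator (Cj j) s)"
      proof (cases "s \<in> Q")
        case True
        then obtain j where j: "j \<in> F" "- j + s \<in> C" using cover by blast
        then have "s \<in> Cj j" unfolding Cj_def by (metis add_minus_cancel image_eqI)
        then have "?h s * indicator Q s = ?h s * indicator (Cj j) s" using True by simp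
        also have "\<dots> \<le> (\<Sum>j\<in>F. ?h s * indicator (Cj j) s)" using j(1) finF by (intro member_le_sum) auto
        finally show ?thesis .
      qed simp
    qed
    also have "\<dots> = (\<Sum>j\<in>F. \<integral>\<^sup>+s. ?h s * indicator (Cj j) s \<partial>\<mu>)"
      by (rule nn_integral_sum) measurable
    also have "\<dots> \<le> (\<Sum>j\<in>F. \<integral>\<^sup>+s. (?a * (\<integral>\<^sup>+x. ?g x * indicator (Dj j) x \<partial>\<mu>)) * indicator (Cj j) s \<partial>\<mu>)"
      by (intro sum_mono nn_integral_mono) (use loc in \<open>auto simp: indicator_def\<close>)
    also have "\<dots> = (\<Sum>j\<in>F. ?c * ?a * (\<integral>\<^sup>+x. ?g x * indicator (Dj j) x \<partial>\<mu>))"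
      using bor by (intro sum.cong refl, subst nn_integral_cmult_indicator) (simp, simp only: mC mult_ac)
    also have "\<dots> = ?c * ?a * (\<integral>\<^sup>+x. (\<Sum>j\<in>F. ?g x * indicator (Dj j) x) \<partial>\<mu>)"
      by (subst nn_integral_sum) (measurable, simp add: sum_distrib_left)
    also have "\<dots> \<le> ?c * ?a * (\<integral>\<^sup>+x. ennreal N0 * ?g x \<partial>\<mu>)"
    proof (intro mult_left_mono nn_integral_mono)
      fix x
      \<comment> \<open>The centres whose enlarged translate contains \<open>x\<close>; their number
        is the overlap at \<open>x\<close>.\<close>
      define F' where "F' = {j \<in> F. x \<in> Dj j}"
      have "real (card F') * measure \<mu> U \<le> measure \<mu> ((\<lambda>t. x + t) ` T)"
      proof (rule packing_bound[OF _ _ U(1)])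
        show "finite F'" using finF by (simp add: F'_def)
        show "disjoint_family_on (\<lambda>s. (\<lambda>t. s + t) ` U) F'"
          using disjF by (rule disjoint_family_on_mono[rotated]) (auto simp: F'_def)
        show "compact ((\<lambda>t. x + t) ` T)" by (intro compact_continuous_image continuous_translate T)
        fix j assume "j \<in> F'"
        then obtain d where d: "d \<in> D" "x = j + d" by (auto simp: F'_def Dj_def)
        show "(\<lambda>t. j + t) ` U \<subseteq> (\<lambda>t. x + t) ` T"
        proof
          fix y assume "y \<in> (\<lambda>t. j + t) ` U"
          then obtain u where u: "u \<in> U" "y = j + u" by auto
          have "y = x + (- d + u)" unfolding d(2) u(2) by (simp add: add.assoc)
          moreover have "- d + u \<in> T" using d(1) u(1) UsubC unfolding T_def by blast
          ultimately show "y \<in> (\<lambda>t. x + t) ` T" by blast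
        qed
      qed
      also have "measure \<mu> ((\<lambda>t. x + t) ` T) = measure \<mu> T"
        using emeasure_translate[of T x] compact_borel[OF T] by (simp add: measure_def)
      finally have "real (card F') \<le> N0" using mU by (simp add: N0_def pos_le_divide_eq)
      moreover have "(\<Sum>j\<in>F. ?g x * indicator (Dj j) x) = of_nat (card F') * ?g x"
      proof -
        have "(\<Sum>j\<in>F. ?g x * indicator (Dj j) x) = (\<Sum>j\<in>F. if x \<in> Dj j then ?g x else 0)"
          by (intro sum.cong) (auto simp: indicator_def)
        also have "\<dots> = (\<Sum>j\<in>F'. ?g x)" unfolding F'_def using finF by (simp only: sum.inter_filter)
        finally show ?thesis by simp
      qed
      ultimately show "(\<Sum>j\<in>F. ?g x * indicator (Dj j) x) \<le> ennreal N0 * ?g x"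
        by (simp add: ennreal_of_nat_eq_real_of_nat mult_right_mono ennreal_leI)
    qed auto
    also have "\<dots> = ?c * ?a * (ennreal N0 * ennreal (L2_ip \<mu> g g))"
      by (simp add: nn_integral_cmult nn_integral_L2[OF g])
    also have "\<dots> = ennreal (r * L2_ip \<mu> g g)"
      using N0 L2.ip_nonneg[OF \<alpha>] L2.ip_nonneg[OF g] by (simp add: r_def ennreal_mult mult_ac)
    finally show ?thesis .
  qed
  then show ?thesis using r0 by blast
qed

end

section \<open>Countable Hilbert sums and orthogonal complements\<close>

definition dsum :: "'v::real_vector set \<Rightarrow> ('v \<Rightarrow> 'v \<Rightarrow> real) \<Rightarrow> (nat \<Rightarrow> 'v) set" where
  "dsum V ip = {g. (\<forall>n. g n \<in> V) \<and> summable (\<lambda>n. ip (g n) (g n))}"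

definition dsum_ip :: "('v \<Rightarrow> 'v \<Rightarrow> real) \<Rightarrow> (nat \<Rightarrow> 'v) \<Rightarrow> (nat \<Rightarrow> 'v) \<Rightarrow> real" where
  "dsum_ip ip g h = (\<Sum>n. ip (g n) (h n))"

context semi_hilbert
begin

lemma dsumD: "g \<in> dsum V ip \<Longrightarrow> g n \<in> V" "g \<in> dsum V ip \<Longrightarrow> summable (\<lambda>n. ip (g n) (g n))"
  by (auto simp: dsum_def)

lemma ip_le_sum: 
  assumes "x \<in> V" "y \<in> V" shows "\<bar>ip x y\<bar> \<le> ip x x + ip y y"
proof -
  have "\<bar>ip x y\<bar> \<le> nm x * nm y" by (rule ip_Cauchy_Schwarz[OF assms])
  also have "\<dots> \<le> (nm x)\<^sup>2 + (nm y)\<^sup>2"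
    using sum_squares_bound[of "nm x" "nm y"] mult_nonneg_nonneg[OF nm_nonneg[OF assms(1)] nm_nonneg[OF assms(2)]]
    by linarith
  finally show ?thesis using assms by (simp add: nm_power2)
qed

lemma dsum_summable:
  assumes "g \<in> dsum V ip" "h \<in> dsum V ip"
  shows "summable (\<lambda>n. ip (g n) (h n))"
proof (rule summable_comparison_test'[where N = 0])
  show "summable (\<lambda>n. ip (g n) (g n) + ip (h n) (h n))"
    using assms by (intro summable_add dsumD)
  show "norm (ip (g n) (h n)) \<le> ip (g n) (g n) + ip (h n) (h n)" for n
    using ip_le_sum[OF dsumD(1)[OF assms(1)] dsumD(1)[OF assms(2)], of n n] by simp
qed

lemma ip_add_self: "x \<in> V \<Longrightarrow> y \<in> V \<Longrightarrow> ip (x + y) (x + y) \<le> 2 * ip x x + 2 * ip y y"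
  using ip_nonneg[of "x - y"] 
  by (simp add: ip_add_left ip_add_right ip_diff_left ip_diff_right add_mem diff_mem ip_commute[of y x])

lemma subspace_dsum: "subspace (dsum V ip)"
proof (rule subspaceI)
  show "0 \<in> dsum V ip" using zero_mem by (simp add: dsum_def ip_zero_left)
  show "x + y \<in> dsum V ip" if "x \<in> dsum V ip" "y \<in> dsum V ip" for x y
  proof -
    have "summable (\<lambda>n. 2 * ip (x n) (x n) + 2 * ip (y n) (y n))"
      using that by (intro summable_add summable_mult dsumD)
    then have "summable (\<lambda>n. ip (x n + y n) (x n + y n))"
      by (rule summable_comparison_test'[where N = 0])
        (use that in \<open>simp add: ip_add_self dsumD add_mem ip_nonneg\<close>)
    then show ?thesis using that by (simp add: dsum_def add_mem)
  qed
  show "c *\<^sub>R x \<in> dsum V ip" if "x \<in> dsum V ip" for c x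
  proof -
    have "summable (\<lambda>n. (c * c) * ip (x n) (x n))" using that by (intro summable_mult dsumD)
    then show ?thesis using that by (simp add: dsum_def scale_mem ip_scale_left ip_scale_right mult.assoc)
  qed
qed

lemma dsum_complete:
  assumes X: "\<And>m. X m \<in> dsum V ip"
    and C: "\<And>e. 0 < e \<Longrightarrow> \<exists>K. \<forall>m\<ge>K. \<forall>n\<ge>K. dsum_ip ip (X m - X n) (X m - X n) < e"
  shows "\<exists>x\<in>dsum V ip. (\<lambda>m. dsum_ip ip (X m - x) (X m - x)) \<longlonglongrightarrow> 0"
proof -
  note dm = subspace_diff[OF subspace_dsum]
  have XV: "X m n \<in> V" for m n by (rule dsumD[OF X])
  have partial: "(\<Sum>n<N. ip (X m n - X k n) (X m n - X k n)) \<le> dsum_ip ip (X m - X k) (X m - X k)" for N m k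
    unfolding dsum_ip_def using dsumD(2)[OF dm[OF X X], of m k] XV
    by (simp only: fun_diff_def) (rule sum_le_suminf, auto intro: ip_nonneg diff_mem)
  have "\<exists>x\<in>V. conv (\<lambda>m. X m n) x" for n
  proof -
    have "\<exists>K. \<forall>m\<ge>K. \<forall>k\<ge>K. ip (X m n - X k n) (X m n - X k n) < e" if e: "0 < e" for e
    proof -
      obtain K where K: "\<forall>m\<ge>K. \<forall>k\<ge>K. dsum_ip ip (X m - X k) (X m - X k) < e" using C[OF e] by blast
      have "ip (X m n - X k n) (X m n - X k n) \<le> (\<Sum>n<Suc n. ip (X m n - X k n) (X m n - X k n))" for m k
        using XV by (intro member_le_sum) (auto intro: ip_nonneg diff_mem)
      then show ?thesis using partial[of _ _ "Suc n"] K by (meson order_le_less_trans)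
    qed
    then show ?thesis using complete[of "\<lambda>m. X m n"] XV by metis
  qed
  then obtain x where x: "\<And>n. x n \<in> V" "\<And>n. conv (\<lambda>m. X m n) (x n)" by metis
  \<comment> \<open>The Cauchy estimate is passed to the limit on finitely many coordinates first,
    where coordinatewise convergence suffices.\<close>
  have est: "(\<Sum>n<N. ip (X m n - x n) (X m n - x n)) \<le> e"
    if K: "\<forall>m\<ge>K. \<forall>k\<ge>K. dsum_ip ip (X m - X k) (X m - X k) < e" and m: "K \<le> m" for K e m N
  proof (rule LIMSEQ_le_const2)
    have cv: "conv (\<lambda>k. X m n - X k n) (X m n - x n)" for n
    proof -
      have "nm ((X m n - X k n) - (X m n - x n)) = nm (X k n - x n)" for k
        using nm_minus_commute[OF x(1) XV, of n k n] by simp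
      then show ?thesis using x(2)[of n] by (simp add: conv_def)
    qed
    show "(\<lambda>k. \<Sum>n<N. ip (X m n - X k n) (X m n - X k n)) \<longlonglongrightarrow> (\<Sum>n<N. ip (X m n - x n) (X m n - x n))"
      using XV x(1) by (intro tendsto_sum ip_tendsto cv diff_mem) auto
    show "\<exists>k0. \<forall>k\<ge>k0. (\<Sum>n<N. ip (X m n - X k n) (X m n - X k n)) \<le> e"
      using partial[of m _ N] K m by (meson less_imp_le order_trans)
  qed
  have est2: "X m - x \<in> dsum V ip" "dsum_ip ip (X m - x) (X m - x) \<le> e"
    if "\<forall>m\<ge>K. \<forall>k\<ge>K. dsum_ip ip (X m - X k) (X m - X k) < e" "K \<le> m" for K e m
  proof -
    have s: "summable (\<lambda>n. ip (X m n - x n) (X m n - x n))"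
    proof (rule bounded_imp_summable[of _ e])
      show "0 \<le> ip (X m n - x n) (X m n - x n)" for n by (intro ip_nonneg diff_mem XV x(1))
      show "(\<Sum>k\<le>n. ip (X m k - x k) (X m k - x k)) \<le> e" for n
        using est[OF that, of "Suc n"] by (simp only: lessThan_Suc_atMost)
    qed
    then show "X m - x \<in> dsum V ip" using XV x(1) by (simp add: dsum_def diff_mem)
    show "dsum_ip ip (X m - x) (X m - x) \<le> e"
      unfolding dsum_ip_def using suminf_le_const[OF s est[OF that]] by simp
  qed
  obtain K where "\<forall>m\<ge>K. \<forall>k\<ge>K. dsum_ip ip (X m - X k) (X m - X k) < 1" using C[of 1] by auto
  from est2(1)[OF this order_refl] have "X K - x \<in> dsum V ip" .
  then have xd: "x \<in> dsum V ip" using dm[OF X[of K]] by fastforce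
  have "(\<lambda>m. dsum_ip ip (X m - x) (X m - x)) \<longlonglongrightarrow> 0"
  proof (rule LIMSEQ_I)
    fix e :: real assume "0 < e"
    then obtain K where K: "\<forall>m\<ge>K. \<forall>k\<ge>K. dsum_ip ip (X m - X k) (X m - X k) < e / 2"
      using C[of "e / 2"] by auto
    have "norm (dsum_ip ip (X m - x) (X m - x) - 0) < e" if "K \<le> m" for m
    proof -
      have "0 \<le> dsum_ip ip (X m - x) (X m - x)"
        unfolding dsum_ip_def
        by (intro suminf_nonneg dsumD(2)[OF est2(1)[OF K that]] ip_nonneg dsumD(1)[OF est2(1)[OF K that]])
      then show ?thesis using est2(2)[OF K that] \<open>0 < e\<close> by simp
    qed
    then show "\<exists>no. \<forall>n\<ge>no. norm (dsum_ip ip (X n - x) (X n - x) - 0) < e" by blast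
  qed
  then show ?thesis using xd by blast
qed

lemma dsum_semi_hilbert: "semi_hilbert (dsum V ip) (dsum_ip ip)"
proof
  show "subspace (dsum V ip)" by (rule subspace_dsum)
  show "dsum_ip ip x y = dsum_ip ip y x" if "x \<in> dsum V ip" "y \<in> dsum V ip" for x y
    unfolding dsum_ip_def using that by (metis (no_types, lifting) dsumD(1) ip_commute)
  show "dsum_ip ip (x + y) z = dsum_ip ip x z + dsum_ip ip y z"
    if "x \<in> dsum V ip" "y \<in> dsum V ip" "z \<in> dsum V ip" for x y z
  proof -
    have "ip ((x + y) n) (z n) = ip (x n) (z n) + ip (y n) (z n)" for n
      using that by (simp add: ip_add_left dsumD)
    then show ?thesis unfolding dsum_ip_def by (simp add: suminf_add dsum_summable that)
  qed
  show "dsum_ip ip (c *\<^sub>R x) y = c * dsum_ip ip x y" if "x \<in> dsum V ip" "y \<in> dsum V ip" for x y c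
  proof -
    have "ip ((c *\<^sub>R x) n) (y n) = c * ip (x n) (y n)" for n
      using that by (simp add: ip_scale_left dsumD)
    then show ?thesis unfolding dsum_ip_def by (simp add: suminf_mult dsum_summable that)
  qed
  show "0 \<le> dsum_ip ip x x" if "x \<in> dsum V ip" for x
    unfolding dsum_ip_def using that by (intro suminf_nonneg dsumD ip_nonneg)
  show "\<exists>x\<in>dsum V ip. (\<lambda>n. dsum_ip ip (X n - x) (X n - x)) \<longlonglongrightarrow> 0"
    if "\<And>n. X n \<in> dsum V ip"
      "\<And>e. 0 < e \<Longrightarrow> \<exists>K. \<forall>m\<ge>K. \<forall>n\<ge>K. dsum_ip ip (X m - X n) (X m - X n) < e" for X
    using that by (rule dsum_complete)
qed

lemma orthogonal_semi_hilbert: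
  assumes S: "S \<subseteq> V"
  shows "semi_hilbert {k \<in> V. \<forall>h\<in>S. ip k h = 0} ip"
proof
  have SV: "h \<in> V" if "h \<in> S" for h using S that by blast
  show "subspace {k \<in> V. \<forall>h\<in>S. ip k h = 0}"
    by (rule subspaceI) (auto simp: zero_mem add_mem scale_mem SV ip_zero_left ip_add_left ip_scale_left)
  fix X assume X: "\<And>n::nat. X n \<in> {k \<in> V. \<forall>h\<in>S. ip k h = 0}"
    and C: "\<And>e. 0 < e \<Longrightarrow> \<exists>K. \<forall>m\<ge>K. \<forall>n\<ge>K. ip (X m - X n) (X m - X n) < e"
  have XV: "X n \<in> V" for n using X by auto
  obtain x where x: "x \<in> V" "(\<lambda>n. ip (X n - x) (X n - x)) \<longlonglongrightarrow> 0"
    using ip_complete[OF XV C] by blast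
  have cv: "conv X x" using tendsto_real_sqrt[OF x(2)] by (simp add: conv_def nm_def)
  have "ip x h = 0" if "h \<in> S" for h
  proof -
    have "(\<lambda>n. ip (X n) h) \<longlonglongrightarrow> ip x h" by (rule ip_tendsto[OF XV x(1) cv SV[OF that] SV[OF that] conv_const])
    moreover have "(\<lambda>n. ip (X n) h) = (\<lambda>n. 0)" using X that by auto
    ultimately show ?thesis using LIMSEQ_unique[OF _ tendsto_const] by metis
  qed
  then show "\<exists>x\<in>{k \<in> V. \<forall>h\<in>S. ip k h = 0}. (\<lambda>n. ip (X n - x) (X n - x)) \<longlonglongrightarrow> 0"
    using x by blast
qed (auto simp: ip_commute ip_add_left ip_scale_left ip_nonneg)

end

context haar
begin

text \<open>For \<open>g\<close> supported in a compact \<open>K\<close> the coefficient vanishes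
  off the compact set \<open>Q\<close> of all a - b with a in \<open>K\<close>, b in
  \<open>L\<close>, so the preceding local bound is global. General \<open>g\<close> follow by
  approximation and Fatou's lemma, as the coefficients converge pointwise.\<close>

lemma matrix_coeff_bound:
  assumes \<alpha>: "\<alpha> \<in> L2 \<mu>" and L: "compact L" and supp: "\<And>x. x \<notin> L \<Longrightarrow> \<alpha> x = 0"
  shows "\<exists>r\<ge>0. \<forall>g\<in>L2 \<mu>. matrix_coeff \<alpha> g \<in> L2 \<mu> \<and> L2.nm (matrix_coeff \<alpha> g) \<le> r * L2.nm g"
proof -
  obtain r where r: "0 \<le> r" "\<And>Q g. compact Q \<Longrightarrow> g \<in> L2 \<mu> \<Longrightarrow>
    (\<integral>\<^sup>+s. ennreal ((cmod (matrix_coeff \<alpha> g s))\<^sup>2) * indicator Q s \<partial>\<mu>) \<le> ennreal (r * L2_ip \<mu> g g)"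
    using matrix_coeff_bound_compact[OF assms] by blast
  have cpt: "(\<integral>\<^sup>+s. ennreal ((cmod (matrix_coeff \<alpha> g s))\<^sup>2) \<partial>\<mu>) \<le> ennreal (r * L2_ip \<mu> g g)"
    if g: "g \<in> L2 \<mu>" and K: "compact K" and gK: "\<And>x. x \<notin> K \<Longrightarrow> g x = 0" for g K
  proof -
    define Q where "Q = {a + b | a b. a \<in> K \<and> b \<in> uminus ` L}"
    have Q: "compact Q" unfolding Q_def by (intro compact_plus compact_uminus K L)
    have "matrix_coeff \<alpha> g s = 0" if s: "s \<notin> Q" for s
    proof -
      have "g x * cnj (\<alpha> (- s + x)) = 0" for x
      proof (rule ccontr)
        assume "g x * cnj (\<alpha> (- s + x)) \<noteq> 0"
        then have "x \<in> K" "- s + x \<in> L" using gK[of x] supp[of "- s + x"] by auto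
        moreover have "s = x + - (- s + x)" by (simp add: minus_add del: add_uminus_conv_diff)
        ultimately show False using s unfolding Q_def by blast
      qed
      then have "(\<lambda>x. g x * cnj (\<alpha> (- s + x))) = (\<lambda>x. 0)" by blast
      then show ?thesis by (simp only: matrix_coeff_def L2_inner_def left_regular_def Bochner_Integration.integral_zero)
    qed
    then have "(\<integral>\<^sup>+s. ennreal ((cmod (matrix_coeff \<alpha> g s))\<^sup>2) \<partial>\<mu>)
        = (\<integral>\<^sup>+s. ennreal ((cmod (matrix_coeff \<alpha> g s))\<^sup>2) * indicator Q s \<partial>\<mu>)"
      by (intro nn_integral_cong) (auto simp: indicator_def)
    then show ?thesis using r(2)[OF Q g] by simp
  qed
  have gen: "(\<integral>\<^sup>+s. ennreal ((cmod (matrix_coeff \<alpha> g s))\<^sup>2) \<partial>\<mu>) \<le> ennreal (r * L2_ip \<mu> g g)"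
    if g: "g \<in> L2 \<mu>" for g
  proof -
    have "\<exists>f K. f \<in> L2 \<mu> \<and> compact K \<and> (\<forall>x. x \<notin> K \<longrightarrow> f x = 0) \<and> L2.nm (f - g) < inverse (real (Suc n))" for n
      using compact_support_approx[OF g] by simp
    then obtain f K where f: "\<And>n. f n \<in> L2 \<mu>" "\<And>n. compact (K n)" "\<And>n x. x \<notin> K n \<Longrightarrow> f n x = 0"
      "\<And>n. L2.nm (f n - g) < inverse (real (Suc n))" by metis
    have dm: "f n - g \<in> L2 \<mu>" for n by (rule L2.diff_mem[OF f(1) g])
    have lim: "(\<lambda>n. L2.nm (f n - g)) \<longlonglongrightarrow> 0"
    proof (rule tendsto_sandwich[OF _ _ tendsto_const LIMSEQ_inverse_real_of_nat])
      show "\<forall>\<^sub>F n in sequentially. 0 \<le> L2.nm (f n - g)"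
        by (intro always_eventually allI L2.nm_nonneg dm)
      show "\<forall>\<^sub>F n in sequentially. L2.nm (f n - g) \<le> inverse (real (Suc n))"
        by (intro always_eventually allI less_imp_le f(4))
    qed
    have pt: "(\<lambda>n. matrix_coeff \<alpha> (f n) s) \<longlonglongrightarrow> matrix_coeff \<alpha> g s" for s
    proof (rule LIM_zero_cancel, rule Lim_null_comparison)
      show "\<forall>\<^sub>F n in sequentially. norm (matrix_coeff \<alpha> (f n) s - matrix_coeff \<alpha> g s) \<le> L2.nm (f n - g) * L2.nm \<alpha>"
      proof (intro always_eventually allI)
        fix n
        have "f n = (\<lambda>x. (f n - g) x + g x)" by (simp add: fun_eq_iff)
        then have "L2_inner \<mu> (f n) (left_regular s \<alpha>) = L2_inner \<mu> (f n - g) (left_regular s \<alpha>) + L2_inner \<mu> g (left_regular s \<alpha>)"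
          using L2_inner_add_left[OF dm g left_regular_L2[OF \<alpha>], of n s] by (simp only:)
        then have "norm (matrix_coeff \<alpha> (f n) s - matrix_coeff \<alpha> g s) = cmod (L2_inner \<mu> (f n - g) (left_regular s \<alpha>))"
          by (simp add: matrix_coeff_def)
        also have "\<dots> \<le> L2.nm (f n - g) * L2.nm \<alpha>"
          using L2_Cauchy_Schwarz[OF dm left_regular_L2[OF \<alpha>], of n s] \<alpha>
          by (simp add: L2.nm_def L2_ip_left_regular)
        finally show "norm (matrix_coeff \<alpha> (f n) s - matrix_coeff \<alpha> g s) \<le> L2.nm (f n - g) * L2.nm \<alpha>" .
      qed
      show "(\<lambda>n. L2.nm (f n - g) * L2.nm \<alpha>) \<longlonglongrightarrow> 0" using tendsto_mult_right[OF lim, of "L2.nm \<alpha>"] by simp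
    qed
    have ips: "(\<lambda>n. L2_ip \<mu> (f n) (f n)) \<longlonglongrightarrow> L2_ip \<mu> g g"
      using lim f(1) g by (intro L2.ip_tendsto) (auto simp: L2.conv_def)
    have "(\<integral>\<^sup>+s. ennreal ((cmod (matrix_coeff \<alpha> g s))\<^sup>2) \<partial>\<mu>)
        = (\<integral>\<^sup>+s. liminf (\<lambda>n. ennreal ((cmod (matrix_coeff \<alpha> (f n) s))\<^sup>2)) \<partial>\<mu>)"
    proof (rule nn_integral_cong)
      fix s
      have "(\<lambda>n. ennreal ((cmod (matrix_coeff \<alpha> (f n) s))\<^sup>2)) \<longlonglongrightarrow> ennreal ((cmod (matrix_coeff \<alpha> g s))\<^sup>2)"
        by (intro tendsto_intros pt)
      then show "ennreal ((cmod (matrix_coeff \<alpha> g s))\<^sup>2) = liminf (\<lambda>n. ennreal ((cmod (matrix_coeff \<alpha> (f n) s))\<^sup>2))"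
        by (rule lim_imp_Liminf[OF trivial_limit_sequentially, symmetric])
    qed
    also have "\<dots> \<le> liminf (\<lambda>n. \<integral>\<^sup>+s. ennreal ((cmod (matrix_coeff \<alpha> (f n) s))\<^sup>2) \<partial>\<mu>)"
    proof (rule nn_integral_liminf)
      fix n
      note [measurable] = matrix_coeff_measurable[OF \<alpha> f(1), of n]
      show "(\<lambda>s. ennreal ((cmod (matrix_coeff \<alpha> (f n) s))\<^sup>2)) \<in> borel_measurable \<mu>" by measurable
    qed
    also have "\<dots> \<le> liminf (\<lambda>n. ennreal (r * L2_ip \<mu> (f n) (f n)))"
      by (intro Liminf_mono always_eventually allI cpt[OF f(1) f(2)] f(3))
    also have "\<dots> = ennreal (r * L2_ip \<mu> g g)"
      by (intro lim_imp_Liminf trivial_limit_sequentially tendsto_ennrealI tendsto_mult_left ips)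
    finally show ?thesis .
  qed
  have "matrix_coeff \<alpha> g \<in> L2 \<mu> \<and> L2.nm (matrix_coeff \<alpha> g) \<le> sqrt r * L2.nm g" if g: "g \<in> L2 \<mu>" for g
  proof -
    have n: "0 \<le> r * L2_ip \<mu> g g" using r(1) L2.ip_nonneg[OF g] by simp
    note * = L2_nn_integralI[OF matrix_coeff_measurable[OF \<alpha> g] gen[OF g] n]
    show ?thesis using *(1) real_sqrt_le_mono[OF *(2)] by (simp add: L2.nm_def real_sqrt_mult)
  qed
  then show ?thesis using r(1) by (intro exI[of _ "sqrt r"]) auto
qed

end

section \<open>Sums of coefficients of the regular representation\<close>

lemma suminf_half_power: "(\<Sum>n. (1 / 2 :: real) ^ Suc n) = 1"
  using power_half_series by (simp add: sums_iff)

context haar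
begin

sublocale DS: semi_hilbert "dsum (L2 \<mu>) (L2_ip \<mu>)" "dsum_ip (L2_ip \<mu>)"
  by (rule L2.dsum_semi_hilbert)

definition translate_seq :: "'a \<Rightarrow> (nat \<Rightarrow> 'a \<Rightarrow> complex) \<Rightarrow> nat \<Rightarrow> 'a \<Rightarrow> complex" where
  "translate_seq s g n = left_regular s (g n)"

definition cmult :: "complex \<Rightarrow> ('a \<Rightarrow> complex) \<Rightarrow> 'a \<Rightarrow> complex" where
  "cmult c f = (\<lambda>x. c * f x)"

definition cmult_seq :: "complex \<Rightarrow> (nat \<Rightarrow> 'a \<Rightarrow> complex) \<Rightarrow> nat \<Rightarrow> 'a \<Rightarrow> complex" where
  "cmult_seq c g n = cmult c (g n)"

lemma cmult_L2: "f \<in> L2 \<mu> \<Longrightarrow> cmult c f \<in> L2 \<mu>"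
  unfolding cmult_def by (rule L2_scale)

lemma L2_ip_cmult_left: "L2_ip \<mu> (cmult c f) g = L2_ip \<mu> f (cmult (cnj c) g)"
proof -
  have "L2_inner \<mu> (cmult c f) g = L2_inner \<mu> f (cmult (cnj c) g)"
    unfolding L2_inner_def cmult_def by (rule arg_cong[where f = "integral\<^sup>L \<mu>"]) (simp add: fun_eq_iff mult_ac)
  then show ?thesis by (simp add: L2_ip_def)
qed

lemma L2_ip_cmult_cmult: "L2_ip \<mu> (cmult c f) (cmult c f) = (cmod c)\<^sup>2 * L2_ip \<mu> f f"
  by (simp add: L2_ip_self cmult_def norm_mult power_mult_distrib)

lemma translate_seq_mem:
  assumes "g \<in> dsum (L2 \<mu>) (L2_ip \<mu>)" shows "translate_seq s g \<in> dsum (L2 \<mu>) (L2_ip \<mu>)"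
  using L2.dsumD[OF assms] by (simp add: dsum_def translate_seq_def left_regular_L2 L2_ip_left_regular)

lemma cmult_seq_mem:
  assumes "g \<in> dsum (L2 \<mu>) (L2_ip \<mu>)" shows "cmult_seq c g \<in> dsum (L2 \<mu>) (L2_ip \<mu>)"
  using L2.dsumD[OF assms] by (simp add: dsum_def cmult_seq_def cmult_L2 L2_ip_cmult_cmult summable_mult)

lemma dsum_ip_translate:
  assumes "g \<in> dsum (L2 \<mu>) (L2_ip \<mu>)" "h \<in> dsum (L2 \<mu>) (L2_ip \<mu>)"
  shows "dsum_ip (L2_ip \<mu>) (translate_seq s g) h = dsum_ip (L2_ip \<mu>) g (translate_seq (- s) h)"
  unfolding dsum_ip_def translate_seq_def L2_ip_def
  using L2.dsumD(1)[OF assms(1)] L2.dsumD(1)[OF assms(2)] by (simp add: L2_inner_left_regular_adjoint)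

lemma dsum_ip_cmult:
  "dsum_ip (L2_ip \<mu>) (cmult_seq c g) h = dsum_ip (L2_ip \<mu>) g (cmult_seq (cnj c) h)"
  by (simp add: dsum_ip_def cmult_seq_def L2_ip_cmult_left)

lemma translate_seq_translate_seq: "translate_seq s (translate_seq t g) = translate_seq (s + t) g"
  by (simp add: translate_seq_def fun_eq_iff left_regular_left_regular[unfolded fun_eq_iff, rule_format])

lemma translate_seq_cmult_seq: "translate_seq s (cmult_seq c g) = cmult_seq c (translate_seq s g)"
  by (simp add: translate_seq_def cmult_seq_def cmult_def left_regular_def fun_eq_iff)

lemma cmult_seq_cmult_seq: "cmult_seq c (cmult_seq d g) = cmult_seq (c * d) g"
  by (simp add: cmult_seq_def cmult_def fun_eq_iff)

lemma continuous_AE_zero: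
  assumes c: "continuous_on UNIV f" and z: "AE x in \<mu>. f x = (0::complex)"
  shows "f x = 0"
proof -
  have op: "open {x. f x \<noteq> 0}"
    using open_Collect_neq[OF c continuous_on_const] .
  then have "emeasure \<mu> {x. f x \<noteq> 0} = 0"
    using z by (subst (asm) AE_iff_measurable[OF _ refl]) auto
  then show ?thesis using emeasure_open_pos[OF op] by auto
qed

text \<open>A sum of coefficients with right bounded first vectors \<open>\<alpha> n\<close> is a single coefficient: the
  map \<open>W k (s) = \<Sum>\<^sub>n d n \<langle>k n, \<lambda>(s) (\<alpha> n)\<rangle>\<close> embeds the cyclic subspace generated by \<open>\<alpha>\<close> equivariantly
  and injectively into \<open>L\<^sup>2(\<mu>)\<close>, and the isometry of its polar decomposition transports \<open>\<alpha>\<close>.\<close>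

lemma sum_of_coefficients_single:
  assumes \<alpha>: "\<alpha> \<in> dsum (L2 \<mu>) (L2_ip \<mu>)" and \<beta>: "\<beta> \<in> dsum (L2 \<mu>) (L2_ip \<mu>)"
    and supp: "\<And>n. \<exists>L. compact L \<and> (\<forall>x. x \<notin> L \<longrightarrow> \<alpha> n x = 0)"
  shows "\<exists>\<xi>\<in>L2 \<mu>. \<exists>\<eta>\<in>L2 \<mu>. \<forall>s. (\<lambda>n. L2_inner \<mu> (left_regular s (\<alpha> n)) (\<beta> n)) sums L2_inner \<mu> (left_regular s \<xi>) \<eta>"
proof -
  let ?H = "dsum (L2 \<mu>) (L2_ip \<mu>)" and ?ip = "dsum_ip (L2_ip \<mu>)"
  note \<alpha>n = L2.dsumD(1)[OF \<alpha>] and \<beta>n = L2.dsumD(1)[OF \<beta>]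
  \<comment> \<open>Complex multiples are included: orthogonality to \<open>orb\<close> for the real
    inner product is then orthogonality to all translates of \<open>\<alpha>\<close> for the complex
    one.\<close>
  define orb where "orb = {cmult_seq c (translate_seq s \<alpha>) | c s. True}"
  have orbH: "o' \<in> ?H" if "o' \<in> orb" for o' using that \<alpha> by (auto simp: orb_def cmult_seq_mem translate_seq_mem)
  have orb_tr: "translate_seq s o' \<in> orb" if o': "o' \<in> orb" for s o'
  proof -
    obtain c t where "o' = cmult_seq c (translate_seq t \<alpha>)" using o' unfolding orb_def by blast
    then have "translate_seq s o' = cmult_seq c (translate_seq (s + t) \<alpha>)"
      by (simp only: translate_seq_cmult_seq translate_seq_translate_seq)
    then show ?thesis unfolding orb_def by blast
  qed
  have orb_cm: "cmult_seq c o' \<in> orb" if o': "o' \<in> orb" for c o'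
  proof -
    obtain c' t where "o' = cmult_seq c' (translate_seq t \<alpha>)" using o' unfolding orb_def by blast
    then have "cmult_seq c o' = cmult_seq (c * c') (translate_seq t \<alpha>)"
      by (simp only: cmult_seq_cmult_seq)
    then show ?thesis unfolding orb_def by blast
  qed
  define S where "S = {h \<in> ?H. \<forall>o'\<in>orb. ?ip h o' = 0}"
  have SH: "S \<subseteq> ?H" by (auto simp: S_def)
  have S_tr: "translate_seq s h \<in> S" if "h \<in> S" for s h
    using that orb_tr[of _ "- s"] orbH by (auto simp: S_def translate_seq_mem dsum_ip_translate)
  have S_cm: "cmult_seq c h \<in> S" if "h \<in> S" for c h
    using that orb_cm[of _ "cnj c"] by (auto simp: S_def cmult_seq_mem dsum_ip_cmult)
  \<comment> \<open>The closed complex span of the translates, obtained as a double orthogonal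
    complement.\<close>
  define K where "K = {k \<in> ?H. \<forall>h\<in>S. ?ip k h = 0}"
  have KH: "k \<in> ?H" if "k \<in> K" for k using that by (simp add: K_def)
  interpret KK: semi_hilbert K ?ip
    unfolding K_def by (rule DS.orthogonal_semi_hilbert[OF SH])
  have K_tr: "translate_seq s k \<in> K" if "k \<in> K" for s k
    using that S_tr[of _ "- s"] SH by (auto simp: K_def translate_seq_mem dsum_ip_translate)
  have K_cm: "cmult_seq c k \<in> K" if "k \<in> K" for c k
    using that S_cm[of _ "cnj c"] by (auto simp: K_def cmult_seq_mem dsum_ip_cmult)
  have orbK: "o' \<in> K" if "o' \<in> orb" for o'
    using that orbH[OF that] SH DS.ip_commute[OF orbH[OF that]] by (auto simp: K_def S_def)
  have \<alpha>orb: "\<alpha> \<in> orb"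
    unfolding orb_def by (intro CollectI exI[of _ 1] exI[of _ 0])
      (simp add: cmult_seq_def cmult_def translate_seq_def left_regular_def fun_eq_iff)
  have trorb: "translate_seq s \<alpha> \<in> orb" for s by (rule orb_tr[OF \<alpha>orb])

  have "\<exists>r\<ge>0. \<forall>g\<in>L2 \<mu>. matrix_coeff (\<alpha> n) g \<in> L2 \<mu> \<and> L2.nm (matrix_coeff (\<alpha> n) g) \<le> r * L2.nm g" for n
    using supp[of n] matrix_coeff_bound[OF \<alpha>n] by metis
  then obtain r where r: "\<And>n. 0 \<le> r n" "\<And>n g. g \<in> L2 \<mu> \<Longrightarrow> matrix_coeff (\<alpha> n) g \<in> L2 \<mu>"
    "\<And>n g. g \<in> L2 \<mu> \<Longrightarrow> L2.nm (matrix_coeff (\<alpha> n) g) \<le> r n * L2.nm g" by metis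
  \<comment> \<open>Positive weights with two geometric bounds: \<open>dle\<close> makes the series
    for \<open>W\<close> converge uniformly, \<open>dr\<close> makes it converge in L2 with norm at
    most 1.\<close>
  define d where "d n = (1 / 2) ^ Suc n / (1 + r n)" for n
  have d0: "0 < d n" for n using r(1)[of n] by (simp add: d_def)
  have dle: "d n \<le> (1 / 2) ^ Suc n" for n
    using r(1)[of n] by (simp add: d_def divide_le_eq mult_left_le)
  have dr: "d n * r n \<le> (1 / 2) ^ Suc n" for n
  proof -
    have "r n / (1 + r n) \<le> 1" using r(1)[of n] by simp
    then have "(1 / 2) ^ Suc n * (r n / (1 + r n)) \<le> (1 / 2) ^ Suc n * 1" by (intro mult_left_mono) auto
    then show ?thesis by (simp add: d_def)
  qed
  have half: "summable (\<lambda>n. (1 / 2 :: real) ^ Suc n)" using power_half_series by (rule sums_summable)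
  have comp_le: "L2.nm (k n) \<le> DS.nm k" if k: "k \<in> ?H" for k n
  proof -
    have "sum (\<lambda>n. L2_ip \<mu> (k n) (k n)) {n} \<le> ?ip k k"
      unfolding dsum_ip_def using L2.dsumD[OF k] by (intro sum_le_suminf) (auto intro: L2.ip_nonneg)
    then show ?thesis by (simp add: L2.nm_def DS.nm_def)
  qed
  have mc_le: "cmod (matrix_coeff (\<alpha> n) g s) \<le> L2.nm g * DS.nm \<alpha>" if g: "g \<in> L2 \<mu>" for n g s
  proof -
    have "cmod (matrix_coeff (\<alpha> n) g s) \<le> L2.nm g * L2.nm (\<alpha> n)"
      using L2_Cauchy_Schwarz[OF g left_regular_L2[OF \<alpha>n], of s n] \<alpha>n
      by (simp add: matrix_coeff_def L2.nm_def L2_ip_left_regular)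
    also have "\<dots> \<le> L2.nm g * DS.nm \<alpha>" using comp_le[OF \<alpha>] L2.nm_nonneg[OF g] by (intro mult_left_mono)
    finally show ?thesis .
  qed
  define w where "w k n s = d n * matrix_coeff (\<alpha> n) (k n) s" for k n s
  define W where "W k = (\<lambda>s. \<Sum>n. w k n s)" for k
  have w_le: "cmod (w k n s) \<le> (1 / 2) ^ Suc n * (DS.nm k * DS.nm \<alpha>)" if k: "k \<in> ?H" for k n s
  proof -
    have "cmod (w k n s) = d n * cmod (matrix_coeff (\<alpha> n) (k n) s)" using d0[of n] by (simp add: w_def norm_mult)
    also have "\<dots> \<le> d n * (DS.nm k * DS.nm \<alpha>)"
      using mc_le[OF L2.dsumD(1)[OF k], of n n s] mult_right_mono[OF comp_le[OF k, of n] DS.nm_nonneg[OF \<alpha>]] d0[of n]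
      by (intro mult_left_mono) auto
    also have "\<dots> \<le> (1 / 2) ^ Suc n * (DS.nm k * DS.nm \<alpha>)"
      using dle DS.nm_nonneg[OF k] DS.nm_nonneg[OF \<alpha>] by (intro mult_right_mono) auto
    finally show ?thesis .
  qed
  have w_summable: "summable (\<lambda>n. w k n s)" if k: "k \<in> ?H" for k s
    by (rule summable_comparison_test'[OF summable_mult2[OF half] w_le[OF k]])
  have w_sums: "(\<lambda>N. \<Sum>n<N. w k n s) \<longlonglongrightarrow> W k s" if "k \<in> ?H" for k s
    using summable_LIMSEQ[OF w_summable[OF that]] by (simp add: W_def)
  have w_L2: "w k n \<in> L2 \<mu>" "L2.nm (w k n) \<le> (1 / 2) ^ Suc n * DS.nm k" if k: "k \<in> ?H" for k n
  proof -
    note kn = L2.dsumD(1)[OF k, of n]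
    have eq: "w k n = (\<lambda>s. complex_of_real (d n) * matrix_coeff (\<alpha> n) (k n) s)" by (simp add: w_def fun_eq_iff)
    show "w k n \<in> L2 \<mu>" unfolding eq by (rule L2_scale[OF r(2)[OF kn]])
    have "L2.nm (w k n) = d n * L2.nm (matrix_coeff (\<alpha> n) (k n))"
      unfolding eq using nm_cmult[OF r(2)[OF kn], of "complex_of_real (d n)" n] d0[of n] by simp
    also have "\<dots> \<le> d n * (r n * L2.nm (k n))" using r(3)[OF kn] d0[of n] by (intro mult_left_mono) auto
    also have "\<dots> = (d n * r n) * L2.nm (k n)" by simp
    also have "\<dots> \<le> (1 / 2) ^ Suc n * DS.nm k"
      using dr comp_le[OF k] L2.nm_nonneg[OF kn] by (intro mult_mono) auto
    finally show "L2.nm (w k n) \<le> (1 / 2) ^ Suc n * DS.nm k" .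
  qed
  have part_L2: "(\<lambda>s. \<Sum>n<N. w k n s) \<in> L2 \<mu>" "L2.nm (\<lambda>s. \<Sum>n<N. w k n s) \<le> DS.nm k" if k: "k \<in> ?H" for k N
  proof -
    show mem: "(\<lambda>s. \<Sum>n<N. w k n s) \<in> L2 \<mu>" for N by (rule L2_sum[OF w_L2(1)[OF k]])
    have "L2.nm (\<lambda>s. \<Sum>n<N. w k n s) \<le> (\<Sum>n<N. (1 / 2) ^ Suc n * DS.nm k)"
    proof (induction N)
      case 0
      show ?case by (simp add: L2.nm_def L2_ip_self)
    next
      case (Suc N)
      have "(\<lambda>s. \<Sum>n<Suc N. w k n s) = (\<lambda>s. \<Sum>n<N. w k n s) + w k N" by (simp add: fun_eq_iff)
      then have "L2.nm (\<lambda>s. \<Sum>n<Suc N. w k n s) \<le> L2.nm (\<lambda>s. \<Sum>n<N. w k n s) + L2.nm (w k N)"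
        using L2.nm_add[OF mem w_L2(1)[OF k]] by metis
      also have "\<dots> \<le> (\<Sum>n<N. (1 / 2) ^ Suc n * DS.nm k) + (1 / 2) ^ Suc N * DS.nm k"
        by (intro add_mono Suc w_L2(2)[OF k])
      finally show ?case by (simp only: sum.lessThan_Suc)
    qed
    also have "\<dots> = (\<Sum>n<N. (1 / 2) ^ Suc n) * DS.nm k" by (rule sum_distrib_right[symmetric])
    also have "(\<Sum>n<N. (1 / 2 :: real) ^ Suc n) \<le> 1"
      using sum_le_suminf[OF half, of "{..<N}"] suminf_half_power by simp
    finally show "L2.nm (\<lambda>s. \<Sum>n<N. w k n s) \<le> DS.nm k"
      using DS.nm_nonneg[OF k] by (simp add: mult_right_mono)
  qed
  have W_L2: "W k \<in> L2 \<mu> \<and> L2_ip \<mu> (W k) (W k) \<le> ?ip k k" if k: "k \<in> ?H" for k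
  proof -
    note [measurable] = L2D(1)[OF part_L2(1)[OF k]]
    have meas: "W k \<in> borel_measurable \<mu>"
      by (rule borel_measurable_LIMSEQ_metric[OF L2D(1)[OF part_L2(1)[OF k]] w_sums[OF k]])
    have "(\<integral>\<^sup>+s. ennreal ((cmod (W k s))\<^sup>2) \<partial>\<mu>) = (\<integral>\<^sup>+s. liminf (\<lambda>N. ennreal ((cmod (\<Sum>n<N. w k n s))\<^sup>2)) \<partial>\<mu>)"
    proof (rule nn_integral_cong)
      fix s
      have "(\<lambda>N. ennreal ((cmod (\<Sum>n<N. w k n s))\<^sup>2)) \<longlonglongrightarrow> ennreal ((cmod (W k s))\<^sup>2)"
        by (intro tendsto_intros w_sums[OF k])
      then show "ennreal ((cmod (W k s))\<^sup>2) = liminf (\<lambda>N. ennreal ((cmod (\<Sum>n<N. w k n s))\<^sup>2))"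
        by (rule lim_imp_Liminf[OF trivial_limit_sequentially, symmetric])
    qed
    also have "\<dots> \<le> liminf (\<lambda>N. \<integral>\<^sup>+s. ennreal ((cmod (\<Sum>n<N. w k n s))\<^sup>2) \<partial>\<mu>)"
      by (rule nn_integral_liminf) measurable
    also have "\<dots> \<le> ennreal (?ip k k)"
    proof (rule Liminf_le)
      show "\<forall>\<^sub>F N in sequentially. (\<integral>\<^sup>+s. ennreal ((cmod (\<Sum>n<N. w k n s))\<^sup>2) \<partial>\<mu>) \<le> ennreal (?ip k k)"
      proof (intro always_eventually allI)
        fix N
        have "(L2.nm (\<lambda>s. \<Sum>n<N. w k n s))\<^sup>2 \<le> (DS.nm k)\<^sup>2"
          by (intro power_mono part_L2(2)[OF k] L2.nm_nonneg part_L2(1)[OF k])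
        then show "(\<integral>\<^sup>+s. ennreal ((cmod (\<Sum>n<N. w k n s))\<^sup>2) \<partial>\<mu>) \<le> ennreal (?ip k k)"
          unfolding nn_integral_L2[OF part_L2(1)[OF k]]
          using L2.nm_power2[OF part_L2(1)[OF k], of N] DS.nm_power2[OF k] by (intro ennreal_leI) simp
      qed
    qed simp
    finally show ?thesis using L2_nn_integralI[OF meas _ DS.ip_nonneg[OF k]] by blast
  qed
  \<comment> \<open>Continuity upgrades vanishing almost everywhere to vanishing everywhere, so that
    in the proof of injectivity every single translate can be tested.\<close>
  have W_cont: "continuous_on UNIV (W k)" if k: "k \<in> ?H" for k
  proof (rule uniform_limit_theorem)
    show "uniform_limit UNIV (\<lambda>N s. \<Sum>n<N. w k n s) (W k) sequentially"
      unfolding W_def by (rule Weierstrass_m_test[OF w_le[OF k] summable_mult2[OF half]])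
    show "\<forall>\<^sub>F N in sequentially. continuous_on UNIV (\<lambda>s. \<Sum>n<N. w k n s)"
      unfolding w_def matrix_coeff_def
      by (intro always_eventually allI continuous_intros continuous_inner_left_regular \<alpha>n L2.dsumD(1)[OF k])
  qed simp
  have inner_right: "L2_inner \<mu> f (cmult c g) = cnj c * L2_inner \<mu> f g" for c f g
    unfolding L2_inner_def cmult_def by (subst integral_mult_right_zero[symmetric]) (simp add: mult_ac)
  have inner_left: "L2_inner \<mu> (cmult c f) g = c * L2_inner \<mu> f g" for c f g
    unfolding cmult_def by (rule L2_inner_scale_left)
  have W_add: "W (k + l) = W k + W l" if k: "k \<in> ?H" and l: "l \<in> ?H" for k l
  proof
    fix s
    have "w (k + l) n s = w k n s + w l n s" for n
      using L2_inner_add_left[OF L2.dsumD(1)[OF k, of n] L2.dsumD(1)[OF l, of n] left_regular_L2[OF \<alpha>n, of s n]]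
      by (simp add: w_def matrix_coeff_def plus_fun_def distrib_left)
    then have "W (k + l) s = (\<Sum>n. w k n s + w l n s)" by (simp only: W_def)
    also have "\<dots> = W k s + W l s"
      unfolding W_def by (rule suminf_add[OF w_summable[OF k] w_summable[OF l], symmetric])
    finally show "W (k + l) s = (W k + W l) s" by simp
  qed
  have W_cm: "W (cmult_seq c k) = cmult c (W k)" if k: "k \<in> ?H" for c k
  proof
    fix s
    have "w (cmult_seq c k) n s = c * w k n s" for n
      by (simp add: w_def matrix_coeff_def cmult_seq_def inner_left)
    then have "W (cmult_seq c k) s = (\<Sum>n. c * w k n s)" by (simp only: W_def)
    also have "\<dots> = c * W k s" unfolding W_def by (rule suminf_mult[OF w_summable[OF k]])
    finally show "W (cmult_seq c k) s = cmult c (W k) s" by (simp add: cmult_def)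
  qed
  have W_tr: "W (translate_seq t k) = left_regular t (W k)" if k: "k \<in> ?H" for t k
  proof
    fix s
    have "w (translate_seq t k) n s = w k n (- t + s)" for n
      using L2_inner_left_regular_adjoint[OF L2.dsumD(1)[OF k] left_regular_L2[OF \<alpha>n], of t n s n]
      by (simp add: w_def matrix_coeff_def translate_seq_def left_regular_left_regular)
    then show "W (translate_seq t k) s = left_regular t (W k) s"
      by (simp only: W_def left_regular_def)
  qed
  have scaleR_cm: "c *\<^sub>R f = cmult (complex_of_real c) f" for c f
    by (simp add: cmult_def fun_eq_iff scaleR_conv_of_real)
  have scaleR_cms: "c *\<^sub>R k = cmult_seq (complex_of_real c) k" for c k
    by (rule ext) (simp add: cmult_seq_def scaleR_cm)
  have W_inj: "?ip k k = 0" if k: "k \<in> K" and 0: "L2_ip \<mu> (W k) (W k) = 0" for k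
  proof -
    note kH = KH[OF k]
    have "AE s in \<mu>. (cmod (W k s))\<^sup>2 = 0"
      using 0 L2D(2)[of "W k" \<mu>] W_L2[OF kH] unfolding L2_ip_self
      by (subst (asm) integral_nonneg_eq_0_iff_AE) auto
    then have "AE s in \<mu>. W k s = 0" by simp
    then have W0: "W k s = 0" for s by (rule continuous_AE_zero[OF W_cont[OF kH]])
    \<comment> \<open>\<open>W k s\<close> is the inner product of the rescaled sequence
      \<open>Dk\<close> with the translate of \<open>\<alpha>\<close> by \<open>s\<close>. If it
      vanishes identically, \<open>Dk\<close> is orthogonal to \<open>orb\<close>, hence to
      \<open>k\<close>; since all \<open>d n\<close> are positive, every component of
      \<open>k\<close> is null.\<close>
    define Dk where "Dk n = cmult (complex_of_real (d n)) (k n)" for n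
    have Dk_ip: "L2_ip \<mu> (Dk n) (Dk n) = (d n)\<^sup>2 * L2_ip \<mu> (k n) (k n)" for n
      by (simp add: Dk_def L2_ip_cmult_cmult)
    have d1: "d n \<le> 1" for n
      using dle[of n] power_le_one[of "1 / 2 :: real" "Suc n"] by linarith
    have DkH: "Dk \<in> ?H"
    proof -
      have "summable (\<lambda>n. L2_ip \<mu> (Dk n) (Dk n))"
      proof (rule summable_comparison_test'[where N = 0])
        show "summable (\<lambda>n. L2_ip \<mu> (k n) (k n))" by (rule L2.dsumD(2)[OF kH])
        fix n
        have "(d n)\<^sup>2 \<le> 1" using d0[of n] d1[of n] by (simp add: power_le_one)
        then have "(d n)\<^sup>2 * L2_ip \<mu> (k n) (k n) \<le> 1 * L2_ip \<mu> (k n) (k n)"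
          by (intro mult_right_mono L2.ip_nonneg L2.dsumD(1)[OF kH])
        then show "norm (L2_ip \<mu> (Dk n) (Dk n)) \<le> L2_ip \<mu> (k n) (k n)"
          using L2.ip_nonneg[OF L2.dsumD(1)[OF kH, of n]] by (simp add: Dk_ip)
      qed
      then show ?thesis using cmult_L2 L2.dsumD(1)[OF kH] by (simp add: dsum_def Dk_def)
    qed
    have "?ip Dk o' = 0" if o': "o' \<in> orb" for o'
    proof -
      obtain c s where cs: "o' = cmult_seq c (translate_seq s \<alpha>)" using o' unfolding orb_def by blast
      have "L2_ip \<mu> (Dk n) (o' n) = Re (cnj c * w k n s)" for n
        by (simp only: L2_ip_def cs cmult_seq_def translate_seq_def Dk_def inner_left inner_right w_def
            matrix_coeff_def mult_ac)
      moreover have "(\<lambda>n. Re (cnj c * w k n s)) sums Re (cnj c * W k s)"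
        unfolding W_def by (intro sums_Re sums_mult summable_sums w_summable kH)
      ultimately have "(\<lambda>n. L2_ip \<mu> (Dk n) (o' n)) sums 0" using W0 by simp
      then show ?thesis unfolding dsum_ip_def by (rule sums_unique[symmetric])
    qed
    then have "Dk \<in> S" using DkH by (simp add: S_def)
    then have "?ip k Dk = 0" using k by (simp add: K_def)
    moreover have "L2_ip \<mu> (k n) (Dk n) = d n * L2_ip \<mu> (k n) (k n)" for n
      by (simp add: Dk_def L2_ip_def inner_right)
    ultimately have "(\<Sum>n. d n * L2_ip \<mu> (k n) (k n)) = 0" by (simp add: dsum_ip_def)
    moreover have "summable (\<lambda>n. d n * L2_ip \<mu> (k n) (k n))"
      using L2.dsum_summable[OF kH DkH] \<open>\<And>n. L2_ip \<mu> (k n) (Dk n) = d n * L2_ip \<mu> (k n) (k n)\<close> by simp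
    moreover have "0 \<le> d n * L2_ip \<mu> (k n) (k n)" for n
      using d0[of n] L2.ip_nonneg[OF L2.dsumD(1)[OF kH]] by (intro mult_nonneg_nonneg) (auto intro: less_imp_le)
    ultimately have "d n * L2_ip \<mu> (k n) (k n) = 0" for n
      using suminf_eq_zero_iff[of "\<lambda>n. d n * L2_ip \<mu> (k n) (k n)"] by blast
    then have "L2_ip \<mu> (k n) (k n) = 0" for n using d0[of n] by (metis less_irrefl mult_eq_0_iff)
    then show ?thesis by (simp add: dsum_ip_def)
  qed
  have W_contr: "L2.nm (W k) \<le> KK.nm k" if "k \<in> K" for k
    using W_L2[OF KH[OF that]] by (simp add: L2.nm_def KK.nm_def)
  \<comment> \<open>Riesz supplies the operator \<open>C\<close> that is the adjoint of
    \<open>W\<close> followed after \<open>W\<close>; the contraction locale is then entered with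
    \<open>Y\<close> = 1 - C.\<close>
  have "\<exists>h\<in>K. \<forall>y\<in>K. L2_ip \<mu> (W y) (W x) = ?ip y h" if x: "x \<in> K" for x
  proof (rule KK.Riesz)
    note WL = W_L2[OF KH, THEN conjunct1]
    show "L2_ip \<mu> (W (y + z)) (W x) = L2_ip \<mu> (W y) (W x) + L2_ip \<mu> (W z) (W x)" if "y \<in> K" "z \<in> K" for y z
      using that x by (simp only: W_add KH L2.ip_add_left WL)
    show "L2_ip \<mu> (W (c *\<^sub>R y)) (W x) = c * L2_ip \<mu> (W y) (W x)" if "y \<in> K" for c y
    proof -
      have "W (c *\<^sub>R y) = c *\<^sub>R W y" using that by (simp only: scaleR_cms W_cm KH scaleR_cm)
      then show ?thesis using that x by (simp only: L2.ip_scale_left WL)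
    qed
    show "\<bar>L2_ip \<mu> (W y) (W x)\<bar> \<le> L2.nm (W x) * KK.nm y" if y: "y \<in> K" for y
    proof -
      have "\<bar>L2_ip \<mu> (W y) (W x)\<bar> \<le> L2.nm (W y) * L2.nm (W x)"
        by (rule L2.ip_Cauchy_Schwarz[OF WL[OF y] WL[OF x]])
      also have "\<dots> \<le> KK.nm y * L2.nm (W x)"
        by (intro mult_right_mono W_contr[OF y] L2.nm_nonneg WL[OF x])
      finally show ?thesis by (simp add: mult.commute)
    qed
  qed
  then obtain C where C: "\<And>x. x \<in> K \<Longrightarrow> C x \<in> K" "\<And>x y. x \<in> K \<Longrightarrow> y \<in> K \<Longrightarrow> L2_ip \<mu> (W y) (W x) = ?ip y (C x)"
    by metis
  interpret ic: injective_contraction K ?ip "L2 \<mu>" "L2_ip \<mu>" W "\<lambda>x. x - C x"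
  proof (intro injective_contraction.intro injective_contraction_axioms.intro KK.semi_hilbert_axioms L2.semi_hilbert_axioms)
    fix x y assume x: "x \<in> K"
    show WxL: "W x \<in> L2 \<mu>" using W_L2[OF KH[OF x]] by blast
    show "W (c *\<^sub>R x) = c *\<^sub>R W x" for c using x by (simp only: scaleR_cms W_cm KH scaleR_cm)
    show "L2_ip \<mu> (W x) (W x) \<le> ?ip x x" using W_L2[OF KH[OF x]] by blast
    show "L2_ip \<mu> (W x) (W x) = 0 \<Longrightarrow> ?ip x x = 0" by (rule W_inj[OF x])
    show "x - C x \<in> K" by (rule KK.diff_mem[OF x C(1)[OF x]])
    assume y: "y \<in> K"
    show "W (x + y) = W x + W y" by (rule W_add[OF KH[OF x] KH[OF y]])
    have "?ip (C x) y = L2_ip \<mu> (W y) (W x)" using C x y KK.ip_commute by simp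
    also have "\<dots> = L2_ip \<mu> (W x) (W y)" using L2.ip_commute W_L2[OF KH[OF x]] W_L2[OF KH[OF y]] by blast
    finally show "?ip (x - C x) y = ?ip x y - L2_ip \<mu> (W x) (W y)"
      using KK.ip_diff_left[OF x C(1)[OF x] y] by simp
  qed
  obtain U where U: "\<forall>x\<in>K. U x \<in> L2 \<mu>" "\<forall>x\<in>K. \<forall>y\<in>K. L2_ip \<mu> (U x) (U y) = ?ip x y"
    and Ucomm: "\<forall>\<rho> \<rho>' \<sigma> \<sigma>'.
        (\<forall>x\<in>K. \<rho> x \<in> K \<and> \<rho>' x \<in> K \<and> W (\<rho> x) = \<sigma> (W x) \<and> W (\<rho>' x) = \<sigma>' (W x)) \<longrightarrow>
        (\<forall>x\<in>K. \<forall>y\<in>K. ?ip (\<rho> x) y = ?ip x (\<rho>' y)) \<longrightarrow>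
        (\<forall>a\<in>L2 \<mu>. \<sigma> a \<in> L2 \<mu> \<and> \<sigma>' a \<in> L2 \<mu>) \<longrightarrow>
        (\<forall>a\<in>L2 \<mu>. \<forall>b\<in>L2 \<mu>. L2_ip \<mu> (\<sigma> a) b = L2_ip \<mu> a (\<sigma>' b)) \<longrightarrow>
        (\<forall>x\<in>K. \<forall>b\<in>L2 \<mu>. L2_ip \<mu> (U (\<rho> x)) b = L2_ip \<mu> (\<sigma> (U x)) b)"
    using ic.polar_isometry by (elim exE conjE) (rule that)
  have U_tr: "L2_ip \<mu> (U (translate_seq s x)) b = L2_ip \<mu> (left_regular s (U x)) b" if "x \<in> K" "b \<in> L2 \<mu>" for s x b
    by (rule Ucomm[rule_format, of "translate_seq s" "translate_seq (- s)" "left_regular s" "left_regular (- s)"])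
      (use that in \<open>simp_all add: K_tr W_tr KH dsum_ip_translate left_regular_L2 L2_ip_def L2_inner_left_regular_adjoint\<close>)
  have U_cm: "L2_ip \<mu> (U (cmult_seq c x)) b = L2_ip \<mu> (cmult c (U x)) b" if "x \<in> K" "b \<in> L2 \<mu>" for c x b
    by (rule Ucomm[rule_format, of "cmult_seq c" "cmult_seq (cnj c)" "cmult c" "cmult (cnj c)"])
      (use that in \<open>simp_all add: K_cm W_cm KH dsum_ip_cmult cmult_L2 L2_ip_cmult_left\<close>)
  \<comment> \<open>The vector \<open>b\<close> is the projection of \<open>\<beta>\<close> to
    \<open>K\<close>. It has the same pairings with the translates of \<open>\<alpha>\<close>, and
    unlike \<open>\<beta>\<close> it lies in the domain of \<open>U\<close>.\<close>
  have "\<exists>b\<in>K. \<forall>k\<in>K. ?ip k \<beta> = ?ip k b"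
  proof (rule KK.Riesz)
    show "?ip (x + y) \<beta> = ?ip x \<beta> + ?ip y \<beta>" if "x \<in> K" "y \<in> K" for x y
      by (intro DS.ip_add_left KH that \<beta>)
    show "?ip (c *\<^sub>R x) \<beta> = c * ?ip x \<beta>" if "x \<in> K" for c x
      by (intro DS.ip_scale_left KH that \<beta>)
    show "\<bar>?ip x \<beta>\<bar> \<le> DS.nm \<beta> * KK.nm x" if "x \<in> K" for x
      using DS.ip_Cauchy_Schwarz[OF KH[OF that] \<beta>] by (simp add: DS.nm_def KK.nm_def mult.commute)
  qed
  then obtain b where b: "b \<in> K" "\<And>k. k \<in> K \<Longrightarrow> ?ip k \<beta> = ?ip k b" by blast
  have \<alpha>K: "\<alpha> \<in> K" by (rule orbK[OF \<alpha>orb])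
  have Ub: "U b \<in> L2 \<mu>" and U\<alpha>: "U \<alpha> \<in> L2 \<mu>" using U(1) b(1) \<alpha>K by auto
  have main: "(\<lambda>n. Re (c * L2_inner \<mu> (left_regular s (\<alpha> n)) (\<beta> n))) sums Re (c * L2_inner \<mu> (left_regular s (U \<alpha>)) (U b))" for c s
  proof -
    define x where "x = translate_seq s \<alpha>"
    have x: "x \<in> K" "cmult_seq c x \<in> K" using trorb[of s] orbK K_cm by (auto simp: x_def)
    have "(\<lambda>n. L2_ip \<mu> (cmult_seq c x n) (\<beta> n)) sums ?ip (cmult_seq c x) \<beta>"
      unfolding dsum_ip_def by (rule summable_sums[OF L2.dsum_summable[OF KH[OF x(2)] \<beta>]])
    moreover have "L2_ip \<mu> (cmult_seq c x n) (\<beta> n) = Re (c * L2_inner \<mu> (left_regular s (\<alpha> n)) (\<beta> n))" for n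
      by (simp only: L2_ip_def cmult_seq_def x_def translate_seq_def inner_left)
    moreover have "?ip (cmult_seq c x) \<beta> = Re (c * L2_inner \<mu> (left_regular s (U \<alpha>)) (U b))"
    proof -
      have "?ip (cmult_seq c x) \<beta> = ?ip (cmult_seq c x) b" by (rule b(2)[OF x(2)])
      also have "\<dots> = L2_ip \<mu> (U (cmult_seq c x)) (U b)" using U(2) x(2) b(1) by simp
      also have "\<dots> = L2_ip \<mu> (U x) (cmult (cnj c) (U b))" by (simp add: U_cm[OF x(1) Ub] L2_ip_cmult_left)
      also have "\<dots> = L2_ip \<mu> (left_regular s (U \<alpha>)) (cmult (cnj c) (U b))"
        unfolding x_def by (rule U_tr[OF \<alpha>K cmult_L2[OF Ub]])
      also have "\<dots> = Re (c * L2_inner \<mu> (left_regular s (U \<alpha>)) (U b))"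
        by (simp only: L2_ip_def inner_right complex_cnj_cnj)
      finally show ?thesis .
    qed
    ultimately show ?thesis by simp
  qed
  have "(\<lambda>n. L2_inner \<mu> (left_regular s (\<alpha> n)) (\<beta> n)) sums L2_inner \<mu> (left_regular s (U \<alpha>)) (U b)" for s
    \<comment> \<open>The choices c = 1 and c = -i recover real and imaginary part.\<close>
    using main[of 1 s] main[of "- \<i>" s] by (simp add: sums_complex_iff)
  then show ?thesis using U\<alpha> Ub by blast
qed

lemma left_regular_cmult: "left_regular s (cmult c f) = cmult c (left_regular s f)"
  by (simp add: left_regular_def cmult_def)

text \<open>Telescope an approximation of \<open>\<xi>\<close> by compactly supported vectors with
  error 4^(-n). The increments decay like 4^(-n), so a factor 2^n can be moved to the first vectors
  and 2^(-n) to \<open>\<eta>\<close> while both sequences remain square summable.\<close>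

lemma coefficient_expansion:
  assumes \<xi>: "\<xi> \<in> L2 \<mu>" and \<eta>: "\<eta> \<in> L2 \<mu>"
  shows "\<exists>\<alpha> \<beta>. \<alpha> \<in> dsum (L2 \<mu>) (L2_ip \<mu>) \<and> \<beta> \<in> dsum (L2 \<mu>) (L2_ip \<mu>) \<and>
    (\<forall>n. \<exists>L. compact L \<and> (\<forall>x. x \<notin> L \<longrightarrow> \<alpha> n x = 0)) \<and>
    (\<forall>s. (\<lambda>n. L2_inner \<mu> (left_regular s (\<alpha> n)) (\<beta> n)) sums L2_inner \<mu> (left_regular s \<xi>) \<eta>)"
proof -
  have "\<exists>f K. f \<in> L2 \<mu> \<and> compact K \<and> (\<forall>x. x \<notin> K \<longrightarrow> f x = 0) \<and> L2.nm (f - \<xi>) < (1 / 4) ^ n" for n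
    using compact_support_approx[OF \<xi>] by simp
  then obtain f K where f: "\<And>n. f n \<in> L2 \<mu>" "\<And>n. compact (K n)" "\<And>n x. x \<notin> K n \<Longrightarrow> f n x = 0"
    "\<And>n. L2.nm (f n - \<xi>) < (1 / 4) ^ n" by metis
  define a where "a n = (case n of 0 \<Rightarrow> f 0 | Suc m \<Rightarrow> f (Suc m) - f m)" for n
  define \<alpha> where "\<alpha> n = cmult (2 ^ n) (a n)" for n
  define \<beta> where "\<beta> n = cmult (1 / 2 ^ n) \<eta>" for n
  have aL: "a n \<in> L2 \<mu>" for n by (cases n) (simp_all add: a_def f(1) L2.diff_mem)
  have aS: "L2.nm (a (Suc m)) \<le> 2 * (1 / 4) ^ m" for m
  proof -
    have "L2.nm (a (Suc m)) \<le> L2.nm (f (Suc m) - \<xi>) + L2.nm (\<xi> - f m)"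
      using L2.nm_diff_triangle[OF f(1) \<xi> f(1)] by (simp add: a_def)
    also have "\<dots> = L2.nm (f (Suc m) - \<xi>) + L2.nm (f m - \<xi>)" using L2.nm_minus_commute[OF \<xi> f(1)] by simp
    also have "\<dots> \<le> (1 / 4) ^ Suc m + (1 / 4) ^ m" by (intro add_mono less_imp_le f(4))
    also have "\<dots> \<le> 2 * (1 / 4) ^ m" by simp
    finally show ?thesis .
  qed
  have "\<alpha> \<in> dsum (L2 \<mu>) (L2_ip \<mu>)"
  proof -
    have "summable (\<lambda>m. L2_ip \<mu> (\<alpha> (Suc m)) (\<alpha> (Suc m)))"
    proof (rule summable_comparison_test'[where N = 0])
      show "summable (\<lambda>m. 16 * (1 / 4 :: real) ^ m)" by (intro summable_mult summable_geometric) simp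
      fix m
      have "L2_ip \<mu> (\<alpha> (Suc m)) (\<alpha> (Suc m)) = (2 ^ Suc m * L2.nm (a (Suc m)))\<^sup>2"
        by (simp add: \<alpha>_def L2_ip_cmult_cmult power_mult_distrib L2.nm_power2[OF aL] norm_power norm_mult)
      also have "\<dots> \<le> (2 ^ Suc m * (2 * (1 / 4) ^ m))\<^sup>2"
        using aS[of m] L2.nm_nonneg[OF aL] by (intro power_mono mult_left_mono mult_nonneg_nonneg) auto
      also have "2 ^ Suc m * (2 * (1 / 4) ^ m) = 4 * (1 / 2 :: real) ^ m"
        by (simp add: power_mult_distrib[symmetric])
      also have "(4 * (1 / 2 :: real) ^ m)\<^sup>2 = 16 * (1 / 4) ^ m"
        by (simp add: power2_eq_square power_mult_distrib[symmetric])
      finally show "norm (L2_ip \<mu> (\<alpha> (Suc m)) (\<alpha> (Suc m))) \<le> 16 * (1 / 4) ^ m"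
        using L2.ip_nonneg[OF cmult_L2[OF aL[of "Suc m"]], of "2 ^ Suc m"] by (simp add: \<alpha>_def)
    qed
    then have "summable (\<lambda>m. L2_ip \<mu> (\<alpha> m) (\<alpha> m))" by (subst (asm) summable_Suc_iff)
    then show ?thesis using cmult_L2[OF aL] by (simp add: dsum_def \<alpha>_def)
  qed
  moreover have "\<beta> \<in> dsum (L2 \<mu>) (L2_ip \<mu>)"
  proof -
    have "summable (\<lambda>m. (1 / 4) ^ m * L2_ip \<mu> \<eta> \<eta>)" by (intro summable_mult2 summable_geometric) simp
    moreover have "L2_ip \<mu> (\<beta> m) (\<beta> m) = (1 / 4) ^ m * L2_ip \<mu> \<eta> \<eta>" for m
      by (simp add: \<beta>_def L2_ip_cmult_cmult norm_divide norm_power power2_eq_square power_mult_distrib[symmetric] power_divide)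
    ultimately show ?thesis using cmult_L2[OF \<eta>] by (simp add: dsum_def \<beta>_def)
  qed
  moreover have "\<exists>L. compact L \<and> (\<forall>x. x \<notin> L \<longrightarrow> \<alpha> n x = 0)" for n
  proof (cases n)
    case 0
    have "\<alpha> n x = 0" if x: "x \<notin> K 0" for x using f(3)[OF x] 0 by (simp add: \<alpha>_def a_def cmult_def)
    then show ?thesis using f(2)[of 0] by blast
  next
    case (Suc m)
    then show ?thesis using f(2,3)
      by (intro exI[of _ "K (Suc m) \<union> K m"]) (auto simp: \<alpha>_def a_def cmult_def intro: compact_Un)
  qed
  moreover have "(\<lambda>n. L2_inner \<mu> (left_regular s (\<alpha> n)) (\<beta> n)) sums L2_inner \<mu> (left_regular s \<xi>) \<eta>" for s
  proof -
    have each: "L2_inner \<mu> (left_regular s (\<alpha> n)) (\<beta> n) = L2_inner \<mu> (left_regular s (a n)) \<eta>" for n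
      unfolding \<alpha>_def \<beta>_def left_regular_cmult L2_inner_def
      by (rule arg_cong[where f = "integral\<^sup>L \<mu>"]) (simp add: cmult_def fun_eq_iff)
    have partial: "(\<Sum>n<Suc M. L2_inner \<mu> (left_regular s (a n)) \<eta>) = L2_inner \<mu> (left_regular s (f M)) \<eta>" for M
    proof (induction M)
      case 0
      show ?case by (simp add: a_def)
    next
      case (Suc M)
      have "left_regular s (f (Suc M)) = (\<lambda>x. left_regular s (f M) x + left_regular s (a (Suc M)) x)"
        by (simp add: a_def left_regular_def)
      then have "L2_inner \<mu> (left_regular s (f (Suc M))) \<eta>
          = L2_inner \<mu> (left_regular s (f M)) \<eta> + L2_inner \<mu> (left_regular s (a (Suc M))) \<eta>"
        by (simp only: L2_inner_add_left[OF left_regular_L2[OF f(1)] left_regular_L2[OF aL] \<eta>])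
      then show ?case using Suc by (simp only: sum.lessThan_Suc)
    qed
    have "(\<lambda>M. L2_inner \<mu> (left_regular s (f M)) \<eta>) \<longlonglongrightarrow> L2_inner \<mu> (left_regular s \<xi>) \<eta>"
    proof (rule LIM_zero_cancel, rule Lim_null_comparison)
      show "\<forall>\<^sub>F M in sequentially. norm (L2_inner \<mu> (left_regular s (f M)) \<eta> - L2_inner \<mu> (left_regular s \<xi>) \<eta>) \<le> (1 / 4) ^ M * L2.nm \<eta>"
      proof (intro always_eventually allI)
        fix M
        have dm: "f M - \<xi> \<in> L2 \<mu>" by (rule L2.diff_mem[OF f(1) \<xi>])
        have "left_regular s (f M) = (\<lambda>x. left_regular s (f M - \<xi>) x + left_regular s \<xi> x)"
          by (simp add: left_regular_def)
        then have "L2_inner \<mu> (left_regular s (f M)) \<eta>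
            = L2_inner \<mu> (left_regular s (f M - \<xi>)) \<eta> + L2_inner \<mu> (left_regular s \<xi>) \<eta>"
          by (simp only: L2_inner_add_left[OF left_regular_L2[OF dm] left_regular_L2[OF \<xi>] \<eta>])
        then have "norm (L2_inner \<mu> (left_regular s (f M)) \<eta> - L2_inner \<mu> (left_regular s \<xi>) \<eta>)
            = cmod (L2_inner \<mu> (left_regular s (f M - \<xi>)) \<eta>)" by simp
        also have "\<dots> \<le> L2.nm (f M - \<xi>) * L2.nm \<eta>"
          using L2_Cauchy_Schwarz[OF left_regular_L2[OF dm] \<eta>, of s] dm by (simp add: L2.nm_def L2_ip_left_regular)
        also have "\<dots> \<le> (1 / 4) ^ M * L2.nm \<eta>"
          using f(4)[of M] L2.nm_nonneg[OF \<eta>] by (intro mult_right_mono) auto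
        finally show "norm (L2_inner \<mu> (left_regular s (f M)) \<eta> - L2_inner \<mu> (left_regular s \<xi>) \<eta>) \<le> (1 / 4) ^ M * L2.nm \<eta>" .
      qed
      show "(\<lambda>M. (1 / 4) ^ M * L2.nm \<eta>) \<longlonglongrightarrow> 0"
        by (intro tendsto_mult_left_zero LIMSEQ_realpow_zero) auto
    qed
    then show ?thesis
      unfolding sums_def each by (subst filterlim_sequentially_Suc[symmetric]) (simp only: partial)
  qed
  ultimately show ?thesis by blast
qed

text \<open>The expansions of the two coefficients are interleaved into one sequence of right
  bounded vectors, and the resulting sum is a single coefficient.\<close>

lemma fourier_functions_add:
  assumes u: "u \<in> fourier_functions \<mu>" and v: "v \<in> fourier_functions \<mu>"
  shows "(\<lambda>s. u s + v s) \<in> fourier_functions \<mu>"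
proof -
  obtain \<xi>1 \<eta>1 where 1: "\<xi>1 \<in> L2 \<mu>" "\<eta>1 \<in> L2 \<mu>" "u = coefficient \<mu> \<xi>1 \<eta>1"
    using u by (auto simp: fourier_functions_def)
  obtain \<xi>2 \<eta>2 where 2: "\<xi>2 \<in> L2 \<mu>" "\<eta>2 \<in> L2 \<mu>" "v = coefficient \<mu> \<xi>2 \<eta>2"
    using v by (auto simp: fourier_functions_def)
  obtain \<alpha>1 \<beta>1 where e1: "\<alpha>1 \<in> dsum (L2 \<mu>) (L2_ip \<mu>)" "\<beta>1 \<in> dsum (L2 \<mu>) (L2_ip \<mu>)"
    "\<And>n. \<exists>L. compact L \<and> (\<forall>x. x \<notin> L \<longrightarrow> \<alpha>1 n x = 0)"
    "\<And>s. (\<lambda>n. L2_inner \<mu> (left_regular s (\<alpha>1 n)) (\<beta>1 n)) sums L2_inner \<mu> (left_regular s \<xi>1) \<eta>1"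
    using coefficient_expansion[OF 1(1,2)] by blast
  obtain \<alpha>2 \<beta>2 where e2: "\<alpha>2 \<in> dsum (L2 \<mu>) (L2_ip \<mu>)" "\<beta>2 \<in> dsum (L2 \<mu>) (L2_ip \<mu>)"
    "\<And>n. \<exists>L. compact L \<and> (\<forall>x. x \<notin> L \<longrightarrow> \<alpha>2 n x = 0)"
    "\<And>s. (\<lambda>n. L2_inner \<mu> (left_regular s (\<alpha>2 n)) (\<beta>2 n)) sums L2_inner \<mu> (left_regular s \<xi>2) \<eta>2"
    using coefficient_expansion[OF 2(1,2)] by blast
  define mix :: "(nat \<Rightarrow> 'a \<Rightarrow> complex) \<Rightarrow> (nat \<Rightarrow> 'a \<Rightarrow> complex) \<Rightarrow> nat \<Rightarrow> 'a \<Rightarrow> complex" where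
    "mix g h n = (if even n then h (n div 2) else g ((n - 1) div 2))" for g h n
  have mix_mem: "mix g h \<in> dsum (L2 \<mu>) (L2_ip \<mu>)"
    if gh: "g \<in> dsum (L2 \<mu>) (L2_ip \<mu>)" "h \<in> dsum (L2 \<mu>) (L2_ip \<mu>)" for g h
  proof -
    have "summable (\<lambda>n. if even n then L2_ip \<mu> (h (n div 2)) (h (n div 2)) else L2_ip \<mu> (g ((n - 1) div 2)) (g ((n - 1) div 2)))"
      by (rule sums_summable[OF sums_if[OF summable_sums[OF L2.dsumD(2)[OF gh(1)]] summable_sums[OF L2.dsumD(2)[OF gh(2)]]]])
    moreover have "(\<lambda>n. L2_ip \<mu> (mix g h n) (mix g h n)) =
      (\<lambda>n. if even n then L2_ip \<mu> (h (n div 2)) (h (n div 2)) else L2_ip \<mu> (g ((n - 1) div 2)) (g ((n - 1) div 2)))"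
      by (auto simp: mix_def)
    ultimately show ?thesis using L2.dsumD(1)[OF gh(1)] L2.dsumD(1)[OF gh(2)] by (auto simp: dsum_def mix_def)
  qed
  have "\<exists>L. compact L \<and> (\<forall>x. x \<notin> L \<longrightarrow> mix \<alpha>1 \<alpha>2 n x = 0)" for n
    using e1(3) e2(3) by (simp add: mix_def)
  from sum_of_coefficients_single[OF mix_mem[OF e1(1) e2(1)] mix_mem[OF e1(2) e2(2)] this]
  obtain \<xi> \<eta> where x: "\<xi> \<in> L2 \<mu>" "\<eta> \<in> L2 \<mu>"
    "\<And>s. (\<lambda>n. L2_inner \<mu> (left_regular s (mix \<alpha>1 \<alpha>2 n)) (mix \<beta>1 \<beta>2 n)) sums L2_inner \<mu> (left_regular s \<xi>) \<eta>"
    by blast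
  have "u s + v s = coefficient \<mu> \<xi> \<eta> s" for s
  proof -
    have "(\<lambda>n. if even n then L2_inner \<mu> (left_regular s (\<alpha>2 (n div 2))) (\<beta>2 (n div 2))
        else L2_inner \<mu> (left_regular s (\<alpha>1 ((n - 1) div 2))) (\<beta>1 ((n - 1) div 2))) sums
        (L2_inner \<mu> (left_regular s \<xi>1) \<eta>1 + L2_inner \<mu> (left_regular s \<xi>2) \<eta>2)"
      using sums_if[OF sums_Re[OF e1(4)[of s]] sums_Re[OF e2(4)[of s]]]
        sums_if[OF sums_Im[OF e1(4)[of s]] sums_Im[OF e2(4)[of s]]]
      by (simp add: sums_complex_iff if_distrib)
    moreover have "(\<lambda>n. L2_inner \<mu> (left_regular s (mix \<alpha>1 \<alpha>2 n)) (mix \<beta>1 \<beta>2 n)) =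
      (\<lambda>n. if even n then L2_inner \<mu> (left_regular s (\<alpha>2 (n div 2))) (\<beta>2 (n div 2))
        else L2_inner \<mu> (left_regular s (\<alpha>1 ((n - 1) div 2))) (\<beta>1 ((n - 1) div 2)))"
      by (auto simp: mix_def)
    ultimately show ?thesis using x(3)[of s] sums_unique2 unfolding 1(3) 2(3) coefficient_def by metis
  qed
  then show ?thesis using x(1,2) unfolding fourier_functions_def by blast
qed

lemma zero_fourier: "(\<lambda>s. 0) \<in> fourier_functions \<mu>"
proof -
  have "(\<lambda>s. 0) = coefficient \<mu> (\<lambda>x. 0) (\<lambda>x. 0)"
    by (simp add: coefficient_def left_regular_def L2_inner_def fun_eq_iff)
  then show ?thesis unfolding fourier_functions_def using L2_zero by blast
qed

end

section \<open>Operator norms\<close>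

text \<open>The common form of the norms defined as infima of constants: once one admissible
  constant is known, the infimum is itself admissible.\<close>

lemma Inf_bound:
  fixes f b :: "'z \<Rightarrow> real"
  assumes b: "\<And>z. 0 \<le> b z" and ex: "0 \<le> C" "\<And>z. P z \<Longrightarrow> f z \<le> C * b z"
  defines "r \<equiv> Inf {C. 0 \<le> C \<and> (\<forall>z. P z \<longrightarrow> f z \<le> C * b z)}"
  shows "0 \<le> r" "r \<le> C" "\<And>z. P z \<Longrightarrow> f z \<le> r * b z"
proof -
  let ?S = "{C. 0 \<le> C \<and> (\<forall>z. P z \<longrightarrow> f z \<le> C * b z)}"
  have C: "C \<in> ?S" using ex by blast
  have bdd: "bdd_below ?S" by (intro bdd_belowI[of _ 0]) blast
  show "0 \<le> r" unfolding r_def using C by (intro cInf_greatest) blast+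
  show "r \<le> C" unfolding r_def by (rule cInf_lower[OF C bdd])
  fix z assume z: "P z"
  show "f z \<le> r * b z"
  proof (cases "b z = 0")
    case True
    then show ?thesis using ex(2)[OF z] by simp
  next
    case False
    then have pos: "0 < b z" using b[of z] by simp
    have "f z / b z \<le> r" unfolding r_def
    proof (rule cInf_greatest)
      show "?S \<noteq> {}" using C by blast
      fix D assume "D \<in> ?S"
      then show "f z / b z \<le> D" using z pos by (simp add: pos_divide_le_eq)
    qed
    then show ?thesis using pos by (simp add: pos_divide_le_eq)
  qed
qed

lemma matrix_opnorm_le:
  assumes "0 \<le> C"
    and "\<And>v. (\<Sum>i\<in>I. (cmod (\<Sum>j\<in>I. A i j * v j))\<^sup>2) \<le> C\<^sup>2 * (\<Sum>j\<in>I. (cmod (v j))\<^sup>2)"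
  shows "matrix_opnorm I A \<le> C"
  unfolding matrix_opnorm_def
proof (rule cInf_lower)
  have "sqrt (\<Sum>i\<in>I. (cmod (\<Sum>j\<in>I. A i j * v j))\<^sup>2) \<le> C * sqrt (\<Sum>j\<in>I. (cmod (v j))\<^sup>2)" for v
    using real_sqrt_le_mono[OF assms(2)[of v]] assms(1) by (simp add: real_sqrt_mult)
  then show "C \<in> {C. 0 \<le> C \<and> (\<forall>v. sqrt (\<Sum>i\<in>I. (cmod (\<Sum>j\<in>I. A i j * v j))\<^sup>2)
      \<le> C * sqrt (\<Sum>j\<in>I. (cmod (v j))\<^sup>2))}" using assms(1) by blast
  show "bdd_below {C. 0 \<le> C \<and> (\<forall>v. sqrt (\<Sum>i\<in>I. (cmod (\<Sum>j\<in>I. A i j * v j))\<^sup>2)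
      \<le> C * sqrt (\<Sum>j\<in>I. (cmod (v j))\<^sup>2))}" by (intro bdd_belowI[of _ 0]) blast
qed

lemma cmod_sum_power2_le:
  "(cmod (\<Sum>i\<in>A. f i))\<^sup>2 \<le> real (card A) * (\<Sum>i\<in>A. (cmod (f i))\<^sup>2)"
proof -
  have "(cmod (\<Sum>i\<in>A. f i))\<^sup>2 \<le> (\<Sum>i\<in>A. cmod (f i))\<^sup>2"
    by (intro power_mono norm_sum) simp
  also have "\<dots> \<le> real (card A) * (\<Sum>i\<in>A. (cmod (f i))\<^sup>2)"
    using Cauchy_Schwarz_ineq_sum[of "\<lambda>_. 1" "\<lambda>i. cmod (f i)" A] by simp
  finally show ?thesis .
qed

text \<open>The Hilbert-Schmidt norm is an admissible constant, so the infimum is a genuine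
  bound.\<close>

lemma matrix_opnorm_bound:
  assumes I: "finite I"
  shows "0 \<le> matrix_opnorm I A"
    "(\<Sum>i\<in>I. (cmod (\<Sum>j\<in>I. A i j * v j))\<^sup>2) \<le> (matrix_opnorm I A)\<^sup>2 * (\<Sum>j\<in>I. (cmod (v j))\<^sup>2)"
proof -
  let ?C = "sqrt (\<Sum>i\<in>I. \<Sum>j\<in>I. (cmod (A i j))\<^sup>2)"
  have C: "sqrt (\<Sum>i\<in>I. (cmod (\<Sum>j\<in>I. A i j * v j))\<^sup>2) \<le> ?C * sqrt (\<Sum>j\<in>I. (cmod (v j))\<^sup>2)" for v
  proof -
    have "(cmod (\<Sum>j\<in>I. A i j * v j))\<^sup>2 \<le> (\<Sum>j\<in>I. (cmod (A i j))\<^sup>2) * (\<Sum>j\<in>I. (cmod (v j))\<^sup>2)" for i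
    proof -
      have "(cmod (\<Sum>j\<in>I. A i j * v j))\<^sup>2 \<le> (\<Sum>j\<in>I. cmod (A i j) * cmod (v j))\<^sup>2"
        using norm_sum[of "\<lambda>j. A i j * v j" I] by (intro power_mono) (simp_all add: norm_mult)
      also have "\<dots> \<le> (\<Sum>j\<in>I. (cmod (A i j))\<^sup>2) * (\<Sum>j\<in>I. (cmod (v j))\<^sup>2)"
        by (rule Cauchy_Schwarz_ineq_sum)
      finally show ?thesis .
    qed
    then have "(\<Sum>i\<in>I. (cmod (\<Sum>j\<in>I. A i j * v j))\<^sup>2)
        \<le> (\<Sum>i\<in>I. \<Sum>j\<in>I. (cmod (A i j))\<^sup>2) * (\<Sum>j\<in>I. (cmod (v j))\<^sup>2)"
      unfolding sum_distrib_right by (intro sum_mono)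
    then show ?thesis unfolding real_sqrt_mult[symmetric] by (rule real_sqrt_le_mono)
  qed
  have C0: "0 \<le> ?C" by (simp add: sum_nonneg)
  note * = Inf_bound[where P = "\<lambda>_. True" and C = ?C and b = "\<lambda>v. sqrt (\<Sum>j\<in>I. (cmod (v j))\<^sup>2)"
      and f = "\<lambda>v. sqrt (\<Sum>i\<in>I. (cmod (\<Sum>j\<in>I. A i j * v j))\<^sup>2)", OF _ C0 C, simplified, folded matrix_opnorm_def]
  have nn: "0 \<le> sqrt (\<Sum>j\<in>I. (cmod (v j))\<^sup>2)" for v :: "'a \<Rightarrow> complex" by (simp add: sum_nonneg)
  show "0 \<le> matrix_opnorm I A" using *(1) by (simp add: sum_nonneg)
  have "sqrt (\<Sum>i\<in>I. (cmod (\<Sum>j\<in>I. A i j * v j))\<^sup>2) \<le> matrix_opnorm I A * sqrt (\<Sum>j\<in>I. (cmod (v j))\<^sup>2)"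
    using *(3) by (simp add: sum_nonneg)
  then have "(sqrt (\<Sum>i\<in>I. (cmod (\<Sum>j\<in>I. A i j * v j))\<^sup>2))\<^sup>2 \<le> (matrix_opnorm I A * sqrt (\<Sum>j\<in>I. (cmod (v j))\<^sup>2))\<^sup>2"
    by (intro power_mono) (simp_all add: sum_nonneg)
  then show "(\<Sum>i\<in>I. (cmod (\<Sum>j\<in>I. A i j * v j))\<^sup>2) \<le> (matrix_opnorm I A)\<^sup>2 * (\<Sum>j\<in>I. (cmod (v j))\<^sup>2)"
    by (simp add: power_mult_distrib sum_nonneg)
qed

lemma L2_norm_nonneg: "0 \<le> L2_norm M f"
  by (simp add: L2_norm_def)

lemma L2_norm_scale: "L2_norm M (\<lambda>x. c * f x) = cmod c * L2_norm M f"
  by (simp add: L2_norm_def norm_mult power_mult_distrib real_sqrt_mult)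

lemma L2_norm_power2: "(L2_norm M f)\<^sup>2 = L2_ip M f f"
  by (simp add: L2_norm_def L2_ip_self)

lemma L2_norm_sum_power2:
  assumes "\<And>i. i \<in> A \<Longrightarrow> f i \<in> L2 M"
  shows "(L2_norm M (\<lambda>x. \<Sum>i\<in>A. f i x))\<^sup>2 \<le> real (card A) * (\<Sum>i\<in>A. (L2_norm M (f i))\<^sup>2)"
proof -
  have "(L2_norm M (\<lambda>x. \<Sum>i\<in>A. f i x))\<^sup>2 = (LINT x|M. (cmod (\<Sum>i\<in>A. f i x))\<^sup>2)"
    by (simp add: L2_norm_power2 L2_ip_self)
  also have "\<dots> \<le> (LINT x|M. real (card A) * (\<Sum>i\<in>A. (cmod (f i x))\<^sup>2))"
    using L2D(2)[OF L2_sum[OF assms]] L2D(2)[OF assms]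
    by (intro integral_mono cmod_sum_power2_le) auto
  also have "\<dots> = real (card A) * (\<Sum>i\<in>A. (L2_norm M (f i))\<^sup>2)"
    using L2D(2)[OF assms] by (simp add: L2_norm_power2 L2_ip_self)
  finally show ?thesis .
qed

text \<open>As for scalar matrices, a crude constant assembled from bounds of the entries shows that
  the infimum is attained.\<close>

lemma L2_matrix_norm_bound:
  assumes "\<And>k l. k < m \<Longrightarrow> l < m \<Longrightarrow> L2_operator M (T k l)"
  shows "0 \<le> L2_matrix_norm M m T"
    "(\<And>l. l < m \<Longrightarrow> \<xi> l \<in> L2 M) \<Longrightarrow>
      (\<Sum>k<m. (L2_norm M (\<lambda>x. \<Sum>l<m. T k l (\<xi> l) x))\<^sup>2)
        \<le> (L2_matrix_norm M m T)\<^sup>2 * (\<Sum>l<m. (L2_norm M (\<xi> l))\<^sup>2)"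
proof -
  have "\<exists>C. \<forall>f\<in>L2 M. L2_norm M (T k l f) \<le> C * L2_norm M f" if "k < m" "l < m" for k l
    using assms[OF that] by (simp add: L2_operator_def)
  then obtain C where C: "\<And>k l f. k < m \<Longrightarrow> l < m \<Longrightarrow> f \<in> L2 M \<Longrightarrow> L2_norm M (T k l f) \<le> C k l * L2_norm M f"
    by metis
  define D where "D = (\<Sum>k<m. \<Sum>l<m. (C k l)\<^sup>2)"
  have D0: "0 \<le> D" by (simp add: D_def sum_nonneg)
  have est: "sqrt (\<Sum>k<m. (L2_norm M (\<lambda>x. \<Sum>l<m. T k l (\<xi> l) x))\<^sup>2)
          \<le> sqrt (real m * D) * sqrt (\<Sum>l<m. (L2_norm M (\<xi> l))\<^sup>2)" if \<xi>: "\<forall>l<m. \<xi> l \<in> L2 M" for \<xi>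
  proof -
    have "(\<Sum>k<m. (L2_norm M (\<lambda>x. \<Sum>l<m. T k l (\<xi> l) x))\<^sup>2)
        \<le> (\<Sum>k<m. real m * (\<Sum>l<m. (C k l)\<^sup>2 * (\<Sum>l<m. (L2_norm M (\<xi> l))\<^sup>2)))"
    proof (intro sum_mono)
      fix k assume k: "k \<in> {..<m}"
      have mem: "T k l (\<xi> l) \<in> L2 M" if "l \<in> {..<m}" for l
        using assms[of k l] k that \<xi> by (simp add: L2_operator_def)
      have "(L2_norm M (T k l (\<xi> l)))\<^sup>2 \<le> (C k l)\<^sup>2 * (\<Sum>l<m. (L2_norm M (\<xi> l))\<^sup>2)" if l: "l \<in> {..<m}" for l
      proof -
        have "(L2_norm M (T k l (\<xi> l)))\<^sup>2 \<le> (C k l * L2_norm M (\<xi> l))\<^sup>2"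
          using C[of k l "\<xi> l"] k l \<xi> by (intro power_mono L2_norm_nonneg) auto
        also have "\<dots> \<le> (C k l)\<^sup>2 * (\<Sum>l<m. (L2_norm M (\<xi> l))\<^sup>2)"
          unfolding power_mult_distrib using l by (intro mult_left_mono member_le_sum) auto
        finally show ?thesis .
      qed
      then have "real m * (\<Sum>l<m. (L2_norm M (T k l (\<xi> l)))\<^sup>2) \<le> real m * (\<Sum>l<m. (C k l)\<^sup>2 * (\<Sum>l<m. (L2_norm M (\<xi> l))\<^sup>2))"
        by (intro mult_left_mono sum_mono) auto
      then show "(L2_norm M (\<lambda>x. \<Sum>l<m. T k l (\<xi> l) x))\<^sup>2 \<le> real m * (\<Sum>l<m. (C k l)\<^sup>2 * (\<Sum>l<m. (L2_norm M (\<xi> l))\<^sup>2))"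
        using L2_norm_sum_power2[of "{..<m}" "\<lambda>l. T k l (\<xi> l)", OF mem] by simp
    qed
    also have "\<dots> = real m * D * (\<Sum>l<m. (L2_norm M (\<xi> l))\<^sup>2)"
      by (simp add: D_def sum_distrib_left[symmetric] sum_distrib_right[symmetric] mult.assoc)
    finally show ?thesis unfolding real_sqrt_mult[symmetric] by (rule real_sqrt_le_mono)
  qed
  have nn: "0 \<le> sqrt (\<Sum>l<m. (L2_norm M (\<xi> l))\<^sup>2)" for \<xi> by (simp add: sum_nonneg)
  have D1: "0 \<le> sqrt (real m * D)" using D0 by simp
  note * = Inf_bound[where P = "\<lambda>\<xi>. \<forall>l<m. \<xi> l \<in> L2 M" and b = "\<lambda>\<xi>. sqrt (\<Sum>l<m. (L2_norm M (\<xi> l))\<^sup>2)",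
      OF nn D1 est, folded L2_matrix_norm_def]
  show "0 \<le> L2_matrix_norm M m T" by (rule *(1))
  assume \<xi>: "\<And>l. l < m \<Longrightarrow> \<xi> l \<in> L2 M"
  have "sqrt (\<Sum>k<m. (L2_norm M (\<lambda>x. \<Sum>l<m. T k l (\<xi> l) x))\<^sup>2) \<le> L2_matrix_norm M m T * sqrt (\<Sum>l<m. (L2_norm M (\<xi> l))\<^sup>2)"
    by (rule *(3)) (simp_all add: \<xi>)
  then have "(sqrt (\<Sum>k<m. (L2_norm M (\<lambda>x. \<Sum>l<m. T k l (\<xi> l) x))\<^sup>2))\<^sup>2
      \<le> (L2_matrix_norm M m T * sqrt (\<Sum>l<m. (L2_norm M (\<xi> l))\<^sup>2))\<^sup>2"
    by (intro power_mono) (simp_all add: sum_nonneg)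
  then show "(\<Sum>k<m. (L2_norm M (\<lambda>x. \<Sum>l<m. T k l (\<xi> l) x))\<^sup>2)
      \<le> (L2_matrix_norm M m T)\<^sup>2 * (\<Sum>l<m. (L2_norm M (\<xi> l))\<^sup>2)"
    by (simp add: power_mult_distrib sum_nonneg)
qed

lemma L2_matrix_norm_le:
  assumes "0 \<le> C" and "\<And>\<xi>. (\<And>l. l < m \<Longrightarrow> \<xi> l \<in> L2 M) \<Longrightarrow>
      (\<Sum>k<m. (L2_norm M (\<lambda>x. \<Sum>l<m. T k l (\<xi> l) x))\<^sup>2) \<le> C * (\<Sum>l<m. (L2_norm M (\<xi> l))\<^sup>2)"
  shows "L2_matrix_norm M m T \<le> sqrt C"
  unfolding L2_matrix_norm_def
proof (rule cInf_lower)
  let ?S = "{C. 0 \<le> C \<and> (\<forall>\<xi>. (\<forall>l<m. \<xi> l \<in> L2 M) \<longrightarrow>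
     sqrt (\<Sum>k<m. (L2_norm M (\<lambda>x. \<Sum>l<m. T k l (\<xi> l) x))\<^sup>2) \<le> C * sqrt (\<Sum>l<m. (L2_norm M (\<xi> l))\<^sup>2))}"
  have "sqrt (\<Sum>k<m. (L2_norm M (\<lambda>x. \<Sum>l<m. T k l (\<xi> l) x))\<^sup>2) \<le> sqrt C * sqrt (\<Sum>l<m. (L2_norm M (\<xi> l))\<^sup>2)"
    if "\<forall>l<m. \<xi> l \<in> L2 M" for \<xi>
    using real_sqrt_le_mono[OF assms(2)[of \<xi>]] that by (simp add: real_sqrt_mult)
  then show "sqrt C \<in> ?S" using assms(1) by simp
  show "bdd_below ?S" by (intro bdd_belowI[of _ 0]) blast
qed

section \<open>Combinations of translation operators\<close>

lemma L2_operator_add_scale: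
  assumes "L2_operator M T" "f \<in> L2 M" "g \<in> L2 M"
  shows "AE x in M. T (\<lambda>y. c * f y + g y) x = c * T f x + T g x"
  using assms unfolding L2_operator_def by blast

lemma L2_operator_null:
  assumes T: "L2_operator M T"
  shows "AE x in M. T (\<lambda>y. 0) x = 0"
  using L2_operator_add_scale[OF T L2_zero L2_zero, of 1] by (simp add: eventually_mono)

lemma L2_operator_sum:
  assumes T: "L2_operator M T" and f: "\<And>i. i \<in> I \<Longrightarrow> f i \<in> L2 M"
  shows "AE x in M. T (\<lambda>y. \<Sum>i\<in>I. c i * f i y) x = (\<Sum>i\<in>I. c i * T (f i) x)"
proof (cases "finite I")
  case True
  then show ?thesis using f
  proof (induction I)
    case empty
    then show ?case using L2_operator_null[OF T] by simp
  next
    case (insert j I)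
    have 1: "(\<lambda>y. \<Sum>i\<in>I. c i * f i y) \<in> L2 M" using insert(4) by (intro L2_sum L2_scale) blast
    have "AE x in M. T (\<lambda>y. c j * f j y + (\<Sum>i\<in>I. c i * f i y)) x
        = c j * T (f j) x + T (\<lambda>y. \<Sum>i\<in>I. c i * f i y) x"
      by (rule L2_operator_add_scale[OF T insert(4)[OF insertI1] 1])
    moreover have "AE x in M. T (\<lambda>y. \<Sum>i\<in>I. c i * f i y) x = (\<Sum>i\<in>I. c i * T (f i) x)"
      using insert by blast
    ultimately show ?case
      by eventually_elim (simp add: insert(1,2))
  qed
next
  case False
  then show ?thesis using L2_operator_null[OF T] by simp
qed

context haar
begin

lemma translation_combination_VN:
  assumes I: "finite I"
  shows "(\<lambda>f x. \<Sum>i\<in>I. c i * left_regular (s i) f x) \<in> VN \<mu>"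
proof -
  let ?T = "\<lambda>f x. \<Sum>i\<in>I. c i * left_regular (s i) f x"
  have mem: "?T f \<in> L2 \<mu>" if "f \<in> L2 \<mu>" for f
    using that by (intro L2_sum L2_scale left_regular_L2)
  have "L2_operator \<mu> ?T"
    unfolding L2_operator_def
  proof (intro conjI ballI allI)
    show "?T f \<in> L2 \<mu>" if "f \<in> L2 \<mu>" for f using that by (rule mem)
    show "AE x in \<mu>. ?T (\<lambda>y. d * f y + g y) x = d * ?T f x + ?T g x" for d f g
      by (simp add: left_regular_def sum.distrib sum_distrib_left algebra_simps)
    have "L2_norm \<mu> (?T f) \<le> sqrt (real (card I) * (\<Sum>i\<in>I. (cmod (c i))\<^sup>2)) * L2_norm \<mu> f" if f: "f \<in> L2 \<mu>" for f
    proof -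
      have "(L2_norm \<mu> (?T f))\<^sup>2 \<le> real (card I) * (\<Sum>i\<in>I. (L2_norm \<mu> (\<lambda>x. c i * left_regular (s i) f x))\<^sup>2)"
        using f by (intro L2_norm_sum_power2 L2_scale left_regular_L2)
      also have "\<dots> = real (card I) * (\<Sum>i\<in>I. (cmod (c i))\<^sup>2) * (L2_norm \<mu> f)\<^sup>2"
        using f by (simp add: L2_norm_scale power_mult_distrib L2_norm_power2 L2_ip_left_regular sum_distrib_right[symmetric])
      finally have "sqrt ((L2_norm \<mu> (?T f))\<^sup>2) \<le> sqrt (real (card I) * (\<Sum>i\<in>I. (cmod (c i))\<^sup>2) * (L2_norm \<mu> f)\<^sup>2)"
        by (rule real_sqrt_le_mono)
      then show ?thesis by (simp add: real_sqrt_mult L2_norm_nonneg)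
    qed
    then show "\<exists>C. \<forall>f\<in>L2 \<mu>. L2_norm \<mu> (?T f) \<le> C * L2_norm \<mu> f" by blast
  qed
  moreover have "L2_commute \<mu> S ?T"
    if S: "L2_operator \<mu> S" and comm: "\<forall>s. L2_commute \<mu> S (left_regular s)" for S
    unfolding L2_commute_def
  proof
    fix f assume f: "f \<in> L2 \<mu>"
    have "AE x in \<mu>. \<forall>i\<in>I. S (left_regular (s i) f) x = left_regular (s i) (S f) x"
      using comm f I by (intro AE_finite_allI) (auto simp: L2_commute_def)
    moreover have "AE x in \<mu>. S (?T f) x = (\<Sum>i\<in>I. c i * S (left_regular (s i) f) x)"
      by (rule L2_operator_sum[OF S left_regular_L2[OF f]])
    ultimately show "AE x in \<mu>. S (?T f) x = ?T (S f) x"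
      by eventually_elim simp
  qed
  ultimately show ?thesis unfolding VN_def by blast
qed

lemma VN_pairing_representation:
  assumes "u \<in> fourier_functions \<mu>"
  obtains \<xi> \<eta> where "\<xi> \<in> L2 \<mu>" "\<eta> \<in> L2 \<mu>" "u = coefficient \<mu> \<xi> \<eta>"
    "\<And>T. VN_pairing \<mu> T u = L2_inner \<mu> (T \<xi>) \<eta>"
proof -
  let ?P = "\<lambda>p. fst p \<in> L2 \<mu> \<and> snd p \<in> L2 \<mu> \<and> u = coefficient \<mu> (fst p) (snd p)"
  obtain \<xi> \<eta> where "\<xi> \<in> L2 \<mu>" "\<eta> \<in> L2 \<mu>" "u = coefficient \<mu> \<xi> \<eta>"
    using assms by (auto simp: fourier_functions_def)
  then have "?P (\<xi>, \<eta>)" by simp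
  then have P: "?P (SOME p. ?P p)" by (rule someI)
  have "VN_pairing \<mu> T u = L2_inner \<mu> (T (fst (SOME p. ?P p))) (snd (SOME p. ?P p))" for T
    by (simp add: VN_pairing_def case_prod_unfold)
  then show ?thesis using P that by blast
qed

text \<open>On combinations of translations the pairing sees only the values of \<open>u\<close>, so
  the choice of representing vectors made in \<open>VN_pairing\<close> disappears.\<close>

lemma VN_pairing_translation_combination:
  assumes "u \<in> fourier_functions \<mu>"
  shows "VN_pairing \<mu> (\<lambda>f x. \<Sum>i\<in>I. c i * left_regular (s i) f x) u = (\<Sum>i\<in>I. c i * u (s i))"
proof -
  obtain \<xi> \<eta> where u: "\<xi> \<in> L2 \<mu>" "\<eta> \<in> L2 \<mu>" "u = coefficient \<mu> \<xi> \<eta>"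
    "\<And>T. VN_pairing \<mu> T u = L2_inner \<mu> (T \<xi>) \<eta>"
    using VN_pairing_representation[OF assms] by blast
  show ?thesis
    unfolding u(4) by (subst L2_inner_sum_left) (simp_all add: u(1,2) left_regular_L2, simp add: u(3) coefficient_def)
qed

text \<open>A bound on the infimum defining the norm in M_n(A(G)) has content only if some constant
  is admissible. Each entry is a vector functional, whose amplifications Cauchy-Schwarz bounds by
  the norms of its two vectors; \<open>D\<close> adds up these bounds crudely over the
  entries.\<close>

lemma fourier_matrix_norm_nonempty:
  fixes n :: nat
  assumes u: "\<And>i j. i < n \<Longrightarrow> j < n \<Longrightarrow> u i j \<in> fourier_functions \<mu>"
  obtains C where "0 \<le> C" "\<And>m T. (\<And>k l. k < m \<Longrightarrow> l < m \<Longrightarrow> T k l \<in> VN \<mu>) \<Longrightarrow>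
    matrix_opnorm ({..<m} \<times> {..<n}) (\<lambda>(k, i) (l, j). VN_pairing \<mu> (T k l) (u i j)) \<le> C * L2_matrix_norm \<mu> m T"
proof -
  have "\<exists>\<xi> \<eta>. i < n \<longrightarrow> j < n \<longrightarrow> \<xi> \<in> L2 \<mu> \<and> \<eta> \<in> L2 \<mu> \<and> (\<forall>T. VN_pairing \<mu> T (u i j) = L2_inner \<mu> (T \<xi>) \<eta>)" for i j
    using VN_pairing_representation[OF u[of i j]] by blast
  then obtain \<xi> \<eta> where x: "\<And>i j. i < n \<Longrightarrow> j < n \<Longrightarrow> \<xi> i j \<in> L2 \<mu>" "\<And>i j. i < n \<Longrightarrow> j < n \<Longrightarrow> \<eta> i j \<in> L2 \<mu>"
    "\<And>i j T. i < n \<Longrightarrow> j < n \<Longrightarrow> VN_pairing \<mu> T (u i j) = L2_inner \<mu> (T (\<xi> i j)) (\<eta> i j)" by metis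
  define D where "D = real n * (\<Sum>i<n. \<Sum>j<n. (L2_norm \<mu> (\<xi> i j))\<^sup>2 * (L2_norm \<mu> (\<eta> i j))\<^sup>2)"
  have D0: "0 \<le> D" by (simp add: D_def sum_nonneg)
  have "matrix_opnorm ({..<m} \<times> {..<n}) (\<lambda>(k, i) (l, j). VN_pairing \<mu> (T k l) (u i j)) \<le> sqrt D * L2_matrix_norm \<mu> m T"
    if T: "\<And>k l. k < m \<Longrightarrow> l < m \<Longrightarrow> T k l \<in> VN \<mu>" for m T
  proof (rule matrix_opnorm_le)
    have op: "L2_operator \<mu> (T k l)" if "k < m" "l < m" for k l using T[OF that] by (simp add: VN_def)
    show "0 \<le> sqrt D * L2_matrix_norm \<mu> m T" using D0 L2_matrix_norm_bound(1)[OF op] by simp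
    fix v :: "nat \<times> nat \<Rightarrow> complex"
    define z where "z i j k = (\<Sum>l<m. VN_pairing \<mu> (T k l) (u i j) * v (l, j))" for i j k
    have z: "(\<Sum>k<m. (cmod (z i j k))\<^sup>2) \<le> (L2_matrix_norm \<mu> m T)\<^sup>2 * ((L2_norm \<mu> (\<xi> i j))\<^sup>2 * (L2_norm \<mu> (\<eta> i j))\<^sup>2) * (\<Sum>l<m. (cmod (v (l, j)))\<^sup>2)"
      if i: "i < n" and j: "j < n" for i j
    proof -
      have vm: "(\<lambda>x. v (l, j) * \<xi> i j x) \<in> L2 \<mu>" for l by (rule L2_scale[OF x(1)[OF i j]])
      have Tm: "T k l (\<xi> i j) \<in> L2 \<mu>" "T k l (\<lambda>x. v (l, j) * \<xi> i j x) \<in> L2 \<mu>" if "k < m" "l < m" for k l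
        using op[OF that] x(1)[OF i j] vm by (simp_all add: L2_operator_def)
      have "(cmod (z i j k))\<^sup>2 \<le> (L2_norm \<mu> (\<lambda>x. \<Sum>l<m. T k l (\<lambda>x. v (l, j) * \<xi> i j x) x))\<^sup>2 * (L2_norm \<mu> (\<eta> i j))\<^sup>2" if k: "k < m" for k
      proof -
        \<comment> \<open>Homogeneity of \<open>T k l\<close>, as the case of a sum with one
          term.\<close>
        have "AE x in \<mu>. T k l (\<lambda>y. \<Sum>o'\<in>{0::nat}. v (l, j) * \<xi> i j y) x = (\<Sum>o'\<in>{0::nat}. v (l, j) * T k l (\<xi> i j) x)" if l: "l < m" for l
          by (rule L2_operator_sum[OF op[OF k l] x(1)[OF i j]])
        then have ae: "AE x in \<mu>. \<forall>l\<in>{..<m}. T k l (\<lambda>y. v (l, j) * \<xi> i j y) x = v (l, j) * T k l (\<xi> i j) x"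
          by (intro AE_finite_allI) simp_all
        have "z i j k = L2_inner \<mu> (\<lambda>x. \<Sum>l<m. v (l, j) * T k l (\<xi> i j) x) (\<eta> i j)"
          unfolding z_def x(3)[OF i j]
          by (subst L2_inner_sum_left[where c = "\<lambda>l. v (l, j)" and f = "\<lambda>l. T k l (\<xi> i j)"])
              (simp_all add: Tm k x(2)[OF i j] mult.commute)
        also have "\<dots> = L2_inner \<mu> (\<lambda>x. \<Sum>l<m. T k l (\<lambda>x. v (l, j) * \<xi> i j x) x) (\<eta> i j)"
          unfolding L2_inner_def
        proof (rule integral_cong_AE)
          show "(\<lambda>x. (\<Sum>l<m. v (l, j) * T k l (\<xi> i j) x) * cnj (\<eta> i j x)) \<in> borel_measurable \<mu>"
            using Tm(1) k x(2)[OF i j] by (intro borel_measurable_times[OF L2D(1) cnj_borel_measurable[OF L2D(1)]] L2_sum L2_scale) auto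
          show "(\<lambda>x. (\<Sum>l<m. T k l (\<lambda>x. v (l, j) * \<xi> i j x) x) * cnj (\<eta> i j x)) \<in> borel_measurable \<mu>"
            using Tm(2) k x(2)[OF i j] by (intro borel_measurable_times[OF L2D(1) cnj_borel_measurable[OF L2D(1)]] L2_sum) auto
          show "AE x in \<mu>. (\<Sum>l<m. v (l, j) * T k l (\<xi> i j) x) * cnj (\<eta> i j x) = (\<Sum>l<m. T k l (\<lambda>x. v (l, j) * \<xi> i j x) x) * cnj (\<eta> i j x)"
            using ae by eventually_elim simp
        qed
        finally have "cmod (z i j k) \<le> L2_norm \<mu> (\<lambda>x. \<Sum>l<m. T k l (\<lambda>x. v (l, j) * \<xi> i j x) x) * L2_norm \<mu> (\<eta> i j)"
          using L2_Cauchy_Schwarz[OF L2_sum[of "{..<m}" "\<lambda>l. T k l (\<lambda>x. v (l, j) * \<xi> i j x)" \<mu>] x(2)[OF i j]] Tm(2) k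
          by (simp add: L2_norm_eq)
        then show ?thesis unfolding power_mult_distrib[symmetric] by (intro power_mono) simp_all
      qed
      then have "(\<Sum>k<m. (cmod (z i j k))\<^sup>2) \<le> (\<Sum>k<m. (L2_norm \<mu> (\<lambda>x. \<Sum>l<m. T k l (\<lambda>x. v (l, j) * \<xi> i j x) x))\<^sup>2) * (L2_norm \<mu> (\<eta> i j))\<^sup>2"
        unfolding sum_distrib_right by (intro sum_mono) simp
      also have "\<dots> \<le> ((L2_matrix_norm \<mu> m T)\<^sup>2 * (\<Sum>l<m. (L2_norm \<mu> (\<lambda>x. v (l, j) * \<xi> i j x))\<^sup>2)) * (L2_norm \<mu> (\<eta> i j))\<^sup>2"
        using vm by (intro mult_right_mono L2_matrix_norm_bound(2) op) simp_all
      also have "\<dots> = (L2_matrix_norm \<mu> m T)\<^sup>2 * ((L2_norm \<mu> (\<xi> i j))\<^sup>2 * (L2_norm \<mu> (\<eta> i j))\<^sup>2) * (\<Sum>l<m. (cmod (v (l, j)))\<^sup>2)"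
        unfolding L2_norm_scale power_mult_distrib sum_distrib_right[symmetric] by (simp add: mult_ac)
      finally show ?thesis .
    qed
    have split: "(\<Sum>b\<in>{..<m} \<times> {..<n}. g b) = (\<Sum>l<m. \<Sum>j<n. g (l, j))" for g :: "nat \<times> nat \<Rightarrow> 'z::comm_monoid_add"
      by (simp add: sum.cartesian_product)
    have inner: "(\<Sum>b\<in>{..<m} \<times> {..<n}. (case (k, i) of (k, i) \<Rightarrow> \<lambda>(l, j). VN_pairing \<mu> (T k l) (u i j)) b * v b) = (\<Sum>j<n. z i j k)" for k i
      unfolding split z_def by (subst sum.swap) simp
    have "(\<Sum>a\<in>{..<m} \<times> {..<n}. (cmod (\<Sum>b\<in>{..<m} \<times> {..<n}. (case a of (k, i) \<Rightarrow> \<lambda>(l, j). VN_pairing \<mu> (T k l) (u i j)) b * v b))\<^sup>2)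
        = (\<Sum>k<m. \<Sum>i<n. (cmod (\<Sum>j<n. z i j k))\<^sup>2)"
      by (simp only: split[of "\<lambda>a. (cmod (\<Sum>b\<in>{..<m} \<times> {..<n}. (case a of (k, i) \<Rightarrow> \<lambda>(l, j). VN_pairing \<mu> (T k l) (u i j)) b * v b))\<^sup>2"] inner)
    also have "\<dots> \<le> (\<Sum>k<m. \<Sum>i<n. real n * (\<Sum>j<n. (cmod (z i j k))\<^sup>2))"
      using cmod_sum_power2_le[of _ "{..<n}"] by (intro sum_mono) simp
    also have "\<dots> = (\<Sum>i<n. \<Sum>k<m. \<Sum>j<n. real n * (cmod (z i j k))\<^sup>2)"
      unfolding sum_distrib_left by (rule sum.swap)
    also have "\<dots> = (\<Sum>i<n. \<Sum>j<n. real n * (\<Sum>k<m. (cmod (z i j k))\<^sup>2))"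
      unfolding sum_distrib_left by (intro sum.cong refl sum.swap)
    also have "\<dots> \<le> (\<Sum>i<n. \<Sum>j<n. real n * ((L2_matrix_norm \<mu> m T)\<^sup>2 * ((L2_norm \<mu> (\<xi> i j))\<^sup>2 * (L2_norm \<mu> (\<eta> i j))\<^sup>2) * (\<Sum>b\<in>{..<m} \<times> {..<n}. (cmod (v b))\<^sup>2)))"
    proof (intro sum_mono mult_left_mono order.trans[OF z])
      fix i j assume ij: "i \<in> {..<n}" "j \<in> {..<n}"
      show "(\<Sum>l<m. (cmod (v (l, j)))\<^sup>2) \<le> (\<Sum>b\<in>{..<m} \<times> {..<n}. (cmod (v b))\<^sup>2)"
        unfolding split using ij by (intro sum_mono member_le_sum[of j _ "\<lambda>j. (cmod (v (_, j)))\<^sup>2"]) simp_all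
    qed (simp_all add: mult_nonneg_nonneg)
    also have "\<dots> = (sqrt D * L2_matrix_norm \<mu> m T)\<^sup>2 * (\<Sum>b\<in>{..<m} \<times> {..<n}. (cmod (v b))\<^sup>2)"
      using D0 by (simp add: power_mult_distrib) (simp add: D_def sum_distrib_left sum_distrib_right mult_ac)
    finally show "(\<Sum>a\<in>{..<m} \<times> {..<n}. (cmod (\<Sum>b\<in>{..<m} \<times> {..<n}. (case a of (k, i) \<Rightarrow> \<lambda>(l, j). VN_pairing \<mu> (T k l) (u i j)) b * v b))\<^sup>2)
        \<le> (sqrt D * L2_matrix_norm \<mu> m T)\<^sup>2 * (\<Sum>b\<in>{..<m} \<times> {..<n}. (cmod (v b))\<^sup>2)" .
  qed
  then show ?thesis using D0 by (intro that[of "sqrt D"]) simp_all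
qed

end

section \<open>Norms of translation matrices\<close>

text \<open>Real and imaginary parts do not interact, because the matrix is real.\<close>

lemma real_matrix_bound_complex:
  fixes A :: "'i \<Rightarrow> 'j \<Rightarrow> real" and v :: "'j \<Rightarrow> complex"
  assumes "\<And>v. (\<Sum>i\<in>I. (\<Sum>j\<in>J. A i j * v j)\<^sup>2) \<le> R * (\<Sum>j\<in>J. (v j)\<^sup>2)"
  shows "(\<Sum>i\<in>I. (cmod (\<Sum>j\<in>J. of_real (A i j) * v j))\<^sup>2) \<le> R * (\<Sum>j\<in>J. (cmod (v j))\<^sup>2)"
proof -
  have "(\<Sum>i\<in>I. (cmod (\<Sum>j\<in>J. of_real (A i j) * v j))\<^sup>2)
      = (\<Sum>i\<in>I. (\<Sum>j\<in>J. A i j * Re (v j))\<^sup>2) + (\<Sum>i\<in>I. (\<Sum>j\<in>J. A i j * Im (v j))\<^sup>2)"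
    by (simp add: cmod_power2 sum.distrib)
  also have "\<dots> \<le> R * (\<Sum>j\<in>J. (Re (v j))\<^sup>2) + R * (\<Sum>j\<in>J. (Im (v j))\<^sup>2)"
    by (intro add_mono assms)
  also have "\<dots> = R * (\<Sum>j\<in>J. (cmod (v j))\<^sup>2)"
    by (simp add: cmod_power2 sum.distrib distrib_left)
  finally show ?thesis .
qed

lemma L2_inner_scale_right: "L2_inner M f (\<lambda>x. c * g x) = cnj c * L2_inner M f g"
  using L2_inner_cnj[of M "\<lambda>x. c * g x" f] L2_inner_cnj[of M g f] L2_inner_scale_left[of M c g f]
  by (metis complex_cnj_mult)

context haar
begin

text \<open>Transference from the regular representation of the discrete group: the coefficient
  \<open>\<phi>\<close> of \<open>w\<close> allows one to compress to the finite set \<open>F\<close>, pointwise in the variable of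
  integration.\<close>

lemma translation_matrix_norm:
  fixes s :: "nat \<Rightarrow> 'a" and a :: "nat \<Rightarrow> nat \<Rightarrow> nat \<Rightarrow> real" and w :: "'a \<Rightarrow> real"
  assumes F: "finite F" and w: "\<And>h. h \<notin> F \<Longrightarrow> w h = 0" "(\<Sum>h\<in>F. (w h)\<^sup>2) = 1" and R: "0 \<le> R"
    and sandwich: "\<And>v. (\<Sum>g\<in>F. \<Sum>k<N. (\<Sum>i<n. \<Sum>h\<in>F. (if g = s i + h then 1 else 0) * (\<Sum>l<N. a i k l * v h l))\<^sup>2)
       \<le> R * (\<Sum>h\<in>F. \<Sum>l<N. (v h l)\<^sup>2)"
  defines "\<phi> \<equiv> \<lambda>i. \<Sum>h\<in>F. w (s i + h) * w h"
  shows "L2_matrix_norm \<mu> N (\<lambda>k l f x. \<Sum>i<n. complex_of_real (\<phi> i * a i k l) * left_regular (s i) f x) \<le> sqrt R"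
proof (rule L2_matrix_norm_le[OF R])
  define b where "b i g h = (if g = s i + h then 1 else 0 :: real)" for i g h
  define A where "A = (\<lambda>(g, k) (h, l). \<Sum>i<n. b i g h * a i k l)"
  have A_real: "(\<Sum>p\<in>F \<times> {..<N}. (\<Sum>q\<in>F \<times> {..<N}. A p q * v q)\<^sup>2) \<le> R * (\<Sum>q\<in>F \<times> {..<N}. (v q)\<^sup>2)" for v
  proof -
    have "(\<Sum>q\<in>F \<times> {..<N}. A (g, k) q * v q) = (\<Sum>i<n. \<Sum>h\<in>F. b i g h * (\<Sum>l<N. a i k l * v (h, l)))" for g k
    proof -
      have "(\<Sum>q\<in>F \<times> {..<N}. A (g, k) q * v q) = (\<Sum>h\<in>F. \<Sum>l<N. \<Sum>i<n. b i g h * (a i k l * v (h, l)))"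
        by (simp add: sum.cartesian_product' A_def sum_distrib_right mult.assoc)
      also have "\<dots> = (\<Sum>h\<in>F. \<Sum>i<n. \<Sum>l<N. b i g h * (a i k l * v (h, l)))"
        by (intro sum.cong refl sum.swap)
      also have "\<dots> = (\<Sum>i<n. \<Sum>h\<in>F. \<Sum>l<N. b i g h * (a i k l * v (h, l)))"
        by (rule sum.swap)
      finally show ?thesis by (simp add: sum_distrib_left)
    qed
    then have "(\<Sum>p\<in>F \<times> {..<N}. (\<Sum>q\<in>F \<times> {..<N}. A p q * v q)\<^sup>2)
        = (\<Sum>g\<in>F. \<Sum>k<N. (\<Sum>i<n. \<Sum>h\<in>F. b i g h * (\<Sum>l<N. a i k l * v (h, l)))\<^sup>2)"
      by (simp add: sum.cartesian_product'[of "\<lambda>p. (\<Sum>q\<in>F \<times> {..<N}. A p q * v q)\<^sup>2"])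
    also have "\<dots> \<le> R * (\<Sum>h\<in>F. \<Sum>l<N. (v (h, l))\<^sup>2)"
      using sandwich[of "\<lambda>h l. v (h, l)"] by (simp only: b_def)
    finally show ?thesis by (simp add: sum.cartesian_product'[of "\<lambda>q. (v q)\<^sup>2"])
  qed
  fix \<xi> :: "nat \<Rightarrow> 'a \<Rightarrow> complex"
  assume \<xi>: "\<And>l. l < N \<Longrightarrow> \<xi> l \<in> L2 \<mu>"
  \<comment> \<open>\<open>\<zeta>\<close> is the image of \<open>\<xi>\<close>. The weight
    \<open>w\<close> spreads \<open>\<xi>\<close> and \<open>\<zeta>\<close> over \<open>F\<close>
    as \<open>X\<close> and \<open>P\<close>, translated back by each element of \<open>F\<close>,
    and \<open>Q\<close> applies the compressed matrix \<open>A\<close> to \<open>X\<close> at every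
    point. The plan is to express the square norm of \<open>\<zeta>\<close> as the inner product of
    \<open>Q\<close> and \<open>P\<close>.\<close>
  define \<zeta> where "\<zeta> k = (\<lambda>x. \<Sum>l<N. \<Sum>i<n. complex_of_real (\<phi> i * a i k l) * left_regular (s i) (\<xi> l) x)" for k
  have \<zeta>: "\<zeta> k \<in> L2 \<mu>" for k unfolding \<zeta>_def by (intro L2_sum L2_scale left_regular_L2 \<xi>) simp
  define X where "X = (\<lambda>(h, l) x. complex_of_real (w h) * left_regular (- h) (\<xi> l) x)"
  define Q where "Q p x = (\<Sum>q\<in>F \<times> {..<N}. complex_of_real (A p q) * X q x)" for p x
  define P where "P = (\<lambda>(g, k) x. complex_of_real (w g) * left_regular (- g) (\<zeta> k) x)"
  have X: "X q \<in> L2 \<mu>" if "q \<in> F \<times> {..<N}" for q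
    using that unfolding X_def by (auto intro!: L2_scale left_regular_L2 \<xi>)
  have Q: "Q p \<in> L2 \<mu>" for p unfolding Q_def by (intro L2_sum L2_scale X)
  have P: "P p \<in> L2 \<mu>" for p
    unfolding P_def by (cases p) (auto intro!: L2_scale left_regular_L2 \<zeta>)
  define c where "c i l k = L2_inner \<mu> (left_regular (s i) (\<xi> l)) (\<zeta> k)" for i l k
  \<comment> \<open>Where \<open>b i g h\<close> is nonzero, g = s_i + h, and the two translations
    differ exactly by \<open>s i\<close>. The inner product then no longer depends on
    \<open>g\<close> and \<open>h\<close>, and summing the weights produces
    \<open>\<phi> i\<close>.\<close>
  have shift: "b i g h * L2_inner \<mu> (left_regular (- h) (\<xi> l)) (left_regular (- g) (\<zeta> k)) = b i g h * c i l k"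
    if l: "l < N" for i g h l k
  proof (cases "g = s i + h")
    case True
    have "left_regular (- h) (\<xi> l) = left_regular (- g) (left_regular (s i) (\<xi> l))"
      by (simp add: True left_regular_left_regular minus_add add.assoc del: add_uminus_conv_diff)
    then show ?thesis by (simp only: c_def L2_inner_left_regular[OF left_regular_L2[OF \<xi>[OF l]] \<zeta>])
  qed (simp add: b_def)
  have "L2_inner \<mu> (Q (g, k)) (P (g, k)) = (\<Sum>h\<in>F. \<Sum>l<N. \<Sum>i<n. b i g h * (w g * w h) * a i k l * c i l k)" for g k
  proof -
    have "L2_inner \<mu> (Q (g, k)) (P (g, k)) = (\<Sum>q\<in>F \<times> {..<N}. A (g, k) q * L2_inner \<mu> (X q) (P (g, k)))"
      unfolding Q_def by (rule L2_inner_sum_left[OF X P])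
    also have "\<dots> = (\<Sum>h\<in>F. \<Sum>l<N. \<Sum>i<n. a i k l * (w g * w h) *
        (b i g h * L2_inner \<mu> (left_regular (- h) (\<xi> l)) (left_regular (- g) (\<zeta> k))))"
      unfolding sum.cartesian_product' A_def X_def P_def prod.case L2_inner_scale_left L2_inner_scale_right
        of_real_sum sum_distrib_right
      by (simp add: mult_ac)
    also have "\<dots> = (\<Sum>h\<in>F. \<Sum>l<N. \<Sum>i<n. b i g h * (w g * w h) * a i k l * c i l k)"
      by (intro sum.cong refl) (simp add: shift mult_ac)
    finally show ?thesis .
  qed
  then have "(\<Sum>p\<in>F \<times> {..<N}. L2_inner \<mu> (Q p) (P p))
      = (\<Sum>g\<in>F. \<Sum>k<N. \<Sum>h\<in>F. \<Sum>l<N. \<Sum>i<n. b i g h * (w g * w h) * a i k l * c i l k)"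
    by (simp add: sum.cartesian_product')
  also have "\<dots> = (\<Sum>k<N. \<Sum>g\<in>F. \<Sum>h\<in>F. \<Sum>l<N. \<Sum>i<n. b i g h * (w g * w h) * a i k l * c i l k)"
    by (rule sum.swap)
  also have "\<dots> = (\<Sum>k<N. \<Sum>l<N. \<Sum>i<n. \<phi> i * a i k l * c i l k)"
  proof (intro sum.cong refl)
    fix k
    have \<phi>: "(\<Sum>g\<in>F. \<Sum>h\<in>F. b i g h * (w g * w h)) = \<phi> i" for i
    proof -
      have "(\<Sum>g\<in>F. b i g h * (w g * w h)) = w (s i + h) * w h" for h
        using F w(1)[of "s i + h"] by (simp add: b_def if_distrib[of "\<lambda>x. x * _"] cong: if_cong)
      then show ?thesis unfolding \<phi>_def by (subst sum.swap) simp
    qed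
    have "(\<Sum>g\<in>F. \<Sum>h\<in>F. \<Sum>l<N. \<Sum>i<n. b i g h * (w g * w h) * a i k l * c i l k)
        = (\<Sum>l<N. \<Sum>i<n. \<Sum>g\<in>F. \<Sum>h\<in>F. b i g h * (w g * w h) * a i k l * c i l k)"
      by (simp only: sum.swap[of _ "{..<N}" F] sum.swap[of _ "{..<n}" F])
    also have "\<dots> = (\<Sum>l<N. \<Sum>i<n. (\<Sum>g\<in>F. \<Sum>h\<in>F. b i g h * (w g * w h)) * a i k l * c i l k)"
      by (simp add: sum_distrib_right)
    finally show "(\<Sum>g\<in>F. \<Sum>h\<in>F. \<Sum>l<N. \<Sum>i<n. b i g h * (w g * w h) * a i k l * c i l k)
        = (\<Sum>l<N. \<Sum>i<n. \<phi> i * a i k l * c i l k)" by (simp add: \<phi>)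
  qed
  also have "\<dots> = (\<Sum>k<N. L2_inner \<mu> (\<zeta> k) (\<zeta> k))"
  proof (intro sum.cong refl)
    fix k
    have "L2_inner \<mu> (\<zeta> k) (\<zeta> k) = (\<Sum>l<N. 1 * L2_inner \<mu> (\<lambda>x. \<Sum>i<n. complex_of_real (\<phi> i * a i k l) * left_regular (s i) (\<xi> l) x) (\<zeta> k))"
      using \<xi> by (subst L2_inner_sum_left[symmetric]) (auto intro!: L2_sum L2_scale left_regular_L2 \<zeta> simp: \<zeta>_def[of k])
    also have "\<dots> = (\<Sum>l<N. \<Sum>i<n. \<phi> i * a i k l * c i l k)"
    proof (intro sum.cong refl)
      fix l assume l: "l \<in> {..<N}"
      have "L2_inner \<mu> (\<lambda>x. \<Sum>i<n. complex_of_real (\<phi> i * a i k l) * left_regular (s i) (\<xi> l) x) (\<zeta> k)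
          = (\<Sum>i<n. complex_of_real (\<phi> i * a i k l) * c i l k)"
        unfolding c_def using l by (intro L2_inner_sum_left left_regular_L2 \<xi> \<zeta>) simp
      then show "1 * L2_inner \<mu> (\<lambda>x. \<Sum>i<n. complex_of_real (\<phi> i * a i k l) * left_regular (s i) (\<xi> l) x) (\<zeta> k)
          = (\<Sum>i<n. \<phi> i * a i k l * c i l k)" by simp
    qed
    finally show "(\<Sum>l<N. \<Sum>i<n. \<phi> i * a i k l * c i l k) = L2_inner \<mu> (\<zeta> k) (\<zeta> k)" ..
  qed
  finally have main: "(\<Sum>k<N. L2_inner \<mu> (\<zeta> k) (\<zeta> k)) = (\<Sum>p\<in>F \<times> {..<N}. L2_inner \<mu> (Q p) (P p))" ..
  have "(\<Sum>k<N. L2_ip \<mu> (\<zeta> k) (\<zeta> k)) = (\<Sum>p\<in>F \<times> {..<N}. L2_ip \<mu> (Q p) (P p))"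
    using arg_cong[OF main, of Re] by (simp add: L2_ip_def)
  also have "\<dots> \<le> (\<Sum>p\<in>F \<times> {..<N}. (L2_ip \<mu> (Q p) (Q p) + L2_ip \<mu> (P p) (P p)) / 2)"
  proof (intro sum_mono)
    fix p
    have "L2_ip \<mu> (Q p) (P p) \<le> L2.nm (Q p) * L2.nm (P p)"
      using L2.ip_Cauchy_Schwarz[OF Q P, of p p] by linarith
    also have "\<dots> \<le> ((L2.nm (Q p))\<^sup>2 + (L2.nm (P p))\<^sup>2) / 2"
      using sum_squares_bound[of "L2.nm (Q p)" "L2.nm (P p)"] by simp
    finally show "L2_ip \<mu> (Q p) (P p) \<le> (L2_ip \<mu> (Q p) (Q p) + L2_ip \<mu> (P p) (P p)) / 2"
      by (simp add: L2.nm_power2 Q P)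
  qed
  also have "\<dots> = ((\<Sum>p\<in>F \<times> {..<N}. L2_ip \<mu> (Q p) (Q p)) + (\<Sum>p\<in>F \<times> {..<N}. L2_ip \<mu> (P p) (P p))) / 2"
    by (simp add: sum.distrib sum_divide_distrib[symmetric])
  finally have half: "(\<Sum>k<N. L2_ip \<mu> (\<zeta> k) (\<zeta> k))
    \<le> ((\<Sum>p\<in>F \<times> {..<N}. L2_ip \<mu> (Q p) (Q p)) + (\<Sum>p\<in>F \<times> {..<N}. L2_ip \<mu> (P p) (P p))) / 2" .
  have ip_scaled: "L2_ip \<mu> (\<lambda>x. complex_of_real t * left_regular g f x) (\<lambda>x. complex_of_real t * left_regular g f x)
      = t\<^sup>2 * L2_ip \<mu> f f" if "f \<in> L2 \<mu>" for t g f
    using L2_ip_cmult_cmult[of t "left_regular g f"] L2_ip_left_regular[OF that that] by (simp add: cmult_def)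
  have PP: "(\<Sum>p\<in>F \<times> {..<N}. L2_ip \<mu> (P p) (P p)) = (\<Sum>k<N. L2_ip \<mu> (\<zeta> k) (\<zeta> k))"
    unfolding sum.cartesian_product' P_def prod.case ip_scaled[OF \<zeta>] sum_distrib_left[symmetric] sum_distrib_right[symmetric] w(2)
    by simp
  have XX: "(\<Sum>q\<in>F \<times> {..<N}. L2_ip \<mu> (X q) (X q)) = (\<Sum>l<N. L2_ip \<mu> (\<xi> l) (\<xi> l))"
  proof -
    have "(\<Sum>q\<in>F \<times> {..<N}. L2_ip \<mu> (X q) (X q)) = (\<Sum>h\<in>F. \<Sum>l<N. (w h)\<^sup>2 * L2_ip \<mu> (\<xi> l) (\<xi> l))"
      unfolding sum.cartesian_product' X_def prod.case by (intro sum.cong refl ip_scaled \<xi>) simp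
    then show ?thesis by (simp add: sum_distrib_left[symmetric] sum_distrib_right[symmetric] w(2))
  qed
  \<comment> \<open>The scalar matrix bound is integrated pointwise in \<open>x\<close>.\<close>
  have QQ: "(\<Sum>p\<in>F \<times> {..<N}. L2_ip \<mu> (Q p) (Q p)) \<le> R * (\<Sum>q\<in>F \<times> {..<N}. L2_ip \<mu> (X q) (X q))"
  proof -
    have "(\<Sum>p\<in>F \<times> {..<N}. L2_ip \<mu> (Q p) (Q p)) = (LINT x|\<mu>. (\<Sum>p\<in>F \<times> {..<N}. (cmod (Q p x))\<^sup>2))"
      using L2D(2)[OF Q] by (simp add: L2_ip_self)
    also have "\<dots> \<le> (LINT x|\<mu>. R * (\<Sum>q\<in>F \<times> {..<N}. (cmod (X q x))\<^sup>2))"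
      using L2D(2)[OF Q] L2D(2)[OF X] real_matrix_bound_complex[OF A_real]
      by (intro integral_mono) (auto simp: Q_def[abs_def] simp del: mem_Sigma_iff)
    also have "\<dots> = R * (\<Sum>q\<in>F \<times> {..<N}. L2_ip \<mu> (X q) (X q))"
      using L2D(2)[OF X] by (simp add: L2_ip_self del: mem_Sigma_iff)
    finally show ?thesis .
  qed
  have "(\<Sum>k<N. L2_ip \<mu> (\<zeta> k) (\<zeta> k)) \<le> R * (\<Sum>l<N. L2_ip \<mu> (\<xi> l) (\<xi> l))"
  proof -
    \<comment> \<open>As the squares of \<open>w\<close> sum to 1, \<open>P\<close> has the same
      norm as \<open>\<zeta>\<close>; the term on the right is absorbed into the left.\<close>
    have "x \<le> r" if "x \<le> (q + x) / 2" "q \<le> r" for x q r :: real using that by simp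
    from this[OF half[unfolded PP] QQ[unfolded XX]] show ?thesis .
  qed
  then show "(\<Sum>k<N. (L2_norm \<mu> (\<lambda>x. \<Sum>l<N. \<Sum>i<n. complex_of_real (\<phi> i * a i k l) * left_regular (s i) (\<xi> l) x))\<^sup>2)
      \<le> R * (\<Sum>l<N. (L2_norm \<mu> (\<xi> l))\<^sup>2)"
    by (simp add: L2_norm_power2 \<zeta>_def)
qed

end

section \<open>Cb-Helson sets\<close>

context haar
begin

text \<open>Complete boundedness of the inverse gives one constant for all matrix sizes. The
  constant is \<open>\<bar>D\<bar> + 1\<close>, because a strict inequality is needed twice: to
  choose a lift close to the quotient norm, and to choose an admissible constant close to the norm
  of that lift.\<close>

lemma cb_Helson_lift:
  assumes E: "cb_Helson \<mu> E"
  obtains C where "0 \<le> C"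
    "\<And>(n::nat) f. (\<And>i j. i < n \<Longrightarrow> j < n \<Longrightarrow> f i j \<in> os_carrier (C0_space E)) \<Longrightarrow>
      (\<And>s. s \<in> E \<Longrightarrow> matrix_opnorm {..<n} (\<lambda>i j. f i j s) \<le> 1) \<Longrightarrow>
      \<exists>x. (\<forall>i<n. \<forall>j<n. x i j \<in> fourier_functions \<mu> \<and> (\<forall>s\<in>E. x i j s = f i j s)) \<and>
        (\<forall>m T. (\<forall>k<m. \<forall>l<m. T k l \<in> VN \<mu>) \<longrightarrow>
          matrix_opnorm ({..<m} \<times> {..<n}) (\<lambda>(k, i) (l, j). VN_pairing \<mu> (T k l) (x i j)) \<le> C * L2_matrix_norm \<mu> m T)"
proof -
  let ?V = "fourier_quotient \<mu> E" and ?W = "C0_space E"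
  define \<psi> where "\<psi> = inv_into (os_carrier ?V) (fourier_inc E)"
  have bij: "bij_betw (fourier_inc E) (os_carrier ?V) (os_carrier ?W)" and cb: "completely_bounded ?W ?V \<psi>"
    using E by (simp_all add: cb_Helson_def operator_space_isomorphism_def \<psi>_def)
  obtain D where D: "\<And>n f. (\<forall>i<n. \<forall>j<n. f i j \<in> os_carrier ?W) \<Longrightarrow> os_norm ?V n (\<lambda>i j. \<psi> (f i j)) \<le> D * os_norm ?W n f"
    using cb unfolding completely_bounded_def by blast
  have coset: "u \<in> fourier_functions \<mu> \<and> (\<forall>s\<in>E. u s = f s)" if f: "f \<in> os_carrier ?W" and u: "u \<in> \<psi> f" for f u
  proof -
    have "\<psi> f \<in> os_carrier ?V" using f bij unfolding \<psi>_def bij_betw_def by (metis inv_into_into)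
    then obtain g where g: "g \<in> fourier_functions \<mu>" "\<psi> f = os_coset (fourier_algebra \<mu>) (vanishing_ideal \<mu> E) g"
      by (auto simp: fourier_quotient_def quotient_space_def fourier_algebra_def)
    have mem: "y \<in> fourier_functions \<mu> \<and> (\<forall>s\<in>E. y s = g s)" if y: "y \<in> \<psi> f" for y
    proof -
      obtain v where v: "v \<in> vanishing_ideal \<mu> E" "y = (\<lambda>s. g s + v s)"
        using y by (auto simp: g(2) os_coset_def fourier_algebra_def)
      have "v s = 0" if "s \<in> E" for s
      proof -
        have "restrict_zero E v s = 0" using v(1) by (simp add: vanishing_ideal_def)
        then show ?thesis using that by (simp add: restrict_zero_def)
      qed
      \<comment> \<open>A member of the coset is \<open>g + v\<close>, a sum of two coefficient
        functions. Eymard's theorem makes it a coefficient function again.\<close>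
      then show ?thesis using v fourier_functions_add[OF g(1), of v] by (simp add: vanishing_ideal_def)
    qed
    have inc: "fourier_inc E (\<psi> f) = f" using f bij unfolding \<psi>_def bij_betw_def by (metis f_inv_into_f)
    have chosen: "(SOME u. u \<in> \<psi> f) \<in> \<psi> f" using someI[of "\<lambda>u. u \<in> \<psi> f"] u by blast
    have "f s = g s" if s: "s \<in> E" for s
    proof -
      have "f s = fourier_inc E (\<psi> f) s" by (simp only: inc)
      also have "\<dots> = (SOME u. u \<in> \<psi> f) s" by (simp add: fourier_inc_def restrict_zero_def s)
      also have "\<dots> = g s" using mem[OF chosen] s by blast
      finally show ?thesis .
    qed
    then show ?thesis using mem[OF u] by simp
  qed
  have nonempty: "\<psi> f \<noteq> {}" if f: "f \<in> os_carrier ?W" for f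
  proof -
    have "\<psi> f \<in> os_carrier ?V" using f bij unfolding \<psi>_def bij_betw_def by (metis inv_into_into)
    moreover have "(\<lambda>s. 0) \<in> vanishing_ideal \<mu> E" using zero_fourier by (simp add: vanishing_ideal_def restrict_zero_def)
    ultimately show ?thesis by (auto simp: fourier_quotient_def quotient_space_def os_coset_def)
  qed
  have "\<exists>x. (\<forall>i<n. \<forall>j<n. x i j \<in> fourier_functions \<mu> \<and> (\<forall>s\<in>E. x i j s = f i j s)) \<and>
        (\<forall>m T. (\<forall>k<m. \<forall>l<m. T k l \<in> VN \<mu>) \<longrightarrow>
          matrix_opnorm ({..<m} \<times> {..<n}) (\<lambda>(k, i) (l, j). VN_pairing \<mu> (T k l) (x i j)) \<le> (\<bar>D\<bar> + 1) * L2_matrix_norm \<mu> m T)"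
    if f: "\<And>i j. i < n \<Longrightarrow> j < n \<Longrightarrow> f i j \<in> os_carrier ?W"
      and f1: "\<And>s. s \<in> E \<Longrightarrow> matrix_opnorm {..<n} (\<lambda>i j. f i j s) \<le> 1" for n :: nat and f
  proof -
    let ?B = "{C. 0 \<le> C \<and> (\<forall>s\<in>E. matrix_opnorm {..<n} (\<lambda>i j. f i j s) \<le> C)}"
    have B1: "1 \<in> ?B" using f1 by simp
    have "0 \<le> Inf ?B" using B1 by (intro cInf_greatest) blast+
    moreover have "Inf ?B \<le> 1" using B1 by (intro cInf_lower bdd_belowI[of _ 0]) blast+
    ultimately have W: "0 \<le> os_norm ?W n f" "os_norm ?W n f \<le> 1" by (simp_all add: C0_space_def)
    have "os_norm ?V n (\<lambda>i j. \<psi> (f i j)) \<le> D * os_norm ?W n f" using f by (intro D) simp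
    also have "\<dots> \<le> \<bar>D\<bar> * 1" using W by (intro mult_mono) auto
    finally have "os_norm ?V n (\<lambda>i j. \<psi> (f i j)) < \<bar>D\<bar> + 1" by simp
    then have less: "Inf {fourier_matrix_norm \<mu> n x | x. \<forall>i<n. \<forall>j<n. x i j \<in> \<psi> (f i j)} < \<bar>D\<bar> + 1"
      by (simp add: fourier_quotient_def quotient_space_def fourier_algebra_def)
    have "\<forall>i<n. \<forall>j<n. (SOME u. u \<in> \<psi> (f i j)) \<in> \<psi> (f i j)"
      using nonempty[OF f] by (simp add: some_in_eq)
    then have "fourier_matrix_norm \<mu> n (\<lambda>i j. SOME u. u \<in> \<psi> (f i j))
        \<in> {fourier_matrix_norm \<mu> n x | x. \<forall>i<n. \<forall>j<n. x i j \<in> \<psi> (f i j)}"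
      by (intro CollectI exI[of _ "\<lambda>i j. SOME u. u \<in> \<psi> (f i j)"] conjI) simp_all
    then have "{fourier_matrix_norm \<mu> n x | x. \<forall>i<n. \<forall>j<n. x i j \<in> \<psi> (f i j)} \<noteq> {}" by (rule ex_in_conv[THEN iffD1, OF exI])
    from cInf_lessD[OF this less]
    obtain x where x: "\<forall>i<n. \<forall>j<n. x i j \<in> \<psi> (f i j)" "fourier_matrix_norm \<mu> n x < \<bar>D\<bar> + 1" by blast
    have xf: "x i j \<in> fourier_functions \<mu> \<and> (\<forall>s\<in>E. x i j s = f i j s)" if ij: "i < n" "j < n" for i j
      using x(1) ij by (intro coset f) simp_all
    let ?S = "{C. 0 \<le> C \<and> (\<forall>m T. (\<forall>k<m. \<forall>l<m. T k l \<in> VN \<mu>) \<longrightarrow>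
      matrix_opnorm ({..<m} \<times> {..<n}) (\<lambda>(k, i) (l, j). VN_pairing \<mu> (T k l) (x i j)) \<le> C * L2_matrix_norm \<mu> m T)}"
    obtain C0 where C0: "0 \<le> C0" "\<And>m T. (\<And>k l. k < m \<Longrightarrow> l < m \<Longrightarrow> T k l \<in> VN \<mu>) \<Longrightarrow>
        matrix_opnorm ({..<m} \<times> {..<n}) (\<lambda>(k, i) (l, j). VN_pairing \<mu> (T k l) (x i j)) \<le> C0 * L2_matrix_norm \<mu> m T"
      using fourier_matrix_norm_nonempty[of n x] xf by blast
    have "C0 \<in> ?S" using C0 by simp
    then have "?S \<noteq> {}" by blast
    from cInf_lessD[OF this x(2)[unfolded fourier_matrix_norm_def]]
    obtain C' where C': "C' \<in> ?S" "C' < \<bar>D\<bar> + 1" by blast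
    have "matrix_opnorm ({..<m} \<times> {..<n}) (\<lambda>(k, i) (l, j). VN_pairing \<mu> (T k l) (x i j)) \<le> (\<bar>D\<bar> + 1) * L2_matrix_norm \<mu> m T"
      if T: "\<forall>k<m. \<forall>l<m. T k l \<in> VN \<mu>" for m T
    proof -
      have "0 \<le> L2_matrix_norm \<mu> m T" using T by (intro L2_matrix_norm_bound(1)) (simp add: VN_def)
      then have "C' * L2_matrix_norm \<mu> m T \<le> (\<bar>D\<bar> + 1) * L2_matrix_norm \<mu> m T"
        using C'(2) by (intro mult_right_mono) simp_all
      moreover have "matrix_opnorm ({..<m} \<times> {..<n}) (\<lambda>(k, i) (l, j). VN_pairing \<mu> (T k l) (x i j)) \<le> C' * L2_matrix_norm \<mu> m T"
        using C'(1) T by simp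
      ultimately show ?thesis by linarith
    qed
    then show ?thesis using xf by blast
  qed
  then show ?thesis by (intro that[of "\<bar>D\<bar> + 1"]) simp_all
qed

text \<open>A locally compact Hausdorff space is completely regular. The point is separated from the
  complement of a relatively compact neighbourhood from which \<open>A\<close> has been
  removed.\<close>

lemma separating_function:
  fixes x :: 'a
  assumes A: "finite A" "x \<notin> A"
  obtains h :: "'a \<Rightarrow> real" and K where "continuous_on UNIV h" "compact K" "\<And>y. y \<notin> K \<Longrightarrow> h y = 0"
    "\<And>y. 0 \<le> h y" "\<And>y. h y \<le> 1" "h x = 1" "\<And>y. y \<in> A \<Longrightarrow> h y = 0"
proof -
  obtain U K where UK: "open U" "compact K" "x \<in> U" "U \<subseteq> K"
    using locally_compact unfolding locally_compact_space_def by (simp add: compactin_euclidean_iff) metis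
  have "Hausdorff_space (euclidean :: 'a topology)"
    unfolding Hausdorff_space_def disjnt_def by (auto intro: hausdorff[simplified])
  then have "completely_regular_space (euclidean :: 'a topology)"
    by (simp add: locally_compact_regular_imp_completely_regular_space locally_compact)
  moreover have "closedin euclidean (- (U - A))"
    using UK(1) A(1) by (simp add: open_Diff finite_imp_closed closed_Compl del: Compl_Diff_eq)
  moreover have "x \<in> topspace euclidean - (- (U - A))" using UK(3) A(2) by simp
  ultimately obtain f where "continuous_map euclidean (top_of_set {0..1::real}) f" and f: "f x = 0" "f ` (- (U - A)) \<subseteq> {1}"
    unfolding completely_regular_space_def by blast
  then have f': "continuous_on UNIV f" "range f \<subseteq> {0..1}"
    by (auto simp: continuous_map_in_subtopology)
  show ?thesis
  proof (rule that[of "\<lambda>y. 1 - f y" K])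
    show "continuous_on UNIV (\<lambda>y. 1 - f y)" using f'(1) by (intro continuous_intros)
  qed (use f f'(2) UK in \<open>auto simp: image_subset_iff\<close>)
qed

text \<open>Subtracting from each function the sum of the others and truncating at 0 makes the
  supports disjoint: \<open>g i y\<close> and \<open>g j y\<close> cannot both be positive, as each
  of \<open>h i y\<close> and \<open>h j y\<close> would exceed the other. The values at the points
  \<open>s i\<close> are unchanged.\<close>

lemma bump_functions:
  fixes s :: "nat \<Rightarrow> 'a"
  assumes s: "inj_on s {..<n}"
  obtains g :: "nat \<Rightarrow> 'a \<Rightarrow> real" and K where
    "\<And>i. i < n \<Longrightarrow> continuous_on UNIV (g i)" "compact K" "\<And>i y. i < n \<Longrightarrow> y \<notin> K \<Longrightarrow> g i y = 0"
    "\<And>i y. i < n \<Longrightarrow> 0 \<le> g i y \<and> g i y \<le> 1" "\<And>i. i < n \<Longrightarrow> g i (s i) = 1"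
    "\<And>i j y. i < n \<Longrightarrow> j < n \<Longrightarrow> i \<noteq> j \<Longrightarrow> g i y = 0 \<or> g j y = 0"
proof -
  define P where "P i h K \<longleftrightarrow> continuous_on UNIV h \<and> compact K \<and> (\<forall>y. y \<notin> K \<longrightarrow> h y = 0) \<and>
    (\<forall>y. 0 \<le> h y \<and> h y \<le> (1::real)) \<and> h (s i) = 1 \<and> (\<forall>y\<in>s ` ({..<n} - {i}). h y = 0)" for i h K
  have "\<exists>h K. P i h K" if i: "i < n" for i
  proof -
    have "finite (s ` ({..<n} - {i}))" "s i \<notin> s ` ({..<n} - {i})" using s i by (auto simp: inj_on_def)
    from separating_function[OF this] show ?thesis unfolding P_def by metis
  qed
  then obtain h L where hL: "\<And>i. i < n \<Longrightarrow> P i (h i) (L i)" by metis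
  have h: "\<And>i. i < n \<Longrightarrow> continuous_on UNIV (h i)" "\<And>i. i < n \<Longrightarrow> compact (L i)"
    "\<And>i y. i < n \<Longrightarrow> y \<notin> L i \<Longrightarrow> h i y = 0" "\<And>i y. i < n \<Longrightarrow> 0 \<le> h i y \<and> h i y \<le> (1::real)"
    "\<And>i. i < n \<Longrightarrow> h i (s i) = 1" "\<And>i y. i < n \<Longrightarrow> y \<in> s ` ({..<n} - {i}) \<Longrightarrow> h i y = 0"
    using hL unfolding P_def by blast+
  define g where "g i y = max 0 (h i y - (\<Sum>j\<in>{..<n} - {i}. h j y))" for i y
  have others: "0 \<le> (\<Sum>j\<in>{..<n} - {i}. h j y)" for i y using h(4) by (intro sum_nonneg) simp
  have le: "g i y \<le> h i y" if "i < n" for i y using others[of y i] h(4)[OF that, of y] by (simp add: g_def)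
  show ?thesis
  proof (rule that[of g "\<Union>i<n. L i"])
    show "continuous_on UNIV (g i)" if "i < n" for i
      unfolding g_def using that by (intro continuous_intros h(1)) simp_all
    show "compact (\<Union>i<n. L i)" using h(2) by (intro compact_UN) simp_all
    show "g i y = 0" if "i < n" "y \<notin> (\<Union>i<n. L i)" for i y
      using le[of i y] h(3)[of i y] that by (simp add: g_def)
    show "0 \<le> g i y \<and> g i y \<le> 1" if "i < n" for i y
      using le[OF that, of y] h(4)[OF that, of y] by (simp add: g_def)
    show "g i (s i) = 1" if i: "i < n" for i
    proof -
      have "(\<Sum>j\<in>{..<n} - {i}. h j (s i)) = 0" using h(6) i by (intro sum.neutral) auto
      then show ?thesis using h(5)[OF i] by (simp add: g_def)
    qed
    show "g i y = 0 \<or> g j y = 0" if ij: "i < n" "j < n" "i \<noteq> j" for i j y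
    proof -
      have "h j y \<le> (\<Sum>j\<in>{..<n} - {i}. h j y)" "h i y \<le> (\<Sum>i\<in>{..<n} - {j}. h i y)"
        using h(4) ij by (intro member_le_sum; simp)+
      then show ?thesis by (simp add: g_def max_def)
    qed
  qed
qed

lemma cb_Helson_finite:
  assumes amen: "discretely_amenable TYPE('a)" and E: "cb_Helson \<mu> E"
  shows "finite E"
proof (rule ccontr)
  assume "infinite E"
  obtain C where C: "0 \<le> C"
    "\<And>(n::nat) f. (\<And>i j. i < n \<Longrightarrow> j < n \<Longrightarrow> f i j \<in> os_carrier (C0_space E)) \<Longrightarrow>
      (\<And>s. s \<in> E \<Longrightarrow> matrix_opnorm {..<n} (\<lambda>i j. f i j s) \<le> 1) \<Longrightarrow>
      \<exists>x. (\<forall>i<n. \<forall>j<n. x i j \<in> fourier_functions \<mu> \<and> (\<forall>s\<in>E. x i j s = f i j s)) \<and>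
        (\<forall>m T. (\<forall>k<m. \<forall>l<m. T k l \<in> VN \<mu>) \<longrightarrow>
          matrix_opnorm ({..<m} \<times> {..<n}) (\<lambda>(k, i) (l, j). VN_pairing \<mu> (T k l) (x i j)) \<le> C * L2_matrix_norm \<mu> m T)"
    using cb_Helson_lift[OF E] by blast
  \<comment> \<open>The comparison at the end reads n^2 N^2 / 16 \<le> 8 n C^2 N^2, and 128 = 16 *
    8.\<close>
  obtain n :: nat where n: "128 * C\<^sup>2 + 1 < real n" using reals_Archimedean2 by blast
  have n1: "1 \<le> n" using n zero_le_power2[of C] by linarith
  obtain s :: "nat \<Rightarrow> 'a" where s: "inj s" "range s \<subseteq> E" using infinite_countable_subset[OF \<open>infinite E\<close>] by blast
  obtain F and w :: "'a \<Rightarrow> real" where F: "finite F" and w: "\<And>h. 0 \<le> w h" "\<And>h. h \<notin> F \<Longrightarrow> w h = 0"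
    "(\<Sum>h\<in>F. (w h)\<^sup>2) = 1" "\<And>i. i < n \<Longrightarrow> 1 / 2 \<le> (\<Sum>h\<in>F. w (s i + h) * w h)"
    using Reiter_vector[OF amen, of n s] by blast
  define b where "b i g h = (if g = s i + h then 1 else 0 :: real)" for i g h
  have b0: "0 \<le> b i g h" for i g h by (simp add: b_def)
  have b1: "(\<Sum>h\<in>F. b i g h) \<le> 1" for i g
  proof -
    have "(\<Sum>h\<in>F. b i g h) = (\<Sum>h\<in>F. if h = - s i + g then 1 else 0)"
      by (intro sum.cong refl) (auto simp: b_def add.assoc[symmetric])
    also have "\<dots> \<le> 1" using F by simp
    finally show ?thesis .
  qed
  have b2: "(\<Sum>g\<in>F. b i g h) \<le> 1" for i h using F by (simp add: b_def)
  obtain N \<tau> e where N: "0 < (N::nat)" "\<And>i x. i < n \<Longrightarrow> x < N \<Longrightarrow> \<tau> i x < N"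
    "\<And>i x. i < n \<Longrightarrow> x < N \<Longrightarrow> \<tau> i (\<tau> i x) = x"
    "is_projection N e" "real N / 2 \<le> (\<Sum>x<N. e x x)"
    "\<And>v. (\<Sum>g\<in>F. \<Sum>x<N. (\<Sum>i<n. \<Sum>h\<in>F. b i g h * (\<Sum>y<N. e (\<tau> i x) y * v h y))\<^sup>2)
       \<le> 8 * real n * (\<Sum>h\<in>F. \<Sum>y<N. (v h y)\<^sup>2)"
    by (rule generic_sandwich[OF n1 F b0 b1 b2]) (rule that; assumption)
  have \<tau>_bij: "bij_betw (\<tau> i) {..<N} {..<N}" if i: "i < n" for i
    by (rule bij_betw_byWitness[where f' = "\<tau> i"]) (use N(2,3) i in auto)
  obtain g K where g: "\<And>i. i < n \<Longrightarrow> continuous_on UNIV (g i)" "compact K" "\<And>i y. i < n \<Longrightarrow> y \<notin> K \<Longrightarrow> g i y = 0"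
    "\<And>i y. i < n \<Longrightarrow> 0 \<le> g i y \<and> g i y \<le> (1::real)" "\<And>i. i < n \<Longrightarrow> g i (s i) = 1"
    "\<And>i j y. i < n \<Longrightarrow> j < n \<Longrightarrow> i \<noteq> j \<Longrightarrow> g i y = 0 \<or> g j y = 0"
    by (rule bump_functions[OF inj_on_subset[OF s(1) subset_UNIV], of n]) (rule that; assumption)
  \<comment> \<open>The function y \<mapsto> \<Sum> g_i(y) u_i with permutation matrices u_i. At
    each point at most one term survives, so it is a contraction pointwise, and at
    \<open>s i\<close> it equals u_i.\<close>
  define f where "f p q y = (if y \<in> E then \<Sum>i<n. complex_of_real (g i y) * (if q = \<tau> i p then 1 else 0) else 0)" for p q y
  have fC: "f p q \<in> os_carrier (C0_space E)" for p q
  proof -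
    let ?f = "\<lambda>y. \<Sum>i<n. complex_of_real (g i y) * (if q = \<tau> i p then 1 else 0)"
    have cont: "continuous_on UNIV ?f" using g(1) by (intro continuous_intros) simp
    have "closed E" using E by (simp add: cb_Helson_def)
    have "compact {y \<in> E. e \<le> cmod (f p q y)}" if e: "0 < e" for e
    proof -
      have eq: "{y \<in> E. e \<le> cmod (f p q y)} = K \<inter> (E \<inter> {y. e \<le> cmod (?f y)})"
      proof -
        have "y \<in> K" if "e \<le> cmod (?f y)" for y
        proof (rule ccontr)
          assume "y \<notin> K"
          then have "?f y = 0" using g(3) by (intro sum.neutral) simp
          then show False using \<open>e \<le> cmod (?f y)\<close> e by simp
        qed
        then show ?thesis by (auto simp: f_def)
      qed
      have "closed {y. e \<le> cmod (?f y)}"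
        by (intro closed_Collect_le continuous_on_const continuous_on_norm cont)
      then show ?thesis unfolding eq using g(2) \<open>closed E\<close> by (intro compact_Int_closed closed_Int)
    qed
    moreover have "continuous_on E (f p q)"
      using continuous_on_subset[OF cont, of E] by (subst continuous_on_cong[OF refl, where g = ?f]) (simp_all add: f_def)
    ultimately show ?thesis by (simp add: C0_space_def f_def)
  qed
  have f1: "matrix_opnorm {..<N} (\<lambda>p q. f p q y) \<le> 1" if y: "y \<in> E" for y
  proof (rule matrix_opnorm_le)
    fix v :: "nat \<Rightarrow> complex"
    have row: "(\<Sum>q<N. f p q y * v q) = (\<Sum>i<n. g i y * v (\<tau> i p))" if p: "p < N" for p
    proof -
      have "(\<Sum>q<N. f p q y * v q) = (\<Sum>q<N. \<Sum>i<n. if q = \<tau> i p then g i y * v q else 0)"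
        using y unfolding f_def sum_distrib_right by (intro sum.cong refl) (auto simp: sum_distrib_right intro!: sum.cong)
      also have "\<dots> = (\<Sum>i<n. \<Sum>q<N. if q = \<tau> i p then g i y * v q else 0)" by (rule sum.swap)
      also have "\<dots> = (\<Sum>i<n. g i y * v (\<tau> i p))" using N(2) p by (intro sum.cong refl) simp
      finally show ?thesis .
    qed
    show "(\<Sum>p<N. (cmod (\<Sum>q<N. f p q y * v q))\<^sup>2) \<le> 1\<^sup>2 * (\<Sum>q<N. (cmod (v q))\<^sup>2)"
    proof (cases "\<exists>i<n. g i y \<noteq> 0")
      case True
      then obtain i where i: "i < n" "g i y \<noteq> 0" by blast
      have "(\<Sum>j<n. g j y * v (\<tau> j p)) = g i y * v (\<tau> i p)" for p
      proof -
        have "(\<Sum>j<n. g j y * v (\<tau> j p)) = (\<Sum>j\<in>{i}. g j y * v (\<tau> j p))"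
        proof (rule sum.mono_neutral_right)
          show "\<forall>j\<in>{..<n} - {i}. g j y * v (\<tau> j p) = 0" using g(6)[of i _ y] i by auto
        qed (use i in auto)
        then show ?thesis by simp
      qed
      then have "(\<Sum>p<N. (cmod (\<Sum>q<N. f p q y * v q))\<^sup>2) = (\<Sum>p<N. (cmod (g i y * v (\<tau> i p)))\<^sup>2)"
        by (intro sum.cong refl) (simp only: row lessThan_iff)
      also have "\<dots> \<le> (\<Sum>p<N. (cmod (v (\<tau> i p)))\<^sup>2)"
        using g(4)[OF i(1), of y] by (intro sum_mono power_mono) (simp_all add: norm_mult mult_left_le_one_le)
      also have "\<dots> = (\<Sum>q<N. (cmod (v q))\<^sup>2)"
        by (rule sum.reindex_bij_betw[OF \<tau>_bij[OF i(1)]])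
      finally show ?thesis by simp
    next
      case False
      then have "(\<Sum>p<N. (cmod (\<Sum>q<N. f p q y * v q))\<^sup>2) = 0"
        by (intro sum.neutral ballI) (simp only: row lessThan_iff, simp)
      then show ?thesis by (simp add: sum_nonneg)
    qed
  qed simp
  obtain x where x: "\<forall>p<N. \<forall>q<N. x p q \<in> fourier_functions \<mu> \<and> (\<forall>s\<in>E. x p q s = f p q s)"
    "\<And>m T. (\<forall>k<m. \<forall>l<m. T k l \<in> VN \<mu>) \<Longrightarrow>
      matrix_opnorm ({..<m} \<times> {..<N}) (\<lambda>(k, i) (l, j). VN_pairing \<mu> (T k l) (x i j)) \<le> C * L2_matrix_norm \<mu> m T"
    using C(2)[of N f, OF fC f1] by blast
  have xs: "x p q (s i) = (if q = \<tau> i p then 1 else 0)" if pq: "p < N" "q < N" and i: "i < n" for p q i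
  proof -
    have "x p q (s i) = (\<Sum>j<n. complex_of_real (g j (s i)) * (if q = \<tau> j p then 1 else 0))"
    proof -
      have "s i \<in> E" using s(2) by blast
      then show ?thesis using x(1) pq by (simp add: f_def)
    qed
    also have "\<dots> = (\<Sum>j\<in>{i}. complex_of_real (g j (s i)) * (if q = \<tau> j p then 1 else 0))"
    proof (rule sum.mono_neutral_right)
      show "\<forall>j\<in>{..<n} - {i}. complex_of_real (g j (s i)) * (if q = \<tau> j p then 1 else 0) = 0"
        using g(6)[of i _ "s i"] g(5)[OF i] i by auto
    qed (use i in auto)
    finally show ?thesis using g(5)[OF i] by simp
  qed
  define \<phi> where "\<phi> i = (\<Sum>h\<in>F. w (s i + h) * w h)" for i
  \<comment> \<open>The scalar factor is \<phi>(s_i) times the (k, l) entry of u_i e, which is the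
    form bounded by the sandwich estimate.\<close>
  define T where "T k l = (\<lambda>\<xi> y. \<Sum>i<n. complex_of_real (\<phi> i * e (\<tau> i k) l) * left_regular (s i) \<xi> y)" for k l
  have T: "T k l \<in> VN \<mu>" for k l unfolding T_def by (rule translation_combination_VN) simp
  have T_norm: "L2_matrix_norm \<mu> N T \<le> sqrt (8 * real n)"
    unfolding T_def \<phi>_def using N(6) F w(2,3)
    by (intro translation_matrix_norm) (simp_all add: b_def)
  define A where "A = (\<lambda>(k, i) (l, j). VN_pairing \<mu> (T k l) (x i j))"
  define D where "D = C * sqrt (8 * real n)"
  have "matrix_opnorm ({..<N} \<times> {..<N}) A \<le> C * L2_matrix_norm \<mu> N T" using x(2)[of N T] T by (simp add: A_def)
  also have "\<dots> \<le> D" unfolding D_def by (rule mult_left_mono[OF T_norm C(1)])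
  finally have A_norm: "matrix_opnorm ({..<N} \<times> {..<N}) A \<le> D" .
  \<comment> \<open>The unnormalised maximally entangled vector, of square norm \<open>N\<close>.
    Testing on it extracts traces: row \<open>(k, k)\<close> pairs the entries of \<open>T\<close>
    with the matching entries of \<open>x\<close>.\<close>
  define v :: "nat \<times> nat \<Rightarrow> complex" where "v = (\<lambda>(l, q). if l = q then 1 else 0)"
  have diag: "(\<Sum>b\<in>{..<N} \<times> {..<N}. A (k, k) b * v b) = complex_of_real (\<Sum>i<n. \<phi> i * e (\<tau> i k) (\<tau> i k))"
    if k: "k < N" for k
  proof -
    have "(\<Sum>b\<in>{..<N} \<times> {..<N}. A (k, k) b * v b) = (\<Sum>l<N. \<Sum>q<N. if l = q then VN_pairing \<mu> (T k l) (x k q) else 0)"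
      unfolding sum.cartesian_product' by (intro sum.cong refl) (simp add: A_def v_def)
    also have "\<dots> = (\<Sum>l<N. VN_pairing \<mu> (T k l) (x k l))" by (intro sum.cong refl) simp
    also have "\<dots> = (\<Sum>l<N. \<Sum>i<n. complex_of_real (\<phi> i * e (\<tau> i k) l) * (if l = \<tau> i k then 1 else 0))"
    proof (intro sum.cong refl)
      fix l assume l: "l \<in> {..<N}"
      have "VN_pairing \<mu> (T k l) (x k l) = (\<Sum>i<n. complex_of_real (\<phi> i * e (\<tau> i k) l) * x k l (s i))"
        unfolding T_def using x(1) k l by (intro VN_pairing_translation_combination) simp
      then show "VN_pairing \<mu> (T k l) (x k l) = (\<Sum>i<n. complex_of_real (\<phi> i * e (\<tau> i k) l) * (if l = \<tau> i k then 1 else 0))"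
        using xs k l by simp
    qed
    also have "\<dots> = (\<Sum>i<n. \<Sum>l<N. complex_of_real (\<phi> i * e (\<tau> i k) l) * (if l = \<tau> i k then 1 else 0))" by (rule sum.swap)
    also have "\<dots> = (\<Sum>i<n. complex_of_real (\<phi> i * e (\<tau> i k) (\<tau> i k)))"
      using N(2) k by (intro sum.cong refl) (simp add: if_distrib[of "\<lambda>x. _ * x"] cong: if_cong)
    finally show ?thesis by simp
  qed
  define t where "t k = (\<Sum>i<n. \<phi> i * e (\<tau> i k) (\<tau> i k))" for k
  have "real n / 2 * (real N / 2) \<le> (\<Sum>i<n. \<phi> i * (\<Sum>x<N. e x x))"
  proof -
    have "(\<Sum>i<n. 1 / 2 * (real N / 2)) \<le> (\<Sum>i<n. \<phi> i * (\<Sum>x<N. e x x))"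
      using w(4) N(5) by (intro sum_mono mult_mono) (auto simp: \<phi>_def intro!: order.trans[OF _ w(4)])
    then show ?thesis by simp
  qed
  \<comment> \<open>The trace of \<open>e\<close> is invariant under the permutation
    \<open>\<tau> i\<close> of its diagonal.\<close>
  also have "\<dots> = (\<Sum>i<n. \<phi> i * (\<Sum>k<N. e (\<tau> i k) (\<tau> i k)))"
    by (intro sum.cong refl arg_cong2[where f = "(*)"] sum.reindex_bij_betw[symmetric, OF \<tau>_bij]) simp
  also have "\<dots> = (\<Sum>k<N. t k)" unfolding t_def sum_distrib_left by (rule sum.swap)
  finally have lower: "real n / 2 * (real N / 2) \<le> (\<Sum>k<N. t k)" .
  have "(\<Sum>k<N. (t k)\<^sup>2) = (\<Sum>k<N. (cmod (\<Sum>b\<in>{..<N} \<times> {..<N}. A (k, k) b * v b))\<^sup>2)"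
    by (intro sum.cong refl) (simp only: diag lessThan_iff t_def[symmetric] norm_of_real power2_abs)
  also have "\<dots> = (\<Sum>a\<in>(\<lambda>k. (k, k)) ` {..<N}. (cmod (\<Sum>b\<in>{..<N} \<times> {..<N}. A a b * v b))\<^sup>2)"
    by (subst sum.reindex) (auto simp: inj_on_def)
  also have "\<dots> \<le> (\<Sum>a\<in>{..<N} \<times> {..<N}. (cmod (\<Sum>b\<in>{..<N} \<times> {..<N}. A a b * v b))\<^sup>2)"
    by (intro sum_mono2) auto
  also have "\<dots> \<le> (matrix_opnorm ({..<N} \<times> {..<N}) A)\<^sup>2 * (\<Sum>b\<in>{..<N} \<times> {..<N}. (cmod (v b))\<^sup>2)"
    by (rule matrix_opnorm_bound(2)) simp
  also have "(\<Sum>b\<in>{..<N} \<times> {..<N}. (cmod (v b))\<^sup>2) = real N"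
  proof -
    have "(\<Sum>b\<in>{..<N} \<times> {..<N}. (cmod (v b))\<^sup>2) = (\<Sum>l<N. \<Sum>q<N. if l = q then 1 else 0)"
      unfolding sum.cartesian_product' by (intro sum.cong refl) (simp add: v_def)
    also have "\<dots> = real N" by simp
    finally show ?thesis .
  qed
  also have "(matrix_opnorm ({..<N} \<times> {..<N}) A)\<^sup>2 * real N \<le> D\<^sup>2 * real N"
    using A_norm by (intro mult_right_mono power_mono matrix_opnorm_bound(1)) simp_all
  finally have upper: "(\<Sum>k<N. (t k)\<^sup>2) \<le> D\<^sup>2 * real N" .
  have "(real n / 2 * (real N / 2))\<^sup>2 \<le> (\<Sum>k<N. t k)\<^sup>2" using lower by (intro power_mono) simp_all
  also have "\<dots> \<le> real N * (\<Sum>k<N. (t k)\<^sup>2)"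
    using Cauchy_Schwarz_ineq_sum[of "\<lambda>_. 1" t "{..<N}"] by simp
  also have "\<dots> \<le> real N * (D\<^sup>2 * real N)" using upper by (intro mult_left_mono) simp_all
  finally have "(real n)\<^sup>2 * (real N)\<^sup>2 \<le> 128 * C\<^sup>2 * real n * (real N)\<^sup>2"
    by (simp add: D_def power2_eq_square field_simps)
  then have "(real n)\<^sup>2 \<le> 128 * C\<^sup>2 * real n" using N(1) by simp
  then have "real n \<le> 128 * C\<^sup>2" using n1 by (simp add: power2_eq_square)
  then show False using n by simp
qed

end

theorem theorem1p2:
  fixes \<mu> :: "'a::{topological_group_add, t2_space} measure" and E :: "'a set"
  assumes "locally_compact_space (euclidean :: 'a topology)"
    and "left_haar_measure \<mu>"
    and "discretely_amenable TYPE('a)"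
    and "cb_Helson \<mu> E"
  shows "finite E"
proof -
  interpret haar \<mu> using assms by unfold_locales
  show ?thesis using assms by (intro cb_Helson_finite)
qed

end
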